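(* Let $(R,\mathfrak m)$ be a complete Noetherian local ring of dimension $n$, let $J\subset I$ be two ideals of $R$, and let $M$ be a finitely generated $R$-module such that $\operatorname{grade}(I,M)=\operatorname{grade}(J,M)=c$ and $H^i_J(M)=0$ for all $i\neq c$. Suppose that $\operatorname{Rad} IR_{\mathfrak p}=\operatorname{Rad} JR_{\mathfrak p}$ for all $\mathfrak p\in V(J)\cap\operatorname{Supp}_R(M)$ such that $\operatorname{depth}_{R_{\mathfrak p}}(M_{\mathfrak p})\leq c$. Then the natural homomorphism $$\operatorname{Hom}_R(M,M)\to\operatorname{Hom}_R(H^c_I(M),H^c_I(M))$$ is an isomorphism.
   Context: $H^i_I(M)$ denotes the $i$-th local cohomology module of $M$ with respect to $I$. For finitely generated $M$, $\operatorname{grade}(I,M)=\inf\{i\in\mathbb Z: H^i_I(M)\neq 0\}$; writing $H^c_I(M)$ presupposes that $c$ is finite. $V(J)$ is the set of prime ideals containing $J$ and $\operatorname{Rad}$ denotes the radical of an ideal. Complete means complete in the $\mathfrak m$-adic topology; then $R$ and all finitely generated $R$-modules are also $I$-adically complete. The natural homomorphism is the one induced by functoriality of local cohomology, $f\mapsto H^c_I(f)$. *)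

theory Defs
  imports "HOL-Algebra.Module" "HOL-Algebra.Ideal_Product" "HOL-Algebra.Ring_Divisibility"
    "HOL-Library.Extended_Nat"
begin

section \<open>Modules\<close>

text \<open>The type of module records has fields for a ring multiplication and a ring unit.
  They play no role in the locale of modules, and are left undefined below.

  Homomorphisms are extensional functions, so that two of them are equal as soon as they agree
  on the carrier.\<close>

definition mod_hom :: "'r ring \<Rightarrow> ('r, 'a) module \<Rightarrow> ('r, 'b) module \<Rightarrow> ('a \<Rightarrow> 'b) set" where
  "mod_hom R A B =
    {f \<in> carrier A \<rightarrow>\<^sub>E carrier B.
      (\<forall>x\<in>carrier A. \<forall>y\<in>carrier A. f (x \<oplus>\<^bsub>A\<^esub> y) = f x \<oplus>\<^bsub>B\<^esub> f y) \<and>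
      (\<forall>r\<in>carrier R. \<forall>x\<in>carrier A. f (r \<odot>\<^bsub>A\<^esub> x) = r \<odot>\<^bsub>B\<^esub> f x)}"

definition mod_iso :: "'r ring \<Rightarrow> ('r, 'a) module \<Rightarrow> ('r, 'b) module \<Rightarrow> ('a \<Rightarrow> 'b) set" where
  "mod_iso R A B = {f \<in> mod_hom R A B. bij_betw f (carrier A) (carrier B)}"

definition Hom_module ::
  "'r ring \<Rightarrow> ('r, 'a) module \<Rightarrow> ('r, 'b) module \<Rightarrow> ('r, 'a \<Rightarrow> 'b) module" where
  "Hom_module R A B =
    \<lparr>carrier = mod_hom R A B, monoid.mult = undefined, one = undefined,
     zero = (\<lambda>x\<in>carrier A. \<zero>\<^bsub>B\<^esub>),
     add = (\<lambda>f g. \<lambda>x\<in>carrier A. f x \<oplus>\<^bsub>B\<^esub> g x),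
     smult = (\<lambda>r f. \<lambda>x\<in>carrier A. r \<odot>\<^bsub>B\<^esub> f x)\<rparr>"

definition zero_module :: "('r, 'a) module \<Rightarrow> bool" where
  "zero_module A \<longleftrightarrow> carrier A = {\<zero>\<^bsub>A\<^esub>}"

definition mod_span :: "'r ring \<Rightarrow> ('r, 'a) module \<Rightarrow> 'a set \<Rightarrow> 'a set" where
  "mod_span R A X = \<Inter>{N. submodule N R A \<and> X \<subseteq> N}"

definition fin_gen_module :: "'r ring \<Rightarrow> ('r, 'a) module \<Rightarrow> bool" where
  "fin_gen_module R A \<longleftrightarrow> (\<exists>X\<subseteq>carrier A. finite X \<and> carrier A = mod_span R A X)"

definition quot_module :: "('r, 'a) module \<Rightarrow> 'a set \<Rightarrow> ('r, 'a set) module" where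
  "quot_module A N =
    \<lparr>carrier = a_rcosets\<^bsub>A\<^esub> N, monoid.mult = undefined, one = undefined,
     zero = N,
     add = (\<lambda>X Y. X <+>\<^bsub>A\<^esub> Y),
     smult = (\<lambda>r X. \<Union>x\<in>X. N +>\<^bsub>A\<^esub> (r \<odot>\<^bsub>A\<^esub> x))\<rparr>"

definition regular_module :: "'r ring \<Rightarrow> ('r, 'r) module" where
  "regular_module R =
    \<lparr>carrier = carrier R, monoid.mult = monoid.mult R, one = \<one>\<^bsub>R\<^esub>, zero = \<zero>\<^bsub>R\<^esub>, add = add R,
     smult = monoid.mult R\<rparr>"


section \<open>Injective resolutions\<close>

text \<open>A definition in HOL cannot quantify over modules of all types.  The test modules range over
  the type of pairs, which has room for isomorphic copies of \<open>E\<close> and of \<open>R\<close> and for all their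
  submodules; by Baer's criterion (inclusions of ideals into \<open>R\<close> suffice) no monomorphism of
  modules of larger type gives a further condition.\<close>

definition injective_module :: "'r ring \<Rightarrow> ('r, 'e) module \<Rightarrow> bool" where
  "injective_module R E \<longleftrightarrow> module R E \<and>
    (\<forall>(A :: ('r, 'r \<times> 'e) module) (B :: ('r, 'r \<times> 'e) module) u g.
      module R A \<and> module R B \<and>
      u \<in> mod_hom R A B \<and> inj_on u (carrier A) \<and> g \<in> mod_hom R A E \<longrightarrow>
      (\<exists>h\<in>mod_hom R B E. \<forall>x\<in>carrier A. h (u x) = g x))"

record ('r, 'm, 'e) resolution =
  res_term :: "nat \<Rightarrow> ('r, 'e) module"
  res_diff :: "nat \<Rightarrow> 'e \<Rightarrow> 'e"
  res_aug :: "'m \<Rightarrow> 'e"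

definition injective_resolution ::
  "'r ring \<Rightarrow> ('r, 'm) module \<Rightarrow> ('r, 'm, 'e) resolution \<Rightarrow> bool" where
  "injective_resolution R M X \<longleftrightarrow>
    (\<forall>i. injective_module R (res_term X i)) \<and>
    (\<forall>i. res_diff X i \<in> mod_hom R (res_term X i) (res_term X (Suc i))) \<and>
    res_aug X \<in> mod_hom R M (res_term X 0) \<and>
    inj_on (res_aug X) (carrier M) \<and>
    res_aug X ` carrier M =
      {x \<in> carrier (res_term X 0). res_diff X 0 x = \<zero>\<^bsub>res_term X 1\<^esub>} \<and>
    (\<forall>i. res_diff X i ` carrier (res_term X i) =
      {x \<in> carrier (res_term X (Suc i)).
         res_diff X (Suc i) x = \<zero>\<^bsub>res_term X (Suc (Suc i))\<^esub>})"

definition resolution_lift ::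
  "'r ring \<Rightarrow> ('r, 'm) module \<Rightarrow> ('r, 'm, 'e) resolution \<Rightarrow> ('r, 'k, 'f) resolution \<Rightarrow>
    ('m \<Rightarrow> 'k) \<Rightarrow> (nat \<Rightarrow> 'e \<Rightarrow> 'f) \<Rightarrow> bool" where
  "resolution_lift R M X Y f \<phi> \<longleftrightarrow>
    (\<forall>i. \<phi> i \<in> mod_hom R (res_term X i) (res_term Y i)) \<and>
    (\<forall>i. \<forall>x\<in>carrier (res_term X i). \<phi> (Suc i) (res_diff X i x) = res_diff Y i (\<phi> i x)) \<and>
    (\<forall>x\<in>carrier M. \<phi> 0 (res_aug X x) = res_aug Y (f x))"


section \<open>Local cohomology\<close>

definition cocycles :: "(nat \<Rightarrow> ('r, 'e) module) \<Rightarrow> (nat \<Rightarrow> 'e \<Rightarrow> 'e) \<Rightarrow> nat \<Rightarrow> 'e set" where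
  "cocycles C d i = {x \<in> carrier (C i). d i x = \<zero>\<^bsub>C (Suc i)\<^esub>}"

definition coboundaries :: "(nat \<Rightarrow> ('r, 'e) module) \<Rightarrow> (nat \<Rightarrow> 'e \<Rightarrow> 'e) \<Rightarrow> nat \<Rightarrow> 'e set" where
  "coboundaries C d i = (case i of 0 \<Rightarrow> {\<zero>\<^bsub>C 0\<^esub>} | Suc j \<Rightarrow> d j ` carrier (C j))"

definition cohomology ::
  "(nat \<Rightarrow> ('r, 'e) module) \<Rightarrow> (nat \<Rightarrow> 'e \<Rightarrow> 'e) \<Rightarrow> nat \<Rightarrow> ('r, 'e set) module" where
  "cohomology C d i = quot_module ((C i)\<lparr>carrier := cocycles C d i\<rparr>) (coboundaries C d i)"

definition torsion_part :: "'r ring \<Rightarrow> 'r set \<Rightarrow> ('r, 'a) module \<Rightarrow> ('r, 'a) module" where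
  "torsion_part R I A =
    A\<lparr>carrier := {x \<in> carrier A. \<exists>t::nat. \<forall>a \<in> I [^]\<^bsub>ideals_set R\<^esub> t. a \<odot>\<^bsub>A\<^esub> x = \<zero>\<^bsub>A\<^esub>}\<rparr>"

text \<open>Local cohomology is the right derived functor of the \<open>I\<close>-torsion functor; as usual, its values
  are determined up to unique isomorphism by the choice of injective resolutions, so the
  resolution \<open>X\<close> of \<open>M\<close> is an argument (and \<open>M\<close> itself is not).  A homomorphism \<open>M \<rightarrow> N\<close> induces a
  map by way of a lift to the resolutions, which is unique up to homotopy.\<close>

definition local_cohomology ::
  "'r ring \<Rightarrow> 'r set \<Rightarrow> ('r, 'm, 'e) resolution \<Rightarrow> nat \<Rightarrow> ('r, 'e set) module" where
  "local_cohomology R I X i = cohomology (\<lambda>j. torsion_part R I (res_term X j)) (res_diff X) i"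

definition local_cohomology_map ::
  "'r ring \<Rightarrow> 'r set \<Rightarrow> ('r, 'm) module \<Rightarrow> ('r, 'm, 'e) resolution \<Rightarrow> ('r, 'k, 'f) resolution \<Rightarrow>
    nat \<Rightarrow> ('m \<Rightarrow> 'k) \<Rightarrow> 'e set \<Rightarrow> 'f set" where
  "local_cohomology_map R I M X Y i f =
    (let \<phi> = (SOME \<phi>. resolution_lift R M X Y f \<phi>);
         B = coboundaries (\<lambda>j. torsion_part R I (res_term Y j)) (res_diff Y) i
     in (\<lambda>C\<in>carrier (local_cohomology R I X i). \<Union>x\<in>C. B +>\<^bsub>res_term Y i\<^esub> \<phi> i x))"

text \<open>The infimum of the empty set is \<open>\<infinity>\<close>.\<close>

definition grade :: "'r ring \<Rightarrow> 'r set \<Rightarrow> ('r, 'm, 'e) resolution \<Rightarrow> enat" where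
  "grade R I X = Inf {enat i | i. \<not> zero_module (local_cohomology R I X i)}"


section \<open>Rings\<close>

definition local_ring :: "'r ring \<Rightarrow> 'r set \<Rightarrow> bool" where
  "local_ring R \<mm> \<longleftrightarrow> cring R \<and> maximalideal \<mm> R \<and> (\<forall>\<nn>. maximalideal \<nn> R \<longrightarrow> \<nn> = \<mm>)"

definition krull_dim :: "'r ring \<Rightarrow> enat" where
  "krull_dim R =
    Sup {enat k | k. \<exists>P :: nat \<Rightarrow> 'r set.
           (\<forall>i\<le>k. primeideal (P i) R) \<and> (\<forall>i<k. P i \<subset> P (Suc i))}"

definition adic_cauchy :: "'r ring \<Rightarrow> 'r set \<Rightarrow> (nat \<Rightarrow> 'r) \<Rightarrow> bool" where
  "adic_cauchy R \<aa> s \<longleftrightarrow> range s \<subseteq> carrier R \<and>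
    (\<forall>t::nat. \<exists>N. \<forall>k\<ge>N. \<forall>l\<ge>N. s k \<ominus>\<^bsub>R\<^esub> s l \<in> \<aa> [^]\<^bsub>ideals_set R\<^esub> t)"

definition adic_limit :: "'r ring \<Rightarrow> 'r set \<Rightarrow> (nat \<Rightarrow> 'r) \<Rightarrow> 'r \<Rightarrow> bool" where
  "adic_limit R \<aa> s x \<longleftrightarrow> x \<in> carrier R \<and>
    (\<forall>t::nat. \<exists>N. \<forall>k\<ge>N. s k \<ominus>\<^bsub>R\<^esub> x \<in> \<aa> [^]\<^bsub>ideals_set R\<^esub> t)"

text \<open>Uniqueness of limits says that the topology is Hausdorff.\<close>

definition adic_complete :: "'r ring \<Rightarrow> 'r set \<Rightarrow> bool" where
  "adic_complete R \<aa> \<longleftrightarrow> (\<forall>s. adic_cauchy R \<aa> s \<longrightarrow> (\<exists>!x. adic_limit R \<aa> s x))"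

definition radical :: "'r ring \<Rightarrow> 'r set \<Rightarrow> 'r set" where
  "radical R \<aa> = {x \<in> carrier R. \<exists>k::nat. x [^]\<^bsub>R\<^esub> k \<in> \<aa>}"

definition prime_variety :: "'r ring \<Rightarrow> 'r set \<Rightarrow> 'r set set" where
  "prime_variety R \<aa> = {\<pp>. primeideal \<pp> R \<and> \<aa> \<subseteq> \<pp>}"


section \<open>Localization\<close>

text \<open>The fraction \<open>x / s\<close> is the set of all pairs equivalent to \<open>(x, s)\<close>.  The operations are
  defined on representatives; each union below is one of equal sets.\<close>

definition fraction :: "'r ring \<Rightarrow> 'r set \<Rightarrow> ('r, 'a) module \<Rightarrow> 'a \<Rightarrow> 'r \<Rightarrow> ('a \<times> 'r) set" where
  "fraction R S A x s =
    {(y, t). y \<in> carrier A \<and> t \<in> S \<and>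
       (\<exists>u\<in>S. u \<odot>\<^bsub>A\<^esub> (t \<odot>\<^bsub>A\<^esub> x) = u \<odot>\<^bsub>A\<^esub> (s \<odot>\<^bsub>A\<^esub> y))}"

definition loc_module ::
  "'r ring \<Rightarrow> 'r set \<Rightarrow> ('r, 'a) module \<Rightarrow> (('r \<times> 'r) set, ('a \<times> 'r) set) module" where
  "loc_module R S A =
    \<lparr>carrier = {fraction R S A x s | x s. x \<in> carrier A \<and> s \<in> S},
     monoid.mult = undefined, one = undefined,
     zero = fraction R S A \<zero>\<^bsub>A\<^esub> \<one>\<^bsub>R\<^esub>,
     add = (\<lambda>U V. \<Union>(x, s)\<in>U. \<Union>(y, t)\<in>V.
       fraction R S A (t \<odot>\<^bsub>A\<^esub> x \<oplus>\<^bsub>A\<^esub> s \<odot>\<^bsub>A\<^esub> y) (s \<otimes>\<^bsub>R\<^esub> t)),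
     smult = (\<lambda>U V. \<Union>(r, s)\<in>U. \<Union>(y, t)\<in>V. fraction R S A (r \<odot>\<^bsub>A\<^esub> y) (s \<otimes>\<^bsub>R\<^esub> t))\<rparr>"

definition loc_ring :: "'r ring \<Rightarrow> 'r set \<Rightarrow> ('r \<times> 'r) set ring" where
  "loc_ring R S =
    (let L = loc_module R S (regular_module R) in
     \<lparr>carrier = carrier L, monoid.mult = smult L,
      one = fraction R S (regular_module R) \<one>\<^bsub>R\<^esub> \<one>\<^bsub>R\<^esub>,
      zero = zero L, add = add L\<rparr>)"

definition loc_ideal :: "'r ring \<Rightarrow> 'r set \<Rightarrow> 'r set \<Rightarrow> ('r \<times> 'r) set set" where
  "loc_ideal R S \<aa> =
    Idl\<^bsub>loc_ring R S\<^esub> ((\<lambda>a. fraction R S (regular_module R) a \<one>\<^bsub>R\<^esub>) ` \<aa>)"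

abbreviation ring_at :: "'r ring \<Rightarrow> 'r set \<Rightarrow> ('r \<times> 'r) set ring" where
  "ring_at R \<pp> \<equiv> loc_ring R (carrier R - \<pp>)"

abbreviation module_at ::
  "'r ring \<Rightarrow> 'r set \<Rightarrow> ('r, 'a) module \<Rightarrow> (('r \<times> 'r) set, ('a \<times> 'r) set) module" where
  "module_at R \<pp> A \<equiv> loc_module R (carrier R - \<pp>) A"

abbreviation ideal_at :: "'r ring \<Rightarrow> 'r set \<Rightarrow> 'r set \<Rightarrow> ('r \<times> 'r) set set" where
  "ideal_at R \<pp> \<aa> \<equiv> loc_ideal R (carrier R - \<pp>) \<aa>"

definition Supp :: "'r ring \<Rightarrow> ('r, 'a) module \<Rightarrow> 'r set set" where
  "Supp R A = {\<pp>. primeideal \<pp> R \<and> \<not> zero_module (module_at R \<pp> A)}"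


section \<open>Depth\<close>

definition ideal_mult :: "'r ring \<Rightarrow> 'r set \<Rightarrow> ('r, 'a) module \<Rightarrow> 'a set" where
  "ideal_mult R Z A = mod_span R A {r \<odot>\<^bsub>A\<^esub> x | r x. r \<in> Z \<and> x \<in> carrier A}"

definition regular_sequence :: "'r ring \<Rightarrow> ('r, 'a) module \<Rightarrow> 'r list \<Rightarrow> bool" where
  "regular_sequence R A rs \<longleftrightarrow> set rs \<subseteq> carrier R \<and>
    (\<forall>i<length rs. \<forall>x\<in>carrier A.
       rs ! i \<odot>\<^bsub>A\<^esub> x \<in> ideal_mult R (set (take i rs)) A \<longrightarrow>
       x \<in> ideal_mult R (set (take i rs)) A) \<and>
    ideal_mult R (set rs) A \<noteq> carrier A"

text \<open>For a local ring with maximal ideal \<open>\<mm>\<close>.  A zero module has no regular sequences and gets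
  the value \<open>0\<close> here instead of the usual \<open>\<infinity>\<close>; at the primes of the support this does not
  occur.\<close>

definition depth :: "'r ring \<Rightarrow> 'r set \<Rightarrow> ('r, 'a) module \<Rightarrow> enat" where
  "depth R \<mm> A = Sup {enat (length rs) | rs. set rs \<subseteq> \<mm> \<and> regular_sequence R A rs}"

end

theory Submission
  imports Defs
begin

text \<open>Let \<open>E\<close> be the resolution and \<open>K\<close>, \<open>L\<close> its subcomplexes of \<open>J\<close>-torsion and of \<open>I\<close>-torsion elements.
  As a complex of injectives that is exact outside of degree \<open>c\<close>, the complex \<open>K\<close> splits below \<open>c\<close>, so
  that its cohomology is a summand of the cocycles \<open>Z\<^sup>c(K)\<close>, and homomorphisms of the cohomology
  extend to chain maps on \<open>K\<close>.

  For \<open>x \<in> \<mm>\<close>, completeness makes the equations \<open>m\<^sub>k = z\<^sub>k + x m\<^sub>k\<^sub>+\<^sub>1\<close> uniquely solvable in \<open>M\<close>.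
  Therefore the complex of inverse sequences \<open>e\<^sub>k = x e\<^sub>k\<^sub>+\<^sub>1\<close> in \<open>E\<close> is contractible; this says that there
  are no extensions of \<open>R\<^sub>x\<close>-modules by \<open>M\<close>, and it implies that chain maps to \<open>E\<close>, and null
  homotopies of them, extend from the \<open>x\<close>-torsion of \<open>E\<close> to \<open>E\<close>.  Iteration over generators of \<open>J\<close>
  identifies the homotopy classes of chain maps from \<open>K\<close> to \<open>E\<close> with the endomorphisms of \<open>M\<close>.

  It remains to see that the cohomology of \<open>K\<close> is \<open>I\<close>-torsion, so that it agrees with that of \<open>L\<close>.
  Otherwise the annihilator of some class is a prime \<open>\<pp>\<close> that contains \<open>J\<close> but not \<open>I\<close>.  It lies in the
  support, hence \<open>M\<^sub>\<pp>\<close> has a regular sequence of length greater than \<open>c\<close>, and iterated mapping cones of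
  its elements show that the elements killed by \<open>\<pp>\<close> form a complex that is exact up to degree \<open>c\<close> in
  the localized resolution.  So some \<open>s \<notin> \<pp>\<close> kills the class, a contradiction.\<close>


section \<open>Linear maps\<close>

text \<open>For \<open>x\<close> in \<open>\<mm>\<close>, unique solvability of the equations says
  that Hom and Ext^1 from R_x to \<open>M\<close> vanish, being lim and lim^1 of multiplication by
  \<open>x\<close> on \<open>M\<close>; no higher Ext arises because R_x has projective dimension at
  most one. An injective module modulo its \<open>x\<close>-torsion is a module over R_x: over a
  Noetherian ring it is divisible by \<open>x\<close>. This is why maps from that quotient to the
  resolution are trivial up to homotopy. The extension step is made for an arbitrary complex of
  injectives as source, because the torsion with respect to one generator of \<open>J\<close> is the
  source for the next one. The obstacle is that a definition cannot range over modules of all types,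
  so derived functors are replaced by explicit chain maps and homotopies, injectivity by Baer's
  criterion, and every new complex of injectives lives on the type of the resolution or of sequences
  in it. That the ring is Noetherian keeps torsion submodules of injectives injective, so that all
  these complexes can be split and extended along.\<close>

definition linear_map :: "'r ring \<Rightarrow> ('r, 'a) module \<Rightarrow> ('r, 'b) module \<Rightarrow> ('a \<Rightarrow> 'b) \<Rightarrow> bool" where
  "linear_map R A B f \<longleftrightarrow> f \<in> carrier A \<rightarrow> carrier B \<and>
    (\<forall>x\<in>carrier A. \<forall>y\<in>carrier A. f (x \<oplus>\<^bsub>A\<^esub> y) = f x \<oplus>\<^bsub>B\<^esub> f y) \<and>
    (\<forall>r\<in>carrier R. \<forall>x\<in>carrier A. f (r \<odot>\<^bsub>A\<^esub> x) = r \<odot>\<^bsub>B\<^esub> f x)"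

text \<open>Subtraction is expressed by the scalar \<open>- 1\<close> because the additive inverse of a module record
  depends on its carrier, whereas submodules below are formed by changing the carrier only.\<close>

definition msub :: "'r ring \<Rightarrow> ('r, 'a) module \<Rightarrow> 'a \<Rightarrow> 'a \<Rightarrow> 'a" where
  "msub R A x y = x \<oplus>\<^bsub>A\<^esub> ((\<ominus>\<^bsub>R\<^esub> \<one>\<^bsub>R\<^esub>) \<odot>\<^bsub>A\<^esub> y)"

text \<open>Baer's criterion serves as the working notion of injectivity: it quantifies over ideals
  only, so it makes sense for every carrier type and can be verified for torsion submodules, inverse
  sequences and cones.\<close>

definition baer :: "'r ring \<Rightarrow> ('r, 'e) module \<Rightarrow> bool" where
  "baer R E \<longleftrightarrow> module R E \<and>
    (\<forall>\<aa> f. ideal \<aa> R \<longrightarrow> linear_map R (regular_module R\<lparr>carrier := \<aa>\<rparr>) E f \<longrightarrow>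
      (\<exists>e\<in>carrier E. \<forall>r\<in>\<aa>. f r = r \<odot>\<^bsub>E\<^esub> e))"

lemma msub_carrier [simp]: "msub R (A\<lparr>carrier := N\<rparr>) = msub R A"
  by (simp add: msub_def fun_eq_iff)

lemma linear_mapI:
  assumes "\<And>x. x \<in> carrier A \<Longrightarrow> f x \<in> carrier B"
    and "\<And>x y. x \<in> carrier A \<Longrightarrow> y \<in> carrier A \<Longrightarrow> f (x \<oplus>\<^bsub>A\<^esub> y) = f x \<oplus>\<^bsub>B\<^esub> f y"
    and "\<And>r x. r \<in> carrier R \<Longrightarrow> x \<in> carrier A \<Longrightarrow> f (r \<odot>\<^bsub>A\<^esub> x) = r \<odot>\<^bsub>B\<^esub> f x"
  shows "linear_map R A B f"
  using assms by (auto simp: linear_map_def)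

lemma linear_closed: "linear_map R A B f \<Longrightarrow> x \<in> carrier A \<Longrightarrow> f x \<in> carrier B"
  by (auto simp: linear_map_def)

lemma linear_add:
  "linear_map R A B f \<Longrightarrow> x \<in> carrier A \<Longrightarrow> y \<in> carrier A \<Longrightarrow> f (x \<oplus>\<^bsub>A\<^esub> y) = f x \<oplus>\<^bsub>B\<^esub> f y"
  by (auto simp: linear_map_def)

lemma linear_smult:
  "linear_map R A B f \<Longrightarrow> r \<in> carrier R \<Longrightarrow> x \<in> carrier A \<Longrightarrow> f (r \<odot>\<^bsub>A\<^esub> x) = r \<odot>\<^bsub>B\<^esub> f x"
  by (auto simp: linear_map_def)

lemma linear_comp:
  "linear_map R A B f \<Longrightarrow> linear_map R B C g \<Longrightarrow> linear_map R A C (\<lambda>x. g (f x))"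
  by (rule linear_mapI) (simp_all add: linear_closed linear_add linear_smult)

lemma linear_id: "linear_map R A A (\<lambda>x. x)"
  by (rule linear_mapI) auto

lemma linear_cong:
  assumes "linear_map R A B f" "module R A" "\<And>x. x \<in> carrier A \<Longrightarrow> f x = g x"
  shows "linear_map R A B g"
proof -
  interpret module R A by fact
  show ?thesis
    by (rule linear_mapI) (simp_all add: assms(3)[symmetric] linear_closed[OF assms(1)]
        linear_add[OF assms(1)] linear_smult[OF assms(1)])
qed

lemma linear_domain:
  "linear_map R A B f \<Longrightarrow> N \<subseteq> carrier A \<Longrightarrow> linear_map R (A\<lparr>carrier := N\<rparr>) B f"
  unfolding linear_map_def Pi_iff by simp blast

lemma linear_codomain:
  "linear_map R A B f \<Longrightarrow> (\<And>x. x \<in> carrier A \<Longrightarrow> f x \<in> N) \<Longrightarrow> linear_map R A (B\<lparr>carrier := N\<rparr>) f"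
  unfolding linear_map_def Pi_iff by simp

lemma linear_codomain':
  "linear_map R A (B\<lparr>carrier := N\<rparr>) f \<Longrightarrow> N \<subseteq> carrier B \<Longrightarrow> linear_map R A B f"
  unfolding linear_map_def Pi_iff by auto

lemma mod_hom_linear: "f \<in> mod_hom R A B \<Longrightarrow> linear_map R A B f"
  unfolding mod_hom_def linear_map_def by auto

text \<open>Extensionality is all that separates the two notions. \<open>linear_map\<close> drops it
  so that composites and restrictions to submodules need not be cut off again.\<close>

lemma mod_hom_iff: "f \<in> mod_hom R A B \<longleftrightarrow> linear_map R A B f \<and> f \<in> extensional (carrier A)"
  unfolding mod_hom_def linear_map_def PiE_def by auto

lemma restrict_mod_hom:
  assumes "linear_map R A B f" "module R A"
  shows "restrict f (carrier A) \<in> mod_hom R A B"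
proof -
  have "linear_map R A B (restrict f (carrier A))"
    by (rule linear_cong[OF assms]) simp
  then show ?thesis by (simp add: mod_hom_iff)
qed

locale fixed_cring = cring R for R :: "'r ring" (structure)
begin

lemma neg1_closed [simp]: "\<ominus> \<one> \<in> carrier R" by simp

lemma mod_closed [simp, intro]:
  assumes "module R A"
  shows "x \<in> carrier A \<Longrightarrow> y \<in> carrier A \<Longrightarrow> x \<oplus>\<^bsub>A\<^esub> y \<in> carrier A"
    and "\<zero>\<^bsub>A\<^esub> \<in> carrier A"
    and "r \<in> carrier R \<Longrightarrow> x \<in> carrier A \<Longrightarrow> r \<odot>\<^bsub>A\<^esub> x \<in> carrier A"
    and "x \<in> carrier A \<Longrightarrow> y \<in> carrier A \<Longrightarrow> msub R A x y \<in> carrier A"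
proof -
  interpret A: module R A by fact
  show "x \<in> carrier A \<Longrightarrow> y \<in> carrier A \<Longrightarrow> x \<oplus>\<^bsub>A\<^esub> y \<in> carrier A" by simp
  show "\<zero>\<^bsub>A\<^esub> \<in> carrier A" by simp
  show "r \<in> carrier R \<Longrightarrow> x \<in> carrier A \<Longrightarrow> r \<odot>\<^bsub>A\<^esub> x \<in> carrier A" by simp
  show "x \<in> carrier A \<Longrightarrow> y \<in> carrier A \<Longrightarrow> msub R A x y \<in> carrier A" by (simp add: msub_def)
qed

lemma mod_simps [simp]:
  assumes "module R A"
  shows "x \<in> carrier A \<Longrightarrow> \<zero>\<^bsub>A\<^esub> \<oplus>\<^bsub>A\<^esub> x = x"
    and "x \<in> carrier A \<Longrightarrow> x \<oplus>\<^bsub>A\<^esub> \<zero>\<^bsub>A\<^esub> = x"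
    and "x \<in> carrier A \<Longrightarrow> \<one> \<odot>\<^bsub>A\<^esub> x = x"
    and "x \<in> carrier A \<Longrightarrow> \<zero> \<odot>\<^bsub>A\<^esub> x = \<zero>\<^bsub>A\<^esub>"
    and "r \<in> carrier R \<Longrightarrow> r \<odot>\<^bsub>A\<^esub> \<zero>\<^bsub>A\<^esub> = \<zero>\<^bsub>A\<^esub>"
    and "x \<in> carrier A \<Longrightarrow> msub R A x x = \<zero>\<^bsub>A\<^esub>"
    and "x \<in> carrier A \<Longrightarrow> msub R A x \<zero>\<^bsub>A\<^esub> = x"
proof -
  interpret A: module R A by fact
  show "x \<in> carrier A \<Longrightarrow> \<zero>\<^bsub>A\<^esub> \<oplus>\<^bsub>A\<^esub> x = x" "x \<in> carrier A \<Longrightarrow> x \<oplus>\<^bsub>A\<^esub> \<zero>\<^bsub>A\<^esub> = x"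
    "x \<in> carrier A \<Longrightarrow> \<one> \<odot>\<^bsub>A\<^esub> x = x" "x \<in> carrier A \<Longrightarrow> \<zero> \<odot>\<^bsub>A\<^esub> x = \<zero>\<^bsub>A\<^esub>"
    "r \<in> carrier R \<Longrightarrow> r \<odot>\<^bsub>A\<^esub> \<zero>\<^bsub>A\<^esub> = \<zero>\<^bsub>A\<^esub>" by simp_all
  show "x \<in> carrier A \<Longrightarrow> msub R A x x = \<zero>\<^bsub>A\<^esub>" "x \<in> carrier A \<Longrightarrow> msub R A x \<zero>\<^bsub>A\<^esub> = x"
    by (simp_all add: msub_def A.smult_l_minus A.r_neg)
qed

lemma mod_ac:
  assumes "module R A"
  shows "x \<in> carrier A \<Longrightarrow> y \<in> carrier A \<Longrightarrow> x \<oplus>\<^bsub>A\<^esub> y = y \<oplus>\<^bsub>A\<^esub> x"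
    and "x \<in> carrier A \<Longrightarrow> y \<in> carrier A \<Longrightarrow> z \<in> carrier A \<Longrightarrow>
      (x \<oplus>\<^bsub>A\<^esub> y) \<oplus>\<^bsub>A\<^esub> z = x \<oplus>\<^bsub>A\<^esub> (y \<oplus>\<^bsub>A\<^esub> z)"
    and "x \<in> carrier A \<Longrightarrow> y \<in> carrier A \<Longrightarrow> z \<in> carrier A \<Longrightarrow>
      x \<oplus>\<^bsub>A\<^esub> (y \<oplus>\<^bsub>A\<^esub> z) = y \<oplus>\<^bsub>A\<^esub> (x \<oplus>\<^bsub>A\<^esub> z)"
proof -
  interpret A: module R A by fact
  show "x \<in> carrier A \<Longrightarrow> y \<in> carrier A \<Longrightarrow> x \<oplus>\<^bsub>A\<^esub> y = y \<oplus>\<^bsub>A\<^esub> x" by (rule A.a_comm)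
  show "x \<in> carrier A \<Longrightarrow> y \<in> carrier A \<Longrightarrow> z \<in> carrier A \<Longrightarrow>
      (x \<oplus>\<^bsub>A\<^esub> y) \<oplus>\<^bsub>A\<^esub> z = x \<oplus>\<^bsub>A\<^esub> (y \<oplus>\<^bsub>A\<^esub> z)" by (rule A.a_assoc)
  show "x \<in> carrier A \<Longrightarrow> y \<in> carrier A \<Longrightarrow> z \<in> carrier A \<Longrightarrow>
      x \<oplus>\<^bsub>A\<^esub> (y \<oplus>\<^bsub>A\<^esub> z) = y \<oplus>\<^bsub>A\<^esub> (x \<oplus>\<^bsub>A\<^esub> z)" by (rule A.a_lcomm)
qed

lemma mod_distr:
  assumes "module R A"
  shows "r \<in> carrier R \<Longrightarrow> x \<in> carrier A \<Longrightarrow> y \<in> carrier A \<Longrightarrow>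
      r \<odot>\<^bsub>A\<^esub> (x \<oplus>\<^bsub>A\<^esub> y) = r \<odot>\<^bsub>A\<^esub> x \<oplus>\<^bsub>A\<^esub> r \<odot>\<^bsub>A\<^esub> y"
    and "r \<in> carrier R \<Longrightarrow> s \<in> carrier R \<Longrightarrow> x \<in> carrier A \<Longrightarrow>
      (r \<oplus> s) \<odot>\<^bsub>A\<^esub> x = r \<odot>\<^bsub>A\<^esub> x \<oplus>\<^bsub>A\<^esub> s \<odot>\<^bsub>A\<^esub> x"
    and "r \<in> carrier R \<Longrightarrow> s \<in> carrier R \<Longrightarrow> x \<in> carrier A \<Longrightarrow>
      (r \<otimes> s) \<odot>\<^bsub>A\<^esub> x = r \<odot>\<^bsub>A\<^esub> (s \<odot>\<^bsub>A\<^esub> x)"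
  using module.smult_r_distr[OF assms] module.smult_l_distr[OF assms]
    module.smult_assoc1[OF assms] by auto

lemma smult_swap:
  assumes "module R A"
  shows "r \<in> carrier R \<Longrightarrow> s \<in> carrier R \<Longrightarrow> x \<in> carrier A \<Longrightarrow>
      r \<odot>\<^bsub>A\<^esub> (s \<odot>\<^bsub>A\<^esub> x) = s \<odot>\<^bsub>A\<^esub> (r \<odot>\<^bsub>A\<^esub> x)"
  using mod_distr(3)[OF assms, symmetric] by (simp add: m_comm)

lemma msub_minus:
  assumes "module R A" "x \<in> carrier A" "y \<in> carrier A"
  shows "msub R A x y = x \<oplus>\<^bsub>A\<^esub> \<ominus>\<^bsub>A\<^esub> y"
proof -
  interpret A: module R A by fact
  show ?thesis using assms by (simp add: msub_def A.smult_l_minus)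
qed

lemma msub_alg:
  assumes A: "module R A"
  shows "x \<in> carrier A \<Longrightarrow> y \<in> carrier A \<Longrightarrow> (msub R A x y = \<zero>\<^bsub>A\<^esub>) = (x = y)"
    and "x \<in> carrier A \<Longrightarrow> y \<in> carrier A \<Longrightarrow> msub R A x y \<oplus>\<^bsub>A\<^esub> y = x"
    and "x \<in> carrier A \<Longrightarrow> y \<in> carrier A \<Longrightarrow> y \<oplus>\<^bsub>A\<^esub> msub R A x y = x"
    and "x \<in> carrier A \<Longrightarrow> y \<in> carrier A \<Longrightarrow> msub R A (x \<oplus>\<^bsub>A\<^esub> y) y = x"
    and "x \<in> carrier A \<Longrightarrow> y \<in> carrier A \<Longrightarrow> msub R A (x \<oplus>\<^bsub>A\<^esub> y) x = y"
    and "x \<in> carrier A \<Longrightarrow> y \<in> carrier A \<Longrightarrow> z \<in> carrier A \<Longrightarrow> (msub R A x y = z) = (x = z \<oplus>\<^bsub>A\<^esub> y)"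
    and "x \<in> carrier A \<Longrightarrow> y \<in> carrier A \<Longrightarrow> msub R A x (msub R A x y) = y"
    and "r \<in> carrier R \<Longrightarrow> x \<in> carrier A \<Longrightarrow> y \<in> carrier A \<Longrightarrow>
      r \<odot>\<^bsub>A\<^esub> msub R A x y = msub R A (r \<odot>\<^bsub>A\<^esub> x) (r \<odot>\<^bsub>A\<^esub> y)"
    and "x \<in> carrier A \<Longrightarrow> y \<in> carrier A \<Longrightarrow> x' \<in> carrier A \<Longrightarrow> y' \<in> carrier A \<Longrightarrow>
      msub R A (x \<oplus>\<^bsub>A\<^esub> x') (y \<oplus>\<^bsub>A\<^esub> y') = msub R A x y \<oplus>\<^bsub>A\<^esub> msub R A x' y'"
    and "x \<in> carrier A \<Longrightarrow> y \<in> carrier A \<Longrightarrow> x' \<in> carrier A \<Longrightarrow> y' \<in> carrier A \<Longrightarrow>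
      msub R A (msub R A x x') (msub R A y y') = msub R A (msub R A x y) (msub R A x' y')"
proof -
  interpret A: module R A by fact
  note [simp] = msub_minus[OF A] A.minus_add A.a_ac A.r_neg A.r_neg1 A.r_neg2
    A.add.inv_closed A.smult_r_distr A.smult_r_minus
  show zero: "(msub R A x y = \<zero>\<^bsub>A\<^esub>) = (x = y)" if "x \<in> carrier A" "y \<in> carrier A" for x y
  proof
    assume "msub R A x y = \<zero>\<^bsub>A\<^esub>"
    then show "x = y" using that
      by (metis A.r_neg A.add.inv_closed A.add.right_cancel msub_minus[OF A])
  qed (use that in simp)
  show "msub R A x y \<oplus>\<^bsub>A\<^esub> y = x" if "x \<in> carrier A" "y \<in> carrier A"
    using that by (simp add: A.l_neg)
  show c3: "y \<oplus>\<^bsub>A\<^esub> msub R A x y = x" if "x \<in> carrier A" "y \<in> carrier A" for x y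
    using that by (simp add: A.l_neg)
  show "msub R A (x \<oplus>\<^bsub>A\<^esub> y) y = x" if "x \<in> carrier A" "y \<in> carrier A"
    using that by (simp add: A.l_neg)
  show c6: "(msub R A x y = z) = (x = z \<oplus>\<^bsub>A\<^esub> y)"
    if "x \<in> carrier A" "y \<in> carrier A" "z \<in> carrier A" for x y z
    using that by (metis A.add.inv_solve_right A.add.inv_closed msub_minus[OF A])
  show "msub R A (x \<oplus>\<^bsub>A\<^esub> y) x = y" if "x \<in> carrier A" "y \<in> carrier A"
    using c6[of "x \<oplus>\<^bsub>A\<^esub> y" x y] that A.a_comm[of x y] by (simp del: A.a_ac msub_minus[OF A])
  show "msub R A x (msub R A x y) = y" if "x \<in> carrier A" "y \<in> carrier A"
    using c6[of x "msub R A x y" y] c3[OF that] that mod_closed(4)[OF A that] by (simp del: A.a_ac msub_minus[OF A])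
  show "r \<odot>\<^bsub>A\<^esub> msub R A x y = msub R A (r \<odot>\<^bsub>A\<^esub> x) (r \<odot>\<^bsub>A\<^esub> y)"
    if "r \<in> carrier R" "x \<in> carrier A" "y \<in> carrier A"
    using that by simp
  show "msub R A (x \<oplus>\<^bsub>A\<^esub> x') (y \<oplus>\<^bsub>A\<^esub> y') = msub R A x y \<oplus>\<^bsub>A\<^esub> msub R A x' y'"
    if "x \<in> carrier A" "y \<in> carrier A" "x' \<in> carrier A" "y' \<in> carrier A"
    using that by simp
  show "msub R A (msub R A x x') (msub R A y y') = msub R A (msub R A x y) (msub R A x' y')"
    if "x \<in> carrier A" "y \<in> carrier A" "x' \<in> carrier A" "y' \<in> carrier A"
    using that by (simp add: A.minus_minus)
qed

lemma linear_msub: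
  assumes "linear_map R A B f" "module R A" "x \<in> carrier A" "y \<in> carrier A"
  shows "f (msub R A x y) = msub R B (f x) (f y)"
  using assms by (simp add: msub_def linear_add linear_smult)

lemma linear_zero:
  assumes "linear_map R A B f" "module R A" "module R B"
  shows "f \<zero>\<^bsub>A\<^esub> = \<zero>\<^bsub>B\<^esub>"
  using linear_smult[OF assms(1), of \<zero> "\<zero>\<^bsub>A\<^esub>"] assms linear_closed[OF assms(1)] by simp

lemma linear_sum:
  assumes "linear_map R A B f" "linear_map R A B g" "module R A" "module R B"
  shows "linear_map R A B (\<lambda>x. f x \<oplus>\<^bsub>B\<^esub> g x)"
  using assms by (intro linear_mapI)
    (simp_all add: linear_closed linear_add linear_smult mod_distr mod_ac)

lemma linear_scale:
  assumes "linear_map R A B f" "module R B" "r \<in> carrier R"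
  shows "linear_map R A B (\<lambda>x. r \<odot>\<^bsub>B\<^esub> f x)"
  using assms by (intro linear_mapI)
    (simp_all add: linear_closed linear_add linear_smult mod_distr smult_swap)

lemma linear_diff:
  assumes "linear_map R A B f" "linear_map R A B g" "module R A" "module R B"
  shows "linear_map R A B (\<lambda>x. msub R B (f x) (g x))"
  unfolding msub_def using assms by (intro linear_sum linear_scale) auto

lemma linear_null: "module R B \<Longrightarrow> linear_map R A B (\<lambda>x. \<zero>\<^bsub>B\<^esub>)"
  by (rule linear_mapI) auto

lemma submoduleI':
  assumes "module R A" "N \<subseteq> carrier A" "\<zero>\<^bsub>A\<^esub> \<in> N"
    "\<And>x y. x \<in> N \<Longrightarrow> y \<in> N \<Longrightarrow> x \<oplus>\<^bsub>A\<^esub> y \<in> N"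
    "\<And>r x. r \<in> carrier R \<Longrightarrow> x \<in> N \<Longrightarrow> r \<odot>\<^bsub>A\<^esub> x \<in> N"
  shows "submodule N R A"
proof -
  interpret A: module R A by fact
  show ?thesis
  proof (rule A.submoduleI)
    fix a assume "a \<in> N"
    then show "\<ominus>\<^bsub>A\<^esub> a \<in> N"
      using assms(2) assms(5)[of "\<ominus> \<one>" a] by (auto simp: A.smult_l_minus subset_iff)
  qed (use assms in auto)
qed

lemma submodule_mod: "submodule N R A \<Longrightarrow> module R A \<Longrightarrow> module R (A\<lparr>carrier := N\<rparr>)"
  by (rule submodule.submodule_is_module)

lemma submodule_rules:
  assumes "submodule N R A" "module R A"
  shows "x \<in> N \<Longrightarrow> x \<in> carrier A" "\<zero>\<^bsub>A\<^esub> \<in> N"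
    "x \<in> N \<Longrightarrow> y \<in> N \<Longrightarrow> x \<oplus>\<^bsub>A\<^esub> y \<in> N"
    "r \<in> carrier R \<Longrightarrow> x \<in> N \<Longrightarrow> r \<odot>\<^bsub>A\<^esub> x \<in> N"
    "x \<in> N \<Longrightarrow> y \<in> N \<Longrightarrow> msub R A x y \<in> N"
proof -
  interpret A: module R "A\<lparr>carrier := N\<rparr>" using submodule_mod[OF assms] .
  have A': "module R (A\<lparr>carrier := N\<rparr>)" using submodule_mod[OF assms] .
  show "x \<in> N \<Longrightarrow> x \<in> carrier A"
    using assms(1) unfolding submodule_def subgroup_def by auto
  show "\<zero>\<^bsub>A\<^esub> \<in> N" "x \<in> N \<Longrightarrow> y \<in> N \<Longrightarrow> x \<oplus>\<^bsub>A\<^esub> y \<in> N"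
    "r \<in> carrier R \<Longrightarrow> x \<in> N \<Longrightarrow> r \<odot>\<^bsub>A\<^esub> x \<in> N"
    "x \<in> N \<Longrightarrow> y \<in> N \<Longrightarrow> msub R A x y \<in> N"
    using mod_closed[OF A'] by auto
qed

lemma regular_module_module: "module R (regular_module R)"
  by (rule moduleI)
    (auto simp: regular_module_def l_distr r_distr m_assoc cring_axioms
      intro!: abelian_groupI a_ac exI[of _ "\<ominus> _"] bexI[of _ "\<ominus> _"] simp: l_neg is_cring)

lemma idealI':
  assumes "\<aa> \<subseteq> carrier R" "\<zero> \<in> \<aa>" "\<And>x y. x \<in> \<aa> \<Longrightarrow> y \<in> \<aa> \<Longrightarrow> x \<oplus> y \<in> \<aa>"
    "\<And>r x. r \<in> carrier R \<Longrightarrow> x \<in> \<aa> \<Longrightarrow> r \<otimes> x \<in> \<aa>"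
  shows "ideal \<aa> R"
proof (rule idealI[OF ring_axioms])
  have "\<ominus> x \<in> \<aa>" if "x \<in> \<aa>" for x
    using assms(4)[OF neg1_closed that] that assms(1) by (auto simp: l_minus)
  then show "subgroup \<aa> (add_monoid R)"
    using assms by (intro subgroup.intro) (auto simp: a_inv_def)
  show "\<And>a x. a \<in> \<aa> \<Longrightarrow> x \<in> carrier R \<Longrightarrow> x \<otimes> a \<in> \<aa>"
    "\<And>a x. a \<in> \<aa> \<Longrightarrow> x \<in> carrier R \<Longrightarrow> a \<otimes> x \<in> \<aa>"
    using assms(4) by (blast, metis assms(1,4) m_comm subsetD)
qed

lemma ideal_rules:
  assumes "ideal \<aa> R"
  shows "x \<in> \<aa> \<Longrightarrow> x \<in> carrier R" "\<zero> \<in> \<aa>" "x \<in> \<aa> \<Longrightarrow> y \<in> \<aa> \<Longrightarrow> x \<oplus> y \<in> \<aa>"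
    "r \<in> carrier R \<Longrightarrow> x \<in> \<aa> \<Longrightarrow> r \<otimes> x \<in> \<aa>"
    "r \<in> carrier R \<Longrightarrow> x \<in> \<aa> \<Longrightarrow> x \<otimes> r \<in> \<aa>"
proof -
  interpret a: ideal \<aa> R by fact
  show "x \<in> \<aa> \<Longrightarrow> x \<in> carrier R" "\<zero> \<in> \<aa>" "x \<in> \<aa> \<Longrightarrow> y \<in> \<aa> \<Longrightarrow> x \<oplus> y \<in> \<aa>"
    "r \<in> carrier R \<Longrightarrow> x \<in> \<aa> \<Longrightarrow> r \<otimes> x \<in> \<aa>" "r \<in> carrier R \<Longrightarrow> x \<in> \<aa> \<Longrightarrow> x \<otimes> r \<in> \<aa>"
    by (simp_all add: a.I_l_closed a.I_r_closed a.Icarr)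
qed

end


section \<open>Injective modules\<close>

context fixed_cring
begin

lemma baer_module: "baer R E \<Longrightarrow> module R E"
  by (simp add: baer_def)

lemma baerD:
  assumes "baer R E" "ideal \<aa> R"
    and "\<And>r. r \<in> \<aa> \<Longrightarrow> f r \<in> carrier E"
    and "\<And>r s. r \<in> \<aa> \<Longrightarrow> s \<in> \<aa> \<Longrightarrow> f (r \<oplus> s) = f r \<oplus>\<^bsub>E\<^esub> f s"
    and "\<And>r s. r \<in> carrier R \<Longrightarrow> s \<in> \<aa> \<Longrightarrow> f (r \<otimes> s) = r \<odot>\<^bsub>E\<^esub> f s"
  obtains e where "e \<in> carrier E" "\<And>r. r \<in> \<aa> \<Longrightarrow> f r = r \<odot>\<^bsub>E\<^esub> e"
proof -
  have "linear_map R (regular_module R\<lparr>carrier := \<aa>\<rparr>) E f"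
    by (rule linear_mapI) (use assms in \<open>auto simp: regular_module_def\<close>)
  then show ?thesis using assms(1,2) that unfolding baer_def by blast
qed

lemma baerI:
  assumes "module R E"
    and "\<And>\<aa> f. ideal \<aa> R \<Longrightarrow> (\<And>r. r \<in> \<aa> \<Longrightarrow> f r \<in> carrier E) \<Longrightarrow>
      (\<And>r s. r \<in> \<aa> \<Longrightarrow> s \<in> \<aa> \<Longrightarrow> f (r \<oplus> s) = f r \<oplus>\<^bsub>E\<^esub> f s) \<Longrightarrow>
      (\<And>r s. r \<in> carrier R \<Longrightarrow> s \<in> \<aa> \<Longrightarrow> f (r \<otimes> s) = r \<odot>\<^bsub>E\<^esub> f s) \<Longrightarrow>
      \<exists>e\<in>carrier E. \<forall>r\<in>\<aa>. f r = r \<odot>\<^bsub>E\<^esub> e"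
  shows "baer R E"
  unfolding baer_def
proof (intro conjI allI impI assms(1))
  fix \<aa> f assume a: "ideal \<aa> R" and f: "linear_map R (regular_module R\<lparr>carrier := \<aa>\<rparr>) E f"
  show "\<exists>e\<in>carrier E. \<forall>r\<in>\<aa>. f r = r \<odot>\<^bsub>E\<^esub> e"
    by (rule assms(2)[OF a])
      (use linear_closed[OF f] linear_add[OF f] linear_smult[OF f] in \<open>simp_all add: regular_module_def\<close>)
qed

text \<open>Partial extensions are handled as graphs, so that Zorn's lemma applies to plain inclusion.\<close>

lemma baer_extend:
  assumes E: "baer R E" and A: "module R A" and B: "module R B"
    and d: "linear_map R A B d" and g: "linear_map R A E g"
    and ker: "\<And>a. a \<in> carrier A \<Longrightarrow> d a = \<zero>\<^bsub>B\<^esub> \<Longrightarrow> g a = \<zero>\<^bsub>E\<^esub>"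
  obtains h where "linear_map R B E h" "\<And>a. a \<in> carrier A \<Longrightarrow> h (d a) = g a"
proof -
  have E': "module R E" using E by (rule baer_module)
  define D where "D = {(d a, g a) | a. a \<in> carrier A}"
  \<comment> \<open>For a graph closed under the operations, the last clause amounts to being
    single-valued. The map \<open>d\<close> need not be injective: \<open>ker\<close> is what makes
    the initial graph \<open>D\<close> satisfy that clause.\<close>
  define good where "good G \<longleftrightarrow> G \<subseteq> carrier B \<times> carrier E \<and> D \<subseteq> G \<and>
     (\<forall>b e b' e'. (b, e) \<in> G \<longrightarrow> (b', e') \<in> G \<longrightarrow> (b \<oplus>\<^bsub>B\<^esub> b', e \<oplus>\<^bsub>E\<^esub> e') \<in> G) \<and>
     (\<forall>r\<in>carrier R. \<forall>b e. (b, e) \<in> G \<longrightarrow> (r \<odot>\<^bsub>B\<^esub> b, r \<odot>\<^bsub>E\<^esub> e) \<in> G) \<and>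
     (\<forall>e. (\<zero>\<^bsub>B\<^esub>, e) \<in> G \<longrightarrow> e = \<zero>\<^bsub>E\<^esub>)" for G
  have D: "good D"
    unfolding good_def
  proof (intro conjI allI impI ballI)
    show "D \<subseteq> carrier B \<times> carrier E"
      using d g by (auto simp: D_def linear_closed)
    show "(b \<oplus>\<^bsub>B\<^esub> b', e \<oplus>\<^bsub>E\<^esub> e') \<in> D" if "(b, e) \<in> D" "(b', e') \<in> D" for b e b' e'
    proof -
      from that obtain a a' where "a \<in> carrier A" "a' \<in> carrier A"
        "b = d a" "e = g a" "b' = d a'" "e' = g a'" by (auto simp: D_def)
      then show ?thesis unfolding D_def using A
        by (auto intro!: exI[of _ "a \<oplus>\<^bsub>A\<^esub> a'"] simp: linear_add[OF d] linear_add[OF g])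
    qed
    show "(r \<odot>\<^bsub>B\<^esub> b, r \<odot>\<^bsub>E\<^esub> e) \<in> D" if "r \<in> carrier R" "(b, e) \<in> D" for r b e
    proof -
      from that obtain a where "a \<in> carrier A" "b = d a" "e = g a" by (auto simp: D_def)
      then show ?thesis unfolding D_def using A that
        by (auto intro!: exI[of _ "r \<odot>\<^bsub>A\<^esub> a"] simp: linear_smult[OF d] linear_smult[OF g])
    qed
    show "e = \<zero>\<^bsub>E\<^esub>" if "(\<zero>\<^bsub>B\<^esub>, e) \<in> D" for e
      using that ker by (auto simp: D_def)
  qed auto
  have "\<exists>G\<in>Collect good. \<forall>H\<in>Collect good. G \<subseteq> H \<longrightarrow> H = G"
  proof (rule subset_Zorn_nonempty)
    show "Collect good \<noteq> {}" using D by auto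
    fix \<C> assume ne: "\<C> \<noteq> {}" and ch: "subset.chain (Collect good) \<C>"
    have gd: "\<And>G. G \<in> \<C> \<Longrightarrow> good G" using ch by (auto simp: subset_chain_def)
    have common: "\<exists>G\<in>\<C>. p \<in> G \<and> q \<in> G" if pq: "p \<in> \<Union>\<C>" "q \<in> \<Union>\<C>" for p q
    proof -
      obtain G H where "G \<in> \<C>" "p \<in> G" "H \<in> \<C>" "q \<in> H" using pq by blast
      moreover have "G \<subseteq> H \<or> H \<subseteq> G"
        using calculation ch unfolding subset_chain_def by blast
      ultimately show ?thesis by blast
    qed
    show "\<Union>\<C> \<in> Collect good"
      unfolding mem_Collect_eq good_def
    proof (intro conjI allI impI ballI)
      show "\<Union>\<C> \<subseteq> carrier B \<times> carrier E" using gd unfolding good_def by blast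
      show "D \<subseteq> \<Union>\<C>" using gd ne unfolding good_def by blast
      show "(b \<oplus>\<^bsub>B\<^esub> b', e \<oplus>\<^bsub>E\<^esub> e') \<in> \<Union>\<C>" if "(b, e) \<in> \<Union>\<C>" "(b', e') \<in> \<Union>\<C>" for b e b' e'
        using common[OF that] gd unfolding good_def by blast
      show "(r \<odot>\<^bsub>B\<^esub> b, r \<odot>\<^bsub>E\<^esub> e) \<in> \<Union>\<C>" if "r \<in> carrier R" "(b, e) \<in> \<Union>\<C>" for r b e
        using that gd unfolding good_def by blast
      show "e = \<zero>\<^bsub>E\<^esub>" if "(\<zero>\<^bsub>B\<^esub>, e) \<in> \<Union>\<C>" for e
        using that gd unfolding good_def by blast
    qed
  qed
  then obtain G where G: "good G" and max: "\<And>H. good H \<Longrightarrow> G \<subseteq> H \<Longrightarrow> H = G" by blast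
  have Gc: "b \<in> carrier B" "e \<in> carrier E" if "(b, e) \<in> G" for b e
    using G that by (auto simp: good_def)
  have Ga: "(b \<oplus>\<^bsub>B\<^esub> b', e \<oplus>\<^bsub>E\<^esub> e') \<in> G" if "(b, e) \<in> G" "(b', e') \<in> G" for b e b' e'
    using G that unfolding good_def by blast
  have Gs: "(r \<odot>\<^bsub>B\<^esub> b, r \<odot>\<^bsub>E\<^esub> e) \<in> G" if "(b, e) \<in> G" "r \<in> carrier R" for r b e
    using G that unfolding good_def by blast
  have Gm: "(msub R B b b', msub R E e e') \<in> G" if "(b, e) \<in> G" "(b', e') \<in> G" for b e b' e'
    unfolding msub_def using that by (intro Ga Gs) auto
  have Gz: "e = \<zero>\<^bsub>E\<^esub>" if "(\<zero>\<^bsub>B\<^esub>, e) \<in> G" for e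
    using G that unfolding good_def by blast
  have Gf: "e = e'" if "(b, e) \<in> G" "(b, e') \<in> G" for b e e'
  proof -
    have "msub R E e e' = \<zero>\<^bsub>E\<^esub>"
      using Gm[OF that] Gz Gc(1)[OF that(1)] B by simp
    then show ?thesis using msub_alg(1)[OF E'] Gc(2) that by blast
  qed
  have DG: "(d a, g a) \<in> G" if "a \<in> carrier A" for a
    using G that unfolding good_def D_def by blast
  have G0: "(\<zero>\<^bsub>B\<^esub>, \<zero>\<^bsub>E\<^esub>) \<in> G"
    using DG[of "\<zero>\<^bsub>A\<^esub>"] linear_zero[OF d A B] linear_zero[OF g A E'] A by simp
  have total: "\<exists>e. (b, e) \<in> G" if b: "b \<in> carrier B" for b
  proof -
    \<comment> \<open>The multiples of \<open>b\<close> at which the partial map is already defined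
      give an ideal; Baer's criterion on it yields the value \<open>e0\<close> to be assigned to
      \<open>b\<close>.\<close>
    define \<aa> where "\<aa> = {r \<in> carrier R. \<exists>e. (r \<odot>\<^bsub>B\<^esub> b, e) \<in> G}"
    define f where "f r = (THE e. (r \<odot>\<^bsub>B\<^esub> b, e) \<in> G)" for r
    have fG: "(r \<odot>\<^bsub>B\<^esub> b, f r) \<in> G" if "r \<in> \<aa>" for r
      using that Gf theI'[of "\<lambda>e. (r \<odot>\<^bsub>B\<^esub> b, e) \<in> G"] by (auto simp: \<aa>_def f_def)
    have feq: "f r = e" if "(r \<odot>\<^bsub>B\<^esub> b, e) \<in> G" "r \<in> carrier R" for r e
      using Gf[OF fG that(1)] that by (auto simp: \<aa>_def)
    have add: "((r \<oplus> s) \<odot>\<^bsub>B\<^esub> b, f r \<oplus>\<^bsub>E\<^esub> f s) \<in> G" if "r \<in> \<aa>" "s \<in> \<aa>" for r s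
      using Ga[OF fG fG, OF that] that b B by (simp add: \<aa>_def mod_distr)
    have mult: "((r \<otimes> s) \<odot>\<^bsub>B\<^esub> b, r \<odot>\<^bsub>E\<^esub> f s) \<in> G" if "r \<in> carrier R" "s \<in> \<aa>" for r s
      using Gs[OF fG, OF that(2,1)] that b B by (simp add: \<aa>_def mod_distr)
    have ideal: "ideal \<aa> R"
    proof (rule idealI')
      show "\<aa> \<subseteq> carrier R" by (auto simp: \<aa>_def)
      show "\<zero> \<in> \<aa>" using G0 b B by (auto simp: \<aa>_def)
      show "r \<oplus> s \<in> \<aa>" if "r \<in> \<aa>" "s \<in> \<aa>" for r s
        using add[OF that] that by (auto simp: \<aa>_def)
      show "r \<otimes> s \<in> \<aa>" if "r \<in> carrier R" "s \<in> \<aa>" for r s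
        using mult[OF that] that by (auto simp: \<aa>_def)
    qed
    obtain e0 where e0: "e0 \<in> carrier E" "\<And>r. r \<in> \<aa> \<Longrightarrow> f r = r \<odot>\<^bsub>E\<^esub> e0"
    proof (rule baerD[OF E ideal])
      show "f r \<in> carrier E" if "r \<in> \<aa>" for r using fG[OF that] Gc by blast
      show "f (r \<oplus> s) = f r \<oplus>\<^bsub>E\<^esub> f s" if "r \<in> \<aa>" "s \<in> \<aa>" for r s
        using feq[OF add[OF that]] that by (auto simp: \<aa>_def)
      show "f (r \<otimes> s) = r \<odot>\<^bsub>E\<^esub> f s" if "r \<in> carrier R" "s \<in> \<aa>" for r s
        using feq[OF mult[OF that]] that by (auto simp: \<aa>_def)
    qed (rule that)
    define H where "H = {(n \<oplus>\<^bsub>B\<^esub> r \<odot>\<^bsub>B\<^esub> b, e \<oplus>\<^bsub>E\<^esub> r \<odot>\<^bsub>E\<^esub> e0) | n e r. (n, e) \<in> G \<and> r \<in> carrier R}"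
    have GH: "G \<subseteq> H"
    proof clarify
      fix n e assume n: "(n, e) \<in> G"
      have "(n \<oplus>\<^bsub>B\<^esub> \<zero> \<odot>\<^bsub>B\<^esub> b, e \<oplus>\<^bsub>E\<^esub> \<zero> \<odot>\<^bsub>E\<^esub> e0) \<in> H" unfolding H_def using n by blast
      then show "(n, e) \<in> H" using n Gc[OF n] b e0 B E' by simp
    qed
    have bH: "(b, e0) \<in> H"
    proof -
      have "(\<zero>\<^bsub>B\<^esub> \<oplus>\<^bsub>B\<^esub> \<one> \<odot>\<^bsub>B\<^esub> b, \<zero>\<^bsub>E\<^esub> \<oplus>\<^bsub>E\<^esub> \<one> \<odot>\<^bsub>E\<^esub> e0) \<in> H" unfolding H_def using G0 by blast
      then show ?thesis using b e0 B E' by simp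
    qed
    have "good H"
      unfolding good_def
    proof (intro conjI allI impI ballI)
      show "H \<subseteq> carrier B \<times> carrier E"
        using Gc b e0 B E' by (auto simp: H_def)
      show "D \<subseteq> H" using GH G by (auto simp: good_def)
    next
      fix x e x' e' assume "(x, e) \<in> H" "(x', e') \<in> H"
      then obtain n1 e1 r1 n2 e2 r2 where *: "(n1, e1) \<in> G" "r1 \<in> carrier R" "(n2, e2) \<in> G" "r2 \<in> carrier R"
        "x = n1 \<oplus>\<^bsub>B\<^esub> r1 \<odot>\<^bsub>B\<^esub> b" "e = e1 \<oplus>\<^bsub>E\<^esub> r1 \<odot>\<^bsub>E\<^esub> e0"
        "x' = n2 \<oplus>\<^bsub>B\<^esub> r2 \<odot>\<^bsub>B\<^esub> b" "e' = e2 \<oplus>\<^bsub>E\<^esub> r2 \<odot>\<^bsub>E\<^esub> e0"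
        by (auto simp: H_def)
      have "x \<oplus>\<^bsub>B\<^esub> x' = (n1 \<oplus>\<^bsub>B\<^esub> n2) \<oplus>\<^bsub>B\<^esub> (r1 \<oplus> r2) \<odot>\<^bsub>B\<^esub> b"
        "e \<oplus>\<^bsub>E\<^esub> e' = (e1 \<oplus>\<^bsub>E\<^esub> e2) \<oplus>\<^bsub>E\<^esub> (r1 \<oplus> r2) \<odot>\<^bsub>E\<^esub> e0"
        using * Gc[OF *(1)] Gc[OF *(3)] b e0 B E' by (simp_all add: mod_distr mod_ac)
      then show "(x \<oplus>\<^bsub>B\<^esub> x', e \<oplus>\<^bsub>E\<^esub> e') \<in> H"
        unfolding H_def using Ga[OF *(1,3)] * by blast
    next
      fix r x e assume r: "r \<in> carrier R" and "(x, e) \<in> H"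
      then obtain n1 e1 r1 where *: "(n1, e1) \<in> G" "r1 \<in> carrier R"
        "x = n1 \<oplus>\<^bsub>B\<^esub> r1 \<odot>\<^bsub>B\<^esub> b" "e = e1 \<oplus>\<^bsub>E\<^esub> r1 \<odot>\<^bsub>E\<^esub> e0"
        by (auto simp: H_def)
      have "r \<odot>\<^bsub>B\<^esub> x = (r \<odot>\<^bsub>B\<^esub> n1) \<oplus>\<^bsub>B\<^esub> (r \<otimes> r1) \<odot>\<^bsub>B\<^esub> b"
        "r \<odot>\<^bsub>E\<^esub> e = (r \<odot>\<^bsub>E\<^esub> e1) \<oplus>\<^bsub>E\<^esub> (r \<otimes> r1) \<odot>\<^bsub>E\<^esub> e0"
        using * r Gc[OF *(1)] b e0 B E' by (simp_all add: mod_distr)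
      then show "(r \<odot>\<^bsub>B\<^esub> x, r \<odot>\<^bsub>E\<^esub> e) \<in> H"
        unfolding H_def using Gs[OF *(1) r] r * by blast
    next
      \<comment> \<open>The enlarged graph stays single-valued: here \<open>r1 b = - n1\<close> puts
        \<open>r1\<close> into the ideal, where multiplication by \<open>e0\<close> agrees with the
        old map.\<close>
      fix e assume "(\<zero>\<^bsub>B\<^esub>, e) \<in> H"
      then obtain n1 e1 r1 where *: "(n1, e1) \<in> G" "r1 \<in> carrier R"
        "\<zero>\<^bsub>B\<^esub> = n1 \<oplus>\<^bsub>B\<^esub> r1 \<odot>\<^bsub>B\<^esub> b" "e = e1 \<oplus>\<^bsub>E\<^esub> r1 \<odot>\<^bsub>E\<^esub> e0"
        by (auto simp: H_def)
      have c: "n1 \<in> carrier B" "e1 \<in> carrier E" using Gc[OF *(1)] by auto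
      have "r1 \<odot>\<^bsub>B\<^esub> b = msub R B \<zero>\<^bsub>B\<^esub> n1"
        using *(2,3) c b B by (metis mod_closed(3) msub_alg(5))
      then have m: "(r1 \<odot>\<^bsub>B\<^esub> b, msub R E \<zero>\<^bsub>E\<^esub> e1) \<in> G"
        using Gm[OF G0 *(1)] by simp
      then have "r1 \<odot>\<^bsub>E\<^esub> e0 = msub R E \<zero>\<^bsub>E\<^esub> e1"
        using feq[OF m *(2)] e0(2)[of r1] *(2) m by (metis (mono_tags, lifting) \<aa>_def mem_Collect_eq)
      then show "e = \<zero>\<^bsub>E\<^esub>"
        using *(4) c E' by (simp add: msub_alg)
    qed
    then have "H = G" using max GH by blast
    then show ?thesis using bH by auto
  qed
  define h where "h b = (THE e. (b, e) \<in> G)" for b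
  have hG: "(b, h b) \<in> G" if "b \<in> carrier B" for b
    using total[OF that] Gf theI'[of "\<lambda>e. (b, e) \<in> G"] unfolding h_def by blast
  have heq: "h b = e" if "(b, e) \<in> G" for b e
    using Gf[OF hG that] Gc[OF that] by auto
  show ?thesis
  proof (rule that)
    show "linear_map R B E h"
    proof (rule linear_mapI)
      show "h x \<in> carrier E" if "x \<in> carrier B" for x using Gc(2)[OF hG[OF that]] .
      show "h (x \<oplus>\<^bsub>B\<^esub> y) = h x \<oplus>\<^bsub>E\<^esub> h y" if "x \<in> carrier B" "y \<in> carrier B" for x y
        by (rule heq[OF Ga[OF hG hG, OF that]])
      show "h (r \<odot>\<^bsub>B\<^esub> x) = r \<odot>\<^bsub>E\<^esub> h x" if "r \<in> carrier R" "x \<in> carrier B" for r x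
        by (rule heq[OF Gs[OF hG[OF that(2)] that(1)]])
    qed
    show "h (d a) = g a" if "a \<in> carrier A" for a
      using heq[OF DG[OF that]] .
  qed
qed

lemma submodule_inclusion: "submodule N R A \<Longrightarrow> module R A \<Longrightarrow> linear_map R (A\<lparr>carrier := N\<rparr>) A (\<lambda>x. x)"
  by (rule linear_mapI) (simp_all add: submodule_rules(1))

lemma baer_extend_submodule:
  assumes "baer R E" "module R B" "submodule N R B" "linear_map R (B\<lparr>carrier := N\<rparr>) E g"
  obtains h where "linear_map R B E h" "\<And>x. x \<in> N \<Longrightarrow> h x = g x"
proof -
  have N: "module R (B\<lparr>carrier := N\<rparr>)" by (rule submodule_mod[OF assms(3,2)])
  show ?thesis
  proof (rule baer_extend[OF assms(1) N assms(2) submodule_inclusion[OF assms(3,2)] assms(4)])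
    fix a assume "a \<in> carrier (B\<lparr>carrier := N\<rparr>)" "a = \<zero>\<^bsub>B\<^esub>"
    then show "g a = \<zero>\<^bsub>E\<^esub>"
      using linear_zero[OF assms(4) N baer_module[OF assms(1)]] by simp
  next
    fix h assume "linear_map R B E h" "\<And>a. a \<in> carrier (B\<lparr>carrier := N\<rparr>) \<Longrightarrow> h a = g a"
    then show thesis by (intro that[of h]) simp_all
  qed
qed

lemma injective_imp_baer:
  assumes "injective_module R (E :: ('r, 'e) module)"
  shows "baer R E"
proof (rule baerI)
  show E: "module R E" using assms by (simp add: injective_module_def)
  fix \<aa> f
  assume a: "ideal \<aa> R" and f: "\<And>r. r \<in> \<aa> \<Longrightarrow> f r \<in> carrier E"
    "\<And>r s. r \<in> \<aa> \<Longrightarrow> s \<in> \<aa> \<Longrightarrow> f (r \<oplus> s) = f r \<oplus>\<^bsub>E\<^esub> f s"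
    "\<And>r s. r \<in> carrier R \<Longrightarrow> s \<in> \<aa> \<Longrightarrow> f (r \<otimes> s) = r \<odot>\<^bsub>E\<^esub> f s"
  \<comment> \<open>Ideals, and \<open>R\<close> itself, are copied to the type over which the test
    modules of \<open>injective_module\<close> range; the second component is frozen at
    zero.\<close>
  define P :: "'r set \<Rightarrow> ('r, 'r \<times> 'e) module" where
    "P N = \<lparr>carrier = N \<times> {\<zero>\<^bsub>E\<^esub>}, monoid.mult = undefined, one = undefined,
        zero = (\<zero>, \<zero>\<^bsub>E\<^esub>), add = (\<lambda>x y. (fst x \<oplus> fst y, \<zero>\<^bsub>E\<^esub>)),
        smult = (\<lambda>r x. (r \<otimes> fst x, \<zero>\<^bsub>E\<^esub>))\<rparr>" for N
  have mod: "module R (P N)" if N: "ideal N R" for N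
  proof -
    note c = ideal_rules[OF N]
    show ?thesis
    proof (rule moduleI[OF is_cring])
      show "abelian_group (P N)"
      proof (rule abelian_groupI)
        fix x assume "x \<in> carrier (P N)"
        then obtain r where r: "x = (r, \<zero>\<^bsub>E\<^esub>)" "r \<in> N" by (auto simp: P_def)
        have "\<ominus> r = \<ominus> \<one> \<otimes> r" using r c(1) by (simp add: l_minus)
        then show "\<exists>y\<in>carrier (P N). y \<oplus>\<^bsub>P N\<^esub> x = \<zero>\<^bsub>P N\<^esub>"
          using r c(4)[OF neg1_closed r(2)] c(1) l_neg[of r]
          by (intro bexI[of _ "(\<ominus> r, \<zero>\<^bsub>E\<^esub>)"]) (auto simp: P_def)
      qed (auto simp: P_def c a_ac)
    qed (auto simp: P_def c l_distr r_distr m_assoc)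
  qed
  have carr: "ideal (carrier R) R" by (rule oneideal)
  let ?g = "restrict (\<lambda>x. f (fst x)) (carrier (P \<aa>))"
  let ?u = "restrict (\<lambda>x. x) (carrier (P \<aa>))"
  have "?u \<in> mod_hom R (P \<aa>) (P (carrier R))" "inj_on ?u (carrier (P \<aa>))"
    "?g \<in> mod_hom R (P \<aa>) E"
    using ideal_rules[OF a] f by (auto simp: mod_hom_def P_def inj_on_def)
  then have "\<exists>h\<in>mod_hom R (P (carrier R)) E. \<forall>x\<in>carrier (P \<aa>). h (?u x) = ?g x"
    using assms[unfolded injective_module_def, THEN conjunct2, rule_format, of "P \<aa>" "P (carrier R)" ?u ?g]
      mod[OF a] mod[OF carr] by (simp only: simp_thms)
  then obtain h where h: "h \<in> mod_hom R (P (carrier R)) E" "\<And>x. x \<in> carrier (P \<aa>) \<Longrightarrow> h (?u x) = ?g x"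
    by blast
  have "f r = r \<odot>\<^bsub>E\<^esub> h (\<one>, \<zero>\<^bsub>E\<^esub>)" if "r \<in> \<aa>" for r
  proof -
    have "h (r \<odot>\<^bsub>P (carrier R)\<^esub> (\<one>, \<zero>\<^bsub>E\<^esub>)) = r \<odot>\<^bsub>E\<^esub> h (\<one>, \<zero>\<^bsub>E\<^esub>)"
      by (rule linear_smult[OF mod_hom_linear[OF h(1)]]) (simp_all add: P_def ideal_rules(1)[OF a that])
    then show ?thesis using h(2)[of "(r, \<zero>\<^bsub>E\<^esub>)"] that ideal_rules(1)[OF a that]
      by (simp add: P_def)
  qed
  moreover have "h (\<one>, \<zero>\<^bsub>E\<^esub>) \<in> carrier E"
    using linear_closed[OF mod_hom_linear[OF h(1)]] by (simp add: P_def)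
  ultimately show "\<exists>e\<in>carrier E. \<forall>r\<in>\<aa>. f r = r \<odot>\<^bsub>E\<^esub> e" by blast
qed

end


section \<open>Complexes and homotopies\<close>

definition complex :: "'r ring \<Rightarrow> (nat \<Rightarrow> ('r, 'e) module) \<Rightarrow> (nat \<Rightarrow> 'e \<Rightarrow> 'e) \<Rightarrow> bool" where
  "complex R C d \<longleftrightarrow> (\<forall>i. module R (C i)) \<and> (\<forall>i. linear_map R (C i) (C (Suc i)) (d i)) \<and>
    (\<forall>i. \<forall>x\<in>carrier (C i). d (Suc i) (d i x) = \<zero>\<^bsub>C (Suc (Suc i))\<^esub>)"

text \<open>The other inclusion is automatic in a complex. In degree 0, where the coboundaries are
  zero by convention, the condition is injectivity of the first differential.\<close>

definition exact_at :: "(nat \<Rightarrow> ('r, 'e) module) \<Rightarrow> (nat \<Rightarrow> 'e \<Rightarrow> 'e) \<Rightarrow> nat \<Rightarrow> bool" where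
  "exact_at C d i \<longleftrightarrow> cocycles C d i \<subseteq> coboundaries C d i"

text \<open>The summand \<open>d h\<close> of a homotopy.\<close>

definition from_below ::
  "(nat \<Rightarrow> ('r, 'b) module) \<Rightarrow> (nat \<Rightarrow> 'b \<Rightarrow> 'b) \<Rightarrow> (nat \<Rightarrow> 'a \<Rightarrow> 'b) \<Rightarrow> nat \<Rightarrow> 'a \<Rightarrow> 'b" where
  "from_below D d h i x = (case i of 0 \<Rightarrow> \<zero>\<^bsub>D 0\<^esub> | Suc j \<Rightarrow> d j (h j x))"

definition null_homotopic ::
  "'r ring \<Rightarrow> (nat \<Rightarrow> ('r, 'a) module) \<Rightarrow> (nat \<Rightarrow> 'a \<Rightarrow> 'a) \<Rightarrow>
    (nat \<Rightarrow> ('r, 'b) module) \<Rightarrow> (nat \<Rightarrow> 'b \<Rightarrow> 'b) \<Rightarrow> (nat \<Rightarrow> 'a \<Rightarrow> 'b) \<Rightarrow> bool" where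
  "null_homotopic R C d D d' \<phi> \<longleftrightarrow> (\<exists>h. (\<forall>i. linear_map R (C (Suc i)) (D i) (h i)) \<and>
     (\<forall>i. \<forall>x\<in>carrier (C i). \<phi> i x = h i (d i x) \<oplus>\<^bsub>D i\<^esub> from_below D d' h i x))"

definition chain_map ::
  "'r ring \<Rightarrow> (nat \<Rightarrow> ('r, 'a) module) \<Rightarrow> (nat \<Rightarrow> 'a \<Rightarrow> 'a) \<Rightarrow>
    (nat \<Rightarrow> ('r, 'b) module) \<Rightarrow> (nat \<Rightarrow> 'b \<Rightarrow> 'b) \<Rightarrow> (nat \<Rightarrow> 'a \<Rightarrow> 'b) \<Rightarrow> bool" where
  "chain_map R C d D d' \<phi> \<longleftrightarrow> (\<forall>i. linear_map R (C i) (D i) (\<phi> i)) \<and>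
     (\<forall>i. \<forall>x\<in>carrier (C i). \<phi> (Suc i) (d i x) = d' i (\<phi> i x))"

lemma complexD:
  assumes "complex R C d"
  shows "module R (C i)" "linear_map R (C i) (C (Suc i)) (d i)"
    "x \<in> carrier (C i) \<Longrightarrow> d (Suc i) (d i x) = \<zero>\<^bsub>C (Suc (Suc i))\<^esub>"
    "x \<in> carrier (C i) \<Longrightarrow> d i x \<in> carrier (C (Suc i))"
  using assms linear_closed[of R "C i" "C (Suc i)" "d i" x] by (auto simp: complex_def)

lemma chain_mapD:
  assumes "chain_map R C d D d' \<phi>"
  shows "linear_map R (C i) (D i) (\<phi> i)"
    "x \<in> carrier (C i) \<Longrightarrow> \<phi> (Suc i) (d i x) = d' i (\<phi> i x)"
    "x \<in> carrier (C i) \<Longrightarrow> \<phi> i x \<in> carrier (D i)"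
  using assms linear_closed[of R "C i" "D i" "\<phi> i" x] by (auto simp: chain_map_def)

lemma exact_atD_Suc:
  assumes "exact_at C d (Suc i)" "x \<in> carrier (C (Suc i))" "d (Suc i) x = \<zero>\<^bsub>C (Suc (Suc i))\<^esub>"
  obtains w where "w \<in> carrier (C i)" "x = d i w"
  using assms by (auto simp: exact_at_def cocycles_def coboundaries_def)

lemma exact_atD_0:
  assumes "exact_at C d 0" "x \<in> carrier (C 0)" "d 0 x = \<zero>\<^bsub>C (Suc 0)\<^esub>"
  shows "x = \<zero>\<^bsub>C 0\<^esub>"
  using assms by (auto simp: exact_at_def cocycles_def coboundaries_def)

context fixed_cring
begin

lemma from_below_linear:
  assumes "complex R D d'" "module R (A :: ('r, 'a) module)"
    and "\<And>j. i = Suc j \<Longrightarrow> linear_map R A (D j) (h j)"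
  shows "linear_map R A (D i) (from_below D d' h i)"
proof (cases i)
  case 0
  then show ?thesis using linear_null[OF complexD(1)[OF assms(1), of 0]]
    by (simp add: from_below_def[abs_def])
next
  case (Suc j)
  then show ?thesis
    using linear_comp[OF assms(3)[OF Suc] complexD(2)[OF assms(1)]]
    by (simp add: from_below_def[abs_def])
qed

lemma from_below_closed:
  assumes "complex R D d'" "\<And>j. i = Suc j \<Longrightarrow> h j x \<in> carrier (D j)"
  shows "from_below D d' h i x \<in> carrier (D i)"
  using complexD(1)[OF assms(1), of 0] assms complexD(4)[OF assms(1)]
  by (auto simp: from_below_def split: nat.split)

text \<open>Splitting a complex of injectives from the left: each step extends \<open>1 - d s\<close>, which vanishes
  on cocycles, along the differential.\<close>

lemma contraction_exists:
  assumes C: "complex R C d" and inj: "\<And>i. baer R (C i)"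
  shows "\<exists>s. \<forall>i. (\<forall>j\<le>i. exact_at C d j) \<longrightarrow> linear_map R (C (Suc i)) (C i) (s i) \<and>
     (\<forall>x\<in>carrier (C i). x = s i (d i x) \<oplus>\<^bsub>C i\<^esub> from_below C d s i x)"
proof -
  note M = complexD(1)[OF C] and lin = complexD(2)[OF C] and dd = complexD(3)[OF C]
    and dc = complexD(4)[OF C]
  define ex where "ex i \<longleftrightarrow> (\<forall>j\<le>i. exact_at C d j)" for i
  \<comment> \<open>The identity \<open>d u d = d\<close> is what the next step needs: it makes
    \<open>1 - d u\<close> vanish on coboundaries, which by exactness are all the cocycles. Both
    predicates are conditional on exactness, so one recursion serves whatever its range.\<close>
  define P where "P i u \<longleftrightarrow> (ex i \<longrightarrow> linear_map R (C (Suc i)) (C i) u \<and>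
     (\<forall>x\<in>carrier (C i). d i (u (d i x)) = d i x) \<and>
     (i = 0 \<longrightarrow> (\<forall>x\<in>carrier (C i). x = u (d i x))))" for i u
  define Q where "Q i u v \<longleftrightarrow> (ex (Suc i) \<longrightarrow>
     (\<forall>x\<in>carrier (C (Suc i)). x = v (d (Suc i) x) \<oplus>\<^bsub>C (Suc i)\<^esub> d i (u x)))" for i u v
  have "\<exists>s. \<forall>i. P i (s i) \<and> Q i (s i) (s (Suc i))"
  proof (rule dependent_nat_choice)
    show "\<exists>u. P 0 u"
    proof (cases "ex 0")
      case True
      then have e: "exact_at C d 0" by (simp add: ex_def)
      obtain h where "linear_map R (C (Suc 0)) (C 0) h" "\<And>a. a \<in> carrier (C 0) \<Longrightarrow> h (d 0 a) = a"
        using baer_extend[OF inj M M lin linear_id, of 0] exact_atD_0[OF e] by blast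
      then have "P 0 h" by (auto simp: P_def)
      then show ?thesis by blast
    qed (simp add: P_def)
  next
    fix u i assume u: "P i u"
    show "\<exists>v. P (Suc i) v \<and> Q i u v"
    proof (cases "ex (Suc i)")
      case True
      then have e: "exact_at C d (Suc i)" and ei: "ex i" by (auto simp: ex_def)
      have ul: "linear_map R (C (Suc i)) (C i) u" and du: "\<And>x. x \<in> carrier (C i) \<Longrightarrow> d i (u (d i x)) = d i x"
        using u ei by (auto simp: P_def)
      let ?g = "\<lambda>x. msub R (C (Suc i)) x (d i (u x))"
      have gl: "linear_map R (C (Suc i)) (C (Suc i)) ?g"
        by (rule linear_diff[OF linear_id linear_comp[OF ul lin] M M])
      obtain v where v: "linear_map R (C (Suc (Suc i))) (C (Suc i)) v"
        "\<And>a. a \<in> carrier (C (Suc i)) \<Longrightarrow> v (d (Suc i) a) = ?g a"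
      proof (rule baer_extend[OF inj M M lin gl])
        fix a assume a: "a \<in> carrier (C (Suc i))" "d (Suc i) a = \<zero>\<^bsub>C (Suc (Suc i))\<^esub>"
        then obtain w where w: "w \<in> carrier (C i)" "a = d i w"
          using exact_atD_Suc[OF e] by blast
        then show "?g a = \<zero>\<^bsub>C (Suc i)\<^esub>" using du a(1) M by simp
      qed (rule that)
      have uc: "d i (u x) \<in> carrier (C (Suc i))" if "x \<in> carrier (C (Suc i))" for x
        using dc linear_closed[OF ul] that by blast
      have "d (Suc i) (v (d (Suc i) x)) = d (Suc i) x" if "x \<in> carrier (C (Suc i))" for x
        using that v(2)[OF that] uc[OF that] dd[OF linear_closed[OF ul that]] dc M
        by (simp add: linear_msub[OF lin M])
      then have "P (Suc i) v" using v(1) by (simp add: P_def)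
      moreover have "Q i u v"
        using v(2) uc M by (simp add: Q_def msub_alg)
      ultimately show ?thesis by blast
    qed (simp add: P_def Q_def)
  qed
  then obtain s where s: "\<And>i. P i (s i)" "\<And>i. Q i (s i) (s (Suc i))" by blast
  show ?thesis
  proof (intro exI[of _ s] allI impI conjI ballI)
    fix i assume "\<forall>j\<le>i. exact_at C d j"
    then have ex: "ex i" by (simp add: ex_def)
    then show l: "linear_map R (C (Suc i)) (C i) (s i)" using s(1)[of i] by (simp add: P_def)
    fix x assume x: "x \<in> carrier (C i)"
    show "x = s i (d i x) \<oplus>\<^bsub>C i\<^esub> from_below C d s i x"
    proof (cases i)
      case 0
      have "s i (d i x) \<in> carrier (C i)" using linear_closed[OF l dc[OF x]] .
      then show ?thesis using s(1)[of i] ex x 0 M by (simp add: P_def from_below_def)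
    next
      case (Suc j)
      then show ?thesis using s(2)[of j] ex x by (simp add: Q_def from_below_def)
    qed
  qed
qed

text \<open>A map that vanishes on cocycles factors through the differential, and injectivity
  extends the factor. The start \<open>g\<close> takes the place of \<phi> minus the contribution
  from below degree \<open>k\<close>: it is \<phi> itself for \<open>k = 0\<close> in
  \<open>null_homotopic_lift\<close>, and \<phi> followed by a projection for \<open>k = c\<close>
  in \<open>null_homotopic_from_cohomology\<close>.\<close>

lemma homotopy_extends:
  assumes C: "complex R C d" and D: "complex R D d'" and inj: "\<And>i. baer R (D i)"
    and ex: "\<And>i. k < i \<Longrightarrow> exact_at C d i"
    and \<phi>: "chain_map R C d D d' \<phi>"
    and g: "linear_map R (C k) (D k) g" "\<And>x. x \<in> carrier (C k) \<Longrightarrow> d' k (g x) = d' k (\<phi> k x)"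
      "\<And>x. x \<in> cocycles C d k \<Longrightarrow> g x = \<zero>\<^bsub>D k\<^esub>"
  obtains h where "\<And>i. k \<le> i \<Longrightarrow> linear_map R (C (Suc i)) (D i) (h i)"
    "\<And>x. x \<in> carrier (C k) \<Longrightarrow> h k (d k x) = g x"
    "\<And>i x. k \<le> i \<Longrightarrow> x \<in> carrier (C (Suc i)) \<Longrightarrow>
      \<phi> (Suc i) x = h (Suc i) (d (Suc i) x) \<oplus>\<^bsub>D (Suc i)\<^esub> d' i (h i x)"
proof -
  note M = complexD(1)[OF C] and lin = complexD(2)[OF C]
    and dc = complexD(4)[OF C]
  note M' = complexD(1)[OF D] and lin' = complexD(2)[OF D] and dd' = complexD(3)[OF D]
    and dc' = complexD(4)[OF D]
  note \<phi>l = chain_mapD(1)[OF \<phi>] and \<phi>d = chain_mapD(2)[OF \<phi>] and \<phi>c = chain_mapD(3)[OF \<phi>]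
  define P where "P n u \<longleftrightarrow> linear_map R (C (Suc (k + n))) (D (k + n)) u \<and>
     (\<forall>x\<in>carrier (C (k + n)). d' (k + n) (u (d (k + n) x)) = d' (k + n) (\<phi> (k + n) x)) \<and>
     (n = 0 \<longrightarrow> (\<forall>x\<in>carrier (C k). u (d k x) = g x))" for n u
  define Q where "Q n u v \<longleftrightarrow>
     (\<forall>x\<in>carrier (C (Suc (k + n))). \<phi> (Suc (k + n)) x = v (d (Suc (k + n)) x) \<oplus>\<^bsub>D (Suc (k + n))\<^esub> d' (k + n) (u x))" for n u v
  have "\<exists>s. \<forall>i. P i (s i) \<and> Q i (s i) (s (Suc i))"
  proof (rule dependent_nat_choice)
    obtain h where "linear_map R (C (Suc k)) (D k) h" "\<And>a. a \<in> carrier (C k) \<Longrightarrow> h (d k a) = g a"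
      using baer_extend[OF inj M M lin g(1)] g(3) by (auto simp: cocycles_def)
    then have "P 0 h" using g(2) by (auto simp: P_def)
    then show "\<exists>u. P 0 u" by blast
  next
    fix u n assume u: "P n u"
    let ?i = "k + n"
    have e: "exact_at C d (Suc ?i)" by (rule ex) simp
    have ul: "linear_map R (C (Suc ?i)) (D ?i) u"
      and du: "\<And>x. x \<in> carrier (C ?i) \<Longrightarrow> d' ?i (u (d ?i x)) = d' ?i (\<phi> ?i x)"
      using u by (auto simp: P_def)
    let ?g = "\<lambda>x. msub R (D (Suc ?i)) (\<phi> (Suc ?i) x) (d' ?i (u x))"
    have gl: "linear_map R (C (Suc ?i)) (D (Suc ?i)) ?g"
      by (rule linear_diff[OF \<phi>l linear_comp[OF ul lin'] M M'])
    obtain v where v: "linear_map R (C (Suc (Suc ?i))) (D (Suc ?i)) v"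
      "\<And>a. a \<in> carrier (C (Suc ?i)) \<Longrightarrow> v (d (Suc ?i) a) = ?g a"
    proof (rule baer_extend[OF inj M M lin gl])
      fix a assume a: "a \<in> carrier (C (Suc ?i))" "d (Suc ?i) a = \<zero>\<^bsub>C (Suc (Suc ?i))\<^esub>"
      then obtain w where w: "w \<in> carrier (C ?i)" "a = d ?i w"
        using exact_atD_Suc[OF e] by blast
      then show "?g a = \<zero>\<^bsub>D (Suc ?i)\<^esub>" using du \<phi>d dc'[OF \<phi>c] M' by simp
    qed (rule that)
    have uc: "d' ?i (u x) \<in> carrier (D (Suc ?i))" if "x \<in> carrier (C (Suc ?i))" for x
      using dc' linear_closed[OF ul] that by blast
    have "d' (Suc ?i) (v (d (Suc ?i) x)) = d' (Suc ?i) (\<phi> (Suc ?i) x)" if "x \<in> carrier (C (Suc ?i))" for x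
      using that v(2)[OF that] uc[OF that] dd'[OF linear_closed[OF ul that]] dc' \<phi>c M'
      by (simp add: linear_msub[OF lin' M'])
    then have "P (Suc n) v" using v(1) by (simp add: P_def)
    moreover have "Q n u v"
      using v(2) uc \<phi>c M' by (simp add: Q_def msub_alg)
    ultimately show "\<exists>v. P (Suc n) v \<and> Q n u v" by blast
  qed
  then obtain s where s: "\<And>i. P i (s i)" "\<And>i. Q i (s i) (s (Suc i))" by blast
  show ?thesis
  proof (rule that)
    show "linear_map R (C (Suc i)) (D i) (s (i - k))" if "k \<le> i" for i
      using s(1)[of "i - k"] that by (simp add: P_def)
    show "s (k - k) (d k x) = g x" if "x \<in> carrier (C k)" for x
      using s(1)[of 0] that by (simp add: P_def)
    show "\<phi> (Suc i) x = s (Suc i - k) (d (Suc i) x) \<oplus>\<^bsub>D (Suc i)\<^esub> d' i (s (i - k) x)"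
      if "k \<le> i" "x \<in> carrier (C (Suc i))" for i x
      using s(2)[of "i - k"] that by (simp add: Q_def Suc_diff_le)
  qed
qed

text \<open>The chain map is zero below \<open>k\<close>, which is compatible with \<open>g\<close>
  because \<open>g\<close> kills coboundaries. It is used for \<open>k = 0\<close> to lift
  endomorphisms of the module and for \<open>k = c\<close> to realize endomorphisms of the
  cohomology.\<close>

lemma chain_map_extends:
  assumes C: "complex R C d" and D: "complex R D d'" and inj: "\<And>i. baer R (D i)"
    and ex: "\<And>i. k < i \<Longrightarrow> exact_at C d i"
    and g: "linear_map R (C k) (D k) g" "\<And>x. x \<in> cocycles C d k \<Longrightarrow> d' k (g x) = \<zero>\<^bsub>D (Suc k)\<^esub>"
      "\<And>j x. k = Suc j \<Longrightarrow> x \<in> carrier (C j) \<Longrightarrow> g (d j x) = \<zero>\<^bsub>D k\<^esub>"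
  obtains \<phi> where "chain_map R C d D d' \<phi>" "\<phi> k = g"
proof -
  note M = complexD(1)[OF C] and lin = complexD(2)[OF C]
  note M' = complexD(1)[OF D] and lin' = complexD(2)[OF D] and dd' = complexD(3)[OF D]
  define P where "P n u \<longleftrightarrow> linear_map R (C (k + n)) (D (k + n)) u \<and>
     (\<forall>x\<in>cocycles C d (k + n). d' (k + n) (u x) = \<zero>\<^bsub>D (Suc (k + n))\<^esub>) \<and> (n = 0 \<longrightarrow> u = g)" for n u
  define Q where "Q n u v \<longleftrightarrow>
     (\<forall>x\<in>carrier (C (k + n)). v (d (k + n) x) = d' (k + n) (u x))" for n and u v :: "'a \<Rightarrow> 'b"
  have "\<exists>s. \<forall>i. P i (s i) \<and> Q i (s i) (s (Suc i))"
  proof (rule dependent_nat_choice)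
    have "P 0 g" using g by (auto simp: P_def)
    then show "\<exists>u. P 0 u" by blast
  next
    fix u n assume u: "P n u"
    let ?i = "k + n"
    have e: "exact_at C d (Suc ?i)" by (rule ex) simp
    have ul: "linear_map R (C ?i) (D ?i) u"
      and du: "\<And>x. x \<in> cocycles C d ?i \<Longrightarrow> d' ?i (u x) = \<zero>\<^bsub>D (Suc ?i)\<^esub>"
      using u by (auto simp: P_def)
    obtain v where v: "linear_map R (C (Suc ?i)) (D (Suc ?i)) v"
      "\<And>a. a \<in> carrier (C ?i) \<Longrightarrow> v (d ?i a) = d' ?i (u a)"
      using baer_extend[OF inj M M lin linear_comp[OF ul lin']] du by (auto simp: cocycles_def)
    have "d' (Suc ?i) (v x) = \<zero>\<^bsub>D (Suc (Suc ?i))\<^esub>" if x: "x \<in> cocycles C d (Suc ?i)" for x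
    proof -
      obtain w where w: "w \<in> carrier (C ?i)" "x = d ?i w"
        using exact_atD_Suc[OF e] x by (auto simp: cocycles_def)
      then show ?thesis using v(2) dd' linear_closed[OF ul] by simp
    qed
    then have "P (Suc n) v" using v(1) by (simp add: P_def)
    moreover have "Q n u v" using v(2) by (simp add: Q_def)
    ultimately show "\<exists>v. P (Suc n) v \<and> Q n u v" by blast
  qed
  then obtain s where s: "\<And>i. P i (s i)" "\<And>i. Q i (s i) (s (Suc i))" by blast
  define \<phi> where "\<phi> i = (if i < k then (\<lambda>x. \<zero>\<^bsub>D i\<^esub>) else s (i - k))" for i
  show ?thesis
  proof (rule that)
    show "\<phi> k = g" using s(1)[of 0] by (simp add: P_def \<phi>_def)
    show "chain_map R C d D d' \<phi>"
      unfolding chain_map_def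
    proof (intro conjI allI ballI)
      show "linear_map R (C i) (D i) (\<phi> i)" for i
        using linear_null[OF M'] s(1)[of "i - k"] by (cases "i < k") (simp_all add: \<phi>_def P_def)
      fix i x assume x: "x \<in> carrier (C i)"
      show "\<phi> (Suc i) (d i x) = d' i (\<phi> i x)"
      proof (cases "k \<le> i")
        case True
        then show ?thesis using s(2)[of "i - k"] x by (simp add: \<phi>_def Q_def Suc_diff_le)
      next
        case False
        have "\<phi> (Suc i) (d i x) = \<zero>\<^bsub>D (Suc i)\<^esub>"
          using False g(3)[of i x] x \<open>\<phi> k = g\<close> by (cases "Suc i = k") (auto simp: \<phi>_def)
        then show ?thesis using False linear_zero[OF lin' M' M'] by (simp add: \<phi>_def)
      qed
    qed
  qed
qed

end


section \<open>Torsion with respect to a multiplicative set\<close>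

definition tors :: "'r ring \<Rightarrow> 'r set \<Rightarrow> ('r, 'a) module \<Rightarrow> ('r, 'a) module" where
  "tors R S A = A\<lparr>carrier := {x \<in> carrier A. \<exists>s\<in>S. s \<odot>\<^bsub>A\<^esub> x = \<zero>\<^bsub>A\<^esub>}\<rparr>"

definition powers :: "'r ring \<Rightarrow> 'r \<Rightarrow> 'r set" where
  "powers R x = {x [^]\<^bsub>R\<^esub> n | n::nat. True}"

locale noetherian_cring = fixed_cring R + noetherian_ring R for R :: "'r ring" (structure)

lemma tors_simps [simp]:
  "zero (tors R S A) = zero A" "add (tors R S A) = add A" "smult (tors R S A) = smult A"
  "msub R (tors R S A) = msub R A"
  by (simp_all add: tors_def)

lemma tors_carrier: "carrier (tors R S A) = {x \<in> carrier A. \<exists>s\<in>S. s \<odot>\<^bsub>A\<^esub> x = \<zero>\<^bsub>A\<^esub>}"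
  by (simp add: tors_def)

context fixed_cring
begin

lemma submonoid_rules:
  assumes "submonoid S R"
  shows "s \<in> S \<Longrightarrow> s \<in> carrier R" "\<one> \<in> S" "s \<in> S \<Longrightarrow> t \<in> S \<Longrightarrow> s \<otimes> t \<in> S" "s \<in> S \<Longrightarrow> s [^] (n::nat) \<in> S"
proof -
  interpret submonoid S R by fact
  show "s \<in> S \<Longrightarrow> s \<in> carrier R" "\<one> \<in> S" "s \<in> S \<Longrightarrow> t \<in> S \<Longrightarrow> s \<otimes> t \<in> S" by auto
  show "s \<in> S \<Longrightarrow> s [^] n \<in> S" by (induction n) auto
qed

lemma powers_submonoid: "x \<in> carrier R \<Longrightarrow> submonoid (powers R x) R"
  by (rule submonoid.intro) (auto simp: powers_def nat_pow_mult intro: exI[of _ 0])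

lemma tors_submodule:
  assumes A: "module R A" and S: "submonoid S R"
  shows "submodule (carrier (tors R S A)) R A"
proof (rule submoduleI'[OF A])
  note S' = submonoid_rules[OF S]
  show "carrier (tors R S A) \<subseteq> carrier A" by (auto simp: tors_carrier)
  show "\<zero>\<^bsub>A\<^esub> \<in> carrier (tors R S A)" using A S'(1,2) by (auto simp: tors_carrier)
  fix x assume x: "x \<in> carrier (tors R S A)"
  then obtain s where s: "x \<in> carrier A" "s \<in> S" "s \<odot>\<^bsub>A\<^esub> x = \<zero>\<^bsub>A\<^esub>" by (auto simp: tors_carrier)
  show "r \<odot>\<^bsub>A\<^esub> x \<in> carrier (tors R S A)" if r: "r \<in> carrier R" for r
    using s r A S'(1)[OF s(2)] by (auto simp: tors_carrier smult_swap[OF A, of _ r] intro!: bexI[of _ s])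
  fix y assume "y \<in> carrier (tors R S A)"
  then obtain t where t: "y \<in> carrier A" "t \<in> S" "t \<odot>\<^bsub>A\<^esub> y = \<zero>\<^bsub>A\<^esub>" by (auto simp: tors_carrier)
  have "(s \<otimes> t) \<odot>\<^bsub>A\<^esub> (x \<oplus>\<^bsub>A\<^esub> y) = t \<odot>\<^bsub>A\<^esub> (s \<odot>\<^bsub>A\<^esub> x) \<oplus>\<^bsub>A\<^esub> s \<odot>\<^bsub>A\<^esub> (t \<odot>\<^bsub>A\<^esub> y)"
    using s(1) t(1) S'(1)[OF s(2)] S'(1)[OF t(2)] A by (simp add: mod_distr smult_swap[OF A, of t s])
  also have "\<dots> = \<zero>\<^bsub>A\<^esub>" using s t S'(1) A by simp
  finally show "x \<oplus>\<^bsub>A\<^esub> y \<in> carrier (tors R S A)"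
    using s t S' A by (auto simp: tors_carrier intro!: bexI[of _ "s \<otimes> t"])
qed

lemma tors_module: "module R A \<Longrightarrow> submonoid S R \<Longrightarrow> module R (tors R S A)"
  using submodule_mod[OF tors_submodule] by (simp add: tors_def)

lemma tors_mem_map:
  assumes "linear_map R A B f" "module R A" "module R B" "submonoid S R" "x \<in> carrier (tors R S A)"
  shows "f x \<in> carrier (tors R S B)"
  using assms submonoid_rules(1)[OF assms(4)] linear_zero[OF assms(1-3)]
  by (auto simp: tors_carrier linear_closed) (metis linear_smult)

lemma tors_linear:
  assumes "linear_map R A B f" "module R A" "module R B" "submonoid S R"
  shows "linear_map R (tors R S A) (tors R S B) f"
proof -
  have "linear_map R (tors R S A) B f"
    unfolding tors_def by (rule linear_domain[OF assms(1)]) auto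
  then show ?thesis
    using linear_codomain[of R "tors R S A" B f "carrier (tors R S B)"] tors_mem_map[OF assms]
    by (simp add: tors_def)
qed

lemma ideal_diff: "ideal \<aa> R \<Longrightarrow> x \<in> \<aa> \<Longrightarrow> y \<in> \<aa> \<Longrightarrow> x \<ominus> y \<in> \<aa>"
proof -
  assume a: "ideal \<aa> R" and xy: "x \<in> \<aa>" "y \<in> \<aa>"
  have "x \<ominus> y = x \<oplus> (\<ominus> \<one>) \<otimes> y"
    using ideal_rules(1)[OF a] xy by (simp add: l_minus a_minus_def)
  then show ?thesis using ideal_rules[OF a] xy by simp
qed

text \<open>Both prescriptions together are one map on the ideal generated by \<aa> and
  \<open>x\<close>, sending \<open>t + x r\<close> to \<open>f t + r v\<close>;
  \<open>compat\<close> is exactly what makes it well defined.\<close>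

lemma baer_two:
  assumes E: "baer R E" and a: "ideal \<aa> R"
    and f: "\<And>r. r \<in> \<aa> \<Longrightarrow> f r \<in> carrier E"
      "\<And>r s. r \<in> \<aa> \<Longrightarrow> s \<in> \<aa> \<Longrightarrow> f (r \<oplus> s) = f r \<oplus>\<^bsub>E\<^esub> f s"
      "\<And>r s. r \<in> carrier R \<Longrightarrow> s \<in> \<aa> \<Longrightarrow> f (r \<otimes> s) = r \<odot>\<^bsub>E\<^esub> f s"
    and x: "x \<in> carrier R" and v: "v \<in> carrier E"
    and compat: "\<And>r. r \<in> carrier R \<Longrightarrow> x \<otimes> r \<in> \<aa> \<Longrightarrow> f (x \<otimes> r) = r \<odot>\<^bsub>E\<^esub> v"
  obtains e where "e \<in> carrier E" "\<And>r. r \<in> \<aa> \<Longrightarrow> f r = r \<odot>\<^bsub>E\<^esub> e" "x \<odot>\<^bsub>E\<^esub> e = v"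
proof -
  have E': "module R E" using E by (rule baer_module)
  note c = ideal_rules[OF a]
  define \<bb> where "\<bb> = {t \<oplus> x \<otimes> r | t r. t \<in> \<aa> \<and> r \<in> carrier R}"
  define F where "F b = (THE e. \<exists>t r. t \<in> \<aa> \<and> r \<in> carrier R \<and> b = t \<oplus> x \<otimes> r \<and> e = f t \<oplus>\<^bsub>E\<^esub> r \<odot>\<^bsub>E\<^esub> v)" for b
  have uniq: "f t \<oplus>\<^bsub>E\<^esub> r \<odot>\<^bsub>E\<^esub> v = f t' \<oplus>\<^bsub>E\<^esub> r' \<odot>\<^bsub>E\<^esub> v"
    if h: "t \<in> \<aa>" "r \<in> carrier R" "t' \<in> \<aa>" "r' \<in> carrier R" "t \<oplus> x \<otimes> r = t' \<oplus> x \<otimes> r'" for t r t' r'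
  proof -
    have cc: "t \<in> carrier R" "t' \<in> carrier R" using h c(1) by auto
    have eq: "x \<otimes> (r' \<ominus> r) = t \<ominus> t'"
    proof -
      have "x \<otimes> (r' \<ominus> r) = (t' \<oplus> x \<otimes> r') \<ominus> x \<otimes> r \<ominus> t'"
        using h(2,4) x cc by algebra
      also have "\<dots> = (t \<oplus> x \<otimes> r) \<ominus> x \<otimes> r \<ominus> t'" using h by simp
      also have "\<dots> = t \<ominus> t'" using h(2,4) x cc by algebra
      finally show ?thesis .
    qed
    have tt: "t \<ominus> t' \<in> \<aa>" using ideal_diff[OF a] h by blast
    have "f (t \<ominus> t') = (r' \<ominus> r) \<odot>\<^bsub>E\<^esub> v"
      using compat[of "r' \<ominus> r"] eq tt h by simp
    moreover have "f t = f (t \<ominus> t') \<oplus>\<^bsub>E\<^esub> f t'"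
    proof -
      have "t = (t \<ominus> t') \<oplus> t'" using cc by algebra
      then show ?thesis using f(2)[OF tt h(3)] by simp
    qed
    moreover have "(r' \<ominus> r) \<odot>\<^bsub>E\<^esub> v \<oplus>\<^bsub>E\<^esub> r \<odot>\<^bsub>E\<^esub> v = r' \<odot>\<^bsub>E\<^esub> v"
    proof -
      have "(r' \<ominus> r) \<oplus> r = r'" using h(2,4) by algebra
      then show ?thesis using h v E' by (metis minus_closed mod_distr(2))
    qed
    moreover have "(r' \<ominus> r) \<odot>\<^bsub>E\<^esub> v \<in> carrier E" "r \<odot>\<^bsub>E\<^esub> v \<in> carrier E" "r' \<odot>\<^bsub>E\<^esub> v \<in> carrier E"
      "f t' \<in> carrier E" using h v E' f(1) by auto
    ultimately show ?thesis using E' by (metis mod_ac)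
  qed
  have F: "F (t \<oplus> x \<otimes> r) = f t \<oplus>\<^bsub>E\<^esub> r \<odot>\<^bsub>E\<^esub> v" if "t \<in> \<aa>" "r \<in> carrier R" for t r
    unfolding F_def
  proof (rule the_equality)
    show "\<exists>t' r'. t' \<in> \<aa> \<and> r' \<in> carrier R \<and> t \<oplus> x \<otimes> r = t' \<oplus> x \<otimes> r' \<and>
        f t \<oplus>\<^bsub>E\<^esub> r \<odot>\<^bsub>E\<^esub> v = f t' \<oplus>\<^bsub>E\<^esub> r' \<odot>\<^bsub>E\<^esub> v"
      using that by (intro exI[of _ t] exI[of _ r]) simp
    fix e assume "\<exists>t' r'. t' \<in> \<aa> \<and> r' \<in> carrier R \<and> t \<oplus> x \<otimes> r = t' \<oplus> x \<otimes> r' \<and>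
        e = f t' \<oplus>\<^bsub>E\<^esub> r' \<odot>\<^bsub>E\<^esub> v"
    then obtain t' r' where t': "t' \<in> \<aa>" "r' \<in> carrier R" "t \<oplus> x \<otimes> r = t' \<oplus> x \<otimes> r'"
      "e = f t' \<oplus>\<^bsub>E\<^esub> r' \<odot>\<^bsub>E\<^esub> v" by (elim exE conjE)
    show "e = f t \<oplus>\<^bsub>E\<^esub> r \<odot>\<^bsub>E\<^esub> v" unfolding t'(4) by (rule uniq[OF that t'(1-3), symmetric])
  qed
  have add: "(t \<oplus> x \<otimes> r) \<oplus> (t' \<oplus> x \<otimes> r') = (t \<oplus> t') \<oplus> x \<otimes> (r \<oplus> r')"
    if "t \<in> \<aa>" "r \<in> carrier R" "t' \<in> \<aa>" "r' \<in> carrier R" for t r t' r'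
    using c(1)[OF that(1)] c(1)[OF that(3)] that x by algebra
  have mult: "s \<otimes> (t \<oplus> x \<otimes> r) = (s \<otimes> t) \<oplus> x \<otimes> (s \<otimes> r)"
    if "t \<in> \<aa>" "r \<in> carrier R" "s \<in> carrier R" for s t r
    using c(1)[OF that(1)] that x by algebra
  have b: "ideal \<bb> R"
  proof (rule idealI')
    show "\<bb> \<subseteq> carrier R" using c(1) x by (auto simp: \<bb>_def)
    have "\<zero> \<oplus> x \<otimes> \<zero> \<in> \<bb>" unfolding \<bb>_def using c(2) by blast
    then show "\<zero> \<in> \<bb>" using x by simp
    fix y assume "y \<in> \<bb>"
    then obtain t r where y: "t \<in> \<aa>" "r \<in> carrier R" "y = t \<oplus> x \<otimes> r" by (auto simp: \<bb>_def)
    show "s \<otimes> y \<in> \<bb>" if "s \<in> carrier R" for s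
      unfolding \<bb>_def y(3) mult[OF y(1,2) that] using y that c(4) by blast
    fix z assume "z \<in> \<bb>"
    then obtain t' r' where z: "t' \<in> \<aa>" "r' \<in> carrier R" "z = t' \<oplus> x \<otimes> r'" by (auto simp: \<bb>_def)
    show "y \<oplus> z \<in> \<bb>"
      unfolding \<bb>_def y(3) z(3) add[OF y(1,2) z(1,2)] using y z c(3) by blast
  qed
  obtain e where e: "e \<in> carrier E" "\<And>r. r \<in> \<bb> \<Longrightarrow> F r = r \<odot>\<^bsub>E\<^esub> e"
  proof (rule baerD[OF E b])
    fix y assume "y \<in> \<bb>"
    then obtain t r where y: "t \<in> \<aa>" "r \<in> carrier R" "y = t \<oplus> x \<otimes> r" by (auto simp: \<bb>_def)
    then show "F y \<in> carrier E" using F f v E' by simp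
    show "F (s \<otimes> y) = s \<odot>\<^bsub>E\<^esub> F y" if "s \<in> carrier R" for s
      using y that F[of "s \<otimes> t" "s \<otimes> r"] F[of t r] f v E' c mult by (simp add: mod_distr)
    fix y' assume "y' \<in> \<bb>"
    then obtain t' r' where y': "t' \<in> \<aa>" "r' \<in> carrier R" "y' = t' \<oplus> x \<otimes> r'" by (auto simp: \<bb>_def)
    then show "F (y \<oplus> y') = F y \<oplus>\<^bsub>E\<^esub> F y'"
      using y F[of "t \<oplus> t'" "r \<oplus> r'"] F[of t r] F[of t' r'] f v E' c add by (simp add: mod_distr mod_ac)
  qed (rule that)
  show ?thesis
  proof (rule that[OF e(1)])
    have f0: "f \<zero> = \<zero>\<^bsub>E\<^esub>" using f(3)[of \<zero> \<zero>] f(1) c(2) E' by simp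
    show "f t = t \<odot>\<^bsub>E\<^esub> e" if "t \<in> \<aa>" for t
    proof -
      have "t \<oplus> x \<otimes> \<zero> \<in> \<bb>" unfolding \<bb>_def using that by blast
      then show ?thesis using F[of t \<zero>] e(2)[of "t \<oplus> x \<otimes> \<zero>"] that c(1)[OF that] x f v E' by simp
    qed
    have "\<zero> \<oplus> x \<otimes> \<one> \<in> \<bb>" unfolding \<bb>_def using c(2) by blast
    then show "x \<odot>\<^bsub>E\<^esub> e = v"
      using F[of \<zero> \<one>] e(2)[of "\<zero> \<oplus> x \<otimes> \<one>"] c(2) x f0 v E' by simp
  qed
qed

end

context noetherian_cring
begin

lemma ideal_chain_stable:
  assumes "\<And>k. ideal (\<cc> k) R" "\<And>k. \<cc> k \<subseteq> \<cc> (Suc k)"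
  obtains n where "\<And>k. n \<le> k \<Longrightarrow> \<cc> k = \<cc> n"
proof -
  have mono: "\<cc> k \<subseteq> \<cc> l" if "k \<le> l" for k l
    using lift_Suc_mono_le[of \<cc>, OF assms(2) that] .
  have "\<Union> (range \<cc>) \<in> range \<cc>"
  proof (rule ideal_chain_is_trivial)
    show "subset.chain {I. ideal I R} (range \<cc>)"
      unfolding subset_chain_def using assms(1) mono by (auto, meson nat_le_linear subsetD)
  qed simp
  then obtain n where "\<Union> (range \<cc>) = \<cc> n" by auto
  then have "\<cc> k \<subseteq> \<cc> n" for k by blast
  then show ?thesis using that[of n] mono by blast
qed

lemma finite_generators:
  assumes "ideal \<aa> R"
  obtains X where "finite X" "X \<subseteq> carrier R" "X \<subseteq> \<aa>" "\<aa> = Idl X"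
    "\<And>\<bb>. ideal \<bb> R \<Longrightarrow> X \<subseteq> \<bb> \<Longrightarrow> \<aa> \<subseteq> \<bb>"
proof -
  obtain X where X: "X \<subseteq> carrier R" "finite X" "\<aa> = Idl X" using finetely_gen[OF assms] by blast
  show ?thesis
    using that[of X] X genideal_self[OF X(1)] genideal_minimal by metis
qed

text \<open>The ideals of all \<open>r\<close> with \<open>s^k r\<close> in \<aa> ascend with
  \<open>k\<close>, so they become stationary. The exponent found here takes over the role of the
  Artin-Rees lemma in the arguments below.\<close>

lemma power_colon_stable:
  assumes a: "ideal \<aa> R" and s: "s \<in> carrier R"
  shows "\<exists>n::nat. \<forall>k::nat. \<forall>r\<in>carrier R. s [^] k \<otimes> r \<in> \<aa> \<longrightarrow> s [^] n \<otimes> r \<in> \<aa>"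
proof -
  note c = ideal_rules[OF a]
  define \<cc> where "\<cc> k = {r \<in> carrier R. s [^] k \<otimes> r \<in> \<aa>}" for k :: nat
  have id: "ideal (\<cc> k) R" for k
  proof (rule idealI')
    show "\<cc> k \<subseteq> carrier R" "\<zero> \<in> \<cc> k" using s c(2) by (auto simp: \<cc>_def)
    show "x \<oplus> y \<in> \<cc> k" if "x \<in> \<cc> k" "y \<in> \<cc> k" for x y
      using that s c(3) by (auto simp: \<cc>_def r_distr)
    show "x \<otimes> y \<in> \<cc> k" if "x \<in> carrier R" "y \<in> \<cc> k" for x y
      using that s c(4)[of x "s [^] k \<otimes> y"] by (auto simp: \<cc>_def m_lcomm)
  qed
  have inc: "\<cc> k \<subseteq> \<cc> (Suc k)" for k
  proof
    fix r assume r: "r \<in> \<cc> k"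
    then have "s \<otimes> (s [^] k \<otimes> r) \<in> \<aa>" using c(4) s by (auto simp: \<cc>_def)
    then show "r \<in> \<cc> (Suc k)" using r s by (auto simp: \<cc>_def m_ac)
  qed
  obtain n where n: "\<And>k. n \<le> k \<Longrightarrow> \<cc> k = \<cc> n" using ideal_chain_stable[of \<cc>, OF id inc] by blast
  have "\<cc> k \<subseteq> \<cc> n" for k
    using n[of k] lift_Suc_mono_le[of \<cc> k n, OF inc] by (cases "n \<le> k") auto
  then show ?thesis unfolding \<cc>_def by (intro exI[of _ n]) auto
qed

text \<open>The ideal has finitely many generators, and the product of annihilators of their images
  kills the whole image.\<close>

lemma common_annihilator:
  assumes E: "module R E" and S: "submonoid S R" and a: "ideal \<aa> R"
    and f: "\<And>r. r \<in> \<aa> \<Longrightarrow> f r \<in> carrier (tors R S E)"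
      "\<And>r s. r \<in> \<aa> \<Longrightarrow> s \<in> \<aa> \<Longrightarrow> f (r \<oplus> s) = f r \<oplus>\<^bsub>E\<^esub> f s"
      "\<And>r s. r \<in> carrier R \<Longrightarrow> s \<in> \<aa> \<Longrightarrow> f (r \<otimes> s) = r \<odot>\<^bsub>E\<^esub> f s"
  obtains s where "s \<in> S" "\<And>r. r \<in> \<aa> \<Longrightarrow> s \<odot>\<^bsub>E\<^esub> f r = \<zero>\<^bsub>E\<^esub>"
proof -
  note S' = submonoid_rules[OF S]
  note c = ideal_rules[OF a]
  have fE: "f r \<in> carrier E" if "r \<in> \<aa>" for r using f(1)[OF that] by (simp add: tors_carrier)
  obtain X where X: "finite X" "X \<subseteq> \<aa>" "\<And>\<bb>. ideal \<bb> R \<Longrightarrow> X \<subseteq> \<bb> \<Longrightarrow> \<aa> \<subseteq> \<bb>"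
    using finite_generators[OF a] by metis
  have "\<exists>s\<in>S. \<forall>x\<in>X. s \<odot>\<^bsub>E\<^esub> f x = \<zero>\<^bsub>E\<^esub>"
    using X(1,2)
  proof (induction rule: finite_induct)
    case empty
    then show ?case using S'(2) by auto
  next
    case (insert x F)
    then obtain s where s: "s \<in> S" "\<forall>x\<in>F. s \<odot>\<^bsub>E\<^esub> f x = \<zero>\<^bsub>E\<^esub>" by auto
    obtain t where t: "t \<in> S" "t \<odot>\<^bsub>E\<^esub> f x = \<zero>\<^bsub>E\<^esub>"
      using f(1)[of x] insert by (auto simp: tors_carrier)
    have "(s \<otimes> t) \<odot>\<^bsub>E\<^esub> f y = \<zero>\<^bsub>E\<^esub>" if y: "y \<in> insert x F" for y
    proof -
      have fy: "f y \<in> carrier E" using fE insert y by auto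
      have "(s \<otimes> t) \<odot>\<^bsub>E\<^esub> f y = s \<odot>\<^bsub>E\<^esub> (t \<odot>\<^bsub>E\<^esub> f y)" "(s \<otimes> t) \<odot>\<^bsub>E\<^esub> f y = t \<odot>\<^bsub>E\<^esub> (s \<odot>\<^bsub>E\<^esub> f y)"
        using S'(1)[OF s(1)] S'(1)[OF t(1)] fy E by (simp_all add: mod_distr smult_swap[OF E, of t])
      then show ?thesis using y s(2) t S'(1) s(1) E by auto
    qed
    then show ?case using S'(3)[OF s(1) t(1)] by blast
  qed
  then obtain s where s: "s \<in> S" "\<forall>x\<in>X. s \<odot>\<^bsub>E\<^esub> f x = \<zero>\<^bsub>E\<^esub>" by blast
  have "ideal {r \<in> \<aa>. s \<odot>\<^bsub>E\<^esub> f r = \<zero>\<^bsub>E\<^esub>} R"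
  proof (rule idealI')
    have "f \<zero> = \<zero>\<^bsub>E\<^esub>" using f(3)[of \<zero> \<zero>] fE c(2) E by simp
    then show "\<zero> \<in> {r \<in> \<aa>. s \<odot>\<^bsub>E\<^esub> f r = \<zero>\<^bsub>E\<^esub>}" using c(2) S'(1)[OF s(1)] E by simp
    show "{r \<in> \<aa>. s \<odot>\<^bsub>E\<^esub> f r = \<zero>\<^bsub>E\<^esub>} \<subseteq> carrier R" using c(1) by auto
    show "x \<oplus> y \<in> {r \<in> \<aa>. s \<odot>\<^bsub>E\<^esub> f r = \<zero>\<^bsub>E\<^esub>}"
      if "x \<in> {r \<in> \<aa>. s \<odot>\<^bsub>E\<^esub> f r = \<zero>\<^bsub>E\<^esub>}" "y \<in> {r \<in> \<aa>. s \<odot>\<^bsub>E\<^esub> f r = \<zero>\<^bsub>E\<^esub>}" for x y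
      using that c(3) f(2) fE S'(1)[OF s(1)] E by (simp add: mod_distr)
    show "r \<otimes> x \<in> {r \<in> \<aa>. s \<odot>\<^bsub>E\<^esub> f r = \<zero>\<^bsub>E\<^esub>}"
      if "r \<in> carrier R" "x \<in> {r \<in> \<aa>. s \<odot>\<^bsub>E\<^esub> f r = \<zero>\<^bsub>E\<^esub>}" for r x
      using that c(4) f(3) fE S'(1)[OF s(1)] E by (simp add: smult_swap[OF E, of s])
  qed
  then have "\<aa> \<subseteq> {r \<in> \<aa>. s \<odot>\<^bsub>E\<^esub> f r = \<zero>\<^bsub>E\<^esub>}" using X(2,3) s(2) by blast
  then show ?thesis using that s(1) by blast
qed

text \<open>A representing element in \<open>E\<close> need not be torsion, so it has to be chosen
  with the extra condition that a suitable power of \<open>s\<close> kills it;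
  \<open>baer_two\<close> allows exactly one such condition.\<close>

lemma baer_tors:
  assumes E: "baer R E" and S: "submonoid S R"
  shows "baer R (tors R S E)"
proof (rule baerI)
  have E': "module R E" using E by (rule baer_module)
  note S' = submonoid_rules[OF S]
  show "module R (tors R S E)" by (rule tors_module[OF E' S])
  fix \<aa> f
  assume a: "ideal \<aa> R" and f: "\<And>r. r \<in> \<aa> \<Longrightarrow> f r \<in> carrier (tors R S E)"
    "\<And>r s. r \<in> \<aa> \<Longrightarrow> s \<in> \<aa> \<Longrightarrow> f (r \<oplus> s) = f r \<oplus>\<^bsub>tors R S E\<^esub> f s"
    "\<And>r s. r \<in> carrier R \<Longrightarrow> s \<in> \<aa> \<Longrightarrow> f (r \<otimes> s) = r \<odot>\<^bsub>tors R S E\<^esub> f s"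
  note f' = f(1) f(2,3)[unfolded tors_simps]
  have fE: "f r \<in> carrier E" if "r \<in> \<aa>" for r using f(1)[OF that] by (simp add: tors_carrier)
  obtain s where s: "s \<in> S" "\<And>r. r \<in> \<aa> \<Longrightarrow> s \<odot>\<^bsub>E\<^esub> f r = \<zero>\<^bsub>E\<^esub>"
    using common_annihilator[OF E' S a f'] by blast
  have sR: "s \<in> carrier R" using S'(1) s(1) by blast
  obtain n :: nat where "\<forall>k::nat. \<forall>r\<in>carrier R. s [^] k \<otimes> r \<in> \<aa> \<longrightarrow> s [^] n \<otimes> r \<in> \<aa>"
    using power_colon_stable[OF a sR] ..
  then have n: "\<And>r. r \<in> carrier R \<Longrightarrow> s [^] Suc n \<otimes> r \<in> \<aa> \<Longrightarrow> s [^] n \<otimes> r \<in> \<aa>"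
    by blast
  \<comment> \<open>Compatibility with \<open>s^(n+1) e = 0\<close>: if \<open>s^(n+1) r\<close>
    lies in the ideal, so does \<open>s^n r\<close> by the choice of \<open>n\<close>, and
    \<open>f (s^(n+1) r) = s f (s^n r)\<close> vanishes because \<open>s\<close> kills the image of
    \<open>f\<close>.\<close>
  obtain e where e: "e \<in> carrier E" "\<And>r. r \<in> \<aa> \<Longrightarrow> f r = r \<odot>\<^bsub>E\<^esub> e" "s [^] Suc n \<odot>\<^bsub>E\<^esub> e = \<zero>\<^bsub>E\<^esub>"
  proof (rule baer_two[OF E a, of f "s [^] Suc n" "\<zero>\<^bsub>E\<^esub>"])
    fix r assume r: "r \<in> carrier R" "s [^] Suc n \<otimes> r \<in> \<aa>"
    have "s [^] Suc n \<otimes> r = s \<otimes> (s [^] n \<otimes> r)" using r sR by (simp add: m_ac)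
    then have "f (s [^] Suc n \<otimes> r) = s \<odot>\<^bsub>E\<^esub> f (s [^] n \<otimes> r)" using f'(3)[OF sR n[OF r]] by simp
    then show "f (s [^] Suc n \<otimes> r) = r \<odot>\<^bsub>E\<^esub> \<zero>\<^bsub>E\<^esub>" using s(2)[OF n[OF r]] r E' by simp
  next
    fix e assume "e \<in> carrier E" "\<And>r. r \<in> \<aa> \<Longrightarrow> f r = r \<odot>\<^bsub>E\<^esub> e" "s [^] Suc n \<odot>\<^bsub>E\<^esub> e = \<zero>\<^bsub>E\<^esub>"
    then show thesis by (rule that)
  qed (use sR E' fE f' in simp_all)
  have "e \<in> carrier (tors R S E)"
    using e(1,3) S'(4)[OF s(1), of "Suc n"] by (auto simp: tors_carrier)
  then show "\<exists>e\<in>carrier (tors R S E). \<forall>r\<in>\<aa>. f r = r \<odot>\<^bsub>tors R S E\<^esub> e"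
    using e(2) by auto
qed

text \<open>Elements that kill \<open>s\<close> obstruct division by \<open>s\<close> itself. Once
  \<open>s^(n+1) r = 0\<close> forces \<open>s^n r = 0\<close>, the equation
  \<open>s^(n+1) e' = s^n e\<close> is solvable, so that \<open>s^n\<close> kills the error
  \<open>s e' - e\<close>.\<close>

lemma tors_divisible:
  assumes E: "baer R E" and S: "submonoid S R" and s: "s \<in> S" and e: "e \<in> carrier E"
  obtains e' where "e' \<in> carrier E" "msub R E (s \<odot>\<^bsub>E\<^esub> e') e \<in> carrier (tors R S E)"
proof -
  have E': "module R E" using E by (rule baer_module)
  note S' = submonoid_rules[OF S]
  have sR: "s \<in> carrier R" using S'(1) s by blast
  have z: "ideal {\<zero>} R" by (rule zeroideal)
  obtain n :: nat where "\<forall>k::nat. \<forall>r\<in>carrier R. s [^] k \<otimes> r \<in> {\<zero>} \<longrightarrow> s [^] n \<otimes> r \<in> {\<zero>}"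
    using power_colon_stable[OF z sR] ..
  then have n: "\<And>r. r \<in> carrier R \<Longrightarrow> s [^] Suc n \<otimes> r \<in> {\<zero>} \<Longrightarrow> s [^] n \<otimes> r \<in> {\<zero>}"
    by blast
  obtain e' where e': "e' \<in> carrier E" "s [^] Suc n \<odot>\<^bsub>E\<^esub> e' = s [^] n \<odot>\<^bsub>E\<^esub> e"
  proof (rule baer_two[OF E z, of "\<lambda>_. \<zero>\<^bsub>E\<^esub>" "s [^] Suc n" "s [^] n \<odot>\<^bsub>E\<^esub> e"])
    fix r assume r: "r \<in> carrier R" "s [^] Suc n \<otimes> r \<in> {\<zero>}"
    have "r \<odot>\<^bsub>E\<^esub> (s [^] n \<odot>\<^bsub>E\<^esub> e) = (s [^] n \<otimes> r) \<odot>\<^bsub>E\<^esub> e"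
      using r sR e E' by (simp add: mod_distr smult_swap[OF E', of r])
    then show "\<zero>\<^bsub>E\<^esub> = r \<odot>\<^bsub>E\<^esub> (s [^] n \<odot>\<^bsub>E\<^esub> e)" using n[OF r] e E' by simp
  next
    fix e' assume "e' \<in> carrier E" "s [^] Suc n \<odot>\<^bsub>E\<^esub> e' = s [^] n \<odot>\<^bsub>E\<^esub> e"
    then show thesis by (rule that)
  qed (use sR e E' in simp_all)
  have "s [^] n \<odot>\<^bsub>E\<^esub> msub R E (s \<odot>\<^bsub>E\<^esub> e') e = \<zero>\<^bsub>E\<^esub>"
    using e' e sR E' by (simp add: msub_alg mod_distr)
  then show ?thesis
    using that[OF e'(1)] S'(4)[OF s, of n] e' e sR E' by (auto simp: tors_carrier)
qed

end


section \<open>Inverse sequences under multiplication by a ring element\<close>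

text \<open>Inverse sequences \<open>e\<^sub>k = x e\<^sub>k\<^sub>+\<^sub>1\<close>, that is, homomorphisms from the localization of the ring
  at \<open>x\<close> to the module.\<close>

definition telescope :: "'r ring \<Rightarrow> 'r \<Rightarrow> ('r, 'e) module \<Rightarrow> ('r, nat \<Rightarrow> 'e) module" where
  "telescope R x E = \<lparr>carrier = {e. \<forall>k. e k \<in> carrier E \<and> x \<odot>\<^bsub>E\<^esub> e (Suc k) = e k},
     monoid.mult = undefined, one = undefined, zero = (\<lambda>_. \<zero>\<^bsub>E\<^esub>),
     add = (\<lambda>e f k. e k \<oplus>\<^bsub>E\<^esub> f k), smult = (\<lambda>r e k. r \<odot>\<^bsub>E\<^esub> e k)\<rparr>"

lemma telescope_simps [simp]:
  "zero (telescope R x E) = (\<lambda>_. \<zero>\<^bsub>E\<^esub>)"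
  "e \<oplus>\<^bsub>telescope R x E\<^esub> f = (\<lambda>k. e k \<oplus>\<^bsub>E\<^esub> f k)"
  "r \<odot>\<^bsub>telescope R x E\<^esub> e = (\<lambda>k. r \<odot>\<^bsub>E\<^esub> e k)"
  by (simp_all add: telescope_def)

lemma telescope_carrier:
  "e \<in> carrier (telescope R x E) \<longleftrightarrow> (\<forall>k. e k \<in> carrier E \<and> x \<odot>\<^bsub>E\<^esub> e (Suc k) = e k)"
  by (simp add: telescope_def)

text \<open>The value of \<open>f\<close> at \<open>q / x\<^sup>k\<close>.  The choice of the quotient does not matter when \<open>f\<close> kills the
  \<open>x\<close>-torsion of \<open>Q\<close>, and a quotient exists when \<open>Q\<close> is injective.\<close>

definition colift :: "'r ring \<Rightarrow> 'r \<Rightarrow> ('r, 'q) module \<Rightarrow> ('q \<Rightarrow> 'e) \<Rightarrow> 'q \<Rightarrow> nat \<Rightarrow> 'e" where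
  "colift R x Q f q k = f (SOME p. p \<in> carrier Q \<and>
     msub R Q (x [^]\<^bsub>R\<^esub> k \<odot>\<^bsub>Q\<^esub> p) q \<in> carrier (tors R (powers R x) Q))"

context fixed_cring
begin

lemma telescope_module:
  assumes E: "module R E" and x: "x \<in> carrier R"
  shows "module R (telescope R x E)"
proof (rule moduleI[OF is_cring])
  show "abelian_group (telescope R x E)"
  proof (rule abelian_groupI)
    fix e assume "e \<in> carrier (telescope R x E)"
    then have e: "\<And>k. e k \<in> carrier E" "\<And>k. x \<odot>\<^bsub>E\<^esub> e (Suc k) = e k" by (auto simp: telescope_carrier)
    have "(\<ominus> \<one>) \<odot>\<^bsub>E\<^esub> e k \<oplus>\<^bsub>E\<^esub> e k = \<zero>\<^bsub>E\<^esub>" for k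
      using mod_ac(1)[OF E, of "(\<ominus> \<one>) \<odot>\<^bsub>E\<^esub> e k" "e k"] mod_simps(6)[OF E, of "e k"] e(1)[of k] E
      by (simp add: msub_def)
    moreover have "(\<lambda>k. (\<ominus> \<one>) \<odot>\<^bsub>E\<^esub> e k) \<in> carrier (telescope R x E)"
      unfolding telescope_carrier
    proof (intro allI conjI)
      fix k
      show "(\<ominus> \<one>) \<odot>\<^bsub>E\<^esub> e k \<in> carrier E" using e(1) E by simp
      show "x \<odot>\<^bsub>E\<^esub> ((\<ominus> \<one>) \<odot>\<^bsub>E\<^esub> e (Suc k)) = (\<ominus> \<one>) \<odot>\<^bsub>E\<^esub> e k"
        using smult_swap[OF E x neg1_closed e(1)] e(2) by simp
    qed
    ultimately show "\<exists>y\<in>carrier (telescope R x E). y \<oplus>\<^bsub>telescope R x E\<^esub> e = \<zero>\<^bsub>telescope R x E\<^esub>"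
      by (intro bexI[of _ "\<lambda>k. (\<ominus> \<one>) \<odot>\<^bsub>E\<^esub> e k"]) simp_all
  next
    fix e f assume "e \<in> carrier (telescope R x E)" "f \<in> carrier (telescope R x E)"
    then have e: "\<And>k. e k \<in> carrier E" "\<And>k. x \<odot>\<^bsub>E\<^esub> e (Suc k) = e k"
      and f: "\<And>k. f k \<in> carrier E" "\<And>k. x \<odot>\<^bsub>E\<^esub> f (Suc k) = f k" by (auto simp: telescope_carrier)
    show "e \<oplus>\<^bsub>telescope R x E\<^esub> f = f \<oplus>\<^bsub>telescope R x E\<^esub> e"
      using e(1) f(1) mod_ac(1)[OF E] by simp
    have "x \<odot>\<^bsub>E\<^esub> (e (Suc k) \<oplus>\<^bsub>E\<^esub> f (Suc k)) = e k \<oplus>\<^bsub>E\<^esub> f k" for k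
      using e f x E by (simp add: mod_distr)
    then show "e \<oplus>\<^bsub>telescope R x E\<^esub> f \<in> carrier (telescope R x E)"
      using e(1) f(1) E by (simp add: telescope_carrier)
    fix g assume "g \<in> carrier (telescope R x E)"
    then show "e \<oplus>\<^bsub>telescope R x E\<^esub> f \<oplus>\<^bsub>telescope R x E\<^esub> g = e \<oplus>\<^bsub>telescope R x E\<^esub> (f \<oplus>\<^bsub>telescope R x E\<^esub> g)"
      using e(1) f(1) mod_ac(2)[OF E] by (simp add: telescope_carrier)
  qed (use E x in \<open>auto simp: telescope_carrier fun_eq_iff\<close>)
next
  fix a e assume a: "a \<in> carrier R" and "e \<in> carrier (telescope R x E)"
  then have e: "\<And>k. e k \<in> carrier E" "\<And>k. x \<odot>\<^bsub>E\<^esub> e (Suc k) = e k" by (auto simp: telescope_carrier)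
  have "x \<odot>\<^bsub>E\<^esub> (a \<odot>\<^bsub>E\<^esub> e (Suc k)) = a \<odot>\<^bsub>E\<^esub> e k" for k
    using smult_swap[OF E x a e(1)] e(2) by simp
  then show "a \<odot>\<^bsub>telescope R x E\<^esub> e \<in> carrier (telescope R x E)"
    using e(1) a E by (simp add: telescope_carrier)
qed (use E x in \<open>auto simp: telescope_carrier mod_distr\<close>)

lemma telescope_power:
  assumes E: "module R E" and x: "x \<in> carrier R" and e: "e \<in> carrier (telescope R x E)"
  shows "e k = x [^] n \<odot>\<^bsub>E\<^esub> e (k + n)"
proof (induction n)
  case 0
  then show ?case using e E by (simp add: telescope_carrier)
next
  case (Suc n)
  have "x \<odot>\<^bsub>E\<^esub> e (k + Suc n) = e (k + n)" "\<And>k. e k \<in> carrier E"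
    using e by (simp_all add: telescope_carrier)
  then show ?case using Suc x E by (simp add: mod_distr del: add_Suc_right)
qed

lemma telescope_linear:
  assumes "linear_map R A B f" "x \<in> carrier R"
  shows "linear_map R (telescope R x A) (telescope R x B) (\<lambda>e k. f (e k))"
proof (rule linear_mapI)
  fix e assume "e \<in> carrier (telescope R x A)"
  then have e: "\<And>k. e k \<in> carrier A" "\<And>k. x \<odot>\<^bsub>A\<^esub> e (Suc k) = e k" by (auto simp: telescope_carrier)
  have "x \<odot>\<^bsub>B\<^esub> f (e (Suc k)) = f (e k)" for k
    using linear_smult[OF assms e(1), of "Suc k"] e(2)[of k] by simp
  then show "(\<lambda>k. f (e k)) \<in> carrier (telescope R x B)"
    using linear_closed[OF assms(1) e(1)] by (simp add: telescope_carrier)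
qed (auto simp: telescope_carrier fun_eq_iff linear_add[OF assms(1)] linear_smult[OF assms(1)])

lemma telescope_eval: "linear_map R (telescope R x A) A (\<lambda>e. e 0)"
  by (rule linear_mapI) (auto simp: telescope_carrier)

text \<open>The solution is built from the left; saturation of the ideal is what makes each step an
  instance of the two-condition form of Baer's criterion.\<close>

lemma telescope_solve:
  assumes E: "baer R E" and a: "ideal \<aa> R" and x: "x \<in> carrier R"
    and sat: "\<And>r. r \<in> carrier R \<Longrightarrow> x \<otimes> r \<in> \<aa> \<Longrightarrow> r \<in> \<aa>"
    and f: "\<And>k r. r \<in> \<aa> \<Longrightarrow> f k r \<in> carrier E"
      "\<And>k r s. r \<in> \<aa> \<Longrightarrow> s \<in> \<aa> \<Longrightarrow> f k (r \<oplus> s) = f k r \<oplus>\<^bsub>E\<^esub> f k s"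
      "\<And>k r s. r \<in> carrier R \<Longrightarrow> s \<in> \<aa> \<Longrightarrow> f k (r \<otimes> s) = r \<odot>\<^bsub>E\<^esub> f k s"
    and v: "\<And>k. v k \<in> carrier E"
    and rel: "\<And>k r. r \<in> \<aa> \<Longrightarrow> f k r = r \<odot>\<^bsub>E\<^esub> v k \<oplus>\<^bsub>E\<^esub> x \<odot>\<^bsub>E\<^esub> f (Suc k) r"
  obtains u where "\<And>k. u k \<in> carrier E" "\<And>k r. r \<in> \<aa> \<Longrightarrow> f k r = r \<odot>\<^bsub>E\<^esub> u k"
    "\<And>k. u k = v k \<oplus>\<^bsub>E\<^esub> x \<odot>\<^bsub>E\<^esub> u (Suc k)"
proof -
  have E': "module R E" using E by (rule baer_module)
  define P where "P k u \<longleftrightarrow> u \<in> carrier E \<and> (\<forall>r\<in>\<aa>. f k r = r \<odot>\<^bsub>E\<^esub> u)" for k u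
  define Q where "Q k u w \<longleftrightarrow> u = v k \<oplus>\<^bsub>E\<^esub> x \<odot>\<^bsub>E\<^esub> w" for k u w
  have "\<exists>u. \<forall>k. P k (u k) \<and> Q k (u k) (u (Suc k))"
  proof (rule dependent_nat_choice)
    obtain e where "e \<in> carrier E" "\<And>r. r \<in> \<aa> \<Longrightarrow> f 0 r = r \<odot>\<^bsub>E\<^esub> e"
      by (rule baerD[OF E a, of "f 0"]) (use f in auto)
    then show "\<exists>u. P 0 u" by (auto simp: P_def)
  next
    fix u k assume u: "P k u"
    then have uE: "u \<in> carrier E" and ur: "\<And>r. r \<in> \<aa> \<Longrightarrow> f k r = r \<odot>\<^bsub>E\<^esub> u" by (auto simp: P_def)
    obtain e where e: "e \<in> carrier E" "\<And>r. r \<in> \<aa> \<Longrightarrow> f (Suc k) r = r \<odot>\<^bsub>E\<^esub> e"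
      "x \<odot>\<^bsub>E\<^esub> e = msub R E u (v k)"
    proof (rule baer_two[OF E a, of "f (Suc k)" x "msub R E u (v k)"])
      fix r assume r: "r \<in> carrier R" "x \<otimes> r \<in> \<aa>"
      have ra: "r \<in> \<aa>" using sat[OF r] .
      have "r \<odot>\<^bsub>E\<^esub> msub R E u (v k) = msub R E (f k r) (r \<odot>\<^bsub>E\<^esub> v k)"
        using r uE v E' ur[OF ra] by (simp add: msub_alg)
      also have "\<dots> = x \<odot>\<^bsub>E\<^esub> f (Suc k) r"
        using rel[OF ra, of k] f(1)[OF ra] r x v E' by (simp add: msub_alg)
      finally show "f (Suc k) (x \<otimes> r) = r \<odot>\<^bsub>E\<^esub> msub R E u (v k)" using f(3)[OF x ra] by simp
    next
      fix e assume "e \<in> carrier E" "\<And>r. r \<in> \<aa> \<Longrightarrow> f (Suc k) r = r \<odot>\<^bsub>E\<^esub> e"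
        "x \<odot>\<^bsub>E\<^esub> e = msub R E u (v k)"
      then show thesis by (rule that)
    qed (use x uE v E' f in simp_all)
    then have "P (Suc k) e" "Q k u e" using uE v E' by (auto simp: P_def Q_def msub_alg)
    then show "\<exists>e. P (Suc k) e \<and> Q k u e" by blast
  qed
  then obtain u where "\<And>k. P k (u k)" "\<And>k. Q k (u k) (u (Suc k))" by blast
  then show ?thesis using that[of u] unfolding P_def Q_def by blast
qed

text \<open>Multiplication by \<open>x\<close> is injective modulo the \<open>x\<close>-torsion, so
  quotients by powers of \<open>x\<close> are unique there.\<close>

lemma tors_powers_smult:
  assumes Q: "module R Q" and x: "x \<in> carrier R" and y: "y \<in> carrier Q"
    and t: "x [^] (k::nat) \<odot>\<^bsub>Q\<^esub> y \<in> carrier (tors R (powers R x) Q)"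
  shows "y \<in> carrier (tors R (powers R x) Q)"
proof -
  obtain n :: nat where "x [^] n \<odot>\<^bsub>Q\<^esub> (x [^] k \<odot>\<^bsub>Q\<^esub> y) = \<zero>\<^bsub>Q\<^esub>"
    using t by (auto simp: tors_carrier powers_def)
  then have "x [^] (n + k) \<odot>\<^bsub>Q\<^esub> y = \<zero>\<^bsub>Q\<^esub>"
    using x y Q by (simp add: nat_pow_mult[symmetric] mod_distr)
  then show ?thesis using y by (auto simp: tors_carrier powers_def)
qed

end

context noetherian_cring
begin

text \<open>This is the general fact that homomorphisms from a flat module to an injective one form
  an injective module. Concretely, the ideal is first saturated with respect to \<open>x\<close>, as
  \<open>telescope_solve\<close> requires.\<close>

lemma telescope_baer:
  assumes E: "baer R E" and x: "x \<in> carrier R"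
  shows "baer R (telescope R x E)"
proof (rule baerI)
  have E': "module R E" using E by (rule baer_module)
  show "module R (telescope R x E)" by (rule telescope_module[OF E' x])
  fix \<aa> F
  assume a: "ideal \<aa> R" and F: "\<And>r. r \<in> \<aa> \<Longrightarrow> F r \<in> carrier (telescope R x E)"
    "\<And>r s. r \<in> \<aa> \<Longrightarrow> s \<in> \<aa> \<Longrightarrow> F (r \<oplus> s) = F r \<oplus>\<^bsub>telescope R x E\<^esub> F s"
    "\<And>r s. r \<in> carrier R \<Longrightarrow> s \<in> \<aa> \<Longrightarrow> F (r \<otimes> s) = r \<odot>\<^bsub>telescope R x E\<^esub> F s"
  note F' = F(1) F(2,3)[unfolded telescope_simps]
  have FE: "F r k \<in> carrier E" "x \<odot>\<^bsub>E\<^esub> F r (Suc k) = F r k" if "r \<in> \<aa>" for r k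
    using F(1)[OF that] by (simp_all add: telescope_carrier)
  note c = ideal_rules[OF a]
  obtain n :: nat where n: "\<forall>k::nat. \<forall>r\<in>carrier R. x [^] k \<otimes> r \<in> \<aa> \<longrightarrow> x [^] n \<otimes> r \<in> \<aa>"
    using power_colon_stable[OF a x] ..
  define \<bb> where "\<bb> = {r \<in> carrier R. x [^] n \<otimes> r \<in> \<aa>}"
  have b: "ideal \<bb> R"
  proof (rule idealI')
    show "\<bb> \<subseteq> carrier R" "\<zero> \<in> \<bb>" using c(2) x by (auto simp: \<bb>_def)
    show "r \<oplus> s \<in> \<bb>" if "r \<in> \<bb>" "s \<in> \<bb>" for r s
      using that x c(3) by (auto simp: \<bb>_def r_distr)
    show "r \<otimes> s \<in> \<bb>" if "r \<in> carrier R" "s \<in> \<bb>" for r s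
      using that x c(4)[of r "x [^] n \<otimes> s"] by (auto simp: \<bb>_def m_lcomm)
  qed
  \<comment> \<open>For \<open>r\<close> in \<bb> only \<open>x^n r\<close> lies in the domain of
    \<open>F\<close>. Reading its image \<open>n\<close> places further on divides by
    \<open>x^n\<close> again, by \<open>telescope_power\<close>.\<close>
  obtain u where u: "\<And>k. u k \<in> carrier E" "\<And>k r. r \<in> \<bb> \<Longrightarrow> F (x [^] n \<otimes> r) (k + n) = r \<odot>\<^bsub>E\<^esub> u k"
    "\<And>k. u k = \<zero>\<^bsub>E\<^esub> \<oplus>\<^bsub>E\<^esub> x \<odot>\<^bsub>E\<^esub> u (Suc k)"
  proof (rule telescope_solve[OF E b x, of "\<lambda>k r. F (x [^] n \<otimes> r) (k + n)" "\<lambda>_. \<zero>\<^bsub>E\<^esub>"])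
    fix r assume r: "r \<in> carrier R" "x \<otimes> r \<in> \<bb>"
    have "x [^] Suc n \<otimes> r \<in> \<aa>" using r x by (simp add: \<bb>_def m_assoc)
    then have "x [^] n \<otimes> r \<in> \<aa>" using n r(1) by blast
    then show "r \<in> \<bb>" using r by (simp add: \<bb>_def)
  next
    fix k r assume r: "r \<in> \<bb>"
    show "F (x [^] n \<otimes> r) (k + n) \<in> carrier E" using FE(1) r by (simp add: \<bb>_def)
    show "F (x [^] n \<otimes> r) (k + n) = r \<odot>\<^bsub>E\<^esub> \<zero>\<^bsub>E\<^esub> \<oplus>\<^bsub>E\<^esub> x \<odot>\<^bsub>E\<^esub> F (x [^] n \<otimes> r) (Suc k + n)"
      using FE r E' x by (simp add: \<bb>_def)
    show "F (x [^] n \<otimes> (r \<oplus> s)) (k + n) = F (x [^] n \<otimes> r) (k + n) \<oplus>\<^bsub>E\<^esub> F (x [^] n \<otimes> s) (k + n)"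
      if "s \<in> \<bb>" for s
      using r that x by (simp add: \<bb>_def r_distr F'(2))
    show "F (x [^] n \<otimes> (s \<otimes> r)) (k + n) = s \<odot>\<^bsub>E\<^esub> F (x [^] n \<otimes> r) (k + n)"
      if "s \<in> carrier R" for s
      using r that x by (simp add: \<bb>_def m_lcomm[of _ s] F'(3))
  next
    fix u assume "\<And>k. u k \<in> carrier E" "\<And>k r. r \<in> \<bb> \<Longrightarrow> F (x [^] n \<otimes> r) (k + n) = r \<odot>\<^bsub>E\<^esub> u k"
    "\<And>k. u k = \<zero>\<^bsub>E\<^esub> \<oplus>\<^bsub>E\<^esub> x \<odot>\<^bsub>E\<^esub> u (Suc k)"
    then show thesis by (rule that)
  next
    show "\<zero>\<^bsub>E\<^esub> \<in> carrier E" by (rule mod_closed(2)[OF E'])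
  qed
  have "u \<in> carrier (telescope R x E)"
    unfolding telescope_carrier
  proof (intro allI conjI u(1))
    fix k
    show "x \<odot>\<^bsub>E\<^esub> u (Suc k) = u k"
      by (rule trans[OF _ u(3)[symmetric]]) (rule mod_simps(1)[OF E' mod_closed(3)[OF E' x u(1)], symmetric])
  qed
  moreover have "F r = r \<odot>\<^bsub>telescope R x E\<^esub> u" if r: "r \<in> \<aa>" for r
  proof
    fix k
    have rb: "r \<in> \<bb>" using c(1)[OF r] c(4)[OF nat_pow_closed[OF x] r] by (simp add: \<bb>_def)
    have "F r k = x [^] n \<odot>\<^bsub>E\<^esub> F r (k + n)" by (rule telescope_power[OF E' x F(1)[OF r]])
    also have "\<dots> = F (x [^] n \<otimes> r) (k + n)" using r x by (simp add: F'(3))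
    finally show "F r k = (r \<odot>\<^bsub>telescope R x E\<^esub> u) k" using u(2)[OF rb] by simp
  qed
  ultimately show "\<exists>e\<in>carrier (telescope R x E). \<forall>r\<in>\<aa>. F r = r \<odot>\<^bsub>telescope R x E\<^esub> e" by blast
qed

text \<open>On the ideal killed by a power of \<open>x\<close> the formal solution \<open>v\<^sub>k + x v\<^sub>k\<^sub>+\<^sub>1 + x\<^sup>2 v\<^sub>k\<^sub>+\<^sub>2 + \<dots>\<close> is
  a finite sum.\<close>

lemma telescope_series:
  assumes E: "baer R E" and x: "x \<in> carrier R" and v: "\<And>k. v k \<in> carrier E"
  obtains u where "\<And>k. u k \<in> carrier E" "\<And>k. u k = v k \<oplus>\<^bsub>E\<^esub> x \<odot>\<^bsub>E\<^esub> u (Suc k)"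
proof -
  have E': "module R E" using E by (rule baer_module)
  \<comment> \<open>\<open>S m k\<close> is the sum of the first \<open>m\<close> terms of the
    series starting at \<open>k\<close>. An \<open>r\<close> killed by \<open>x^m\<close> does not
    see the later terms.\<close>
  define S where "S = rec_nat (\<lambda>k. \<zero>\<^bsub>E\<^esub>) (\<lambda>_ g k. v k \<oplus>\<^bsub>E\<^esub> x \<odot>\<^bsub>E\<^esub> g (Suc k))"
  have S0: "S 0 k = \<zero>\<^bsub>E\<^esub>" and S1: "S (Suc m) k = v k \<oplus>\<^bsub>E\<^esub> x \<odot>\<^bsub>E\<^esub> S m (Suc k)" for m k
    by (simp_all add: S_def)
  have SE: "S m k \<in> carrier E" for m k
    by (induction m arbitrary: k) (use v x E' in \<open>simp_all add: S0 S1\<close>)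
  have stab: "r \<odot>\<^bsub>E\<^esub> S m k = r \<odot>\<^bsub>E\<^esub> S (Suc m) k" if "r \<in> carrier R" "x [^] m \<otimes> r = \<zero>" for m k r
    using that
  proof (induction m arbitrary: k r)
    case 0
    then show ?case using SE E' by (simp add: S0)
  next
    case (Suc m)
    have xr: "(x \<otimes> r) \<in> carrier R" "x [^] m \<otimes> (x \<otimes> r) = \<zero>" using Suc.prems x by (simp_all add: m_assoc)
    have "r \<odot>\<^bsub>E\<^esub> S (Suc l) k = r \<odot>\<^bsub>E\<^esub> v k \<oplus>\<^bsub>E\<^esub> (x \<otimes> r) \<odot>\<^bsub>E\<^esub> S l (Suc k)" for l
      using Suc.prems(1) x v SE E' by (simp add: S1 mod_distr smult_swap[OF E', of r x])
    then show ?case using Suc.IH[OF xr] by simp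
  qed
  have z: "ideal {\<zero>} R" by (rule zeroideal)
  obtain n :: nat where n: "\<forall>k::nat. \<forall>r\<in>carrier R. x [^] k \<otimes> r \<in> {\<zero>} \<longrightarrow> x [^] n \<otimes> r \<in> {\<zero>}"
    using power_colon_stable[OF z x] ..
  define \<bb> where "\<bb> = {r \<in> carrier R. x [^] n \<otimes> r = \<zero>}"
  have b: "ideal \<bb> R"
  proof (rule idealI')
    show "\<bb> \<subseteq> carrier R" "\<zero> \<in> \<bb>" using x by (auto simp: \<bb>_def)
    show "r \<oplus> s \<in> \<bb>" if "r \<in> \<bb>" "s \<in> \<bb>" for r s
      using that x by (auto simp: \<bb>_def r_distr)
    show "r \<otimes> s \<in> \<bb>" if "r \<in> carrier R" "s \<in> \<bb>" for r s
      using that x by (auto simp: \<bb>_def m_lcomm[of _ r])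
  qed
  show ?thesis
  proof (rule telescope_solve[OF E b x, of "\<lambda>k r. r \<odot>\<^bsub>E\<^esub> S n k" v])
    fix r assume r: "r \<in> carrier R" "x \<otimes> r \<in> \<bb>"
    have "x [^] Suc n \<otimes> r \<in> {\<zero>}" using r x by (simp add: \<bb>_def m_assoc)
    then have "x [^] n \<otimes> r \<in> {\<zero>}" using n r(1) by blast
    then show "r \<in> \<bb>" using r by (simp add: \<bb>_def)
  next
    fix k r assume r: "r \<in> \<bb>"
    then have r': "r \<in> carrier R" "x [^] n \<otimes> r = \<zero>" by (auto simp: \<bb>_def)
    show "r \<odot>\<^bsub>E\<^esub> S n k \<in> carrier E" using SE r' E' by simp
    have "r \<odot>\<^bsub>E\<^esub> S n k = r \<odot>\<^bsub>E\<^esub> S (Suc n) k" by (rule stab[OF r'])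
    then show "r \<odot>\<^bsub>E\<^esub> S n k = r \<odot>\<^bsub>E\<^esub> v k \<oplus>\<^bsub>E\<^esub> x \<odot>\<^bsub>E\<^esub> (r \<odot>\<^bsub>E\<^esub> S n (Suc k))"
      using r' SE v x E' by (simp add: S1 mod_distr smult_swap[OF E', of r x])
    show "(r \<oplus> s) \<odot>\<^bsub>E\<^esub> S n k = r \<odot>\<^bsub>E\<^esub> S n k \<oplus>\<^bsub>E\<^esub> s \<odot>\<^bsub>E\<^esub> S n k" if "s \<in> \<bb>" for s
      using r' that SE E' by (simp add: \<bb>_def mod_distr)
    show "(s \<otimes> r) \<odot>\<^bsub>E\<^esub> S n k = s \<odot>\<^bsub>E\<^esub> (r \<odot>\<^bsub>E\<^esub> S n k)" if "s \<in> carrier R" for s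
      using r' that SE E' by (simp add: mod_distr)
  next
    fix u assume "\<And>k. u k \<in> carrier E" "\<And>k r. r \<in> \<bb> \<Longrightarrow> r \<odot>\<^bsub>E\<^esub> S n k = r \<odot>\<^bsub>E\<^esub> u k"
    "\<And>k. u k = v k \<oplus>\<^bsub>E\<^esub> x \<odot>\<^bsub>E\<^esub> u (Suc k)"
    then show thesis by (intro that[of u])
  qed (use v in simp)
qed

lemma telescope_complex:
  assumes "complex R E d" "x \<in> carrier R"
  shows "complex R (\<lambda>i. telescope R x (E i)) (\<lambda>i e k. d i (e k))"
  unfolding complex_def
  using telescope_module[OF complexD(1)[OF assms(1)] assms(2)]
    telescope_linear[OF complexD(2)[OF assms(1)] assms(2)]
  by (simp add: telescope_carrier complexD(3)[OF assms(1)])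

text \<open>The lim-lim^1 argument: primitives chosen entry by entry need not form an inverse
  sequence, and the defect can be removed because \<open>u = v + x u'\<close> is solvable among
  cocycles in every degree.\<close>

lemma telescope_exact:
  assumes E: "complex R E d" and inj: "\<And>i. baer R (E i)" and x: "x \<in> carrier R"
    and ex: "\<And>i. 0 < i \<Longrightarrow> exact_at E d i"
    and div: "\<And>z. (\<And>k. z k \<in> cocycles E d 0) \<Longrightarrow> (\<And>k. x \<odot>\<^bsub>E 0\<^esub> z (Suc k) = z k) \<Longrightarrow> z 0 = \<zero>\<^bsub>E 0\<^esub>"
    and ser: "\<And>v. (\<And>k. v k \<in> cocycles E d 0) \<Longrightarrow>
      \<exists>u. \<forall>k. u k \<in> cocycles E d 0 \<and> u k = v k \<oplus>\<^bsub>E 0\<^esub> x \<odot>\<^bsub>E 0\<^esub> u (Suc k)"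
  shows "exact_at (\<lambda>i. telescope R x (E i)) (\<lambda>i e k. d i (e k)) i"
  unfolding exact_at_def
proof
  note M = complexD(1)[OF E] and lin = complexD(2)[OF E] and dd = complexD(3)[OF E]
    and dc = complexD(4)[OF E]
  fix e assume "e \<in> cocycles (\<lambda>i. telescope R x (E i)) (\<lambda>i e k. d i (e k)) i"
  then have e: "\<And>k. e k \<in> carrier (E i)" "\<And>k. x \<odot>\<^bsub>E i\<^esub> e (Suc k) = e k" "\<And>k. d i (e k) = \<zero>\<^bsub>E (Suc i)\<^esub>"
    by (auto simp: cocycles_def telescope_carrier fun_eq_iff)
  show "e \<in> coboundaries (\<lambda>i. telescope R x (E i)) (\<lambda>i e k. d i (e k)) i"
  proof (cases i)
    case 0
    have "e m = \<zero>\<^bsub>E 0\<^esub>" for m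
      using div[of "\<lambda>k. e (k + m)"] e 0 by (simp add: cocycles_def)
    then show ?thesis using 0 by (auto simp: coboundaries_def)
  next
    case (Suc j)
    have "\<forall>k. \<exists>w. w \<in> carrier (E j) \<and> e k = d j w"
      using exact_atD_Suc[OF ex[of "Suc j"]] e Suc by (metis zero_less_Suc)
    then obtain w where w: "\<And>k. w k \<in> carrier (E j)" "\<And>k. e k = d j (w k)" by metis
    \<comment> \<open>The failure of the primitives \<open>w\<close> to be an inverse sequence. It
      consists of cocycles since \<open>e\<close> is an inverse sequence, and adding a solution
      \<open>u\<close> of the series for \<open>v\<close> repairs \<open>w\<close>.\<close>
    define v where "v k = msub R (E j) (x \<odot>\<^bsub>E j\<^esub> w (Suc k)) (w k)" for k
    have vE: "v k \<in> carrier (E j)" for k using w x M by (simp add: v_def)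
    have "d j (v k) = msub R (E (Suc j)) (x \<odot>\<^bsub>E (Suc j)\<^esub> e (Suc k)) (e k)" for k
      unfolding v_def using w x M by (simp add: linear_msub[OF lin M] linear_smult[OF lin])
    then have dv: "d j (v k) = \<zero>\<^bsub>E (Suc j)\<^esub>" for k
      using e(1)[of k] e(2)[of k] M[of "Suc j"] Suc by simp
    have "\<exists>u. \<forall>k. u k \<in> cocycles E d j \<and> u k = v k \<oplus>\<^bsub>E j\<^esub> x \<odot>\<^bsub>E j\<^esub> u (Suc k)"
    proof (cases j)
      case 0
      then show ?thesis using ser[of v] vE dv by (simp add: cocycles_def)
    next
      case (Suc l)
      \<comment> \<open>In positive degree the defect is a coboundary, so the series is summed in
        the injective module one degree lower and mapped up; only degree 0 depends on the hypothesis
        \<open>ser\<close>.\<close>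
      have "\<forall>k. \<exists>y. y \<in> carrier (E l) \<and> v k = d l y"
        using exact_atD_Suc[OF ex[of "Suc l"]] vE dv Suc by (metis zero_less_Suc)
      then obtain y where y: "\<And>k. y k \<in> carrier (E l)" "\<And>k. v k = d l (y k)" by metis
      obtain t where t: "\<And>k. t k \<in> carrier (E l)" "\<And>k. t k = y k \<oplus>\<^bsub>E l\<^esub> x \<odot>\<^bsub>E l\<^esub> t (Suc k)"
        by (rule telescope_series[of "E l" x y, OF inj x y(1)]) (rule that)
      have dt: "d l (t k) = v k \<oplus>\<^bsub>E j\<^esub> x \<odot>\<^bsub>E j\<^esub> d l (t (Suc k))" for k
        by (subst t(2)) (use y t(1) x M Suc in \<open>simp add: linear_add[OF lin] linear_smult[OF lin]\<close>)
      show ?thesis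
      proof (intro exI[of _ "\<lambda>k. d l (t k)"] allI conjI dt)
        show "d l (t k) \<in> cocycles E d j" for k
          using t(1) dc dd Suc by (simp add: cocycles_def)
      qed
    qed
    then obtain u where "\<forall>k. u k \<in> cocycles E d j \<and> u k = v k \<oplus>\<^bsub>E j\<^esub> x \<odot>\<^bsub>E j\<^esub> u (Suc k)" ..
    then have u: "\<And>k. u k \<in> carrier (E j)" "\<And>k. d j (u k) = \<zero>\<^bsub>E (Suc j)\<^esub>"
      "\<And>k. u k = v k \<oplus>\<^bsub>E j\<^esub> x \<odot>\<^bsub>E j\<^esub> u (Suc k)" unfolding cocycles_def by blast+
    define t where "t = (\<lambda>k. w k \<oplus>\<^bsub>E j\<^esub> u k)"
    have wu: "w k \<oplus>\<^bsub>E j\<^esub> u k = x \<odot>\<^bsub>E j\<^esub> w (Suc k) \<oplus>\<^bsub>E j\<^esub> x \<odot>\<^bsub>E j\<^esub> u (Suc k)" for k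
    proof -
      have "w k \<oplus>\<^bsub>E j\<^esub> u k = (w k \<oplus>\<^bsub>E j\<^esub> v k) \<oplus>\<^bsub>E j\<^esub> x \<odot>\<^bsub>E j\<^esub> u (Suc k)"
        by (subst u(3)) (use w(1) vE u(1) x M in \<open>simp add: mod_ac(2)[OF M]\<close>)
      also have "w k \<oplus>\<^bsub>E j\<^esub> v k = x \<odot>\<^bsub>E j\<^esub> w (Suc k)"
        unfolding v_def using w(1) x M by (simp add: msub_alg)
      finally show ?thesis .
    qed
    have "t \<in> carrier (telescope R x (E j))"
      using wu[symmetric] unfolding telescope_carrier t_def using w(1) u(1) x M by (simp add: mod_distr)
    moreover have "e = (\<lambda>k. d j (t k))"
      using w u(1,2) M dc by (simp add: fun_eq_iff t_def linear_add[OF lin])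
    ultimately show ?thesis using Suc by (auto simp: coboundaries_def)
  qed
qed

end


section \<open>Extension of chain maps from the torsion\<close>

lemma from_below_cong:
  "(\<And>j. i = Suc j \<Longrightarrow> h j x = h' j x) \<Longrightarrow> from_below D d h i x = from_below D d h' i x"
  by (auto simp: from_below_def split: nat.split)

context noetherian_cring
begin

text \<open>Two candidates for the quotient of \<open>q\<close> by \<open>x^k\<close> differ by an
  element whose multiple by \<open>x^k\<close> is torsion, hence by torsion, which \<open>f\<close>
  does not see.\<close>

lemma colift_eq:
  assumes Q: "module R Q" and E: "module R E" and x: "x \<in> carrier R" and f: "linear_map R Q E f"
    and kill: "\<And>q. q \<in> carrier (tors R (powers R x) Q) \<Longrightarrow> f q = \<zero>\<^bsub>E\<^esub>"
    and q: "q \<in> carrier Q" and p: "p \<in> carrier Q"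
      "msub R Q (x [^] k \<odot>\<^bsub>Q\<^esub> p) q \<in> carrier (tors R (powers R x) Q)"
  shows "colift R x Q f q k = f p"
proof -
  let ?t = "carrier (tors R (powers R x) Q)"
  define p' where "p' = (SOME p. p \<in> carrier Q \<and> msub R Q (x [^] k \<odot>\<^bsub>Q\<^esub> p) q \<in> ?t)"
  have p': "p' \<in> carrier Q" "msub R Q (x [^] k \<odot>\<^bsub>Q\<^esub> p') q \<in> ?t"
    using someI[of "\<lambda>p. p \<in> carrier Q \<and> msub R Q (x [^] k \<odot>\<^bsub>Q\<^esub> p) q \<in> ?t" p] p
    unfolding p'_def by auto
  have xk: "x [^] k \<in> carrier R" using x by simp
  have "msub R Q (msub R Q (x [^] k \<odot>\<^bsub>Q\<^esub> p') q) (msub R Q (x [^] k \<odot>\<^bsub>Q\<^esub> p) q) \<in> ?t"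
    by (rule submodule_rules(5)[OF tors_submodule[OF Q powers_submonoid[OF x]] Q p'(2) p(2)])
  moreover have "msub R Q (msub R Q (x [^] k \<odot>\<^bsub>Q\<^esub> p') q) (msub R Q (x [^] k \<odot>\<^bsub>Q\<^esub> p) q)
      = x [^] k \<odot>\<^bsub>Q\<^esub> msub R Q p' p"
    using msub_alg(10)[OF Q, of "x [^] k \<odot>\<^bsub>Q\<^esub> p'" "x [^] k \<odot>\<^bsub>Q\<^esub> p" q q] p p' q xk Q
    by (simp add: msub_alg(8))
  ultimately have "msub R Q p' p \<in> ?t"
    using tors_powers_smult[OF Q x] p(1) p'(1) Q by simp
  then have "msub R E (f p') (f p) = \<zero>\<^bsub>E\<^esub>"
    using kill linear_msub[OF f Q p'(1) p(1)] by simp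
  then show ?thesis
    using msub_alg(1)[OF E] linear_closed[OF f] p(1) p'(1) by (simp add: colift_def p'_def)
qed

lemma colift_obtain:
  assumes "baer R Q" "x \<in> carrier R" "q \<in> carrier Q"
  obtains p where "p \<in> carrier Q" "msub R Q (x [^] (k::nat) \<odot>\<^bsub>Q\<^esub> p) q \<in> carrier (tors R (powers R x) Q)"
proof -
  have "x [^] k \<in> powers R x" by (auto simp: powers_def)
  then show ?thesis
    using tors_divisible[OF assms(1) powers_submonoid[OF assms(2)] _ assms(3)] that by blast
qed

text \<open>A map that kills the \<open>x\<close>-torsion of \<open>Q\<close> is a map from a module
  over R_x, and so corresponds to a map into the homomorphisms from R_x to \<open>E\<close>, that
  is, into the inverse sequences. Evaluation at index 0 recovers it.\<close>

lemma colift_linear: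
  assumes Q: "baer R Q" and E: "module R E" and x: "x \<in> carrier R" and f: "linear_map R Q E f"
    and kill: "\<And>q. q \<in> carrier (tors R (powers R x) Q) \<Longrightarrow> f q = \<zero>\<^bsub>E\<^esub>"
  shows "linear_map R Q (telescope R x E) (colift R x Q f)"
    and "q \<in> carrier Q \<Longrightarrow> colift R x Q f q 0 = f q"
    and "q \<in> carrier (tors R (powers R x) Q) \<Longrightarrow> colift R x Q f q = \<zero>\<^bsub>telescope R x E\<^esub>"
proof -
  have Q': "module R Q" using Q by (rule baer_module)
  let ?t = "carrier (tors R (powers R x) Q)"
  have sub: "submodule ?t R Q" by (rule tors_submodule[OF Q' powers_submonoid[OF x]])
  note t = submodule_rules[OF sub Q']
  note eq = colift_eq[OF Q' E x f kill]
  have xk: "x [^] k \<in> carrier R" for k :: nat using x by simp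
  show "linear_map R Q (telescope R x E) (colift R x Q f)"
  proof (rule linear_mapI)
    fix q assume q: "q \<in> carrier Q"
    show "colift R x Q f q \<in> carrier (telescope R x E)"
      unfolding telescope_carrier
    proof (intro allI conjI)
      fix k :: nat
      obtain p where p: "p \<in> carrier Q" "msub R Q (x [^] k \<odot>\<^bsub>Q\<^esub> p) q \<in> ?t"
        by (rule colift_obtain[where k = k, OF Q x q])
      show "colift R x Q f q k \<in> carrier E" using eq[OF _ q p] linear_closed[OF f p(1)] by simp
      obtain p' where p': "p' \<in> carrier Q" "msub R Q (x [^] Suc k \<odot>\<^bsub>Q\<^esub> p') q \<in> ?t"
        by (rule colift_obtain[where k = "Suc k", OF Q x q])
      have "msub R Q (x [^] k \<odot>\<^bsub>Q\<^esub> (x \<odot>\<^bsub>Q\<^esub> p')) q \<in> ?t"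
        using p' x Q' by (simp add: mod_distr)
      then have "colift R x Q f q k = f (x \<odot>\<^bsub>Q\<^esub> p')" using eq[OF _ q, of "x \<odot>\<^bsub>Q\<^esub> p'" k] p'(1) x Q' by simp
      moreover have "colift R x Q f q (Suc k) = f p'" using eq[OF _ q p'] by simp
      ultimately show "x \<odot>\<^bsub>E\<^esub> colift R x Q f q (Suc k) = colift R x Q f q k"
        using linear_smult[OF f x p'(1)] by simp
    qed
  next
    fix q q' assume q: "q \<in> carrier Q" "q' \<in> carrier Q"
    have "colift R x Q f (q \<oplus>\<^bsub>Q\<^esub> q') k = colift R x Q f q k \<oplus>\<^bsub>E\<^esub> colift R x Q f q' k" for k
    proof -
      obtain p where p: "p \<in> carrier Q" "msub R Q (x [^] k \<odot>\<^bsub>Q\<^esub> p) q \<in> ?t"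
        by (rule colift_obtain[where k = k, OF Q x q(1)])
      obtain p' where p': "p' \<in> carrier Q" "msub R Q (x [^] k \<odot>\<^bsub>Q\<^esub> p') q' \<in> ?t"
        by (rule colift_obtain[where k = k, OF Q x q(2)])
      have "msub R Q (x [^] k \<odot>\<^bsub>Q\<^esub> (p \<oplus>\<^bsub>Q\<^esub> p')) (q \<oplus>\<^bsub>Q\<^esub> q') \<in> ?t"
        using t(3)[OF p(2) p'(2)] p(1) p'(1) q xk Q' by (simp add: mod_distr msub_alg(9))
      then have "colift R x Q f (q \<oplus>\<^bsub>Q\<^esub> q') k = f (p \<oplus>\<^bsub>Q\<^esub> p')"
        using eq[of "q \<oplus>\<^bsub>Q\<^esub> q'" "p \<oplus>\<^bsub>Q\<^esub> p'" k] p(1) p'(1) q Q' by simp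
      then show ?thesis using eq[OF _ q(1) p] eq[OF _ q(2) p'] linear_add[OF f p(1) p'(1)] by simp
    qed
    then show "colift R x Q f (q \<oplus>\<^bsub>Q\<^esub> q') = colift R x Q f q \<oplus>\<^bsub>telescope R x E\<^esub> colift R x Q f q'"
      by (simp add: fun_eq_iff)
  next
    fix r q assume r: "r \<in> carrier R" and q: "q \<in> carrier Q"
    have "colift R x Q f (r \<odot>\<^bsub>Q\<^esub> q) k = r \<odot>\<^bsub>E\<^esub> colift R x Q f q k" for k
    proof -
      obtain p where p: "p \<in> carrier Q" "msub R Q (x [^] k \<odot>\<^bsub>Q\<^esub> p) q \<in> ?t"
        by (rule colift_obtain[where k = k, OF Q x q])
      have "msub R Q (x [^] k \<odot>\<^bsub>Q\<^esub> (r \<odot>\<^bsub>Q\<^esub> p)) (r \<odot>\<^bsub>Q\<^esub> q) \<in> ?t"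
        using t(4)[OF r p(2)] p(1) q r xk Q' by (simp add: msub_alg(8) smult_swap[OF Q', of _ r])
      then have "colift R x Q f (r \<odot>\<^bsub>Q\<^esub> q) k = f (r \<odot>\<^bsub>Q\<^esub> p)"
        using eq[of "r \<odot>\<^bsub>Q\<^esub> q" "r \<odot>\<^bsub>Q\<^esub> p" k] p(1) q r Q' by simp
      then show ?thesis using eq[OF _ q p] linear_smult[OF f r p(1)] by simp
    qed
    then show "colift R x Q f (r \<odot>\<^bsub>Q\<^esub> q) = r \<odot>\<^bsub>telescope R x E\<^esub> colift R x Q f q"
      by (simp add: fun_eq_iff)
  qed
  show "colift R x Q f q 0 = f q" if "q \<in> carrier Q"
    using eq[OF _ that that, of 0] that t(2) Q' by simp
  show "colift R x Q f q = \<zero>\<^bsub>telescope R x E\<^esub>" if q: "q \<in> ?t"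
  proof -
    have q': "q \<in> carrier Q" using t(1) q by blast
    have "colift R x Q f q k = f \<zero>\<^bsub>Q\<^esub>" for k
      using eq[OF _ q', of "\<zero>\<^bsub>Q\<^esub>" k] t(5)[OF t(2) q] xk Q' by simp
    then show ?thesis using linear_zero[OF f Q' E] by (simp add: fun_eq_iff)
  qed
qed

lemma colift_natural:
  assumes P: "baer R P" and Q: "baer R Q" and E: "module R E" and x: "x \<in> carrier R"
    and u: "linear_map R P Q u" and f: "linear_map R Q E f" and g: "linear_map R P E g"
    and kill: "\<And>q. q \<in> carrier (tors R (powers R x) Q) \<Longrightarrow> f q = \<zero>\<^bsub>E\<^esub>"
    and gf: "\<And>q. q \<in> carrier P \<Longrightarrow> g q = f (u q)"
    and q: "q \<in> carrier P"
  shows "colift R x P g q = colift R x Q f (u q)"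
proof
  fix k :: nat
  have P': "module R P" and Q': "module R Q" using P Q by (auto intro: baer_module)
  have pw: "submonoid (powers R x) R" by (rule powers_submonoid[OF x])
  obtain p where p: "p \<in> carrier P" "msub R P (x [^] k \<odot>\<^bsub>P\<^esub> p) q \<in> carrier (tors R (powers R x) P)"
    by (rule colift_obtain[where k = k, OF P x q])
  have "g y = \<zero>\<^bsub>E\<^esub>" if "y \<in> carrier (tors R (powers R x) P)" for y
    using kill[OF tors_mem_map[OF u P' Q' pw that]] gf that by (simp add: tors_carrier)
  then have 1: "colift R x P g q k = g p" using colift_eq[OF P' E x g _ q p] by blast
  have "u (msub R P (x [^] k \<odot>\<^bsub>P\<^esub> p) q) \<in> carrier (tors R (powers R x) Q)"
    by (rule tors_mem_map[OF u P' Q' pw p(2)])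
  then have "msub R Q (x [^] k \<odot>\<^bsub>Q\<^esub> u p) (u q) \<in> carrier (tors R (powers R x) Q)"
    using p(1) q x P' by (simp add: linear_msub[OF u P'] linear_smult[OF u])
  then have "colift R x Q f (u q) k = f (u p)"
    using colift_eq[OF Q' E x f kill linear_closed[OF u q] linear_closed[OF u p(1)]] by blast
  then show "colift R x P g q k = colift R x Q f (u q) k" using 1 gf[OF p(1)] by simp
qed

end

text \<open>For the module of cocycles in degree 0, \<open>div\<close> is the vanishing of Hom from
  R_x and \<open>ser\<close> the vanishing of Ext^1.\<close>

locale telescoping = noetherian_cring R for R :: "'r ring" (structure) +
  fixes E :: "nat \<Rightarrow> ('r, 'e) module" and d :: "nat \<Rightarrow> 'e \<Rightarrow> 'e" and x :: 'r
  assumes complex: "complex R E d" and inj: "\<And>i. baer R (E i)" and x: "x \<in> carrier R"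
    and exact: "\<And>i. 0 < i \<Longrightarrow> exact_at E d i"
    and div: "\<And>z. (\<And>k. z k \<in> cocycles E d 0) \<Longrightarrow> (\<And>k. x \<odot>\<^bsub>E 0\<^esub> z (Suc k) = z k) \<Longrightarrow> z 0 = \<zero>\<^bsub>E 0\<^esub>"
    and ser: "\<And>v. (\<And>k. v k \<in> cocycles E d 0) \<Longrightarrow>
      \<exists>u. \<forall>k. u k \<in> cocycles E d 0 \<and> u k = v k \<oplus>\<^bsub>E 0\<^esub> x \<odot>\<^bsub>E 0\<^esub> u (Suc k)"
begin

abbreviation tor where "tor Q \<equiv> tors R (powers R x) Q"

definition kills_torsion :: "('r, 'q) module \<Rightarrow> ('r, 'e) module \<Rightarrow> ('q \<Rightarrow> 'e) \<Rightarrow> bool" where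
  "kills_torsion Q A f \<longleftrightarrow> linear_map R Q A f \<and> (\<forall>q\<in>carrier (tor Q). f q = \<zero>\<^bsub>A\<^esub>)"

text \<open>A contraction of the complex of inverse sequences contracts every complex of maps that kill
  the \<open>x\<close>-torsion, naturally in the source.\<close>

definition natural_contraction :: "(nat \<Rightarrow> ('r, 'q) module \<Rightarrow> ('q \<Rightarrow> 'e) \<Rightarrow> 'q \<Rightarrow> 'e) \<Rightarrow> bool" where
  "natural_contraction H \<longleftrightarrow>
    (\<forall>i Q f. baer R Q \<longrightarrow> kills_torsion Q (E (Suc i)) f \<longrightarrow> kills_torsion Q (E i) (H i Q f)) \<and>
    (\<forall>i Q f q. baer R Q \<longrightarrow> kills_torsion Q (E i) f \<longrightarrow> q \<in> carrier Q \<longrightarrow>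
      f q = H i Q (\<lambda>q. d i (f q)) q \<oplus>\<^bsub>E i\<^esub> from_below E d (\<lambda>j. H j Q f) i q) \<and>
    (\<forall>i P Q u f g q. baer R P \<longrightarrow> baer R Q \<longrightarrow> linear_map R P Q u \<longrightarrow>
      kills_torsion Q (E (Suc i)) f \<longrightarrow> linear_map R P (E (Suc i)) g \<longrightarrow>
      (\<forall>q\<in>carrier P. g q = f (u q)) \<longrightarrow> q \<in> carrier P \<longrightarrow> H i P g q = H i Q f (u q))"

lemma natural_contractionD:
  assumes "natural_contraction H"
  shows "baer R Q \<Longrightarrow> kills_torsion Q (E (Suc i)) f \<Longrightarrow> kills_torsion Q (E i) (H i Q f)"
    and "baer R Q \<Longrightarrow> kills_torsion Q (E i) f \<Longrightarrow> q \<in> carrier Q \<Longrightarrow>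
      f q = H i Q (\<lambda>q. d i (f q)) q \<oplus>\<^bsub>E i\<^esub> from_below E d (\<lambda>j. H j Q f) i q"
    and "baer R P \<Longrightarrow> baer R Q \<Longrightarrow> linear_map R P Q u \<Longrightarrow>
      kills_torsion Q (E (Suc i)) f \<Longrightarrow> linear_map R P (E (Suc i)) g \<Longrightarrow>
      (\<And>q. q \<in> carrier P \<Longrightarrow> g q = f (u q)) \<Longrightarrow> q \<in> carrier P \<Longrightarrow> H i P g q = H i Q f (u q)"
  using assms unfolding natural_contraction_def by blast+

text \<open>The inverse sequences form a complex of injectives that is exact in every degree, 0
  included, so \<open>contraction_exists\<close> contracts it. That contraction does not involve
  \<open>Q\<close>, whence the naturality.\<close>

lemma natural_contraction_exists:
  "\<exists>H :: nat \<Rightarrow> ('r, 'q) module \<Rightarrow> ('q \<Rightarrow> 'e) \<Rightarrow> 'q \<Rightarrow> 'e. natural_contraction H"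
proof -
  note M = complexD(1)[OF complex] and lin = complexD(2)[OF complex]
  let ?T = "\<lambda>i. telescope R x (E i)" and ?d = "\<lambda>i e k. d i (e k)"
  have T: "complex R ?T ?d" by (rule telescope_complex[OF complex x])
  have TM: "module R (?T i)" for i by (rule complexD(1)[OF T])
  have Tex: "exact_at ?T ?d i" for i 
    by (rule telescope_exact[where E = E and d = d, OF complex inj x])
      (assumption | fact exact | fact div | fact ser)+
  obtain s where s: "\<And>i. linear_map R (?T (Suc i)) (?T i) (s i)"
    "\<And>i y. y \<in> carrier (?T i) \<Longrightarrow> y = s i (?d i y) \<oplus>\<^bsub>?T i\<^esub> from_below ?T ?d s i y"
    using contraction_exists[OF T telescope_baer[OF inj x]] Tex by blast
  \<comment> \<open>Pass to inverse sequences, contract there, and return by evaluation at index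
    0.\<close>
  define H where "H i Q f q = s i (colift R x Q f q) 0" for i and Q :: "('r, 'q) module" and f q
  have cl: "linear_map R Q (?T i) (colift R x Q f)"
    "\<And>q. q \<in> carrier Q \<Longrightarrow> colift R x Q f q 0 = f q"
    "\<And>q. q \<in> carrier (tor Q) \<Longrightarrow> colift R x Q f q = \<zero>\<^bsub>?T i\<^esub>"
    if "baer R Q" "kills_torsion Q (E i) f" for Q :: "('r, 'q) module" and i f
    using colift_linear[OF that(1) M x, of i f] that(2) by (auto simp: kills_torsion_def)
  have "natural_contraction H"
    unfolding natural_contraction_def
  proof (intro conjI allI impI)
    fix i and Q :: "('r, 'q) module" and f
    assume Q: "baer R Q" and f: "kills_torsion Q (E (Suc i)) f"
    have "linear_map R Q (?T i) (\<lambda>q. s i (colift R x Q f q))"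
      by (rule linear_comp[OF cl(1)[OF Q f] s(1)])
    then have "linear_map R Q (E i) (H i Q f)"
      unfolding H_def by (rule linear_comp[OF _ telescope_eval])
    moreover have "H i Q f q = \<zero>\<^bsub>E i\<^esub>" if "q \<in> carrier (tor Q)" for q
      using cl(3)[OF Q f that] linear_zero[OF s(1) TM TM, of i] by (simp add: H_def)
    ultimately show "kills_torsion Q (E i) (H i Q f)" by (simp add: kills_torsion_def)
  next
    fix i and Q :: "('r, 'q) module" and f q
    assume Q: "baer R Q" and f: "kills_torsion Q (E i) f" and q: "q \<in> carrier Q"
    have Q': "module R Q" by (rule baer_module[OF Q])
    have fl: "linear_map R Q (E i) f" using f by (simp add: kills_torsion_def)
    have df: "linear_map R Q (E (Suc i)) (\<lambda>q. d i (f q))" by (rule linear_comp[OF fl lin])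
    have cd: "?d i (colift R x Q f q) = colift R x Q (\<lambda>q. d i (f q)) q"
    proof
      fix k :: nat
      obtain p where p: "p \<in> carrier Q" "msub R Q (x [^] k \<odot>\<^bsub>Q\<^esub> p) q \<in> carrier (tor Q)"
        by (rule colift_obtain[where k = k, OF Q x q])
      have "colift R x Q f q k = f p"
        using colift_eq[OF Q' M x fl _ q p] f by (auto simp: kills_torsion_def)
      moreover have "colift R x Q (\<lambda>q. d i (f q)) q k = d i (f p)"
        using colift_eq[OF Q' M x df _ q p] f linear_zero[OF lin M M] by (auto simp: kills_torsion_def)
      ultimately show "d i (colift R x Q f q k) = colift R x Q (\<lambda>q. d i (f q)) q k" by simp
    qed
    have c: "colift R x Q f q \<in> carrier (?T i)" by (rule linear_closed[OF cl(1)[OF Q f] q])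
    have "f q = colift R x Q f q 0" using cl(2)[OF Q f q] by simp
    also have "\<dots> = (s i (?d i (colift R x Q f q)) \<oplus>\<^bsub>?T i\<^esub> from_below ?T ?d s i (colift R x Q f q)) 0"
      using s(2)[OF c] by simp
    also have "\<dots> = H i Q (\<lambda>q. d i (f q)) q \<oplus>\<^bsub>E i\<^esub> from_below E d (\<lambda>j. H j Q f) i q"
      unfolding cd by (cases i) (simp_all add: H_def from_below_def)
    finally show "f q = H i Q (\<lambda>q. d i (f q)) q \<oplus>\<^bsub>E i\<^esub> from_below E d (\<lambda>j. H j Q f) i q" .
  next
    fix i and P Q :: "('r, 'q) module" and u f g q
    assume "baer R P" "baer R Q" "linear_map R P Q u" "kills_torsion Q (E (Suc i)) f"
      "linear_map R P (E (Suc i)) g" "\<forall>q\<in>carrier P. g q = f (u q)" "q \<in> carrier P"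
    then have "colift R x P g q = colift R x Q f (u q)"
      by (intro colift_natural[OF _ _ M x]) (auto simp: kills_torsion_def)
    then show "H i P g q = H i Q f (u q)" by (simp add: H_def)
  qed
  then show ?thesis by blast
qed

text \<open>The homotopy on the torsion is extended degree by degree to maps \<open>k\<close>. What
  remains of \<phi> after subtracting \<open>k d + d k\<close> is a chain map \<open>g\<close> that
  kills the torsion, and the natural contraction makes such a map null-homotopic.\<close>

lemma null_homotopic_from_torsion:
  assumes Q: "complex R Q dQ" and injQ: "\<And>i. baer R (Q i)"
    and \<phi>: "chain_map R Q dQ E d \<phi>"
    and null: "null_homotopic R (\<lambda>i. tor (Q i)) dQ E d \<phi>"
  shows "null_homotopic R (Q :: nat \<Rightarrow> ('r, 'q) module) dQ E d \<phi>"
proof -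
  note M = complexD(1)[OF complex] and lin = complexD(2)[OF complex]
  note MQ = complexD(1)[OF Q] and linQ = complexD(2)[OF Q] and ddQ = complexD(3)[OF Q]
    and dcQ = complexD(4)[OF Q]
  note \<phi>l = chain_mapD(1)[OF \<phi>] and \<phi>d = chain_mapD(2)[OF \<phi>] and \<phi>c = chain_mapD(3)[OF \<phi>]
  obtain H :: "nat \<Rightarrow> ('r, 'q) module \<Rightarrow> ('q \<Rightarrow> 'e) \<Rightarrow> 'q \<Rightarrow> 'e" where H: "natural_contraction H"
    using natural_contraction_exists by blast
  note H1 = natural_contractionD(1)[OF H] and H2 = natural_contractionD(2)[OF H]
    and H3 = natural_contractionD(3)[OF H]
  obtain h where h: "\<And>i. linear_map R (tor (Q (Suc i))) (E i) (h i)"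
    "\<And>i q. q \<in> carrier (tor (Q i)) \<Longrightarrow> \<phi> i q = h i (dQ i q) \<oplus>\<^bsub>E i\<^esub> from_below E d h i q"
    using null unfolding null_homotopic_def by blast
  have sub: "submodule (carrier (tor (Q i))) R (Q i)" for i
    by (rule tors_submodule[OF MQ powers_submonoid[OF x]])
  have "\<exists>k. linear_map R (Q (Suc i)) (E i) k \<and> (\<forall>q\<in>carrier (tor (Q (Suc i))). k q = h i q)" for i
  proof -
    have "linear_map R (Q (Suc i)\<lparr>carrier := carrier (tor (Q (Suc i)))\<rparr>) (E i) (h i)"
      using h(1)[of i] by (simp add: tors_def)
    then show ?thesis using baer_extend_submodule[OF inj MQ sub] by metis
  qed
  then obtain k where k: "\<And>i. linear_map R (Q (Suc i)) (E i) (k i)"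
    "\<And>i q. q \<in> carrier (tor (Q (Suc i))) \<Longrightarrow> k i q = h i q" by metis
  define g where "g i q = msub R (E i) (\<phi> i q) (k i (dQ i q) \<oplus>\<^bsub>E i\<^esub> from_below E d k i q)" for i q
  have fbl: "linear_map R (Q i) (E i) (from_below E d k i)" for i
    by (rule from_below_linear[OF complex MQ]) (use k(1) in auto)
  have kd: "linear_map R (Q i) (E i) (\<lambda>q. k i (dQ i q))" for i by (rule linear_comp[OF linQ k(1)])
  have gl: "linear_map R (Q i) (E i) (g i)" for i
    unfolding g_def by (rule linear_diff[OF \<phi>l linear_sum[OF kd fbl MQ M] MQ M])
  have gk: "kills_torsion (Q i) (E i) (g i)" for i
    unfolding kills_torsion_def
  proof (intro conjI ballI gl)
    fix q assume q: "q \<in> carrier (tor (Q i))"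
    then have q': "q \<in> carrier (Q i)" by (simp add: tors_carrier)
    have "dQ i q \<in> carrier (tor (Q (Suc i)))"
      by (rule tors_mem_map[OF linQ MQ MQ powers_submonoid[OF x] q])
    then have "k i (dQ i q) = h i (dQ i q)" by (rule k(2))
    moreover have "from_below E d k i q = from_below E d h i q"
      by (rule from_below_cong) (use k(2) q in auto)
    ultimately have "\<phi> i q = k i (dQ i q) \<oplus>\<^bsub>E i\<^esub> from_below E d k i q" using h(2)[OF q] by simp
    then show "g i q = \<zero>\<^bsub>E i\<^esub>" using \<phi>c[OF q'] M by (simp add: g_def)
  qed
  have gd: "g (Suc i) (dQ i q) = d i (g i q)" if q: "q \<in> carrier (Q i)" for i q
  proof -
    have kc: "k i (dQ i q) \<in> carrier (E i)" "from_below E d k i q \<in> carrier (E i)"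
      using linear_closed[OF kd q] linear_closed[OF fbl q] by auto
    have 1: "d i (from_below E d k i q) = \<zero>\<^bsub>E (Suc i)\<^esub>"
      using complexD(3)[OF complex] linear_zero[OF lin M M] linear_closed[OF k(1)] q
      by (cases i) (auto simp: from_below_def)
    have "d i (g i q) = msub R (E (Suc i)) (d i (\<phi> i q)) (d i (k i (dQ i q)))"
      using kc \<phi>c[OF q] M linear_closed[OF lin]
      by (simp add: g_def linear_msub[OF lin M] linear_add[OF lin] 1)
    moreover have "k (Suc i) (dQ (Suc i) (dQ i q)) = \<zero>\<^bsub>E (Suc i)\<^esub>"
      using ddQ[OF q] linear_zero[OF k(1) MQ M] by simp
    ultimately show ?thesis
      using \<phi>d[OF q] M linear_closed[OF lin kc(1)] by (simp add: g_def from_below_def)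
  qed
  define K where "K i = H i (Q (Suc i)) (g (Suc i))" for i
  have Kl: "linear_map R (Q (Suc i)) (E i) (K i)" for i
    using H1[OF injQ gk] by (simp add: K_def kills_torsion_def)
  have gK: "g i q = K i (dQ i q) \<oplus>\<^bsub>E i\<^esub> from_below E d K i q" if q: "q \<in> carrier (Q i)" for i q
  proof -
    \<comment> \<open>Contracting in the target yields \<open>H\<close> applied to
      \<open>d g\<close>. Since \<open>d g = g dQ\<close>, naturality along \<open>dQ\<close> turns
      this into \<open>K\<close> after \<open>dQ\<close>, the missing summand of a homotopy.\<close>
    have "H i (Q i) (\<lambda>q. d i (g i q)) q = H i (Q (Suc i)) (g (Suc i)) (dQ i q)"
      by (rule H3[OF injQ injQ linQ gk linear_comp[OF gl lin] _ q]) (simp add: gd)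
    moreover have "from_below E d (\<lambda>j. H j (Q i) (g i)) i q = from_below E d K i q"
      by (rule from_below_cong) (simp add: K_def)
    ultimately show ?thesis using H2[OF injQ gk q] by (simp add: K_def)
  qed
  define h' where "h' i q = k i q \<oplus>\<^bsub>E i\<^esub> K i q" for i q
  have "\<phi> i q = h' i (dQ i q) \<oplus>\<^bsub>E i\<^esub> from_below E d h' i q" if q: "q \<in> carrier (Q i)" for i q
  proof -
    have fbK: "linear_map R (Q i) (E i) (from_below E d K i)"
      by (rule from_below_linear[OF complex MQ]) (use Kl in auto)
    have c: "k i (dQ i q) \<in> carrier (E i)" "K i (dQ i q) \<in> carrier (E i)"
      "from_below E d k i q \<in> carrier (E i)" "from_below E d K i q \<in> carrier (E i)"
      using linear_closed[OF kd q] linear_closed[OF fbl q] linear_closed[OF fbK q]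
        linear_closed[OF Kl dcQ[OF q]] by auto
    have fb: "from_below E d h' i q = from_below E d k i q \<oplus>\<^bsub>E i\<^esub> from_below E d K i q"
    proof (cases i)
      case 0
      then show ?thesis using M by (simp add: from_below_def)
    next
      case (Suc j)
      then show ?thesis using linear_closed[OF k(1)] linear_closed[OF Kl] q
        by (simp add: from_below_def h'_def linear_add[OF lin])
    qed
    have "\<phi> i q = g i q \<oplus>\<^bsub>E i\<^esub> (k i (dQ i q) \<oplus>\<^bsub>E i\<^esub> from_below E d k i q)"
      using c \<phi>c[OF q] M by (simp add: g_def msub_alg(2))
    then show ?thesis
      unfolding gK[OF q] fb h'_def using c M by (simp add: mod_ac)
  qed
  moreover have "linear_map R (Q (Suc i)) (E i) (h' i)" for i
    unfolding h'_def by (rule linear_sum[OF k(1) Kl MQ M])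
  ultimately show ?thesis unfolding null_homotopic_def by blast
qed

text \<open>Degreewise extensions \<theta> need not commute with the differentials, but the failure
  \<open>e = d \<theta> - \<theta> d\<close> kills the torsion. The contraction writes
  \<open>e = d K - K d\<close> with \<open>K\<close> killing the torsion too, so \<theta> - K is a
  chain map with the same restriction.\<close>

lemma chain_map_extends_from_torsion:
  assumes Q: "complex R Q dQ" and injQ: "\<And>i. baer R (Q i)"
    and \<psi>: "chain_map R (\<lambda>i. tor (Q i)) dQ E d \<psi>"
  obtains \<phi> where "chain_map R (Q :: nat \<Rightarrow> ('r, 'q) module) dQ E d \<phi>"
    "\<And>i q. q \<in> carrier (tor (Q i)) \<Longrightarrow> \<phi> i q = \<psi> i q"
proof -
  note M = complexD(1)[OF complex] and lin = complexD(2)[OF complex]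
  note MQ = complexD(1)[OF Q] and linQ = complexD(2)[OF Q] and ddQ = complexD(3)[OF Q]
    and dcQ = complexD(4)[OF Q]
  obtain H :: "nat \<Rightarrow> ('r, 'q) module \<Rightarrow> ('q \<Rightarrow> 'e) \<Rightarrow> 'q \<Rightarrow> 'e" where H: "natural_contraction H"
    using natural_contraction_exists by blast
  note H1 = natural_contractionD(1)[OF H] and H2 = natural_contractionD(2)[OF H]
    and H3 = natural_contractionD(3)[OF H]
  have sub: "submodule (carrier (tor (Q i))) R (Q i)" for i
    by (rule tors_submodule[OF MQ powers_submonoid[OF x]])
  have "\<exists>k. linear_map R (Q i) (E i) k \<and> (\<forall>q\<in>carrier (tor (Q i)). k q = \<psi> i q)" for i
  proof -
    have "linear_map R (Q i\<lparr>carrier := carrier (tor (Q i))\<rparr>) (E i) (\<psi> i)"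
      using chain_mapD(1)[OF \<psi>, of i] by (simp add: tors_def)
    then show ?thesis using baer_extend_submodule[OF inj MQ sub] by metis
  qed
  then obtain \<theta> where \<theta>: "\<And>i. linear_map R (Q i) (E i) (\<theta> i)"
    "\<And>i q. q \<in> carrier (tor (Q i)) \<Longrightarrow> \<theta> i q = \<psi> i q" by metis
  define e where "e i q = msub R (E (Suc i)) (d i (\<theta> i q)) (\<theta> (Suc i) (dQ i q))" for i q
  have el: "linear_map R (Q i) (E (Suc i)) (e i)" for i
    unfolding e_def by (rule linear_diff[OF linear_comp[OF \<theta>(1) lin] linear_comp[OF linQ \<theta>(1)] MQ M])
  have ek: "kills_torsion (Q i) (E (Suc i)) (e i)" for i
    unfolding kills_torsion_def
  proof (intro conjI ballI el)
    fix q assume q: "q \<in> carrier (tor (Q i))"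
    have dq: "dQ i q \<in> carrier (tor (Q (Suc i)))"
      by (rule tors_mem_map[OF linQ MQ MQ powers_submonoid[OF x] q])
    show "e i q = \<zero>\<^bsub>E (Suc i)\<^esub>"
      using \<theta>(2)[OF q] \<theta>(2)[OF dq] chain_mapD(2,3)[OF \<psi> q] linear_closed[OF lin] M
      by (simp add: e_def)
  qed
  define K where "K i = H i (Q i) (e i)" for i
  have Kk: "kills_torsion (Q i) (E i) (K i)" for i
    unfolding K_def by (rule H1[OF injQ ek])
  then have Kl: "linear_map R (Q i) (E i) (K i)" for i by (simp add: kills_torsion_def)
  have eK: "e i q = msub R (E (Suc i)) (d i (K i q)) (K (Suc i) (dQ i q))" if q: "q \<in> carrier (Q i)" for i q
  proof -
    \<comment> \<open>The failure anticommutes with the differentials, \<open>d e = - e dQ\<close>,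
      so naturality is applied along the negative of \<open>dQ\<close>.\<close>
    let ?u = "\<lambda>q. (\<ominus> \<one>) \<odot>\<^bsub>Q (Suc i)\<^esub> dQ i q"
    have u: "linear_map R (Q i) (Q (Suc i)) ?u" by (rule linear_scale[OF linQ MQ]) simp
    have "d (Suc i) (e i p) = e (Suc i) (?u p)" if p: "p \<in> carrier (Q i)" for p
    proof -
      have c: "\<theta> i p \<in> carrier (E i)" "\<theta> (Suc i) (dQ i p) \<in> carrier (E (Suc i))"
        "dQ i p \<in> carrier (Q (Suc i))" "d (Suc i) (\<theta> (Suc i) (dQ i p)) \<in> carrier (E (Suc (Suc i)))"
        using linear_closed[OF \<theta>(1)] linear_closed[OF lin] dcQ p by auto
      have "d (Suc i) (e i p) = msub R (E (Suc (Suc i))) \<zero>\<^bsub>E (Suc (Suc i))\<^esub> (d (Suc i) (\<theta> (Suc i) (dQ i p)))"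
        using c complexD(3,4)[OF complex c(1)] M by (simp add: e_def linear_msub[OF lin M])
      also have "\<dots> = (\<ominus> \<one>) \<odot>\<^bsub>E (Suc (Suc i))\<^esub> d (Suc i) (\<theta> (Suc i) (dQ i p))"
        using c M by (simp add: msub_def)
      also have "\<dots> = (\<ominus> \<one>) \<odot>\<^bsub>E (Suc (Suc i))\<^esub> e (Suc i) (dQ i p)"
        using c ddQ[OF p] linear_zero[OF \<theta>(1) MQ M] M by (simp add: e_def)
      also have "\<dots> = e (Suc i) (?u p)" using linear_smult[OF el neg1_closed c(3)] by simp
      finally show ?thesis .
    qed
    then have "H (Suc i) (Q i) (\<lambda>q. d (Suc i) (e i q)) q = K (Suc i) (?u q)"
      unfolding K_def by (intro H3[OF injQ injQ u ek linear_comp[OF el lin] _ q])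
    also have "\<dots> = (\<ominus> \<one>) \<odot>\<^bsub>E (Suc i)\<^esub> K (Suc i) (dQ i q)"
      using linear_smult[OF Kl neg1_closed dcQ[OF q]] by simp
    finally have "e i q = (\<ominus> \<one>) \<odot>\<^bsub>E (Suc i)\<^esub> K (Suc i) (dQ i q) \<oplus>\<^bsub>E (Suc i)\<^esub> d i (K i q)"
      using H2[OF injQ ek q] by (simp add: from_below_def K_def)
    then show ?thesis
      unfolding msub_def
      using mod_ac(1)[OF M] linear_closed[OF lin linear_closed[OF Kl q]] linear_closed[OF Kl dcQ[OF q]] M
      by simp
  qed
  define \<phi> where "\<phi> i q = msub R (E i) (\<theta> i q) (K i q)" for i q
  show ?thesis
  proof (rule that[of \<phi>])
    show "\<phi> i q = \<psi> i q" if q: "q \<in> carrier (tor (Q i))" for i q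
      using \<theta>(2)[OF q] Kk[of i] q chain_mapD(3)[OF \<psi> q] M by (simp add: \<phi>_def kills_torsion_def)
    show "chain_map R Q dQ E d \<phi>"
      unfolding chain_map_def
    proof (intro conjI allI ballI)
      show "linear_map R (Q i) (E i) (\<phi> i)" for i
        unfolding \<phi>_def by (rule linear_diff[OF \<theta>(1) Kl MQ M])
      fix i q assume q: "q \<in> carrier (Q i)"
      have c: "\<theta> i q \<in> carrier (E i)" "\<theta> (Suc i) (dQ i q) \<in> carrier (E (Suc i))"
        "K i q \<in> carrier (E i)" "K (Suc i) (dQ i q) \<in> carrier (E (Suc i))"
        "d i (\<theta> i q) \<in> carrier (E (Suc i))" "d i (K i q) \<in> carrier (E (Suc i))"
        using linear_closed[OF \<theta>(1)] linear_closed[OF Kl] linear_closed[OF lin] dcQ[OF q] q by auto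
      have "msub R (E (Suc i)) (d i (\<theta> i q)) (\<theta> (Suc i) (dQ i q)) =
        msub R (E (Suc i)) (d i (K i q)) (K (Suc i) (dQ i q))"
        using eK[OF q] by (simp add: e_def)
      then have "msub R (E (Suc i)) (msub R (E (Suc i)) (d i (\<theta> i q)) (\<theta> (Suc i) (dQ i q)))
         (msub R (E (Suc i)) (d i (K i q)) (K (Suc i) (dQ i q))) = \<zero>\<^bsub>E (Suc i)\<^esub>"
        using c M by simp
      then have "msub R (E (Suc i)) (msub R (E (Suc i)) (d i (\<theta> i q)) (d i (K i q)))
         (msub R (E (Suc i)) (\<theta> (Suc i) (dQ i q)) (K (Suc i) (dQ i q))) = \<zero>\<^bsub>E (Suc i)\<^esub>"
        using msub_alg(10)[OF M c(5,6,2,4)] by simp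
      then have "msub R (E (Suc i)) (d i (\<theta> i q)) (d i (K i q)) =
         msub R (E (Suc i)) (\<theta> (Suc i) (dQ i q)) (K (Suc i) (dQ i q))"
        using msub_alg(1)[OF M] mod_closed(4)[OF M] c by blast
      then show "\<phi> (Suc i) (dQ i q) = d i (\<phi> i q)"
        using c M by (simp add: \<phi>_def linear_msub[OF lin M])
    qed
  qed
qed

end

section \<open>Torsion with respect to an ideal, one generator at a time\<close>

definition iter_tors :: "'r ring \<Rightarrow> 'r list \<Rightarrow> ('r, 'a) module \<Rightarrow> ('r, 'a) module" where
  "iter_tors R xs A = foldr (\<lambda>x. tors R (powers R x)) xs A"

lemma iter_tors_simps [simp]:
  "iter_tors R [] A = A"
  "iter_tors R (x # xs) A = tors R (powers R x) (iter_tors R xs A)"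
  by (simp_all add: iter_tors_def)

lemma iter_tors_ops [simp]:
  "zero (iter_tors R xs A) = zero A" "add (iter_tors R xs A) = add A" "smult (iter_tors R xs A) = smult A"
  by (induction xs) auto

lemma iter_tors_record: "iter_tors R xs A = A\<lparr>carrier := carrier (iter_tors R xs A)\<rparr>"
proof -
  have "\<exists>C. iter_tors R xs A = A\<lparr>carrier := C\<rparr>"
  proof (induction xs)
    case Nil
    have "A = A\<lparr>carrier := carrier A\<rparr>" by simp
    then show ?case unfolding iter_tors_simps by blast
  next
    case (Cons x xs)
    then show ?case by (auto simp: tors_def)
  qed
  then show ?thesis by auto
qed

lemma iter_tors_carrier:
  "carrier (iter_tors R xs A) =
    {z \<in> carrier A. \<forall>x\<in>set xs. \<exists>n::nat. x [^]\<^bsub>R\<^esub> n \<odot>\<^bsub>A\<^esub> z = \<zero>\<^bsub>A\<^esub>}"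
  by (induction xs) (auto simp: tors_carrier powers_def)

lemma ideals_set_simps [simp]:
  "\<one>\<^bsub>ideals_set R\<^esub> = carrier R"
  "I \<otimes>\<^bsub>ideals_set R\<^esub> J = ideal_prod R I J"
  by (simp_all add: ideals_set_def)

context noetherian_cring
begin

lemma ideal_pow_ideal: "ideal I R \<Longrightarrow> ideal (I [^]\<^bsub>ideals_set R\<^esub> (t::nat)) R"
  by (induction t) (simp_all add: oneideal ideal_prod_is_ideal)

lemma ideal_pow_mem: "ideal I R \<Longrightarrow> a \<in> I \<Longrightarrow> a [^] (t::nat) \<in> I [^]\<^bsub>ideals_set R\<^esub> t"
proof (induction t)
  case (Suc t)
  then have "a [^] t \<otimes> a \<in> ideal_prod R (I [^]\<^bsub>ideals_set R\<^esub> t) I"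
    by (intro ideal_prod.prod) auto
  then show ?case by simp
qed simp

lemma colon_ideal:
  assumes A: "module R (A :: ('r, 'a) module)" and W: "submodule W R A" and z: "z \<in> carrier A"
    and C: "C \<subseteq> carrier R"
  shows "ideal {r \<in> carrier R. \<forall>a\<in>C. a \<odot>\<^bsub>A\<^esub> (r \<odot>\<^bsub>A\<^esub> z) \<in> W} R"
proof (rule idealI')
  note w = submodule_rules[OF W A]
  show "\<zero> \<in> {r \<in> carrier R. \<forall>a\<in>C. a \<odot>\<^bsub>A\<^esub> (r \<odot>\<^bsub>A\<^esub> z) \<in> W}"
    using C z A w(2) by (auto simp: subset_iff)
  fix r assume r: "r \<in> {r \<in> carrier R. \<forall>a\<in>C. a \<odot>\<^bsub>A\<^esub> (r \<odot>\<^bsub>A\<^esub> z) \<in> W}"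
  show "r \<oplus> s \<in> {r \<in> carrier R. \<forall>a\<in>C. a \<odot>\<^bsub>A\<^esub> (r \<odot>\<^bsub>A\<^esub> z) \<in> W}"
    if "s \<in> {r \<in> carrier R. \<forall>a\<in>C. a \<odot>\<^bsub>A\<^esub> (r \<odot>\<^bsub>A\<^esub> z) \<in> W}" for s
    using r that C z A w(3) by (auto simp: mod_distr subset_iff)
  show "s \<otimes> r \<in> {r \<in> carrier R. \<forall>a\<in>C. a \<odot>\<^bsub>A\<^esub> (r \<odot>\<^bsub>A\<^esub> z) \<in> W}" if s: "s \<in> carrier R" for s
  proof -
    have "a \<odot>\<^bsub>A\<^esub> ((s \<otimes> r) \<odot>\<^bsub>A\<^esub> z) = s \<odot>\<^bsub>A\<^esub> (a \<odot>\<^bsub>A\<^esub> (r \<odot>\<^bsub>A\<^esub> z))" if "a \<in> C" for a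
      using r s that C z A by (auto simp: mod_distr smult_swap[OF A, of a s])
    then show ?thesis using r s w(4) by auto
  qed
qed auto

text \<open>Induction on the sum of the exponents: multiplying by a generator lowers it by one.\<close>

lemma ideal_pow_kills:
  assumes A: "module R (A :: ('r, 'a) module)" and W: "submodule W R A" and X: "finite X" "X \<subseteq> carrier R"
    and z: "z \<in> carrier A" and k: "\<And>x. x \<in> X \<Longrightarrow> x [^] (k x :: nat) \<odot>\<^bsub>A\<^esub> z \<in> W"
  shows "\<forall>a \<in> (Idl X) [^]\<^bsub>ideals_set R\<^esub> Suc (sum k X). a \<odot>\<^bsub>A\<^esub> z \<in> W"
  using z k
proof (induction "sum k X" arbitrary: k z)
  note w = submodule_rules[OF W A]
  let ?I = "Idl X"
  have I: "ideal ?I R" by (rule genideal_ideal[OF X(2)])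
  have step: "\<forall>a \<in> ?I [^]\<^bsub>ideals_set R\<^esub> Suc N. a \<odot>\<^bsub>A\<^esub> z \<in> W"
    if z: "z \<in> carrier A" and x: "\<And>x a. x \<in> X \<Longrightarrow> a \<in> ?I [^]\<^bsub>ideals_set R\<^esub> N \<Longrightarrow> a \<odot>\<^bsub>A\<^esub> (x \<odot>\<^bsub>A\<^esub> z) \<in> W"
    for N :: nat and z
  proof
    have IN: "?I [^]\<^bsub>ideals_set R\<^esub> N \<subseteq> carrier R"
      using ideal_rules(1)[OF ideal_pow_ideal[OF I]] by blast
    have "?I \<subseteq> {r \<in> carrier R. \<forall>a\<in>?I [^]\<^bsub>ideals_set R\<^esub> N. a \<odot>\<^bsub>A\<^esub> (r \<odot>\<^bsub>A\<^esub> z) \<in> W}"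
      by (rule genideal_minimal[OF colon_ideal[OF A W z IN]]) (use x X(2) in auto)
    then have sub: "a \<odot>\<^bsub>A\<^esub> (r \<odot>\<^bsub>A\<^esub> z) \<in> W" if "r \<in> ?I" "a \<in> ?I [^]\<^bsub>ideals_set R\<^esub> N" for r a
      using that by blast
    fix a assume "a \<in> ?I [^]\<^bsub>ideals_set R\<^esub> Suc N"
    then have "a \<in> ideal_prod R (?I [^]\<^bsub>ideals_set R\<^esub> N) ?I" by simp
    then have "a \<in> carrier R \<and> a \<odot>\<^bsub>A\<^esub> z \<in> W"
    proof (induction rule: ideal_prod.induct)
      case (prod i j)
      then have "i \<in> carrier R" "j \<in> carrier R" using IN ideal_rules(1)[OF I] by blast+
      then show ?case using sub[OF prod(2,1)] z A by (simp add: mod_distr)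
    next
      case (sum s t)
      then show ?case using z A w(3) by (simp add: mod_distr)
    qed
    then show "a \<odot>\<^bsub>A\<^esub> z \<in> W" by blast
  qed
  {
    case (0 k z)
    show ?case
    \<comment> \<open>Without generators the ideal is zero, but its zeroth power is still the whole
      ring; this case needs the successor in the exponent.\<close>
    proof (cases "X = {}")
      case True
      then show ?thesis using step[OF 0(2), of 0] 0(1) by simp
    next
      case False
      then obtain x where "x \<in> X" by blast
      then have "z \<in> W" using 0(3)[of x] 0(1,2) X A by simp
      then show ?thesis
        using w(4) ideal_rules(1)[OF ideal_pow_ideal[OF I]] by blast
    qed
  next
    case (Suc N k z)
    show ?case
    proof (cases "\<exists>x\<in>X. k x = 0")
      case True
      then obtain x where "x \<in> X" "k x = 0" by blast
      then have "z \<in> W" using Suc.prems(2)[of x] Suc.prems(1) A by simp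
      then show ?thesis
        using w(4) ideal_rules(1)[OF ideal_pow_ideal[OF I]] by blast
    next
      case False
      show ?thesis
        unfolding Suc.hyps(2)[symmetric]
      proof (rule step[OF Suc.prems(1)])
        fix x a assume x: "x \<in> X" and a: "a \<in> ?I [^]\<^bsub>ideals_set R\<^esub> Suc N"
        have xR: "x \<in> carrier R" using x X by blast
        define k' where "k' = k(x := k x - 1)"
        have kx: "k x = Suc (k' x)" using False x by (simp add: k'_def)
        have "sum k X = k x + sum k (X - {x})" "sum k' X = k' x + sum k' (X - {x})"
          using sum.remove[OF X(1) x] by auto
        moreover have "sum k' (X - {x}) = sum k (X - {x})" by (rule sum.cong) (auto simp: k'_def)
        ultimately have N: "N = sum k' X" using kx Suc.hyps(2) by simp
        have "y [^] k' y \<odot>\<^bsub>A\<^esub> (x \<odot>\<^bsub>A\<^esub> z) \<in> W" if y: "y \<in> X" for y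
        proof (cases "y = x")
          case True
          then show ?thesis using Suc.prems(2)[OF x] kx xR Suc.prems(1) A by (simp add: mod_distr)
        next
          case False
          have yR: "y \<in> carrier R" using y X by blast
          have "y [^] k' y \<odot>\<^bsub>A\<^esub> (x \<odot>\<^bsub>A\<^esub> z) = x \<odot>\<^bsub>A\<^esub> (y [^] k y \<odot>\<^bsub>A\<^esub> z)"
            using False xR yR Suc.prems(1) smult_swap[OF A, of "y [^] k y" x z] by (simp add: k'_def)
          then show ?thesis using w(4)[OF xR Suc.prems(2)[OF y]] by simp
        qed
        then show "a \<odot>\<^bsub>A\<^esub> (x \<odot>\<^bsub>A\<^esub> z) \<in> W"
          using Suc.hyps(1)[OF N, of "x \<odot>\<^bsub>A\<^esub> z"] a N xR Suc.prems(1) A by simp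
      qed
    qed
  }
qed

text \<open>If each generator has a power that kills \<open>z\<close>, then so has the ideal, by
  \<open>ideal_pow_kills\<close>. This reduces torsion with respect to an ideal to the one-element
  steps of the previous section.\<close>

lemma torsion_part_iter:
  assumes A: "module R A" and xs: "set xs \<subseteq> carrier R"
  shows "torsion_part R (Idl (set xs)) A = iter_tors R xs A"
proof -
  have I: "ideal (Idl (set xs)) R" by (rule genideal_ideal[OF xs])
  have "{z \<in> carrier A. \<exists>t::nat. \<forall>a \<in> (Idl (set xs)) [^]\<^bsub>ideals_set R\<^esub> t. a \<odot>\<^bsub>A\<^esub> z = \<zero>\<^bsub>A\<^esub>} =
     carrier (iter_tors R xs A)" (is "?l = ?r")
  proof
    show "?l \<subseteq> ?r"
      unfolding iter_tors_carrier using ideal_pow_mem[OF I] genideal_self[OF xs] by blast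
    show "?r \<subseteq> ?l"
    proof
      fix z assume z: "z \<in> ?r"
      then obtain k where k: "\<And>x. x \<in> set xs \<Longrightarrow> x [^] (k x :: nat) \<odot>\<^bsub>A\<^esub> z = \<zero>\<^bsub>A\<^esub>" and zA: "z \<in> carrier A"
        unfolding iter_tors_carrier by (auto simp: Bex_def) metis
      have W: "submodule {\<zero>\<^bsub>A\<^esub>} R A" by (rule submoduleI'[OF A]) (use A in auto)
      have "\<forall>a \<in> (Idl (set xs)) [^]\<^bsub>ideals_set R\<^esub> Suc (sum k (set xs)). a \<odot>\<^bsub>A\<^esub> z \<in> {\<zero>\<^bsub>A\<^esub>}"
        by (rule ideal_pow_kills[OF A W _ xs zA]) (use k in auto)
      then show "z \<in> ?l" using zA by blast
    qed
  qed
  then show ?thesis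
    using iter_tors_record[of R xs A] by (simp add: torsion_part_def)
qed

lemma iter_tors_module:
  "module R A \<Longrightarrow> set xs \<subseteq> carrier R \<Longrightarrow> module R (iter_tors R xs A)"
  by (induction xs) (auto intro: tors_module powers_submonoid)

lemma iter_tors_baer: "baer R A \<Longrightarrow> set xs \<subseteq> carrier R \<Longrightarrow> baer R (iter_tors R xs A)"
  by (induction xs) (auto intro: baer_tors powers_submonoid)

lemma iter_tors_linear:
  assumes "linear_map R A B f" "module R A" "module R B" "set xs \<subseteq> carrier R"
  shows "linear_map R (iter_tors R xs A) (iter_tors R xs B) f"
  using assms(4)
  by (induction xs) (use assms in \<open>auto intro: tors_linear iter_tors_module powers_submonoid\<close>)

lemma iter_tors_complex:
  assumes "complex R E d" "set xs \<subseteq> carrier R"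
  shows "complex R (\<lambda>i. iter_tors R xs (E i)) d"
  unfolding complex_def
proof (intro conjI allI ballI)
  show "module R (iter_tors R xs (E i))" for i by (rule iter_tors_module[OF complexD(1)[OF assms(1)] assms(2)])
  show "linear_map R (iter_tors R xs (E i)) (iter_tors R xs (E (Suc i))) (d i)" for i
    using iter_tors_linear[OF complexD(2)[OF assms(1)]] complexD(1)[OF assms(1)] assms(2) by blast
  show "d (Suc i) (d i x) = \<zero>\<^bsub>iter_tors R xs (E (Suc (Suc i)))\<^esub>"
    if "x \<in> carrier (iter_tors R xs (E i))" for i x
    using that complexD(3)[OF assms(1)] by (simp add: iter_tors_carrier)
qed

lemma iter_tors_chain_map:
  assumes "chain_map R Q dQ E d \<phi>" "complex R Q dQ" "set xs \<subseteq> carrier R"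
  shows "chain_map R (\<lambda>i. iter_tors R xs (Q i)) dQ E d \<phi>"
  unfolding chain_map_def
proof (intro conjI allI ballI)
  fix i
  show "linear_map R (iter_tors R xs (Q i)) (E i) (\<phi> i)"
    by (subst iter_tors_record, rule linear_domain[OF chain_mapD(1)[OF assms(1)]]) (auto simp: iter_tors_carrier)
  show "\<phi> (Suc i) (dQ i x) = d i (\<phi> i x)" if "x \<in> carrier (iter_tors R xs (Q i))" for x
    using that chain_mapD(2)[OF assms(1)] by (simp add: iter_tors_carrier)
qed

text \<open>The torsion for \<open>x # xs\<close> is the \<open>x\<close>-torsion of that for
  \<open>xs\<close>, which is again a complex of injectives and serves as the source in the
  one-element lemma.\<close>

lemma null_homotopic_from_iter_tors:
  assumes tel: "\<And>x. x \<in> set xs \<Longrightarrow> telescoping R E d x" and xs: "set xs \<subseteq> carrier R"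
    and E: "complex R E d" and inj: "\<And>i. baer R (E i)"
    and \<phi>: "chain_map R E d E d \<phi>"
    and null: "null_homotopic R (\<lambda>i. iter_tors R xs (E i)) d E d \<phi>"
  shows "null_homotopic R E d E d \<phi>"
  using tel xs null
proof (induction xs)
  case (Cons x xs)
  then interpret telescoping R E d x by simp
  have "null_homotopic R (\<lambda>i. iter_tors R xs (E i)) d E d \<phi>"
  proof (rule null_homotopic_from_torsion)
    show "complex R (\<lambda>i. iter_tors R xs (E i)) d" using iter_tors_complex[OF E] Cons by simp
    show "chain_map R (\<lambda>i. iter_tors R xs (E i)) d E d \<phi>"
      using iter_tors_chain_map[OF \<phi> E] Cons by simp
  qed (use Cons iter_tors_baer inj in auto)
  then show ?case using Cons by auto
qed simp

lemma chain_map_extends_from_iter_tors: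
  assumes tel: "\<And>x. x \<in> set xs \<Longrightarrow> telescoping R E d x" and xs: "set xs \<subseteq> carrier R"
    and E: "complex R E d" and inj: "\<And>i. baer R (E i)"
    and \<psi>: "chain_map R (\<lambda>i. iter_tors R xs (E i)) d E d \<psi>"
  shows "\<exists>\<phi>. chain_map R E d E d \<phi> \<and> (\<forall>i. \<forall>q\<in>carrier (iter_tors R xs (E i)). \<phi> i q = \<psi> i q)"
  using tel xs \<psi>
proof (induction xs arbitrary: \<psi>)
  case (Cons x xs)
  then interpret telescoping R E d x by simp
  have c: "complex R (\<lambda>i. iter_tors R xs (E i)) d" using iter_tors_complex[OF E] Cons by simp
  have b: "baer R (iter_tors R xs (E i))" for i using iter_tors_baer[OF inj] Cons by simp
  have p: "chain_map R (\<lambda>i. tors R (powers R x) (iter_tors R xs (E i))) d E d \<psi>" using Cons by simp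
  obtain \<theta> where \<theta>: "chain_map R (\<lambda>i. iter_tors R xs (E i)) d E d \<theta>"
    "\<And>i q. q \<in> carrier (tors R (powers R x) (iter_tors R xs (E i))) \<Longrightarrow> \<theta> i q = \<psi> i q"
    by (rule chain_map_extends_from_torsion[OF c b p]) (rule that)
  obtain \<phi> where \<phi>: "chain_map R E d E d \<phi>" "\<And>i q. q \<in> carrier (iter_tors R xs (E i)) \<Longrightarrow> \<phi> i q = \<theta> i q"
    using Cons.IH[OF _ _ \<theta>(1)] Cons.prems by auto
  have "\<phi> i q = \<psi> i q" if "q \<in> carrier (iter_tors R (x # xs) (E i))" for i q
    using \<theta>(2) \<phi>(2) that by (simp add: tors_carrier)
  then show ?case using \<phi>(1) by blast
qed auto

end

section \<open>Spans and the ascending chain condition\<close>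

context fixed_cring
begin

lemma mod_span_superset: "X \<subseteq> mod_span R A X"
  by (auto simp: mod_span_def)

lemma mod_span_minimal: "submodule N R A \<Longrightarrow> X \<subseteq> N \<Longrightarrow> mod_span R A X \<subseteq> N"
  by (auto simp: mod_span_def)

lemma mod_span_submodule:
  assumes A: "module R (A :: ('r, 'a) module)" and X: "X \<subseteq> carrier A"
  shows "submodule (mod_span R A X) R A"
proof (rule submoduleI'[OF A])
  show "mod_span R A X \<subseteq> carrier A"
    by (rule mod_span_minimal[OF module.carrier_is_submodule[OF A] X])
qed (auto simp: mod_span_def submodule_rules(2-4)[OF _ A])

lemma mod_span_insert:
  assumes A: "module R (A :: ('r, 'a) module)" and g: "g \<in> carrier A" and X: "X \<subseteq> carrier A"
  shows "mod_span R A (insert g X) = {r \<odot>\<^bsub>A\<^esub> g \<oplus>\<^bsub>A\<^esub> n | r n. r \<in> carrier R \<and> n \<in> mod_span R A X}"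
    (is "_ = ?N")
proof
  note s = submodule_rules[OF mod_span_submodule[OF A X] A]
  have N: "submodule ?N R A"
  proof (rule submoduleI'[OF A])
    show "?N \<subseteq> carrier A" using g s(1) A by auto
    have "\<zero> \<odot>\<^bsub>A\<^esub> g \<oplus>\<^bsub>A\<^esub> \<zero>\<^bsub>A\<^esub> \<in> ?N" using s(2) by blast
    then show "\<zero>\<^bsub>A\<^esub> \<in> ?N" using g A by simp
    fix v assume "v \<in> ?N"
    then obtain r n where v: "r \<in> carrier R" "n \<in> mod_span R A X" "v = r \<odot>\<^bsub>A\<^esub> g \<oplus>\<^bsub>A\<^esub> n" by blast
    {
      fix t assume t: "t \<in> carrier R"
      have "t \<odot>\<^bsub>A\<^esub> v = (t \<otimes> r) \<odot>\<^bsub>A\<^esub> g \<oplus>\<^bsub>A\<^esub> t \<odot>\<^bsub>A\<^esub> n"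
        using v t g s(1)[OF v(2)] A by (simp add: mod_distr)
      then show "t \<odot>\<^bsub>A\<^esub> v \<in> ?N" using v t s(4)[OF t v(2)] by blast
    next
      fix v' assume "v' \<in> ?N"
      then obtain r' n' where v': "r' \<in> carrier R" "n' \<in> mod_span R A X" "v' = r' \<odot>\<^bsub>A\<^esub> g \<oplus>\<^bsub>A\<^esub> n'" by blast
      have "v \<oplus>\<^bsub>A\<^esub> v' = (r \<oplus> r') \<odot>\<^bsub>A\<^esub> g \<oplus>\<^bsub>A\<^esub> (n \<oplus>\<^bsub>A\<^esub> n')"
        using v v' g s(1)[OF v(2)] s(1)[OF v'(2)] A by (simp add: mod_distr mod_ac)
      then show "v \<oplus>\<^bsub>A\<^esub> v' \<in> ?N" using v v' s(3)[OF v(2) v'(2)] by blast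
    }
  qed
  have "\<one> \<odot>\<^bsub>A\<^esub> g \<oplus>\<^bsub>A\<^esub> \<zero>\<^bsub>A\<^esub> \<in> ?N" using s(2) by blast
  moreover have "x \<in> ?N" if x: "x \<in> X" for x
  proof -
    have "\<zero> \<odot>\<^bsub>A\<^esub> g \<oplus>\<^bsub>A\<^esub> x \<in> ?N" using x mod_span_superset[of X A] by blast
    then show ?thesis using g x X A by (simp add: subset_iff)
  qed
  ultimately show "mod_span R A (insert g X) \<subseteq> ?N"
    using g A by (intro mod_span_minimal[OF N]) auto
  show "?N \<subseteq> mod_span R A (insert g X)"
  proof
    have gX: "insert g X \<subseteq> carrier A" using g X by blast
    note s' = submodule_rules[OF mod_span_submodule[OF A gX] A]
    have sup: "insert g X \<subseteq> mod_span R A (insert g X)" by (rule mod_span_superset)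
    have sub: "mod_span R A X \<subseteq> mod_span R A (insert g X)"
      by (rule mod_span_minimal[OF mod_span_submodule[OF A gX]]) (use sup in simp)
    have "g \<in> mod_span R A (insert g X)" using sup by simp
    then show "v \<in> mod_span R A (insert g X)" if "v \<in> ?N" for v
      using that sub s'(3,4) by auto
  qed
qed

end

context noetherian_cring
begin

text \<open>Induction on the generators: the chain is stationary once both its intersections with
  the smaller span and the ideals of coefficients at the new generator are.\<close>

lemma span_chain_stable:
  assumes A: "module R (A :: ('r, 'a) module)" and X: "finite X" "X \<subseteq> carrier A"
    and N: "\<And>k. submodule (N k) R A" "\<And>k. N k \<subseteq> mod_span R A X" "\<And>k. N k \<subseteq> N (Suc k)"
  shows "\<exists>n. \<forall>k\<ge>n. N k = N n"
  using X N
proof (induction X arbitrary: N rule: finite_induct)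
  case empty
  have "submodule {\<zero>\<^bsub>A\<^esub>} R A" by (rule submoduleI'[OF A]) (use A in auto)
  then have "mod_span R A {} \<subseteq> {\<zero>\<^bsub>A\<^esub>}" by (rule mod_span_minimal) simp
  then have "N k = {\<zero>\<^bsub>A\<^esub>}" for k
    using empty submodule_rules(2)[OF empty(2) A] by blast
  then show ?case by auto
next
  case (insert g X)
  have g: "g \<in> carrier A" and X: "X \<subseteq> carrier A" using insert.prems(1) by auto
  let ?S = "mod_span R A X"
  note s = submodule_rules[OF mod_span_submodule[OF A X] A]
  note n = submodule_rules[OF insert.prems(2) A]
  have mono: "N k \<subseteq> N l" if "k \<le> l" for k l
    using lift_Suc_mono_le[of N, OF insert.prems(4) that] .
  have "\<exists>n. \<forall>k\<ge>n. N k \<inter> ?S = N n \<inter> ?S"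
  proof (rule insert.IH[OF X])
    show "submodule (N k \<inter> ?S) R A" for k
      by (rule submoduleI'[OF A]) (use n s in auto)
  qed (use insert.prems(4) in auto)
  then obtain n1 where n1: "\<And>k. n1 \<le> k \<Longrightarrow> N k \<inter> ?S = N n1 \<inter> ?S" by blast
  \<comment> \<open>The possible coefficients at the new generator \<open>g\<close> of elements of
    \<open>N k\<close>.\<close>
  define \<cc> where "\<cc> k = {r \<in> carrier R. \<exists>v\<in>?S. r \<odot>\<^bsub>A\<^esub> g \<oplus>\<^bsub>A\<^esub> v \<in> N k}" for k
  have id: "ideal (\<cc> k) R" for k
  proof (rule idealI')
    show "\<zero> \<in> \<cc> k"
      using s(2) n(2) g A by (auto simp: \<cc>_def intro!: bexI[of _ "\<zero>\<^bsub>A\<^esub>"])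
    fix r assume "r \<in> \<cc> k"
    then obtain v where v: "r \<in> carrier R" "v \<in> ?S" "r \<odot>\<^bsub>A\<^esub> g \<oplus>\<^bsub>A\<^esub> v \<in> N k" by (auto simp: \<cc>_def)
    {
      fix r' assume "r' \<in> \<cc> k"
      then obtain v' where v': "r' \<in> carrier R" "v' \<in> ?S" "r' \<odot>\<^bsub>A\<^esub> g \<oplus>\<^bsub>A\<^esub> v' \<in> N k" by (auto simp: \<cc>_def)
      have "(r \<oplus> r') \<odot>\<^bsub>A\<^esub> g \<oplus>\<^bsub>A\<^esub> (v \<oplus>\<^bsub>A\<^esub> v') = (r \<odot>\<^bsub>A\<^esub> g \<oplus>\<^bsub>A\<^esub> v) \<oplus>\<^bsub>A\<^esub> (r' \<odot>\<^bsub>A\<^esub> g \<oplus>\<^bsub>A\<^esub> v')"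
        using v(1) v'(1) g s(1)[OF v(2)] s(1)[OF v'(2)] A by (simp add: mod_distr mod_ac)
      then have "(r \<oplus> r') \<odot>\<^bsub>A\<^esub> g \<oplus>\<^bsub>A\<^esub> (v \<oplus>\<^bsub>A\<^esub> v') \<in> N k" using n(3)[OF v(3) v'(3)] by simp
      then show "r \<oplus> r' \<in> \<cc> k" using v(1) v'(1) s(3)[OF v(2) v'(2)] unfolding \<cc>_def by blast
    next
      fix t assume t: "t \<in> carrier R"
      have "(t \<otimes> r) \<odot>\<^bsub>A\<^esub> g \<oplus>\<^bsub>A\<^esub> t \<odot>\<^bsub>A\<^esub> v = t \<odot>\<^bsub>A\<^esub> (r \<odot>\<^bsub>A\<^esub> g \<oplus>\<^bsub>A\<^esub> v)"
        using v(1) t g s(1)[OF v(2)] A by (simp add: mod_distr)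
      then have "(t \<otimes> r) \<odot>\<^bsub>A\<^esub> g \<oplus>\<^bsub>A\<^esub> t \<odot>\<^bsub>A\<^esub> v \<in> N k" using n(4)[OF t v(3)] by simp
      then show "t \<otimes> r \<in> \<cc> k" using v(1) t s(4)[OF t v(2)] unfolding \<cc>_def by blast
    }
  qed (auto simp: \<cc>_def)
  have "\<cc> k \<subseteq> \<cc> (Suc k)" for k using insert.prems(4) by (auto simp: \<cc>_def)
  then obtain n2 where n2: "\<And>k. n2 \<le> k \<Longrightarrow> \<cc> k = \<cc> n2"
    using ideal_chain_stable[of \<cc>, OF id] by blast
  define m where "m = max n1 n2"
  have "N k \<subseteq> N m" if k: "m \<le> k" for k
  proof
    fix v assume v: "v \<in> N k"
    then obtain r w where w: "r \<in> carrier R" "w \<in> ?S" "v = r \<odot>\<^bsub>A\<^esub> g \<oplus>\<^bsub>A\<^esub> w"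
      using insert.prems(3)[of k] mod_span_insert[OF A g X] by blast
    then have "r \<in> \<cc> k" using v by (auto simp: \<cc>_def)
    then have "r \<in> \<cc> m" using n2[of k] n2[of m] k by (simp add: m_def)
    then obtain w' where w': "w' \<in> ?S" "r \<odot>\<^bsub>A\<^esub> g \<oplus>\<^bsub>A\<^esub> w' \<in> N m" by (auto simp: \<cc>_def)
    have c: "r \<odot>\<^bsub>A\<^esub> g \<in> carrier A" "w \<in> carrier A" "w' \<in> carrier A"
      using w(1) g s(1) w(2) w'(1) A by auto
    \<comment> \<open>Two elements with the same coefficient at \<open>g\<close> differ by an
      element of the smaller span, where the chain is already stationary.\<close>
    have "msub R A v (r \<odot>\<^bsub>A\<^esub> g \<oplus>\<^bsub>A\<^esub> w') \<in> N k"
      using n(5)[OF v] mono[OF k] w'(2) by blast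
    moreover have "msub R A v (r \<odot>\<^bsub>A\<^esub> g \<oplus>\<^bsub>A\<^esub> w') = msub R A w w'"
      using msub_alg(9)[OF A c(1) c(1) c(2) c(3)] c A w(3) by simp
    ultimately have "msub R A w w' \<in> N k \<inter> ?S" using s(5)[OF w(2) w'(1)] by simp
    then have d: "msub R A w w' \<in> N m" using n1[of k] n1[of m] k by (auto simp: m_def)
    have "v = msub R A w w' \<oplus>\<^bsub>A\<^esub> (r \<odot>\<^bsub>A\<^esub> g \<oplus>\<^bsub>A\<^esub> w')"
      using c A w(3) msub_alg(2)[OF A c(2,3)] mod_ac(3)[OF A, of "msub R A w w'" "r \<odot>\<^bsub>A\<^esub> g" w'] by simp
    then show "v \<in> N m" using n(3)[OF d w'(2)] by simp
  qed
  then show ?case using mono by (intro exI[of _ m]) blast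
qed

end


section \<open>Complete local rings\<close>

locale complete_local_ring = noetherian_cring R for R :: "'r ring" (structure) +
  fixes \<mm> :: "'r set"
  assumes local_ring: "local_ring R \<mm>" and complete: "adic_complete R \<mm>"
begin

lemma max_ideal: "ideal \<mm> R" and max: "maximalideal \<mm> R"
  using local_ring by (auto simp: local_ring_def intro: maximalideal.axioms)

abbreviation mpow ("\<mm>^_" [1000] 1000) where "\<mm>^t \<equiv> \<mm> [^]\<^bsub>ideals_set R\<^esub> (t::nat)"

lemma mpow_ideal: "ideal (\<mm>^t) R"
  by (rule ideal_pow_ideal[OF max_ideal])

lemma mpow_Suc: "x \<in> \<mm> \<Longrightarrow> y \<in> \<mm>^t \<Longrightarrow> x \<otimes> y \<in> \<mm>^(Suc t)"
proof -
  assume xy: "x \<in> \<mm>" "y \<in> \<mm>^t"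
  then have "x \<otimes> y = y \<otimes> x"
    using ideal_rules(1)[OF max_ideal] ideal_rules(1)[OF mpow_ideal] m_comm by blast
  then show ?thesis using xy by (simp add: ideal_prod.prod)
qed

text \<open>The solution is the convergent series with terms \<open>x^i a (k + i)\<close>. Constant
  data give a constant solution, which is recorded because the geometric series is needed
  below.\<close>

lemma ring_series:
  assumes x: "x \<in> \<mm>" and a: "\<And>k. a k \<in> carrier R"
  obtains s where "\<And>k. s k \<in> carrier R" "\<And>k. s k = a k \<oplus> x \<otimes> s (Suc k)"
    "\<And>k. (\<And>l. a l = a 0) \<Longrightarrow> s k = s 0"
proof -
  have xR: "x \<in> carrier R" using ideal_rules(1)[OF max_ideal x] .
  \<comment> \<open>\<open>S m k\<close> is the partial sum with \<open>m\<close> terms of the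
    series starting at index \<open>k\<close>.\<close>
  define S where "S = rec_nat (\<lambda>k. \<zero>) (\<lambda>_ g k. a k \<oplus> x \<otimes> g (Suc k))"
  have S0: "S 0 k = \<zero>" and S1: "S (Suc m) k = a k \<oplus> x \<otimes> S m (Suc k)" for m k
    by (simp_all add: S_def)
  have SR: "S m k \<in> carrier R" for m k
    by (induction m arbitrary: k) (use a xR in \<open>simp_all add: S0 S1\<close>)
  have diff: "S l k \<ominus> S n k \<in> \<mm>^n" if "n \<le> l" for l n k
    using that
  proof (induction n arbitrary: l k)
    case 0
    then show ?case using SR by simp
  next
    case (Suc n)
    then obtain l' where l': "l = Suc l'" "n \<le> l'" by (cases l) auto
    have "(a k \<oplus> x \<otimes> S l' (Suc k)) \<ominus> (a k \<oplus> x \<otimes> S n (Suc k)) = x \<otimes> (S l' (Suc k) \<ominus> S n (Suc k))"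
      using a[of k] xR SR[of l' "Suc k"] SR[of n "Suc k"] by algebra
    then show ?case using mpow_Suc[OF x Suc.IH[OF l'(2)]] by (simp add: l' S1)
  qed
  have "adic_cauchy R \<mm> (\<lambda>n. S n k)" for k
    unfolding adic_cauchy_def
  proof (intro conjI allI)
    show "range (\<lambda>n. S n k) \<subseteq> carrier R" using SR by auto
    fix t
    show "\<exists>N. \<forall>i\<ge>N. \<forall>l\<ge>N. S i k \<ominus> S l k \<in> \<mm>^t"
    proof (intro exI[of _ t] allI impI)
      fix i l assume "t \<le> i" "t \<le> l"
      then have "(S i k \<ominus> S t k) \<ominus> (S l k \<ominus> S t k) \<in> \<mm>^t"
        by (intro ideal_diff[OF mpow_ideal] diff)
      moreover have "(S i k \<ominus> S t k) \<ominus> (S l k \<ominus> S t k) = S i k \<ominus> S l k"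
        using SR[of i k] SR[of t k] SR[of l k] by algebra
      ultimately show "S i k \<ominus> S l k \<in> \<mm>^t" by simp
    qed
  qed
  then have lim: "\<exists>!y. adic_limit R \<mm> (\<lambda>n. S n k) y" for k
    using complete unfolding adic_complete_def by blast
  define s where "s k = (THE y. adic_limit R \<mm> (\<lambda>n. S n k) y)" for k
  have s: "adic_limit R \<mm> (\<lambda>n. S n k) (s k)" for k
    unfolding s_def by (rule theI'[OF lim])
  have sR: "s k \<in> carrier R" for k using s[of k] by (simp add: adic_limit_def)
  show ?thesis
  proof (rule that[of s, OF sR])
    fix k
    \<comment> \<open>Both sides of the recursion are limits of the same partial sums, up to a shift
      of the number of terms; uniqueness of limits identifies them.\<close>
    have "adic_limit R \<mm> (\<lambda>n. S n k) (a k \<oplus> x \<otimes> s (Suc k))"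
      unfolding adic_limit_def
    proof (intro conjI allI)
      show "a k \<oplus> x \<otimes> s (Suc k) \<in> carrier R" using a xR sR by simp
      fix t
      obtain N where N: "\<And>n. N \<le> n \<Longrightarrow> S n (Suc k) \<ominus> s (Suc k) \<in> \<mm>^t"
        using s[of "Suc k"] unfolding adic_limit_def by blast
      have "S n k \<ominus> (a k \<oplus> x \<otimes> s (Suc k)) \<in> \<mm>^t" if n: "Suc N \<le> n" for n
      proof -
        obtain n' where n': "n = Suc n'" "N \<le> n'" using n by (cases n) auto
        have "(a k \<oplus> x \<otimes> S n' (Suc k)) \<ominus> (a k \<oplus> x \<otimes> s (Suc k)) = x \<otimes> (S n' (Suc k) \<ominus> s (Suc k))"
          using a[of k] xR SR[of n' "Suc k"] sR[of "Suc k"] by algebra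
        then show ?thesis using ideal_rules(4)[OF mpow_ideal xR N[OF n'(2)]] by (simp add: n' S1)
      qed
      then show "\<exists>N. \<forall>n\<ge>N. S n k \<ominus> (a k \<oplus> x \<otimes> s (Suc k)) \<in> \<mm>^t" by blast
    qed
    then show "s k = a k \<oplus> x \<otimes> s (Suc k)" using lim s by blast
  next
    fix k assume const: "\<And>l. a l = a 0"
    have "S n k = S n l" for n k l
    proof (induction n arbitrary: k l)
      case (Suc n)
      then show ?case using const[of k] const[of l] by (metis S1)
    qed (simp add: S0)
    then have "(\<lambda>n. S n k) = (\<lambda>n. S n 0)" by (simp add: fun_eq_iff)
    then show "s k = s 0" by (simp add: s_def)
  qed
qed

text \<open>The geometric series: the equation for \<open>s\<close> says that it is inverse to
  \<open>1 - x\<close>.\<close>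

lemma one_minus_unit:
  assumes "x \<in> \<mm>"
  obtains s where "s \<in> carrier R" "s = \<one> \<oplus> x \<otimes> s"
proof -
  show ?thesis
  proof (rule ring_series[OF assms, of "\<lambda>_. \<one>"])
    fix s assume s: "\<And>k. s k \<in> carrier R" "\<And>k. s k = \<one> \<oplus> x \<otimes> s (Suc k)"
      "\<And>k. (\<And>l::nat. \<one> = \<one>) \<Longrightarrow> s k = s 0"
    have "s (Suc 0) = s 0" using s(3) by blast
    then show thesis using that[of "s 0"] s(1)[of 0] s(2)[of 0] by simp
  qed simp
qed

text \<open>If \<open>a\<close> in \<open>J\<close> were outside \<mm>, maximality would give
  \<open>1 = t + r a\<close> with \<open>t\<close> in \<mm>. By completeness
  \<open>1 - t = r a\<close> is a unit, so \<open>J\<close> would contain 1.\<close>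

lemma proper_ideal_le_max:
  assumes J: "ideal J R" "\<one> \<notin> J"
  shows "J \<subseteq> \<mm>"
proof (rule ccontr)
  note c = ideal_rules[OF max_ideal]
  assume "\<not> J \<subseteq> \<mm>"
  then obtain a where a: "a \<in> J" "a \<notin> \<mm>" by blast
  have aR: "a \<in> carrier R" using ideal_rules(1)[OF J(1) a(1)] .
  define K where "K = {t \<oplus> r \<otimes> a | t r. t \<in> \<mm> \<and> r \<in> carrier R}"
  have K: "ideal K R"
  proof (rule idealI')
    show "K \<subseteq> carrier R" using c(1) aR by (auto simp: K_def)
    have "\<zero> \<oplus> \<zero> \<otimes> a \<in> K" unfolding K_def using c(2) by blast
    then show "\<zero> \<in> K" using aR by simp
    fix y assume "y \<in> K"
    then obtain t r where y: "t \<in> \<mm>" "r \<in> carrier R" "y = t \<oplus> r \<otimes> a" by (auto simp: K_def)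
    {
      fix s assume s: "s \<in> carrier R"
      have "s \<otimes> y = s \<otimes> t \<oplus> (s \<otimes> r) \<otimes> a" unfolding y(3) using s c(1)[OF y(1)] y(2) aR by algebra
      then show "s \<otimes> y \<in> K" unfolding K_def using c(4)[OF s y(1)] s y(2) by blast
    next
      fix y' assume "y' \<in> K"
      then obtain t' r' where y': "t' \<in> \<mm>" "r' \<in> carrier R" "y' = t' \<oplus> r' \<otimes> a" by (auto simp: K_def)
      have "y \<oplus> y' = (t \<oplus> t') \<oplus> (r \<oplus> r') \<otimes> a"
        unfolding y(3) y'(3) using c(1)[OF y(1)] y(2) c(1)[OF y'(1)] y'(2) aR by algebra
      then show "y \<oplus> y' \<in> K" unfolding K_def using c(3)[OF y(1) y'(1)] y(2) y'(2) by blast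
    }
  qed
  have "\<mm> \<subseteq> K"
  proof
    fix t assume t: "t \<in> \<mm>"
    then have "t \<oplus> \<zero> \<otimes> a \<in> K" unfolding K_def by blast
    then show "t \<in> K" using aR c(1)[OF t] by simp
  qed
  moreover have "a \<in> K"
  proof -
    have "\<zero> \<oplus> \<one> \<otimes> a \<in> K" unfolding K_def using c(2) by blast
    then show ?thesis using aR by simp
  qed
  ultimately have "K = carrier R"
    using maximalideal.I_maximal[OF max K] a(2) ideal_rules(1)[OF K] by blast
  then have "\<one> \<in> K" by simp
  then obtain t r where tr: "t \<in> \<mm>" "r \<in> carrier R" "\<one> = t \<oplus> r \<otimes> a" by (auto simp: K_def)
  obtain s where s: "s \<in> carrier R" "s = \<one> \<oplus> t \<otimes> s" by (rule one_minus_unit[OF tr(1)])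
  have tR: "t \<in> carrier R" using c(1)[OF tr(1)] .
  have "\<one> = s \<ominus> t \<otimes> s"
  proof -
    have "\<one> = (\<one> \<oplus> t \<otimes> s) \<ominus> t \<otimes> s" using s(1) tR by algebra
    then show ?thesis using s(2) by simp
  qed
  also have "\<dots> = s \<otimes> (\<one> \<ominus> t)" using s(1) tR by algebra
  also have "\<one> \<ominus> t = r \<otimes> a"
  proof -
    have "(t \<oplus> r \<otimes> a) \<ominus> t = r \<otimes> a" using tR tr(2) aR by algebra
    then show ?thesis using tr(3) by simp
  qed
  finally have "\<one> = (s \<otimes> r) \<otimes> a" using s(1) tr(2) aR by (simp add: m_assoc)
  then show False using ideal_rules(4)[OF J(1), of "s \<otimes> r" a] s(1) tr(2) a(1) J(2) by simp
qed

text \<open>The cyclic submodules generated by the \<open>z k\<close> ascend, so at some point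
  \<open>z (n+1) = r z n = (r x) z (n+1)\<close>, and \<open>1 - r x\<close> is a unit. Multiplying
  back down by \<open>x\<close> reaches \<open>z 0\<close>.\<close>

lemma module_divisible_zero:
  assumes M: "module R (M :: ('r, 'a) module)" "fin_gen_module R M" and x: "x \<in> \<mm>"
    and z: "\<And>k. z k \<in> carrier M" "\<And>k. x \<odot>\<^bsub>M\<^esub> z (Suc k) = z k"
  shows "z 0 = \<zero>\<^bsub>M\<^esub>"
proof -
  have xR: "x \<in> carrier R" using ideal_rules(1)[OF max_ideal x] .
  obtain X where X: "X \<subseteq> carrier M" "finite X" "carrier M = mod_span R M X"
    using M(2) by (auto simp: fin_gen_module_def)
  define N where "N k = {r \<odot>\<^bsub>M\<^esub> z k | r. r \<in> carrier R}" for k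
  have "\<exists>n. \<forall>k\<ge>n. N k = N n"
  proof (rule span_chain_stable[OF M(1) X(2,1)])
    fix k
    show "submodule (N k) R M"
    proof (rule submoduleI'[OF M(1)])
      show "N k \<subseteq> carrier M" using z(1) M(1) by (auto simp: N_def)
      have "\<zero> \<odot>\<^bsub>M\<^esub> z k \<in> N k" unfolding N_def by blast
      then show "\<zero>\<^bsub>M\<^esub> \<in> N k" using z(1) M(1) by simp
      fix v assume "v \<in> N k"
      then obtain r where r: "r \<in> carrier R" "v = r \<odot>\<^bsub>M\<^esub> z k" by (auto simp: N_def)
      {
        fix w assume "w \<in> N k"
        then obtain s where s: "s \<in> carrier R" "w = s \<odot>\<^bsub>M\<^esub> z k" by (auto simp: N_def)
        have "v \<oplus>\<^bsub>M\<^esub> w = (r \<oplus> s) \<odot>\<^bsub>M\<^esub> z k" using r s z(1) M(1) by (simp add: mod_distr)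
        then show "v \<oplus>\<^bsub>M\<^esub> w \<in> N k" unfolding N_def using r s by blast
      next
        fix t assume t: "t \<in> carrier R"
        have "t \<odot>\<^bsub>M\<^esub> v = (t \<otimes> r) \<odot>\<^bsub>M\<^esub> z k" using r t z(1) M(1) by (simp add: mod_distr)
        then show "t \<odot>\<^bsub>M\<^esub> v \<in> N k" unfolding N_def using r t by blast
      }
    qed
    then show "N k \<subseteq> mod_span R M X" using X(3) submodule_rules(1)[OF _ M(1)] by blast
    show "N k \<subseteq> N (Suc k)"
    proof
      fix v assume "v \<in> N k"
      then obtain r where r: "r \<in> carrier R" "v = r \<odot>\<^bsub>M\<^esub> z k" by (auto simp: N_def)
      have "v = (r \<otimes> x) \<odot>\<^bsub>M\<^esub> z (Suc k)"
        using r xR z(1)[of "Suc k"] z(2)[of k] M(1) by (simp add: mod_distr)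
      then show "v \<in> N (Suc k)" unfolding N_def using r xR by blast
    qed
  qed
  then obtain n where n: "N (Suc n) = N n" by (metis le_SucI order_refl)
  have "\<one> \<odot>\<^bsub>M\<^esub> z (Suc n) \<in> N (Suc n)" unfolding N_def by blast
  then obtain r where r: "r \<in> carrier R" "z (Suc n) = r \<odot>\<^bsub>M\<^esub> z n"
    using n z(1) M(1) by (auto simp: N_def)
  let ?y = "z (Suc n)" and ?t = "r \<otimes> x"
  have yy: "?y = ?t \<odot>\<^bsub>M\<^esub> ?y"
    using r(2) z(2)[of n] z(1) xR r(1) M(1) by (metis mod_distr(3))
  have tm: "?t \<in> \<mm>" using ideal_rules(4)[OF max_ideal r(1) x] .
  obtain s where s: "s \<in> carrier R" "s = \<one> \<oplus> ?t \<otimes> s" by (rule one_minus_unit[OF tm])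
  have "s \<odot>\<^bsub>M\<^esub> ?y = (\<one> \<oplus> ?t \<otimes> s) \<odot>\<^bsub>M\<^esub> ?y" using s(2) by simp
  also have "\<dots> = ?y \<oplus>\<^bsub>M\<^esub> s \<odot>\<^bsub>M\<^esub> (?t \<odot>\<^bsub>M\<^esub> ?y)"
    using s(1) r(1) xR z(1) M(1) smult_swap[OF M(1), of s ?t ?y] by (simp add: mod_distr(2) mod_distr(3)[of M ?t s])
  also have "\<dots> = ?y \<oplus>\<^bsub>M\<^esub> s \<odot>\<^bsub>M\<^esub> ?y" using yy by simp
  finally have "msub R M (s \<odot>\<^bsub>M\<^esub> ?y) (s \<odot>\<^bsub>M\<^esub> ?y) = ?y"
    using msub_alg(6)[OF M(1), of "s \<odot>\<^bsub>M\<^esub> ?y" "s \<odot>\<^bsub>M\<^esub> ?y" ?y] s(1) z(1) M(1) by simp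
  then have y0: "?y = \<zero>\<^bsub>M\<^esub>" using s(1) z(1) M(1) by simp
  have "z k = \<zero>\<^bsub>M\<^esub>" if "k \<le> Suc n" for k
    using that
  proof (induction k rule: inc_induct)
    case base
    then show ?case using y0 .
  next
    case (step k)
    then show ?case using z(2)[of k] xR M(1) by simp
  qed
  then show ?thesis by simp
qed

text \<open>Coefficients of the \<open>v k\<close> at the generators may be chosen arbitrarily,
  since only existence is wanted: each coordinate is solved by a series in the ring, so no topology
  on \<open>M\<close> is involved.\<close>

lemma module_series:
  assumes M: "module R (M :: ('r, 'a) module)" "fin_gen_module R M" and x: "x \<in> \<mm>"
    and v: "\<And>k. v k \<in> carrier M"
  shows "\<exists>u. \<forall>k. u k \<in> carrier M \<and> u k = v k \<oplus>\<^bsub>M\<^esub> x \<odot>\<^bsub>M\<^esub> u (Suc k)"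
proof -
  have xR: "x \<in> carrier R" using ideal_rules(1)[OF max_ideal x] .
  obtain X where X: "X \<subseteq> carrier M" "finite X" "carrier M = mod_span R M X"
    using M(2) by (auto simp: fin_gen_module_def)
  have "\<exists>u. \<forall>k. u k \<in> mod_span R M X \<and> u k = v k \<oplus>\<^bsub>M\<^esub> x \<odot>\<^bsub>M\<^esub> u (Suc k)"
    if "\<And>k. v k \<in> mod_span R M X" for v
    using X(2,1) that
  proof (induction X arbitrary: v rule: finite_induct)
    case empty
    have z: "submodule {\<zero>\<^bsub>M\<^esub>} R M" by (rule submoduleI'[OF M(1)]) (use M(1) in auto)
    then have sp: "mod_span R M {} = {\<zero>\<^bsub>M\<^esub>}"
      using mod_span_minimal[OF z] submodule_rules(2)[OF mod_span_submodule[OF M(1)] M(1)] by blast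
    then have "v k = \<zero>\<^bsub>M\<^esub>" for k using empty.prems(2) by simp
    then show ?case using xR M(1) sp by (intro exI[of _ "\<lambda>_. \<zero>\<^bsub>M\<^esub>"]) simp
  next
    case (insert g X)
    have g: "g \<in> carrier M" and X: "X \<subseteq> carrier M" using insert.prems(1) by auto
    let ?S = "mod_span R M X"
    note s = submodule_rules[OF mod_span_submodule[OF M(1) X] M(1)]
    have "\<forall>k. \<exists>r n. r \<in> carrier R \<and> n \<in> ?S \<and> v k = r \<odot>\<^bsub>M\<^esub> g \<oplus>\<^bsub>M\<^esub> n"
      using insert.prems(2) unfolding mod_span_insert[OF M(1) g X] by blast
    then obtain r n where rn: "\<And>k. r k \<in> carrier R" "\<And>k. n k \<in> ?S" "\<And>k. v k = r k \<odot>\<^bsub>M\<^esub> g \<oplus>\<^bsub>M\<^esub> n k"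
      by metis
    obtain t where t: "\<And>k. t k \<in> carrier R" "\<And>k. t k = r k \<oplus> x \<otimes> t (Suc k)"
      by (rule ring_series[OF x rn(1)]) (rule that)
    obtain w where w: "\<And>k. w k \<in> ?S" "\<And>k. w k = n k \<oplus>\<^bsub>M\<^esub> x \<odot>\<^bsub>M\<^esub> w (Suc k)"
      using insert.IH[OF X, of n] rn(2) by blast
    show ?case
    proof (intro exI[of _ "\<lambda>k. t k \<odot>\<^bsub>M\<^esub> g \<oplus>\<^bsub>M\<^esub> w k"] allI conjI)
      fix k
      show "t k \<odot>\<^bsub>M\<^esub> g \<oplus>\<^bsub>M\<^esub> w k \<in> mod_span R M (insert g X)"
        unfolding mod_span_insert[OF M(1) g X] using t(1) w(1) by blast
      have c: "w (Suc k) \<in> carrier M" "n k \<in> carrier M" using w(1) rn(2) s(1) by auto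
      have "t k \<odot>\<^bsub>M\<^esub> g \<oplus>\<^bsub>M\<^esub> w k = (r k \<oplus> x \<otimes> t (Suc k)) \<odot>\<^bsub>M\<^esub> g \<oplus>\<^bsub>M\<^esub> (n k \<oplus>\<^bsub>M\<^esub> x \<odot>\<^bsub>M\<^esub> w (Suc k))"
        using t(2)[of k] w(2)[of k] by simp
      also have "\<dots> = v k \<oplus>\<^bsub>M\<^esub> x \<odot>\<^bsub>M\<^esub> (t (Suc k) \<odot>\<^bsub>M\<^esub> g \<oplus>\<^bsub>M\<^esub> w (Suc k))"
        using c rn(1) t(1) xR g M(1) by (simp add: rn(3) mod_distr mod_ac)
      finally show "t k \<odot>\<^bsub>M\<^esub> g \<oplus>\<^bsub>M\<^esub> w k = v k \<oplus>\<^bsub>M\<^esub> x \<odot>\<^bsub>M\<^esub> (t (Suc k) \<odot>\<^bsub>M\<^esub> g \<oplus>\<^bsub>M\<^esub> w (Suc k))" .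
    qed
  qed
  then show ?thesis using v X(3) by simp
qed

end


section \<open>Quotients and cohomology\<close>

lemma a_r_coset_carrier [simp]: "a_r_coset (A\<lparr>carrier := N\<rparr>) = a_r_coset A"
  by (simp add: fun_eq_iff a_r_coset_def r_coset_def)

lemma coset_mem: "y \<in> N +>\<^bsub>A\<^esub> z \<longleftrightarrow> (\<exists>b\<in>N. y = b \<oplus>\<^bsub>A\<^esub> z)"
  by (auto simp: a_r_coset_def r_coset_def)

lemma quot_module_simps:
  "carrier (quot_module A N) = {N +>\<^bsub>A\<^esub> z | z. z \<in> carrier A}"
  "zero (quot_module A N) = N"
  "add (quot_module A N) = (\<lambda>X Y. X <+>\<^bsub>A\<^esub> Y)"
  "smult (quot_module A N) = (\<lambda>r X. \<Union>x\<in>X. N +>\<^bsub>A\<^esub> (r \<odot>\<^bsub>A\<^esub> x))"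
  by (auto simp: quot_module_def A_RCOSETS_def RCOSETS_def a_r_coset_def)

context noetherian_cring
begin

context
  fixes A :: "('r, 'a) module" and N :: "'a set"
  assumes A: "module R A" and N: "submodule N R A"
begin

lemma coset_self: "z \<in> carrier A \<Longrightarrow> z \<in> N +>\<^bsub>A\<^esub> z"
  unfolding coset_mem using submodule_rules(2)[OF N A] A by (intro bexI[of _ "\<zero>\<^bsub>A\<^esub>"]) simp_all

lemma coset_subset: "z \<in> carrier A \<Longrightarrow> y \<in> N +>\<^bsub>A\<^esub> z \<Longrightarrow> y \<in> carrier A"
  unfolding coset_mem using submodule_rules(1)[OF N A] A by auto

lemma coset_mem_iff:
  assumes "z \<in> carrier A" "y \<in> carrier A"
  shows "y \<in> N +>\<^bsub>A\<^esub> z \<longleftrightarrow> msub R A y z \<in> N"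
  unfolding coset_mem
proof
  assume "\<exists>b\<in>N. y = b \<oplus>\<^bsub>A\<^esub> z"
  then show "msub R A y z \<in> N"
    using assms submodule_rules(1)[OF N A] A by (auto simp: msub_alg(4))
next
  assume "msub R A y z \<in> N"
  then show "\<exists>b\<in>N. y = b \<oplus>\<^bsub>A\<^esub> z"
    using assms A by (intro bexI[of _ "msub R A y z"]) (simp_all add: msub_alg(2))
qed

lemma coset_eq_iff:
  assumes z: "z \<in> carrier A" "z' \<in> carrier A"
  shows "N +>\<^bsub>A\<^esub> z = N +>\<^bsub>A\<^esub> z' \<longleftrightarrow> msub R A z z' \<in> N"
proof
  assume "N +>\<^bsub>A\<^esub> z = N +>\<^bsub>A\<^esub> z'"
  then show "msub R A z z' \<in> N" using coset_self[OF z(1)] coset_mem_iff[OF z(2,1)] by simp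
next
  note n = submodule_rules[OF N A]
  assume d: "msub R A z z' \<in> N"
  have z_eq: "z = msub R A z z' \<oplus>\<^bsub>A\<^esub> z'" using z A by (simp add: msub_alg(2))
  have "y \<in> N +>\<^bsub>A\<^esub> z \<longleftrightarrow> y \<in> N +>\<^bsub>A\<^esub> z'" if y: "y \<in> carrier A" for y
  proof -
    have e: "msub R A y z' = msub R A y z \<oplus>\<^bsub>A\<^esub> msub R A z z'"
    proof -
      have "y = (msub R A y z \<oplus>\<^bsub>A\<^esub> msub R A z z') \<oplus>\<^bsub>A\<^esub> z'"
        using y z A z_eq[symmetric] by (simp add: mod_ac(2)[OF A] msub_alg(2))
      then show ?thesis using y z A by (simp add: msub_alg(6))
    qed
    have "msub R A y z = msub R A (msub R A y z') (msub R A z z')"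
      unfolding e using y z A by (simp add: msub_alg(4))
    then show ?thesis
      unfolding coset_mem_iff[OF z(1) y] coset_mem_iff[OF z(2) y] using n(3,5) d e by metis
  qed
  then show "N +>\<^bsub>A\<^esub> z = N +>\<^bsub>A\<^esub> z'" using coset_subset z by blast
qed

lemma coset_zero: "N +>\<^bsub>A\<^esub> z = N \<longleftrightarrow> z \<in> N" if z: "z \<in> carrier A"
proof -
  have "N +>\<^bsub>A\<^esub> \<zero>\<^bsub>A\<^esub> = N"
    using submodule_rules(1)[OF N A] A by (auto simp: set_eq_iff coset_mem)
  then show ?thesis using coset_eq_iff[OF z, of "\<zero>\<^bsub>A\<^esub>"] z A by simp
qed

lemma zero_module_quot: "zero_module (quot_module A N) \<longleftrightarrow> carrier A \<subseteq> N"
proof -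
  have "zero_module (quot_module A N) \<longleftrightarrow> (\<forall>z\<in>carrier A. N +>\<^bsub>A\<^esub> z = N)"
    unfolding zero_module_def quot_module_simps using mod_closed(2)[OF A] by auto
  then show ?thesis using coset_zero by blast
qed

lemma coset_add:
  assumes z: "z \<in> carrier A" "z' \<in> carrier A"
  shows "(N +>\<^bsub>A\<^esub> z) <+>\<^bsub>A\<^esub> (N +>\<^bsub>A\<^esub> z') = N +>\<^bsub>A\<^esub> (z \<oplus>\<^bsub>A\<^esub> z')"
proof -
  note n = submodule_rules[OF N A]
  have e: "(b \<oplus>\<^bsub>A\<^esub> z) \<oplus>\<^bsub>A\<^esub> (b' \<oplus>\<^bsub>A\<^esub> z') = (b \<oplus>\<^bsub>A\<^esub> b') \<oplus>\<^bsub>A\<^esub> (z \<oplus>\<^bsub>A\<^esub> z')"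
    if "b \<in> N" "b' \<in> N" for b b'
    using n(1)[OF that(1)] n(1)[OF that(2)] z A by (simp add: mod_ac)
  show ?thesis
  proof
    show "(N +>\<^bsub>A\<^esub> z) <+>\<^bsub>A\<^esub> (N +>\<^bsub>A\<^esub> z') \<subseteq> N +>\<^bsub>A\<^esub> (z \<oplus>\<^bsub>A\<^esub> z')"
    proof
      fix y assume "y \<in> (N +>\<^bsub>A\<^esub> z) <+>\<^bsub>A\<^esub> (N +>\<^bsub>A\<^esub> z')"
      then obtain b b' where "b \<in> N" "b' \<in> N" "y = (b \<oplus>\<^bsub>A\<^esub> z) \<oplus>\<^bsub>A\<^esub> (b' \<oplus>\<^bsub>A\<^esub> z')"
        by (auto simp: set_add_def set_mult_def coset_mem)
      then show "y \<in> N +>\<^bsub>A\<^esub> (z \<oplus>\<^bsub>A\<^esub> z')" using e n(3) unfolding coset_mem by metis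
    qed
    show "N +>\<^bsub>A\<^esub> (z \<oplus>\<^bsub>A\<^esub> z') \<subseteq> (N +>\<^bsub>A\<^esub> z) <+>\<^bsub>A\<^esub> (N +>\<^bsub>A\<^esub> z')"
    proof
      fix y assume "y \<in> N +>\<^bsub>A\<^esub> (z \<oplus>\<^bsub>A\<^esub> z')"
      then obtain b where b: "b \<in> N" "y = b \<oplus>\<^bsub>A\<^esub> (z \<oplus>\<^bsub>A\<^esub> z')" by (auto simp: coset_mem)
      then have "y = (b \<oplus>\<^bsub>A\<^esub> z) \<oplus>\<^bsub>A\<^esub> (\<zero>\<^bsub>A\<^esub> \<oplus>\<^bsub>A\<^esub> z')"
        using n(1) z A by (simp add: mod_ac)
      moreover have "b \<oplus>\<^bsub>A\<^esub> z \<in> N +>\<^bsub>A\<^esub> z" "\<zero>\<^bsub>A\<^esub> \<oplus>\<^bsub>A\<^esub> z' \<in> N +>\<^bsub>A\<^esub> z'"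
        using b n(2) by (auto simp: coset_mem)
      ultimately show "y \<in> (N +>\<^bsub>A\<^esub> z) <+>\<^bsub>A\<^esub> (N +>\<^bsub>A\<^esub> z')"
        by (auto simp: set_add_def set_mult_def)
    qed
  qed
qed

text \<open>Collapses the unions over representatives by which scalar multiplication on quotients
  and the induced map on cohomology are defined.\<close>

lemma coset_Union:
  assumes "z \<in> carrier A" "\<And>y. y \<in> N +>\<^bsub>A\<^esub> z \<Longrightarrow> F y = F z"
  shows "(\<Union>y\<in>N +>\<^bsub>A\<^esub> z. F y) = F z"
proof -
  have "(\<Union>y\<in>N +>\<^bsub>A\<^esub> z. F y) = (\<Union>y\<in>N +>\<^bsub>A\<^esub> z. F z)"
    by (rule SUP_cong[OF refl assms(2)])
  then show ?thesis using coset_self[OF assms(1)] by auto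
qed

lemma coset_smult:
  assumes z: "z \<in> carrier A" and r: "r \<in> carrier R"
  shows "(\<Union>y\<in>N +>\<^bsub>A\<^esub> z. N +>\<^bsub>A\<^esub> (r \<odot>\<^bsub>A\<^esub> y)) = N +>\<^bsub>A\<^esub> (r \<odot>\<^bsub>A\<^esub> z)"
proof (rule coset_Union[OF z])
  note n = submodule_rules[OF N A]
  fix y assume y: "y \<in> N +>\<^bsub>A\<^esub> z"
  then have yA: "y \<in> carrier A" by (rule coset_subset[OF z])
  have "msub R A (r \<odot>\<^bsub>A\<^esub> y) (r \<odot>\<^bsub>A\<^esub> z) \<in> N"
    using n(4)[OF r] y coset_mem_iff[OF z yA] yA z r A by (simp add: msub_alg(8)[symmetric])
  then show "N +>\<^bsub>A\<^esub> (r \<odot>\<^bsub>A\<^esub> y) = N +>\<^bsub>A\<^esub> (r \<odot>\<^bsub>A\<^esub> z)"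
    using coset_eq_iff yA z r A by simp
qed

end

lemma cocycles_submodule:
  assumes C: "complex R (C :: nat \<Rightarrow> ('r, 'e) module) d"
  shows "submodule (cocycles C d i) R (C i)"
proof (rule submoduleI'[OF complexD(1)[OF C]])
  note M = complexD(1)[OF C] and lin = complexD(2)[OF C]
  show "cocycles C d i \<subseteq> carrier (C i)" by (auto simp: cocycles_def)
  show "\<zero>\<^bsub>C i\<^esub> \<in> cocycles C d i"
    using linear_zero[OF lin M M, of i] M[of i] by (simp add: cocycles_def)
  show "x \<oplus>\<^bsub>C i\<^esub> y \<in> cocycles C d i" if "x \<in> cocycles C d i" "y \<in> cocycles C d i" for x y
    using that M[of i] M[of "Suc i"] by (simp add: cocycles_def linear_add[OF lin])
  show "r \<odot>\<^bsub>C i\<^esub> x \<in> cocycles C d i" if "r \<in> carrier R" "x \<in> cocycles C d i" for r x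
    using that M[of i] M[of "Suc i"] by (simp add: cocycles_def linear_smult[OF lin])
qed

lemma coboundaries_submodule:
  assumes C: "complex R (C :: nat \<Rightarrow> ('r, 'e) module) d"
  shows "submodule (coboundaries C d i) R (C i)"
proof (cases i)
  case 0
  then show ?thesis using complexD(1)[OF C, of 0]
    by (intro submoduleI') (auto simp: coboundaries_def)
next
  case (Suc j)
  note M = complexD(1)[OF C] and lin = complexD(2)[OF C] and dc = complexD(4)[OF C]
  have "submodule (d j ` carrier (C j)) R (C (Suc j))"
  proof (rule submoduleI'[OF M])
    show "\<zero>\<^bsub>C (Suc j)\<^esub> \<in> d j ` carrier (C j)"
      using linear_zero[OF lin M M, of j] M by (metis image_eqI mod_closed(2))
    fix x assume "x \<in> d j ` carrier (C j)"
    then obtain v where v: "v \<in> carrier (C j)" "x = d j v" by blast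
    show "r \<odot>\<^bsub>C (Suc j)\<^esub> x \<in> d j ` carrier (C j)" if "r \<in> carrier R" for r
      using v that M by (intro image_eqI[of _ _ "r \<odot>\<^bsub>C j\<^esub> v"]) (simp_all add: linear_smult[OF lin])
    fix y assume "y \<in> d j ` carrier (C j)"
    then obtain w where w: "w \<in> carrier (C j)" "y = d j w" by blast
    show "x \<oplus>\<^bsub>C (Suc j)\<^esub> y \<in> d j ` carrier (C j)"
      using v w M by (intro image_eqI[of _ _ "v \<oplus>\<^bsub>C j\<^esub> w"]) (simp_all add: linear_add[OF lin])
  qed (use dc in auto)
  then show ?thesis using Suc by (simp add: coboundaries_def)
qed

lemma coboundaries_cocycles:
  assumes C: "complex R (C :: nat \<Rightarrow> ('r, 'e) module) d"
  shows "coboundaries C d i \<subseteq> cocycles C d i"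
proof (cases i)
  case 0
  then show ?thesis using submodule_rules(2)[OF cocycles_submodule[OF C] complexD(1)[OF C]]
    by (simp add: coboundaries_def)
next
  case (Suc j)
  then show ?thesis using complexD(3,4)[OF C] by (auto simp: coboundaries_def cocycles_def)
qed

lemma coboundaries_submodule_cocycles:
  assumes C: "complex R (C :: nat \<Rightarrow> ('r, 'a) module) d"
  shows "submodule (coboundaries C d i) R ((C i)\<lparr>carrier := cocycles C d i\<rparr>)"
  by (rule submoduleI'[OF submodule_mod[OF cocycles_submodule[OF C] complexD(1)[OF C]]])
    (use coboundaries_cocycles[OF C] submodule_rules[OF coboundaries_submodule[OF C] complexD(1)[OF C]] in auto)

lemma zero_module_cohomology:
  assumes C: "complex R (C :: nat \<Rightarrow> ('r, 'a) module) d"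
  shows "zero_module (cohomology C d i) \<longleftrightarrow> exact_at C d i"
  unfolding cohomology_def exact_at_def
  using zero_module_quot[OF submodule_mod[OF cocycles_submodule[OF C] complexD(1)[OF C]]
      coboundaries_submodule_cocycles[OF C]] by simp

end

lemma torsion_part_simps [simp]:
  "zero (torsion_part R I A) = zero A" "add (torsion_part R I A) = add A"
  "smult (torsion_part R I A) = smult A" "msub R (torsion_part R I A) = msub R A"
  "(torsion_part R I A)\<lparr>carrier := N\<rparr> = A\<lparr>carrier := N\<rparr>"
  "a_r_coset (torsion_part R I A) = a_r_coset A"
  by (simp_all add: torsion_part_def)

lemma torsion_part_carrier:
  "carrier (torsion_part R I A) =
    {x \<in> carrier A. \<exists>t::nat. \<forall>a \<in> I [^]\<^bsub>ideals_set R\<^esub> t. a \<odot>\<^bsub>A\<^esub> x = \<zero>\<^bsub>A\<^esub>}"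
  by (simp add: torsion_part_def)

lemma resolution_facts:
  assumes "injective_resolution R M X"
  shows "injective_module R (res_term X i)"
    "linear_map R (res_term X i) (res_term X (Suc i)) (res_diff X i)"
    "linear_map R M (res_term X 0) (res_aug X)"
    "inj_on (res_aug X) (carrier M)"
    "res_aug X ` carrier M = cocycles (res_term X) (res_diff X) 0"
    "res_diff X i ` carrier (res_term X i) = cocycles (res_term X) (res_diff X) (Suc i)"
  using assms by (auto simp: injective_resolution_def cocycles_def intro: mod_hom_linear)


section \<open>Endomorphisms of local cohomology\<close>

locale resolved_module = complete_local_ring R \<mm> for R :: "'r ring" (structure) and \<mm> +
  fixes M :: "('r, 'm) module" and X :: "('r, 'm, 'e) resolution"
  assumes M: "module R M" "fin_gen_module R M" and res: "injective_resolution R M X"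
begin

abbreviation E where "E \<equiv> res_term X"
abbreviation d where "d \<equiv> res_diff X"
abbreviation aug where "aug \<equiv> res_aug X"

lemma baer_E: "baer R (E i)"
  by (rule injective_imp_baer[OF resolution_facts(1)[OF res]])

lemma module_E: "module R (E i)"
  by (rule baer_module[OF baer_E])

lemma complex_E: "complex R E d"
  unfolding complex_def
proof (intro conjI allI ballI module_E resolution_facts(2)[OF res])
  fix i x assume "x \<in> carrier (E i)"
  then have "d i x \<in> cocycles E d (Suc i)" using resolution_facts(6)[OF res, of i] by blast
  then show "d (Suc i) (d i x) = \<zero>\<^bsub>E (Suc (Suc i))\<^esub>" by (simp add: cocycles_def)
qed

lemma exact_E: "0 < i \<Longrightarrow> exact_at E d i"
  using resolution_facts(6)[OF res] by (cases i) (auto simp: exact_at_def coboundaries_def)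

lemma aug_linear: "linear_map R M (E 0) aug"
  by (rule resolution_facts(3)[OF res])

lemma aug_eq: "x \<in> carrier M \<Longrightarrow> y \<in> carrier M \<Longrightarrow> aug x = aug y \<Longrightarrow> x = y"
  using resolution_facts(4)[OF res] by (auto dest: inj_onD)

lemma aug_cocycle: "x \<in> carrier M \<Longrightarrow> d 0 (aug x) = \<zero>\<^bsub>E (Suc 0)\<^esub>"
  using resolution_facts(5)[OF res] by (auto simp: cocycles_def)

lemma cocycle_aug:
  assumes "z \<in> cocycles E d 0"
  obtains m where "m \<in> carrier M" "z = aug m"
  using assms resolution_facts(5)[OF res] by blast

text \<open>Exactness identifies the cocycles in degree 0 with \<open>M\<close>, for which the two
  conditions are \<open>module_divisible_zero\<close> and \<open>module_series\<close>.\<close>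

lemma telescoping_E:
  assumes x: "x \<in> \<mm>"
  shows "telescoping R E d x"
proof
  show "complex R E d" by (rule complex_E)
  show "baer R (E i)" for i by (rule baer_E)
  show xR: "x \<in> carrier R" by (rule ideal_rules(1)[OF max_ideal x])
  show "exact_at E d i" if "0 < i" for i by (rule exact_E[OF that])
  show "z 0 = \<zero>\<^bsub>E 0\<^esub>"
    if z: "\<And>k. z k \<in> cocycles E d 0" "\<And>k. x \<odot>\<^bsub>E 0\<^esub> z (Suc k) = z k" for z
  proof -
    have "\<forall>k. \<exists>m. m \<in> carrier M \<and> z k = aug m"
      using z(1) resolution_facts(5)[OF res] by blast
    then obtain m where m: "\<And>k. m k \<in> carrier M" "\<And>k. z k = aug (m k)"
      by metis
    have "aug (x \<odot>\<^bsub>M\<^esub> m (Suc k)) = aug (m k)" for k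
      using z(2)[of k] m xR by (simp add: linear_smult[OF aug_linear])
    then have "x \<odot>\<^bsub>M\<^esub> m (Suc k) = m k" for k using aug_eq m(1) xR M(1) by simp
    then have "m 0 = \<zero>\<^bsub>M\<^esub>" using module_divisible_zero[OF M x, of m] m(1) by blast
    then show ?thesis using m(2)[of 0] linear_zero[OF aug_linear M(1) module_E] by simp
  qed
  show "\<exists>u. \<forall>k. u k \<in> cocycles E d 0 \<and> u k = v k \<oplus>\<^bsub>E 0\<^esub> x \<odot>\<^bsub>E 0\<^esub> u (Suc k)"
    if v: "\<And>k. v k \<in> cocycles E d 0" for v
  proof -
    have "\<forall>k. \<exists>m. m \<in> carrier M \<and> v k = aug m"
      using v resolution_facts(5)[OF res] by blast
    then obtain m where m: "\<And>k. m k \<in> carrier M" "\<And>k. v k = aug (m k)"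
      by metis
    obtain u where "\<forall>k. u k \<in> carrier M \<and> u k = m k \<oplus>\<^bsub>M\<^esub> x \<odot>\<^bsub>M\<^esub> u (Suc k)"
      using module_series[where v = m, OF M x m(1)] ..
    then have u: "\<And>k. u k \<in> carrier M" "\<And>k. u k = m k \<oplus>\<^bsub>M\<^esub> x \<odot>\<^bsub>M\<^esub> u (Suc k)"
      by blast+
    show ?thesis
    proof (intro exI[of _ "\<lambda>k. aug (u k)"] allI conjI)
      fix k
      show "aug (u k) \<in> cocycles E d 0" using u(1) resolution_facts(5)[OF res] by blast
      have "aug (u k) = aug (m k \<oplus>\<^bsub>M\<^esub> x \<odot>\<^bsub>M\<^esub> u (Suc k))" using u(2)[of k] by simp
      then show "aug (u k) = v k \<oplus>\<^bsub>E 0\<^esub> x \<odot>\<^bsub>E 0\<^esub> aug (u (Suc k))"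
        using u(1)[of "Suc k"] m xR M(1) by (simp add: linear_add[OF aug_linear] linear_smult[OF aug_linear])
    qed
  qed
qed

lemma lift_exists:
  assumes f: "linear_map R M M f"
  obtains \<phi> where "chain_map R E d E d \<phi>" "\<And>x. x \<in> carrier M \<Longrightarrow> \<phi> 0 (aug x) = aug (f x)"
proof -
  obtain g where g: "linear_map R (E 0) (E 0) g" "\<And>x. x \<in> carrier M \<Longrightarrow> g (aug x) = aug (f x)"
  proof (rule baer_extend[OF baer_E M(1) module_E aug_linear linear_comp[OF f aug_linear]])
    fix x assume x: "x \<in> carrier M" "aug x = \<zero>\<^bsub>E 0\<^esub>"
    then have "x = \<zero>\<^bsub>M\<^esub>" using aug_eq[of x "\<zero>\<^bsub>M\<^esub>"] linear_zero[OF aug_linear M(1) module_E] M(1) by simp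
    then show "aug (f x) = \<zero>\<^bsub>E 0\<^esub>"
      using linear_zero[OF f M(1) M(1)] linear_zero[OF aug_linear M(1) module_E] by simp
  qed (rule that)
  have "d 0 (g x) = \<zero>\<^bsub>E (Suc 0)\<^esub>" if x: "x \<in> cocycles E d 0" for x
  proof -
    obtain m where m: "m \<in> carrier M" "x = aug m" by (rule cocycle_aug[OF x])
    then show ?thesis using g(2) aug_cocycle linear_closed[OF f] by simp
  qed
  then have z: "\<And>x. x \<in> cocycles E d 0 \<Longrightarrow> d 0 (g x) = \<zero>\<^bsub>E (Suc 0)\<^esub>" .
  obtain \<phi> where \<phi>: "chain_map R E d E d \<phi>" "\<phi> 0 = g"
  proof (rule chain_map_extends[OF complex_E complex_E baer_E exact_E g(1) z])
    fix \<phi> assume "chain_map R E d E d \<phi>" "\<phi> 0 = g"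
    then show thesis by (rule that)
  qed simp_all
  then show ?thesis using that g(2) by blast
qed

text \<open>The uniqueness half of the comparison theorem: \<open>homotopy_extends\<close> at degree
  0 with \<phi> itself as start, which vanishes on cocycles because they come from
  \<open>M\<close>.\<close>

lemma null_homotopic_lift:
  assumes \<phi>: "chain_map R E d E d \<phi>" and zero: "\<And>x. x \<in> carrier M \<Longrightarrow> \<phi> 0 (aug x) = \<zero>\<^bsub>E 0\<^esub>"
  shows "null_homotopic R E d E d \<phi>"
proof -
  have z: "\<phi> 0 x = \<zero>\<^bsub>E 0\<^esub>" if x: "x \<in> cocycles E d 0" for x
    using cocycle_aug[OF x] zero by metis
  obtain h where h: "\<And>i. linear_map R (E (Suc i)) (E i) (h i)"
    "\<And>x. x \<in> carrier (E 0) \<Longrightarrow> h 0 (d 0 x) = \<phi> 0 x"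
    "\<And>i x. x \<in> carrier (E (Suc i)) \<Longrightarrow> \<phi> (Suc i) x = h (Suc i) (d (Suc i) x) \<oplus>\<^bsub>E (Suc i)\<^esub> d i (h i x)"
  proof (rule homotopy_extends[OF complex_E complex_E baer_E exact_E \<phi> chain_mapD(1)[OF \<phi>, of 0] _ z])
    fix h
    assume "\<And>i. 0 \<le> i \<Longrightarrow> linear_map R (E (Suc i)) (E i) (h i)"
      "\<And>x. x \<in> carrier (E 0) \<Longrightarrow> h 0 (d 0 x) = \<phi> 0 x"
      "\<And>i x. 0 \<le> i \<Longrightarrow> x \<in> carrier (E (Suc i)) \<Longrightarrow>
        \<phi> (Suc i) x = h (Suc i) (d (Suc i) x) \<oplus>\<^bsub>E (Suc i)\<^esub> d i (h i x)"
    then show thesis by (intro that[of h]) simp_all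
  qed simp_all
  have "\<phi> i x = h i (d i x) \<oplus>\<^bsub>E i\<^esub> from_below E d h i x" if x: "x \<in> carrier (E i)" for i x
  proof (cases i)
    case 0
    then show ?thesis using h(2) x chain_mapD(3)[OF \<phi>, of x 0] module_E by (simp add: from_below_def)
  next
    case (Suc j)
    then show ?thesis using h(3) x by (simp add: from_below_def)
  qed
  then show ?thesis using h(1) unfolding null_homotopic_def by blast
qed

end

section \<open>The torsion functor of an ideal on modules and complexes\<close>

context noetherian_cring
begin

lemma ideal_pow_mono:
  assumes "J \<subseteq> I"
  shows "J [^]\<^bsub>ideals_set R\<^esub> (t::nat) \<subseteq> I [^]\<^bsub>ideals_set R\<^esub> t"
proof (induction t)
  case (Suc t)
  show ?case
  proof
    fix a assume "a \<in> J [^]\<^bsub>ideals_set R\<^esub> Suc t"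
    then have "a \<in> ideal_prod R (J [^]\<^bsub>ideals_set R\<^esub> t) J" by simp
    then have "a \<in> ideal_prod R (I [^]\<^bsub>ideals_set R\<^esub> t) I"
      using Suc assms by induction (auto intro: ideal_prod.intros)
    then show "a \<in> I [^]\<^bsub>ideals_set R\<^esub> Suc t" by simp
  qed
qed simp

lemma torsion_part_mono:
  assumes "J \<subseteq> I"
  shows "carrier (torsion_part R I A) \<subseteq> carrier (torsion_part R J A)"
proof
  fix x assume "x \<in> carrier (torsion_part R I A)"
  then obtain t :: nat where "x \<in> carrier A" "\<forall>a \<in> I [^]\<^bsub>ideals_set R\<^esub> t. a \<odot>\<^bsub>A\<^esub> x = \<zero>\<^bsub>A\<^esub>"
    unfolding torsion_part_carrier by blast
  moreover then have "\<forall>a \<in> J [^]\<^bsub>ideals_set R\<^esub> t. a \<odot>\<^bsub>A\<^esub> x = \<zero>\<^bsub>A\<^esub>"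
    using ideal_pow_mono[OF assms, of t] by blast
  ultimately show "x \<in> carrier (torsion_part R J A)" unfolding torsion_part_carrier by blast
qed

lemma torsion_part_map:
  assumes I: "ideal I R" and f: "linear_map R A B f" and AB: "module R A" "module R B"
    and x: "x \<in> carrier (torsion_part R I A)"
  shows "f x \<in> carrier (torsion_part R I B)"
proof -
  obtain t :: nat where t: "\<And>a. a \<in> I [^]\<^bsub>ideals_set R\<^esub> t \<Longrightarrow> a \<odot>\<^bsub>A\<^esub> x = \<zero>\<^bsub>A\<^esub>" and xA: "x \<in> carrier A"
    using x unfolding torsion_part_carrier by blast
  have "a \<odot>\<^bsub>B\<^esub> f x = \<zero>\<^bsub>B\<^esub>" if "a \<in> I [^]\<^bsub>ideals_set R\<^esub> t" for a
    using linear_smult[OF f ideal_rules(1)[OF ideal_pow_ideal[OF I] that] xA] t[OF that]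
      linear_zero[OF f AB] by simp
  then show ?thesis using linear_closed[OF f xA] unfolding torsion_part_carrier by blast
qed

lemma ideal_generators_list:
  assumes "ideal I R"
  obtains xs where "set xs \<subseteq> carrier R" "set xs \<subseteq> I" "I = Idl (set xs)"
proof -
  obtain Y where "finite Y" "Y \<subseteq> carrier R" "Y \<subseteq> I" "I = Idl Y"
    using finite_generators[OF assms] by metis
  moreover then obtain xs where "set xs = Y" using finite_list by blast
  ultimately show ?thesis using that by metis
qed

lemma torsion_part_baer:
  assumes "ideal I R" "baer R A"
  shows "baer R (torsion_part R I A)"
proof -
  obtain xs where xs: "set xs \<subseteq> carrier R" "I = Idl (set xs)" using ideal_generators_list[OF assms(1)] by metis
  show ?thesis
    unfolding xs(2) torsion_part_iter[OF baer_module[OF assms(2)] xs(1)]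
    by (rule iter_tors_baer[OF assms(2) xs(1)])
qed

lemma torsion_part_complex:
  assumes "ideal I R" "complex R C d"
  shows "complex R (\<lambda>i. torsion_part R I (C i)) d"
proof -
  obtain xs where xs: "set xs \<subseteq> carrier R" "I = Idl (set xs)" using ideal_generators_list[OF assms(1)] by metis
  show ?thesis
    unfolding xs(2) torsion_part_iter[OF complexD(1)[OF assms(2)] xs(1)]
    by (rule iter_tors_complex[OF assms(2) xs(1)])
qed

end

text \<open>A null-homotopic endomorphism of the resolution preserves torsion, hence so does the homotopy.\<close>

lemma (in resolved_module) null_homotopic_coboundary:
  assumes "null_homotopic R E d E d \<phi>" and a: "ideal \<aa> R"
    and z: "z \<in> cocycles (\<lambda>i. torsion_part R \<aa> (E i)) d i"
  shows "\<phi> i z \<in> coboundaries (\<lambda>i. torsion_part R \<aa> (E i)) d i" (is "_ \<in> ?B")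
proof -
  obtain h where h: "\<And>i. linear_map R (E (Suc i)) (E i) (h i)"
    "\<And>i x. x \<in> carrier (E i) \<Longrightarrow> \<phi> i x = h i (d i x) \<oplus>\<^bsub>E i\<^esub> from_below E d h i x"
    using assms(1) unfolding null_homotopic_def by blast
  have zE: "z \<in> carrier (E i)" using z by (simp add: cocycles_def torsion_part_carrier)
  have "h i (d i z) = \<zero>\<^bsub>E i\<^esub>"
    using z linear_zero[OF h(1) module_E module_E] by (simp add: cocycles_def)
  moreover have "from_below E d h i z \<in> ?B"
    using torsion_part_map[OF a h(1) module_E module_E] z
    by (cases i) (auto simp: from_below_def coboundaries_def cocycles_def)
  moreover have "submodule ?B R (torsion_part R \<aa> (E i))"
    by (rule coboundaries_submodule[OF torsion_part_complex[OF a complex_E]])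
  ultimately show ?thesis
    using h(2)[OF zE] submodule_rules(1)[of ?B "torsion_part R \<aa> (E i)" "from_below E d h i z"]
      mod_simps(1)[OF module_E, of "from_below E d h i z"]
      complexD(1)[OF torsion_part_complex[OF a complex_E], of i]
    by (simp add: torsion_part_carrier)
qed

text \<open>Properness of \<open>J\<close> puts it inside \<mm>, where the series above converge; in
  the theorem it comes from the finiteness of the grade.\<close>

locale two_ideals = resolved_module R \<mm> M X
  for R :: "'r ring" (structure) and \<mm> and M :: "('r, 'm) module" and X :: "('r, 'm, 'e) resolution" +
  fixes I J :: "'r set" and c :: nat
  assumes I: "ideal I R" and J: "ideal J R" and JI: "J \<subseteq> I" and J_proper: "\<one> \<notin> J"
    and exact_J: "\<And>i. i \<noteq> c \<Longrightarrow> exact_at (\<lambda>i. torsion_part R J (res_term X i)) (res_diff X) i"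
begin

abbreviation K where "K i \<equiv> torsion_part R J (E i)"
abbreviation L where "L i \<equiv> torsion_part R I (E i)"
abbreviation ZK where "ZK \<equiv> cocycles K d c"
abbreviation BK where "BK \<equiv> coboundaries K d c"
abbreviation ZL where "ZL \<equiv> cocycles L d c"
abbreviation BL where "BL \<equiv> coboundaries L d c"

lemma complex_K: "complex R K d" and complex_L: "complex R L d"
  by (rule torsion_part_complex[OF J complex_E], rule torsion_part_complex[OF I complex_E])

lemma baer_K: "baer R (K i)"
  by (rule torsion_part_baer[OF J baer_E])

lemma module_K: "module R (K i)"
  by (rule baer_module[OF baer_K])

lemma L_K: "x \<in> carrier (L i) \<Longrightarrow> x \<in> carrier (K i)"
  using torsion_part_mono[OF JI, of "E i"] by (rule subsetD)

lemma K_E: "x \<in> carrier (K i) \<Longrightarrow> x \<in> carrier (E i)"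
  by (simp add: torsion_part_carrier)

text \<open>Because \<open>J\<close> is contained in \<open>I\<close>, the module \<open>L i\<close>
  is also the \<open>I\<close>-torsion of \<open>K i\<close>. Hence maps that exist only on
  \<open>K\<close>, such as the contraction \<open>s\<close>, preserve it.\<close>

lemma L_map:
  assumes f: "linear_map R (K i) (K j) f" and x: "x \<in> carrier (L i)"
  shows "f x \<in> carrier (L j)"
proof -
  have "x \<in> carrier (torsion_part R I (K i))"
    using x L_K[OF x] by (simp add: torsion_part_carrier[of R I])
  then have "f x \<in> carrier (torsion_part R I (K j))"
    by (rule torsion_part_map[OF I f module_K module_K])
  then show ?thesis using K_E by (simp add: torsion_part_carrier[of R I])
qed

lemma L_map_E:
  assumes "linear_map R (E i) (E j) f" "x \<in> carrier (L i)"
  shows "f x \<in> carrier (L j)"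
  by (rule torsion_part_map[OF I assms(1) module_E module_E assms(2)])

lemma ZL_ZK: "z \<in> ZL \<Longrightarrow> z \<in> ZK"
  unfolding cocycles_def mem_Collect_eq torsion_part_simps using L_K by (elim conjE) (intro conjI)

lemma BL_BK: "z \<in> BL \<Longrightarrow> z \<in> BK"
  by (cases c) (use L_K in \<open>fastforce simp: coboundaries_def\<close>)+

lemma sub_ZK: "submodule ZK R (K c)" and sub_BK: "submodule BK R (K c)"
  and sub_ZL: "submodule ZL R (L c)" and sub_BL: "submodule BL R (L c)"
  and BK_ZK: "BK \<subseteq> ZK" and BL_ZL: "BL \<subseteq> ZL"
  by (rule cocycles_submodule[OF complex_K], rule coboundaries_submodule[OF complex_K],
    rule cocycles_submodule[OF complex_L], rule coboundaries_submodule[OF complex_L],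
    rule coboundaries_cocycles[OF complex_K], rule coboundaries_cocycles[OF complex_L])

lemma ZKD: "z \<in> ZK \<Longrightarrow> z \<in> carrier (K c)" "z \<in> ZK \<Longrightarrow> d c z = \<zero>\<^bsub>E (Suc c)\<^esub>"
  by (simp_all add: cocycles_def)

lemma ZLD: "z \<in> ZL \<Longrightarrow> z \<in> carrier (L c)" "z \<in> ZL \<Longrightarrow> z \<in> carrier (K c)"
    "z \<in> ZL \<Longrightarrow> z \<in> carrier (E c)"
proof -
  assume z: "z \<in> ZL"
  show "z \<in> carrier (L c)" using z unfolding cocycles_def by blast
  show K: "z \<in> carrier (K c)" by (rule ZKD(1)[OF ZL_ZK[OF z]])
  show "z \<in> carrier (E c)" by (rule K_E[OF K])
qed

text \<open>A contraction of \<open>K\<close> is available only below degree \<open>c\<close>. It is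
  fixed once, so that the projection \<open>pr\<close> becomes one definite linear map.\<close>

definition s :: "nat \<Rightarrow> 'e \<Rightarrow> 'e" where
  "s = (SOME s. \<forall>i<c. linear_map R (K (Suc i)) (K i) (s i) \<and>
     (\<forall>x\<in>carrier (K i). x = s i (d i x) \<oplus>\<^bsub>K i\<^esub> from_below K d s i x))"

lemma s:
  shows s_linear: "i < c \<Longrightarrow> linear_map R (K (Suc i)) (K i) (s i)"
    and s_contraction: "i < c \<Longrightarrow> x \<in> carrier (K i) \<Longrightarrow> x = s i (d i x) \<oplus>\<^bsub>E i\<^esub> from_below K d s i x"
proof -
  obtain s' where s': "\<forall>i. (\<forall>j\<le>i. exact_at K d j) \<longrightarrow> linear_map R (K (Suc i)) (K i) (s' i) \<and>
     (\<forall>x\<in>carrier (K i). x = s' i (d i x) \<oplus>\<^bsub>K i\<^esub> from_below K d s' i x)"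
    using contraction_exists[OF complex_K baer_K] ..
  have p: "linear_map R (K (Suc i)) (K i) (s' i) \<and>
     (\<forall>x\<in>carrier (K i). x = s' i (d i x) \<oplus>\<^bsub>K i\<^esub> from_below K d s' i x)" if i: "i < c" for i
  proof (rule s'[THEN spec, THEN mp], intro allI impI)
    fix j assume "j \<le> i"
    then show "exact_at K d j" using i by (intro exact_J) simp
  qed
  have q: "\<forall>i<c. linear_map R (K (Suc i)) (K i) (s i) \<and>
     (\<forall>x\<in>carrier (K i). x = s i (d i x) \<oplus>\<^bsub>K i\<^esub> from_below K d s i x)"
    unfolding s_def by (rule someI[of _ s']) (intro allI impI p)
  show "linear_map R (K (Suc i)) (K i) (s i)" if "i < c"
    using q that by blast
  show "x = s i (d i x) \<oplus>\<^bsub>E i\<^esub> from_below K d s i x" if "i < c" "x \<in> carrier (K i)"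
    using q[THEN spec, THEN mp, OF that(1), THEN conjunct2, THEN bspec, OF that(2)]
    unfolding torsion_part_simps .
qed

text \<open>The projection onto a complement of the coboundaries in degree \<open>c\<close>.\<close>

definition pr :: "'e \<Rightarrow> 'e" where
  "pr z = msub R (E c) z (from_below K d s c z)"

lemma ds_linear: "linear_map R (K c) (K c) (from_below K d s c)"
  by (rule from_below_linear[OF complex_K module_K]) (use s_linear in auto)

lemma pr_linear: "linear_map R (K c) (K c) pr"
  using linear_diff[OF linear_id ds_linear module_K module_K] by (simp add: pr_def[abs_def])

text \<open>For \<open>z = d w\<close> the contraction writes \<open>w\<close> as
  \<open>s d w\<close> plus a coboundary. Applying \<open>d\<close> gives \<open>z = d s z\<close>,
  so that nothing is left after the subtraction in \<open>pr\<close>.\<close>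

lemma pr_BK: "z \<in> BK \<Longrightarrow> pr z = \<zero>\<^bsub>E c\<^esub>"
proof (cases c)
  case 0
  assume z: "z \<in> BK"
  then have "z = \<zero>\<^bsub>E c\<^esub>" using 0 by (simp add: coboundaries_def)
  then show ?thesis using linear_zero[OF pr_linear module_K module_K] by simp
next
  case (Suc j)
  assume "z \<in> BK"
  then obtain w where w: "w \<in> carrier (K j)" "z = d j w" using Suc by (auto simp: coboundaries_def)
  note lin = complexD(2)[OF complex_K] and dc = complexD(4)[OF complex_K]
  have sd: "s j (d j w) \<in> carrier (K j)" using linear_closed[OF s_linear[of j] dc[OF w(1)]] Suc by simp
  have fb: "from_below K d s j w \<in> carrier (K j)"
    by (rule from_below_closed[OF complex_K]) (use linear_closed[OF s_linear] w Suc in auto)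
  have fb0: "d j (from_below K d s j w) = \<zero>\<^bsub>E (Suc j)\<^esub>"
  proof (cases j)
    case 0
    then show ?thesis using linear_zero[OF lin module_K module_K, of 0] by (simp add: from_below_def)
  next
    case j: (Suc l)
    then show ?thesis using complexD(3)[OF complex_K] linear_closed[OF s_linear[of l]] w Suc
      by (simp add: from_below_def)
  qed
  have "z = d j (s j (d j w) \<oplus>\<^bsub>E j\<^esub> from_below K d s j w)"
    using s_contraction[of j w] w Suc by simp
  also have "\<dots> = d j (s j z)"
    using linear_add[OF lin sd fb] fb0 dc[OF sd] module_K[of "Suc j"] w(2)
      mod_simps(2)[OF module_K[of "Suc j"], of "d j (s j z)"] by simp
  finally have "from_below K d s c z = z" using Suc by (simp add: from_below_def)
  moreover have "z \<in> carrier (K c)" using dc[OF w(1)] w(2) Suc by simp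
  ultimately show ?thesis
    using mod_simps(6)[OF module_E K_E, of z c] by (simp add: pr_def)
qed

lemma pr_diff: "z \<in> carrier (K c) \<Longrightarrow> msub R (E c) z (pr z) \<in> BK"
proof -
  assume z: "z \<in> carrier (K c)"
  have "from_below K d s c z \<in> BK"
    using linear_closed[OF s_linear] z by (cases c) (auto simp: from_below_def coboundaries_def)
  then show ?thesis
    using msub_alg(7)[OF module_K z linear_closed[OF ds_linear z]] by (simp add: pr_def)
qed

text \<open>The contraction respects \<open>I\<close>-torsion by \<open>L_map\<close>, so
  \<open>pr\<close> does not change classes in the cohomology of \<open>L\<close> either.\<close>

lemma pr_diff_L: "z \<in> carrier (L c) \<Longrightarrow> msub R (E c) z (pr z) \<in> BL"
proof -
  assume z: "z \<in> carrier (L c)"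
  have "from_below K d s c z \<in> BL"
    using L_map[OF s_linear] z by (cases c) (auto simp: from_below_def coboundaries_def)
  then show ?thesis
    using msub_alg(7)[OF module_K L_K[OF z] linear_closed[OF ds_linear L_K[OF z]]] by (simp add: pr_def)
qed

lemma pr_ZK: "z \<in> ZK \<Longrightarrow> pr z \<in> ZK"
proof -
  assume z: "z \<in> ZK"
  have "msub R (K c) z (msub R (K c) z (pr z)) \<in> ZK"
    using submodule_rules(5)[OF sub_ZK module_K z] BK_ZK pr_diff[OF ZKD(1)[OF z]] by auto
  then show ?thesis
    using msub_alg(7)[OF module_K ZKD(1)[OF z] linear_closed[OF pr_linear ZKD(1)[OF z]]] by simp
qed

lemma chain_map_ZL:
  assumes "chain_map R E d E d \<phi>" and z: "z \<in> ZL"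
  shows "\<phi> c z \<in> ZL"
proof -
  have "d c (\<phi> c z) = \<phi> (Suc c) (d c z)" using chain_mapD(2)[OF assms(1) ZLD(3)[OF z]] by simp
  also have "\<dots> = \<zero>\<^bsub>E (Suc c)\<^esub>"
    using z linear_zero[OF chain_mapD(1)[OF assms(1)] module_E module_E, of "Suc c"]
    by (simp add: cocycles_def)
  finally show ?thesis
    using L_map_E[OF chain_mapD(1)[OF assms(1)] ZLD(1)[OF z]] by (simp add: cocycles_def)
qed

lemma chain_map_BL:
  assumes "chain_map R E d E d \<phi>" and z: "z \<in> BL"
  shows "\<phi> c z \<in> BL"
proof (cases c)
  case 0
  then have "z = \<zero>\<^bsub>E c\<^esub>" using z by (simp add: coboundaries_def)
  then have "\<phi> c z = \<zero>\<^bsub>E c\<^esub>"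
    using linear_zero[OF chain_mapD(1)[OF assms(1)] module_E module_E, of c] by simp
  then show ?thesis using 0 by (simp add: coboundaries_def)
next
  case (Suc j)
  then obtain w where w: "w \<in> carrier (L j)" "z = d j w" using z by (auto simp: coboundaries_def)
  then have "\<phi> c z = d j (\<phi> j w)"
    using chain_mapD(2)[OF assms(1) K_E[OF L_K[OF w(1)]]] Suc by simp
  then show ?thesis using L_map_E[OF chain_mapD(1)[OF assms(1)] w(1)] Suc by (auto simp: coboundaries_def)
qed

lemma chain_map_K:
  assumes "chain_map R E d E d \<phi>"
  shows "chain_map R K d K d \<phi>" "chain_map R K d E d \<phi>"
proof -
  have l: "linear_map R (K i) (E i) (\<phi> i)" for i
    unfolding torsion_part_def by (rule linear_domain[OF chain_mapD(1)[OF assms]]) auto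
  have "linear_map R (K i) (K i) (\<phi> i)" for i
  proof -
    have "linear_map R (K i) (E i\<lparr>carrier := carrier (K i)\<rparr>) (\<phi> i)"
      by (rule linear_codomain[OF l])
        (rule torsion_part_map[OF J chain_mapD(1)[OF assms] module_E module_E])
    then show ?thesis by (simp add: torsion_part_def)
  qed
  then show "chain_map R K d K d \<phi>" "chain_map R K d E d \<phi>"
    using l chain_mapD(2)[OF assms K_E] unfolding chain_map_def by blast+
qed

end

text \<open>The assumption isolates all that the arguments on endomorphisms use of the radical and
  depth hypotheses; it is established by \<open>cohomology_torsion\<close>.\<close>

locale torsion_ideals = two_ideals R \<mm> M X I J c
  for R :: "'r ring" (structure) and \<mm> and M :: "('r, 'm) module" and X :: "('r, 'm, 'e) resolution"
    and I J c +
  assumes tor: "\<And>z. z \<in> cocycles (\<lambda>i. torsion_part R J (res_term X i)) (res_diff X) c \<Longrightarrow>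
     \<exists>t::nat. \<forall>a \<in> I [^]\<^bsub>ideals_set R\<^esub> t.
       a \<odot>\<^bsub>res_term X c\<^esub> z \<in> coboundaries (\<lambda>i. torsion_part R J (res_term X i)) (res_diff X) c"
begin

text \<open>Since \<open>pr\<close> is linear and kills coboundaries, whatever annihilates the class
  of \<open>z\<close> annihilates \<open>pr z\<close> itself. Thus a class killed by a power of
  \<open>I\<close> has a representative in \<open>L\<close>, which identifies the two local
  cohomology modules.\<close>

lemma pr_ZL: "z \<in> ZK \<Longrightarrow> pr z \<in> ZL"
proof -
  assume z: "z \<in> ZK"
  obtain t :: nat where t: "\<And>a. a \<in> I [^]\<^bsub>ideals_set R\<^esub> t \<Longrightarrow> a \<odot>\<^bsub>E c\<^esub> z \<in> BK"
    using tor[OF z] by blast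
  have "a \<odot>\<^bsub>E c\<^esub> pr z = \<zero>\<^bsub>E c\<^esub>" if a: "a \<in> I [^]\<^bsub>ideals_set R\<^esub> t" for a
    using linear_smult[OF pr_linear ideal_rules(1)[OF ideal_pow_ideal[OF I] a] ZKD(1)[OF z]]
      pr_BK[OF t[OF a]] by simp
  moreover have "pr z \<in> carrier (E c)" using K_E[OF ZKD(1)[OF pr_ZK[OF z]]] .
  ultimately have "pr z \<in> carrier (L c)" unfolding torsion_part_carrier by blast
  then show ?thesis using pr_ZK[OF z] by (simp add: cocycles_def)
qed

text \<open>Injectivity of the natural map rests on this. A map that is zero on the cohomology of
  \<open>L\<close> is zero on that of \<open>K\<close>, hence null-homotopic on \<open>K\<close>,
  whose only cohomology is in degree \<open>c\<close>; the homotopy then extends to \<open>E\<close>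
  along the generators of \<open>J\<close>.\<close>

lemma null_homotopic_from_cohomology:
  assumes \<phi>: "chain_map R E d E d \<phi>" and zero: "\<And>z. z \<in> ZL \<Longrightarrow> \<phi> c z \<in> BL"
  shows "null_homotopic R E d E d \<phi>"
proof -
  note \<phi>K = chain_map_K(1)[OF \<phi>]
  note \<phi>l = chain_mapD(1)[OF \<phi>K] and \<phi>c = chain_mapD(3)[OF \<phi>K]
  note lin = complexD(2)[OF complex_K] and dc = complexD(4)[OF complex_K]
  have BKc: "z \<in> BK \<Longrightarrow> z \<in> carrier (K c)" for z
    using BK_ZK ZKD(1) by blast
  have \<phi>BK: "\<phi> c z \<in> BK" if z: "z \<in> BK" for z
  proof (cases c)
    case 0
    then have "z = \<zero>\<^bsub>K c\<^esub>" using z by (simp add: coboundaries_def)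
    then have "\<phi> c z = \<zero>\<^bsub>K c\<^esub>"
      using linear_zero[OF \<phi>l module_K module_K, of c] by simp
    then show ?thesis using 0 by (simp add: coboundaries_def)
  next
    case (Suc j)
    then obtain w where w: "w \<in> carrier (K j)" "z = d j w" using z by (auto simp: coboundaries_def)
    then show ?thesis
      using chain_mapD(2)[OF \<phi>K w(1)] \<phi>c[OF w(1)] Suc by (auto simp: coboundaries_def)
  qed
  have \<phi>ZK: "\<phi> c z \<in> BK" if z: "z \<in> ZK" for z
  proof -
    have zc: "z \<in> carrier (K c)" "pr z \<in> carrier (K c)" "msub R (E c) z (pr z) \<in> carrier (K c)"
      using ZKD(1)[OF z] ZKD(1)[OF pr_ZK[OF z]] BKc[OF pr_diff[OF ZKD(1)[OF z]]] by auto
    have "z = msub R (E c) z (pr z) \<oplus>\<^bsub>K c\<^esub> pr z" using msub_alg(2)[OF module_K zc(1,2)] by simp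
    then have "\<phi> c z = \<phi> c (msub R (E c) z (pr z)) \<oplus>\<^bsub>K c\<^esub> \<phi> c (pr z)"
      using linear_add[OF \<phi>l zc(3,2)] by simp
    then show ?thesis
      using submodule_rules(3)[OF sub_BK module_K] \<phi>BK[OF pr_diff[OF zc(1)]] BL_BK[OF zero[OF pr_ZL[OF z]]]
      by simp
  qed
  \<comment> \<open>This is \<phi> minus the part \<open>d s \<phi>\<close> supplied by the homotopy
    from below \<open>c\<close>. It vanishes on cocycles because \<phi> sends them to coboundaries,
    which \<open>pr\<close> kills.\<close>
  let ?g = "\<lambda>z. pr (\<phi> c z)"
  have gl: "linear_map R (K c) (K c) ?g" by (rule linear_comp[OF \<phi>l pr_linear])
  have dfb: "d c (from_below K d s c y) = \<zero>\<^bsub>E (Suc c)\<^esub>" if "y \<in> carrier (K c)" for y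
    using complexD(3)[OF complex_K] linear_closed[OF s_linear] that linear_zero[OF lin module_K module_K, of 0]
    by (cases c) (auto simp: from_below_def)
  have gd: "d c (?g z) = d c (\<phi> c z)" if z: "z \<in> carrier (K c)" for z
    using linear_msub[OF lin module_K \<phi>c[OF z] linear_closed[OF ds_linear \<phi>c[OF z]]] dfb[OF \<phi>c[OF z]]
      mod_simps(7)[OF module_K dc[OF \<phi>c[OF z]]] by (simp add: pr_def)
  obtain h where h: "\<And>i. c \<le> i \<Longrightarrow> linear_map R (K (Suc i)) (K i) (h i)"
    "\<And>x. x \<in> carrier (K c) \<Longrightarrow> h c (d c x) = ?g x"
    "\<And>i x. c \<le> i \<Longrightarrow> x \<in> carrier (K (Suc i)) \<Longrightarrow>
      \<phi> (Suc i) x = h (Suc i) (d (Suc i) x) \<oplus>\<^bsub>K (Suc i)\<^esub> d i (h i x)"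
  proof (rule homotopy_extends[OF complex_K complex_K baer_K exact_J \<phi>K gl gd])
    fix z assume "z \<in> ZK"
    then show "?g z = \<zero>\<^bsub>K c\<^esub>" using pr_BK[OF \<phi>ZK] by simp
  qed (simp, assumption, rule that)
  \<comment> \<open>Below \<open>c\<close> the contraction composed with \<phi> is a homotopy; from
    \<open>c\<close> on it is continued by the extension started with \<open>?g\<close>.\<close>
  define h' where "h' i = (if i < c then (\<lambda>x. s i (\<phi> (Suc i) x)) else h i)" for i
  have h'l: "linear_map R (K (Suc i)) (K i) (h' i)" for i
    using h(1)[of i] linear_comp[OF \<phi>l s_linear[of i]] by (simp add: h'_def)
  have "\<phi> i x = h' i (d i x) \<oplus>\<^bsub>E i\<^esub> from_below K d h' i x" if x: "x \<in> carrier (K i)" for i x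
  proof (cases "i < c")
    case True
    have "from_below K d h' i x = from_below K d s i (\<phi> i x)"
      using True by (cases i) (auto simp: from_below_def h'_def)
    then show ?thesis
      using s_contraction[OF True \<phi>c[OF x]] chain_mapD(2)[OF \<phi>K x] True by (simp add: h'_def)
  next
    case False
    show ?thesis
    proof (cases "i = c")
      case True
      have "from_below K d h' c x = from_below K d s c (\<phi> c x)"
        by (cases c) (auto simp: from_below_def h'_def)
      moreover have "?g x \<oplus>\<^bsub>K c\<^esub> from_below K d s c (\<phi> c x) = \<phi> c x"
      proof -
        have y: "\<phi> c x \<in> carrier (K c)" using \<phi>c x True by simp
        show ?thesis
          using msub_alg(2)[OF module_K y linear_closed[OF ds_linear y]] by (simp add: pr_def)
      qed
      ultimately show ?thesis using h(2)[of x] x True by (simp add: h'_def)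
    next
      case ne: False
      then obtain j where j: "i = Suc j" "c \<le> j" using False by (cases i) auto
      then show ?thesis using h(3)[of j x] x by (simp add: from_below_def h'_def)
    qed
  qed
  then have hE: "\<And>i x. x \<in> carrier (K i) \<Longrightarrow> \<phi> i x = h' i (d i x) \<oplus>\<^bsub>E i\<^esub> from_below E d h' i x"
    by (simp add: from_below_def split: nat.split)
  have h'E: "linear_map R (K (Suc i)) (E i) (h' i)" for i
  proof (rule linear_codomain')
    show "linear_map R (K (Suc i)) (E i\<lparr>carrier := carrier (K i)\<rparr>) (h' i)"
      using h'l[of i] by (simp add: torsion_part_def)
    show "carrier (K i) \<subseteq> carrier (E i)" using K_E by blast
  qed
  have null: "null_homotopic R K d E d \<phi>"
    unfolding null_homotopic_def using hE h'E by blast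
  obtain xs where xs: "set xs \<subseteq> carrier R" "set xs \<subseteq> J" "J = Idl (set xs)"
    using ideal_generators_list[OF J] by metis
  have Jm: "J \<subseteq> \<mm>" by (rule proper_ideal_le_max[OF J J_proper])
  show ?thesis
  proof (rule null_homotopic_from_iter_tors[OF _ xs(1) complex_E baer_E \<phi>])
    show "telescoping R E d x" if "x \<in> set xs" for x
      by (rule telescoping_E) (use that xs(2) Jm in blast)
    show "null_homotopic R (\<lambda>i. iter_tors R xs (E i)) d E d \<phi>"
      using null unfolding xs(3) torsion_part_iter[OF module_E xs(1)] .
  qed
qed

end

section \<open>Combinations of chain maps, and quotient modules\<close>

context noetherian_cring
begin

lemma chain_map_sum:
  assumes "chain_map R C d D d' \<phi>" "chain_map R C d D d' \<psi>" "complex R C d" "complex R D d'"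
  shows "chain_map R C d D d' (\<lambda>i x. \<phi> i x \<oplus>\<^bsub>D i\<^esub> \<psi> i x)"
  unfolding chain_map_def
proof (intro conjI allI ballI)
  show "linear_map R (C i) (D i) (\<lambda>x. \<phi> i x \<oplus>\<^bsub>D i\<^esub> \<psi> i x)" for i
    by (rule linear_sum[OF chain_mapD(1)[OF assms(1)] chain_mapD(1)[OF assms(2)]
        complexD(1)[OF assms(3)] complexD(1)[OF assms(4)]])
  show "\<phi> (Suc i) (d i x) \<oplus>\<^bsub>D (Suc i)\<^esub> \<psi> (Suc i) (d i x) = d' i (\<phi> i x \<oplus>\<^bsub>D i\<^esub> \<psi> i x)"
    if x: "x \<in> carrier (C i)" for i x
    using chain_mapD(2,3)[OF assms(1) x] chain_mapD(2,3)[OF assms(2) x]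
    by (simp add: linear_add[OF complexD(2)[OF assms(4)]])
qed

lemma chain_map_scale:
  assumes "chain_map R C d D d' \<phi>" "complex R D d'" "r \<in> carrier R"
  shows "chain_map R C d D d' (\<lambda>i x. r \<odot>\<^bsub>D i\<^esub> \<phi> i x)"
  unfolding chain_map_def
proof (intro conjI allI ballI)
  show "linear_map R (C i) (D i) (\<lambda>x. r \<odot>\<^bsub>D i\<^esub> \<phi> i x)" for i
    by (rule linear_scale[OF chain_mapD(1)[OF assms(1)] complexD(1)[OF assms(2)] assms(3)])
  show "r \<odot>\<^bsub>D (Suc i)\<^esub> \<phi> (Suc i) (d i x) = d' i (r \<odot>\<^bsub>D i\<^esub> \<phi> i x)"
    if x: "x \<in> carrier (C i)" for i x
    using chain_mapD(2,3)[OF assms(1) x] assms(3)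
    by (simp add: linear_smult[OF complexD(2)[OF assms(2)]])
qed

lemma chain_map_diff:
  assumes "chain_map R C d D d' \<phi>" "chain_map R C d D d' \<psi>" "complex R C d" "complex R D d'"
  shows "chain_map R C d D d' (\<lambda>i x. msub R (D i) (\<phi> i x) (\<psi> i x))"
  unfolding msub_def by (intro chain_map_sum[OF assms(1) chain_map_scale[OF assms(2,4)] assms(3,4)]) simp

lemma quot_module_module:
  assumes A: "module R (A :: ('r, 'a) module)" and N: "submodule N R A"
  shows "module R (quot_module A N)"
proof (rule moduleI[OF is_cring])
  note q = quot_module_simps[of A N] and add = coset_add[OF A N] and mult = coset_smult[OF A N]
  have N0: "N = N +>\<^bsub>A\<^esub> \<zero>\<^bsub>A\<^esub>"
    using coset_zero[OF A N, of "\<zero>\<^bsub>A\<^esub>"] submodule_rules(2)[OF N A] A by simp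
  show "abelian_group (quot_module A N)"
  proof (rule abelian_groupI)
    show "\<zero>\<^bsub>quot_module A N\<^esub> \<in> carrier (quot_module A N)"
      unfolding q using N0 A by (intro CollectI exI[of _ "\<zero>\<^bsub>A\<^esub>"]) simp
    fix x assume "x \<in> carrier (quot_module A N)"
    then obtain u where u: "u \<in> carrier A" "x = N +>\<^bsub>A\<^esub> u" unfolding q by blast
    have "x = N +>\<^bsub>A\<^esub> \<zero>\<^bsub>A\<^esub> <+>\<^bsub>A\<^esub> x" using u A by (simp add: add)
    then show "\<zero>\<^bsub>quot_module A N\<^esub> \<oplus>\<^bsub>quot_module A N\<^esub> x = x" unfolding q using N0 by simp
    have "(\<ominus> \<one>) \<odot>\<^bsub>A\<^esub> u \<oplus>\<^bsub>A\<^esub> u = \<zero>\<^bsub>A\<^esub>"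
      using mod_simps(6)[OF A u(1)] mod_ac(1)[OF A u(1), of "(\<ominus> \<one>) \<odot>\<^bsub>A\<^esub> u"] u A by (simp add: msub_def)
    then have "N +>\<^bsub>A\<^esub> ((\<ominus> \<one>) \<odot>\<^bsub>A\<^esub> u) <+>\<^bsub>A\<^esub> x = N" using u A N0 by (simp add: add)
    then show "\<exists>y\<in>carrier (quot_module A N). y \<oplus>\<^bsub>quot_module A N\<^esub> x = \<zero>\<^bsub>quot_module A N\<^esub>"
      unfolding q using u A by (intro bexI[of _ "N +>\<^bsub>A\<^esub> ((\<ominus> \<one>) \<odot>\<^bsub>A\<^esub> u)"]) auto
    fix y assume "y \<in> carrier (quot_module A N)"
    then obtain v where v: "v \<in> carrier A" "y = N +>\<^bsub>A\<^esub> v" unfolding q by blast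
    show "x \<oplus>\<^bsub>quot_module A N\<^esub> y \<in> carrier (quot_module A N)"
      unfolding q u(2) v(2) add[OF u(1) v(1)] using u(1) v(1) A by blast
    show "x \<oplus>\<^bsub>quot_module A N\<^esub> y = y \<oplus>\<^bsub>quot_module A N\<^esub> x"
      unfolding q u(2) v(2) add[OF u(1) v(1)] add[OF v(1) u(1)] using mod_ac(1)[OF A u(1) v(1)] by simp
    fix z assume "z \<in> carrier (quot_module A N)"
    then obtain w where w: "w \<in> carrier A" "z = N +>\<^bsub>A\<^esub> w" unfolding q by blast
    show "x \<oplus>\<^bsub>quot_module A N\<^esub> y \<oplus>\<^bsub>quot_module A N\<^esub> z = x \<oplus>\<^bsub>quot_module A N\<^esub> (y \<oplus>\<^bsub>quot_module A N\<^esub> z)"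
      unfolding q u(2) v(2) w(2) using u(1) v(1) w(1) A by (simp add: add mod_ac(2)[OF A])
  qed
next
  note q = quot_module_simps[of A N] and add = coset_add[OF A N] and mult = coset_smult[OF A N]
  fix a x assume a: "a \<in> carrier R" and "x \<in> carrier (quot_module A N)"
  then obtain u where u: "u \<in> carrier A" "x = N +>\<^bsub>A\<^esub> u" unfolding q by blast
  show "a \<odot>\<^bsub>quot_module A N\<^esub> x \<in> carrier (quot_module A N)"
    unfolding q u(2) mult[OF u(1) a] using u(1) a A by blast
  fix b assume b: "b \<in> carrier R"
  show "(a \<oplus> b) \<odot>\<^bsub>quot_module A N\<^esub> x = a \<odot>\<^bsub>quot_module A N\<^esub> x \<oplus>\<^bsub>quot_module A N\<^esub> b \<odot>\<^bsub>quot_module A N\<^esub> x"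
    unfolding q u(2) using u(1) a b A by (simp add: add mult mod_distr)
  show "(a \<otimes> b) \<odot>\<^bsub>quot_module A N\<^esub> x = a \<odot>\<^bsub>quot_module A N\<^esub> (b \<odot>\<^bsub>quot_module A N\<^esub> x)"
    unfolding q u(2) using u(1) a b A by (simp add: mult mod_distr)
next
  note q = quot_module_simps[of A N] and add = coset_add[OF A N] and mult = coset_smult[OF A N]
  fix a x y assume a: "a \<in> carrier R" and "x \<in> carrier (quot_module A N)" "y \<in> carrier (quot_module A N)"
  then obtain u v where u: "u \<in> carrier A" "x = N +>\<^bsub>A\<^esub> u" and v: "v \<in> carrier A" "y = N +>\<^bsub>A\<^esub> v"
    unfolding q by blast
  show "a \<odot>\<^bsub>quot_module A N\<^esub> (x \<oplus>\<^bsub>quot_module A N\<^esub> y) =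
      a \<odot>\<^bsub>quot_module A N\<^esub> x \<oplus>\<^bsub>quot_module A N\<^esub> a \<odot>\<^bsub>quot_module A N\<^esub> y"
    unfolding q u(2) v(2) using u(1) v(1) a A by (simp add: add mult mod_distr)
next
  note q = quot_module_simps[of A N] and mult = coset_smult[OF A N]
  fix x assume "x \<in> carrier (quot_module A N)"
  then obtain u where u: "u \<in> carrier A" "x = N +>\<^bsub>A\<^esub> u" unfolding q by blast
  show "\<one> \<odot>\<^bsub>quot_module A N\<^esub> x = x"
    unfolding q u(2) using u(1) A by (simp add: mult)
qed

lemma coset_linear:
  assumes A: "module R (A :: ('r, 'a) module)" and N: "submodule N R A"
  shows "linear_map R A (quot_module A N) (\<lambda>z. N +>\<^bsub>A\<^esub> z)"
  by (rule linear_mapI) (auto simp: quot_module_simps coset_add[OF A N] coset_smult[OF A N])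

end

section \<open>The natural map on endomorphisms and its bijectivity\<close>

context torsion_ideals
begin

abbreviation A where "A \<equiv> (E c)\<lparr>carrier := ZL\<rparr>"
abbreviation H where "H \<equiv> local_cohomology R I X c"
abbreviation cls where "cls z \<equiv> BL +>\<^bsub>E c\<^esub> z"

lemma H_def: "H = quot_module A BL"
  by (simp add: local_cohomology_def cohomology_def)

lemma module_A: "module R A"
  using submodule_mod[OF sub_ZL complexD(1)[OF complex_L]] by simp

lemma sub_BL_A: "submodule BL R A"
  using coboundaries_submodule_cocycles[OF complex_L] by simp

lemma module_H: "module R H"
  unfolding H_def by (rule quot_module_module[OF module_A sub_BL_A])

lemma cls_linear: "linear_map R A H cls"
  unfolding H_def using coset_linear[OF module_A sub_BL_A] by simp

lemma carrier_H: "carrier H = {cls z | z. z \<in> ZL}"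
  unfolding H_def quot_module_simps by simp

lemma cls_eq: "z \<in> ZL \<Longrightarrow> z' \<in> ZL \<Longrightarrow> cls z = cls z' \<longleftrightarrow> msub R (E c) z z' \<in> BL"
  using coset_eq_iff[OF module_A sub_BL_A, of z z'] by simp

lemma cls_pr: "z \<in> ZL \<Longrightarrow> cls (pr z) = cls z"
proof -
  assume z: "z \<in> ZL"
  have "cls z = cls (pr z)"
    using cls_eq[OF z pr_ZL[OF ZL_ZK[OF z]]] pr_diff_L[OF ZLD(1)[OF z]] by simp
  then show ?thesis by simp
qed

text \<open>Makes the choice of a lift in \<open>local_cohomology_map\<close> immaterial: two lifts
  differ by a null-homotopic map, and such a map sends torsion cocycles to coboundaries of torsion
  elements.\<close>

lemma lift_unique:
  assumes \<phi>: "chain_map R E d E d \<phi>" and \<psi>: "chain_map R E d E d \<psi>"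
    and eq: "\<And>x. x \<in> carrier M \<Longrightarrow> \<phi> 0 (aug x) = \<psi> 0 (aug x)" and z: "z \<in> ZL"
  shows "cls (\<phi> c z) = cls (\<psi> c z)"
proof -
  have "null_homotopic R E d E d (\<lambda>i x. msub R (E i) (\<phi> i x) (\<psi> i x))"
  proof (rule null_homotopic_lift[OF chain_map_diff[OF \<phi> \<psi> complex_E complex_E]])
    fix x assume x: "x \<in> carrier M"
    show "msub R (E 0) (\<phi> 0 (aug x)) (\<psi> 0 (aug x)) = \<zero>\<^bsub>E 0\<^esub>"
      unfolding eq[OF x] by (rule mod_simps(6)[OF module_E chain_mapD(3)[OF \<psi> linear_closed[OF aug_linear x]]])
  qed
  then have "msub R (E c) (\<phi> c z) (\<psi> c z) \<in> BL" by (rule null_homotopic_coboundary[OF _ I z])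
  then show ?thesis using cls_eq[OF chain_map_ZL[OF \<phi> z] chain_map_ZL[OF \<psi> z]] by simp
qed

lemma local_cohomology_map_cls:
  assumes f: "linear_map R M M f" and \<psi>: "chain_map R E d E d \<psi>"
    and lift: "\<forall>x\<in>carrier M. \<psi> 0 (aug x) = aug (f x)" and z: "z \<in> ZL"
  shows "local_cohomology_map R I M X X c f (cls z) = cls (\<psi> c z)"
proof -
  define \<phi> where "\<phi> = (SOME \<phi>. resolution_lift R M X X f \<phi>)"
  \<comment> \<open>A resolution lift consists of extensional maps, so \<psi> is cut down to the
    carriers before it can witness that a lift exists.\<close>
  have "resolution_lift R M X X f (\<lambda>i. restrict (\<psi> i) (carrier (E i)))"
    unfolding resolution_lift_def
  proof (intro conjI allI ballI)
    show "restrict (\<psi> i) (carrier (E i)) \<in> mod_hom R (E i) (E i)" for i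
      by (rule restrict_mod_hom[OF chain_mapD(1)[OF \<psi>] module_E])
    show "restrict (\<psi> (Suc i)) (carrier (E (Suc i))) (d i x) = d i (restrict (\<psi> i) (carrier (E i)) x)"
      if "x \<in> carrier (E i)" for i x
      using chain_mapD(2)[OF \<psi> that] complexD(4)[OF complex_E that] that by simp
    show "restrict (\<psi> 0) (carrier (E 0)) (aug x) = aug (f x)" if "x \<in> carrier M" for x
      using bspec[OF lift that] linear_closed[OF aug_linear that] by simp
  qed
  then have "resolution_lift R M X X f \<phi>" unfolding \<phi>_def by (rule someI[where P = "resolution_lift R M X X f"])
  then have \<phi>: "chain_map R E d E d \<phi>" and \<phi>0: "\<And>x. x \<in> carrier M \<Longrightarrow> \<phi> 0 (aug x) = aug (f x)"
    unfolding resolution_lift_def chain_map_def by (auto intro: mod_hom_linear)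
  have "cls z \<in> carrier H" using z carrier_H by blast
  then have "local_cohomology_map R I M X X c f (cls z) = (\<Union>x\<in>cls z. cls (\<phi> c x))"
    by (simp add: local_cohomology_map_def \<phi>_def Let_def)
  also have "\<dots> = cls (\<phi> c z)"
  proof -
    have "cls (\<phi> c y) = cls (\<phi> c z)" if y: "y \<in> cls z" for y
    proof -
      have yZ: "y \<in> ZL" using coset_subset[OF module_A sub_BL_A, of z y] y z by simp
      have "msub R (E c) y z \<in> BL" using coset_mem_iff[OF module_A sub_BL_A, of z y] y z yZ by simp
      then have "\<phi> c (msub R (E c) y z) \<in> BL" by (rule chain_map_BL[OF \<phi>])
      then have "msub R (E c) (\<phi> c y) (\<phi> c z) \<in> BL"
        using linear_msub[OF chain_mapD(1)[OF \<phi>] module_E ZLD(3)[OF yZ] ZLD(3)[OF z]] by simp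
      then show ?thesis using cls_eq[OF chain_map_ZL[OF \<phi> yZ] chain_map_ZL[OF \<phi> z]] by simp
    qed
    then show ?thesis using coset_Union[OF module_A sub_BL_A, of z "\<lambda>y. cls (\<phi> c y)"] z by simp
  qed
  also have "\<dots> = cls (\<psi> c z)"
    by (rule lift_unique[OF \<phi> \<psi> _ z]) (simp add: \<phi>0 lift)
  finally show ?thesis .
qed

lemma local_cohomology_map_hom:
  assumes f: "linear_map R M M f"
  shows "local_cohomology_map R I M X X c f \<in> mod_hom R H H"
proof -
  obtain \<psi> where \<psi>: "chain_map R E d E d \<psi>" "\<forall>x\<in>carrier M. \<psi> 0 (aug x) = aug (f x)"
    by (rule lift_exists[OF f]) (rule that, assumption, rule ballI)
  note eq = local_cohomology_map_cls[OF f \<psi>]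
  have \<psi>l: "linear_map R A A (\<psi> c)"
    using chain_mapD(1)[OF \<psi>(1), of c] chain_map_ZL[OF \<psi>(1)] ZLD(3)
    by (intro linear_codomain linear_domain) auto
  have comp: "linear_map R A H (\<lambda>z. cls (\<psi> c z))" by (rule linear_comp[OF \<psi>l cls_linear])
  have "linear_map R H H (local_cohomology_map R I M X X c f)"
  proof (rule linear_mapI)
    fix C assume "C \<in> carrier H"
    then obtain z where z: "z \<in> ZL" "C = cls z" unfolding carrier_H by blast
    show "local_cohomology_map R I M X X c f C \<in> carrier H"
      unfolding z(2) eq[OF z(1)] using linear_closed[OF comp] z(1) by simp
    show "local_cohomology_map R I M X X c f (r \<odot>\<^bsub>H\<^esub> C) = r \<odot>\<^bsub>H\<^esub> local_cohomology_map R I M X X c f C"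
      if r: "r \<in> carrier R" for r
    proof -
      have "r \<odot>\<^bsub>H\<^esub> C = cls (r \<odot>\<^bsub>E c\<^esub> z)" using linear_smult[OF cls_linear r] z by simp
      moreover have "r \<odot>\<^bsub>E c\<^esub> z \<in> ZL" using mod_closed(3)[OF module_A r] z(1) by simp
      ultimately show ?thesis using eq z linear_smult[OF comp r] by simp
    qed
    fix D assume "D \<in> carrier H"
    then obtain y where y: "y \<in> ZL" "D = cls y" unfolding carrier_H by blast
    have "C \<oplus>\<^bsub>H\<^esub> D = cls (z \<oplus>\<^bsub>E c\<^esub> y)" using linear_add[OF cls_linear] z y by simp
    moreover have "z \<oplus>\<^bsub>E c\<^esub> y \<in> ZL" using mod_closed(1)[OF module_A] z(1) y(1) by simp
    ultimately show "local_cohomology_map R I M X X c f (C \<oplus>\<^bsub>H\<^esub> D) =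
        local_cohomology_map R I M X X c f C \<oplus>\<^bsub>H\<^esub> local_cohomology_map R I M X X c f D"
      using eq z y linear_add[OF comp] by simp
  qed
  moreover have "local_cohomology_map R I M X X c f \<in> extensional (carrier H)"
    by (simp add: local_cohomology_map_def Let_def)
  ultimately show ?thesis by (simp add: mod_hom_iff)
qed

text \<open>The difference of the two lifts is null-homotopic on all of \<open>E\<close>. In degree
  0 it therefore factors through the differential, which vanishes on the image of
  \<open>M\<close>.\<close>

lemma local_cohomology_map_inj:
  assumes f: "linear_map R M M f" and g: "linear_map R M M g"
    and eq: "\<And>z. z \<in> ZL \<Longrightarrow> local_cohomology_map R I M X X c f (cls z) = local_cohomology_map R I M X X c g (cls z)"
    and x: "x \<in> carrier M"
  shows "f x = g x"
proof -
  obtain \<phi> where \<phi>: "chain_map R E d E d \<phi>" "\<forall>x\<in>carrier M. \<phi> 0 (aug x) = aug (f x)"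
    by (rule lift_exists[OF f]) (rule that, assumption, rule ballI)
  obtain \<psi> where \<psi>: "chain_map R E d E d \<psi>" "\<forall>x\<in>carrier M. \<psi> 0 (aug x) = aug (g x)"
    by (rule lift_exists[OF g]) (rule that, assumption, rule ballI)
  have "null_homotopic R E d E d (\<lambda>i x. msub R (E i) (\<phi> i x) (\<psi> i x))"
  proof (rule null_homotopic_from_cohomology[OF chain_map_diff[OF \<phi>(1) \<psi>(1) complex_E complex_E]])
    fix z assume z: "z \<in> ZL"
    have "cls (\<phi> c z) = cls (\<psi> c z)"
      using eq[OF z] local_cohomology_map_cls[OF f \<phi> z] local_cohomology_map_cls[OF g \<psi> z] by simp
    then show "msub R (E c) (\<phi> c z) (\<psi> c z) \<in> BL"
      using cls_eq[OF chain_map_ZL[OF \<phi>(1) z] chain_map_ZL[OF \<psi>(1) z]] by simp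
  qed
  then obtain h where h: "\<And>i. linear_map R (E (Suc i)) (E i) (h i)"
    "\<And>i x. x \<in> carrier (E i) \<Longrightarrow>
      msub R (E i) (\<phi> i x) (\<psi> i x) = h i (d i x) \<oplus>\<^bsub>E i\<^esub> from_below E d h i x"
    unfolding null_homotopic_def by blast
  have ax: "aug x \<in> carrier (E 0)" by (rule linear_closed[OF aug_linear x])
  have "msub R (E 0) (aug (f x)) (aug (g x)) = h 0 (d 0 (aug x)) \<oplus>\<^bsub>E 0\<^esub> \<zero>\<^bsub>E 0\<^esub>"
    using h(2)[OF ax] \<phi>(2) \<psi>(2) x by (simp add: from_below_def)
  also have "\<dots> = \<zero>\<^bsub>E 0\<^esub>"
    using aug_cocycle[OF x] linear_zero[OF h(1) module_E module_E, of 0] module_E[of 0] by simp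
  finally have "aug (f x) = aug (g x)"
    using msub_alg(1)[OF module_E linear_closed[OF aug_linear linear_closed[OF f x]]
        linear_closed[OF aug_linear linear_closed[OF g x]]] by simp
  then show ?thesis using aug_eq linear_closed[OF f x] linear_closed[OF g x] by blast
qed

text \<open>The cohomology is a summand of the cocycles of \<open>K\<close>, so \<open>g\<close>
  acts on these and extends to a chain map on \<open>K\<close>. Completeness extends it further to
  \<open>E\<close>, where the cocycles in degree 0 are \<open>M\<close>.\<close>

lemma local_cohomology_map_surj:
  assumes g: "linear_map R H H g"
  obtains f where "linear_map R M M f"
    "\<And>z. z \<in> ZL \<Longrightarrow> local_cohomology_map R I M X X c f (cls z) = g (cls z)"
proof -
  define rep where "rep C = (SOME y. y \<in> ZL \<and> C = cls y)" for C
  have rep: "rep C \<in> ZL" "cls (rep C) = C" if C: "C \<in> carrier H" for C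
  proof -
    have "\<exists>y. y \<in> ZL \<and> C = cls y" using C unfolding carrier_H by blast
    then have "rep C \<in> ZL \<and> C = cls (rep C)" unfolding rep_def by (rule someI_ex)
    then show "rep C \<in> ZL" "cls (rep C) = C" by auto
  qed
  \<comment> \<open>As \<open>pr\<close> kills coboundaries, the value does not depend on the
    representative; \<open>q\<close> is a linear section of the passage to classes.\<close>
  define q where "q C = pr (rep C)" for C
  have pr_A: "linear_map R A (K c) pr"
    using linear_domain[OF pr_linear, of ZL] ZLD(2) by (auto simp: torsion_part_def)
  have q_cls: "q (cls y) = pr y" if y: "y \<in> ZL" for y
  proof -
    have C: "cls y \<in> carrier H" using y carrier_H by blast
    have "msub R (E c) (rep (cls y)) y \<in> BL" using cls_eq[OF rep(1)[OF C] y] rep(2)[OF C] by simp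
    then have "pr (msub R (E c) (rep (cls y)) y) = \<zero>\<^bsub>E c\<^esub>" using pr_BK BL_BK by blast
    then have "msub R (K c) (pr (rep (cls y))) (pr y) = \<zero>\<^bsub>K c\<^esub>"
      using linear_msub[OF pr_A module_A, of "rep (cls y)" y] rep(1)[OF C] y by simp
    then show ?thesis
      using msub_alg(1)[OF module_K, of "pr (rep (cls y))" c "pr y"] rep(1)[OF C] y
        linear_closed[OF pr_A] by (simp add: q_def)
  qed
  have q_lin: "linear_map R H (K c) q"
  proof (rule linear_mapI)
    fix C assume "C \<in> carrier H"
    then obtain z where z: "z \<in> ZL" "C = cls z" unfolding carrier_H by blast
    show "q C \<in> carrier (K c)" unfolding z(2) q_cls[OF z(1)] using linear_closed[OF pr_A] z(1) by simp
    show "q (r \<odot>\<^bsub>H\<^esub> C) = r \<odot>\<^bsub>K c\<^esub> q C" if r: "r \<in> carrier R" for r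
    proof -
      have "r \<odot>\<^bsub>H\<^esub> C = cls (r \<odot>\<^bsub>E c\<^esub> z)" using linear_smult[OF cls_linear r] z by simp
      moreover have "r \<odot>\<^bsub>E c\<^esub> z \<in> ZL" using mod_closed(3)[OF module_A r] z(1) by simp
      ultimately show ?thesis using q_cls z linear_smult[OF pr_A r] by simp
    qed
    fix D assume "D \<in> carrier H"
    then obtain y where y: "y \<in> ZL" "D = cls y" unfolding carrier_H by blast
    have "C \<oplus>\<^bsub>H\<^esub> D = cls (z \<oplus>\<^bsub>E c\<^esub> y)" using linear_add[OF cls_linear] z y by simp
    moreover have "z \<oplus>\<^bsub>E c\<^esub> y \<in> ZL" using mod_closed(1)[OF module_A] z(1) y(1) by simp
    ultimately show "q (C \<oplus>\<^bsub>H\<^esub> D) = q C \<oplus>\<^bsub>K c\<^esub> q D"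
      using q_cls z y linear_add[OF pr_A] by simp
  qed
  let ?ZK = "(K c)\<lparr>carrier := ZK\<rparr>"
  have pr_ZA: "linear_map R ?ZK A pr"
  proof -
    have "linear_map R ?ZK (K c) pr" using linear_domain[OF pr_linear, of ZK] ZKD(1) by blast
    then have "linear_map R ?ZK ((K c)\<lparr>carrier := ZL\<rparr>) pr"
      by (rule linear_codomain) (use pr_ZL in simp)
    then show ?thesis by simp
  qed
  \<comment> \<open>The endomorphism of the cocycles of \<open>K\<close> that is \<open>g\<close> on
    the summand and zero on the coboundaries.\<close>
  define \<Psi> where "\<Psi> z = q (g (cls (pr z)))" for z
  have \<Psi>l: "linear_map R ?ZK (K c) \<Psi>"
    unfolding \<Psi>_def by (rule linear_comp[OF linear_comp[OF linear_comp[OF pr_ZA cls_linear] g] q_lin])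
  have gc: "g (cls (pr z)) \<in> carrier H" if "z \<in> ZK" for z
    using linear_closed[OF g] pr_ZL[OF that] carrier_H by blast
  have \<Psi>ZL: "\<Psi> z \<in> ZL" "cls (\<Psi> z) = g (cls (pr z))" if z: "z \<in> ZK" for z
  proof -
    show "\<Psi> z \<in> ZL" unfolding \<Psi>_def q_def using pr_ZL ZL_ZK rep(1)[OF gc[OF z]] by blast
    show "cls (\<Psi> z) = g (cls (pr z))"
      unfolding \<Psi>_def q_def using cls_pr[OF rep(1)[OF gc[OF z]]] rep(2)[OF gc[OF z]] by simp
  qed
  obtain \<Phi> where \<Phi>: "linear_map R (K c) (K c) \<Phi>" "\<And>z. z \<in> ZK \<Longrightarrow> \<Phi> z = \<Psi> z"
    by (rule baer_extend_submodule[OF baer_K module_K sub_ZK \<Psi>l]) (rule that)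
  \<comment> \<open>Possible because \<Phi> takes cocycles to cocycles and kills coboundaries, so
    zero maps can be used below \<open>c\<close>.\<close>
  obtain \<psi> where \<psi>: "chain_map R K d K d \<psi>" "\<psi> c = \<Phi>"
  proof (rule chain_map_extends[OF complex_K complex_K baer_K exact_J \<Phi>(1)])
    show "i \<noteq> c" if "c < i" for i using that by simp
    show "d c (\<Phi> x) = \<zero>\<^bsub>K (Suc c)\<^esub>" if "x \<in> ZK" for x
      using ZKD(2)[OF ZL_ZK[OF \<Psi>ZL(1)[OF that]]] \<Phi>(2)[OF that] by simp
    show "\<Phi> (d j x) = \<zero>\<^bsub>K c\<^esub>" if j: "c = Suc j" and x: "x \<in> carrier (K j)" for j x
    proof -
      have dB: "d j x \<in> BK" using x j by (auto simp: coboundaries_def)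
      then have dZ: "d j x \<in> ZK" using BK_ZK by blast
      have "cls (pr (d j x)) = \<zero>\<^bsub>H\<^esub>"
        using linear_zero[OF cls_linear module_A module_H] pr_BK[OF dB] by simp
      then have "\<Psi> (d j x) = q (g \<zero>\<^bsub>H\<^esub>)" by (simp add: \<Psi>_def)
      then show ?thesis
        using \<Phi>(2)[OF dZ] linear_zero[OF g module_H module_H] linear_zero[OF q_lin module_H module_K] by simp
    qed
  qed (rule that)
  have \<psi>E: "chain_map R K d E d \<psi>"
  proof -
    have "linear_map R (K i) (E i) (\<psi> i)" for i
    proof (rule linear_codomain')
      show "linear_map R (K i) (E i\<lparr>carrier := carrier (K i)\<rparr>) (\<psi> i)"
        using chain_mapD(1)[OF \<psi>(1), of i] by (simp add: torsion_part_def)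
      show "carrier (K i) \<subseteq> carrier (E i)" using K_E by blast
    qed
    then show ?thesis using chain_mapD(2)[OF \<psi>(1)] by (simp add: chain_map_def)
  qed
  obtain xs where xs: "set xs \<subseteq> carrier R" "set xs \<subseteq> J" "J = Idl (set xs)"
    using ideal_generators_list[OF J] by metis
  have Jm: "J \<subseteq> \<mm>" by (rule proper_ideal_le_max[OF J J_proper])
  have tel: "telescoping R E d x" if "x \<in> set xs" for x
    by (rule telescoping_E) (use that xs(2) Jm in blast)
  have "chain_map R (\<lambda>i. iter_tors R xs (E i)) d E d \<psi>"
    using \<psi>E unfolding xs(3) torsion_part_iter[OF module_E xs(1)] .
  then obtain \<phi> where \<phi>: "chain_map R E d E d \<phi>"
    "\<And>i q. q \<in> carrier (iter_tors R xs (E i)) \<Longrightarrow> \<phi> i q = \<psi> i q"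
    using chain_map_extends_from_iter_tors[OF tel xs(1) complex_E baer_E] by blast
  have \<phi>K: "\<phi> i z = \<psi> i z" if "z \<in> carrier (K i)" for i z
    using \<phi>(2) that unfolding xs(3) torsion_part_iter[OF module_E xs(1)] .
  \<comment> \<open>A chain map of the resolution preserves the kernel of the first differential,
    and that kernel is the image of \<open>M\<close>.\<close>
  define f where "f x = (THE y. y \<in> carrier M \<and> aug y = \<phi> 0 (aug x))" for x
  have f: "f x \<in> carrier M" "aug (f x) = \<phi> 0 (aug x)" if x: "x \<in> carrier M" for x
  proof -
    have ax: "aug x \<in> carrier (E 0)" by (rule linear_closed[OF aug_linear x])
    have "d 0 (\<phi> 0 (aug x)) = \<zero>\<^bsub>E (Suc 0)\<^esub>"
      using chain_mapD(2)[OF \<phi>(1) ax] aug_cocycle[OF x] linear_zero[OF chain_mapD(1)[OF \<phi>(1)] module_E module_E, of "Suc 0"]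
      by simp
    then have "\<phi> 0 (aug x) \<in> cocycles E d 0" using chain_mapD(3)[OF \<phi>(1) ax] by (simp add: cocycles_def)
    then obtain m where "m \<in> carrier M" "aug m = \<phi> 0 (aug x)" by (rule cocycle_aug) simp
    then have "\<exists>!y. y \<in> carrier M \<and> aug y = \<phi> 0 (aug x)" using aug_eq by metis
    then have "f x \<in> carrier M \<and> aug (f x) = \<phi> 0 (aug x)" unfolding f_def by (rule theI')
    then show "f x \<in> carrier M" "aug (f x) = \<phi> 0 (aug x)" by auto
  qed
  note \<phi>0 = linear_comp[OF aug_linear chain_mapD(1)[OF \<phi>(1)]]
  have fl: "linear_map R M M f"
  proof (rule linear_mapI)
    fix x assume x: "x \<in> carrier M"
    show "f x \<in> carrier M" by (rule f(1)[OF x])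
    show "f (r \<odot>\<^bsub>M\<^esub> x) = r \<odot>\<^bsub>M\<^esub> f x" if r: "r \<in> carrier R" for r
      using f x r M(1) linear_smult[OF \<phi>0 r x] linear_smult[OF aug_linear r f(1)[OF x]]
      by (intro aug_eq) simp_all
    fix y assume y: "y \<in> carrier M"
    show "f (x \<oplus>\<^bsub>M\<^esub> y) = f x \<oplus>\<^bsub>M\<^esub> f y"
      using f x y M(1) linear_add[OF \<phi>0 x y] linear_add[OF aug_linear f(1)[OF x] f(1)[OF y]]
      by (intro aug_eq) simp_all
  qed
  show ?thesis
  proof (rule that[OF fl])
    fix z assume z: "z \<in> ZL"
    have zK: "z \<in> ZK" by (rule ZL_ZK[OF z])
    have "local_cohomology_map R I M X X c f (cls z) = cls (\<phi> c z)"
      by (rule local_cohomology_map_cls[OF fl \<phi>(1) _ z]) (simp add: f)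
    also have "\<phi> c z = \<Psi> z" using \<phi>K[OF ZKD(1)[OF zK]] \<psi>(2) \<Phi>(2)[OF zK] by simp
    also have "cls (\<Psi> z) = g (cls z)" using \<Psi>ZL(2)[OF zK] cls_pr[OF z] by simp
    finally show "local_cohomology_map R I M X X c f (cls z) = g (cls z)" .
  qed
qed

theorem endomorphism_iso:
  "(\<lambda>f\<in>carrier (Hom_module R M M). local_cohomology_map R I M X X c f)
     \<in> mod_iso R (Hom_module R M M) (Hom_module R H H)"
proof -
  let ?F = "local_cohomology_map R I M X X c"
  have car: "carrier (Hom_module R A B) = mod_hom R A B" for A :: "('r, 'x) module" and B :: "('r, 'y) module"
    by (simp add: Hom_module_def)
  have add: "f \<oplus>\<^bsub>Hom_module R A B\<^esub> g = (\<lambda>x\<in>carrier A. f x \<oplus>\<^bsub>B\<^esub> g x)"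
    and smult: "r \<odot>\<^bsub>Hom_module R A B\<^esub> f = (\<lambda>x\<in>carrier A. r \<odot>\<^bsub>B\<^esub> f x)"
    for A :: "('r, 'x) module" and B :: "('r, 'y) module" and f g r
    by (simp_all add: Hom_module_def)
  have ext: "F = G" if "F \<in> mod_hom R H H" "G \<in> extensional (carrier H)"
    "\<And>z. z \<in> ZL \<Longrightarrow> F (cls z) = G (cls z)" for F G
    by (rule extensionalityI[of _ "carrier H"]) (use that carrier_H in \<open>auto simp: mod_hom_iff\<close>)
  have lin: "linear_map R (Hom_module R M M) (Hom_module R H H) ?F"
  proof (rule linear_mapI)
    fix f assume "f \<in> carrier (Hom_module R M M)"
    then have f: "linear_map R M M f" unfolding car by (rule mod_hom_linear)
    show "?F f \<in> carrier (Hom_module R H H)" unfolding car by (rule local_cohomology_map_hom[OF f])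
    obtain \<phi> where \<phi>: "chain_map R E d E d \<phi>" "\<forall>x\<in>carrier M. \<phi> 0 (aug x) = aug (f x)"
      by (rule lift_exists[OF f]) (rule that, assumption, rule ballI)
    note cf = local_cohomology_map_cls[OF f \<phi>]
    show "?F (r \<odot>\<^bsub>Hom_module R M M\<^esub> f) = r \<odot>\<^bsub>Hom_module R H H\<^esub> ?F f" if r: "r \<in> carrier R" for r
    proof -
      have rf: "linear_map R M M (r \<odot>\<^bsub>Hom_module R M M\<^esub> f)"
        unfolding smult by (rule mod_hom_linear[OF restrict_mod_hom[OF linear_scale[OF f M(1) r] M(1)]])
      show ?thesis
      proof (rule ext[OF local_cohomology_map_hom[OF rf]])
        show "r \<odot>\<^bsub>Hom_module R H H\<^esub> ?F f \<in> extensional (carrier H)" unfolding smult by simp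
        fix z assume z: "z \<in> ZL"
        have "?F (r \<odot>\<^bsub>Hom_module R M M\<^esub> f) (cls z) = cls (r \<odot>\<^bsub>E c\<^esub> \<phi> c z)"
        proof (rule local_cohomology_map_cls[OF rf chain_map_scale[OF \<phi>(1) complex_E r] _ z], rule ballI)
          fix x assume x: "x \<in> carrier M"
          show "r \<odot>\<^bsub>E 0\<^esub> \<phi> 0 (aug x) = aug ((r \<odot>\<^bsub>Hom_module R M M\<^esub> f) x)"
            unfolding smult using x \<phi>(2) linear_smult[OF aug_linear r linear_closed[OF f x]] by simp
        qed
        also have "\<dots> = r \<odot>\<^bsub>H\<^esub> cls (\<phi> c z)"
          using linear_smult[OF cls_linear r, of "\<phi> c z"] chain_map_ZL[OF \<phi>(1) z] by simp
        finally show "?F (r \<odot>\<^bsub>Hom_module R M M\<^esub> f) (cls z) = (r \<odot>\<^bsub>Hom_module R H H\<^esub> ?F f) (cls z)"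
          unfolding smult using z carrier_H cf[OF z] by auto
      qed
    qed
    fix g assume "g \<in> carrier (Hom_module R M M)"
    then have g: "linear_map R M M g" unfolding car by (rule mod_hom_linear)
    obtain \<psi> where \<psi>: "chain_map R E d E d \<psi>" "\<forall>x\<in>carrier M. \<psi> 0 (aug x) = aug (g x)"
      by (rule lift_exists[OF g]) (rule that, assumption, rule ballI)
    note cg = local_cohomology_map_cls[OF g \<psi>]
    have fg: "linear_map R M M (f \<oplus>\<^bsub>Hom_module R M M\<^esub> g)"
      unfolding add by (rule mod_hom_linear[OF restrict_mod_hom[OF linear_sum[OF f g M(1) M(1)] M(1)]])
    show "?F (f \<oplus>\<^bsub>Hom_module R M M\<^esub> g) = ?F f \<oplus>\<^bsub>Hom_module R H H\<^esub> ?F g"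
    proof (rule ext[OF local_cohomology_map_hom[OF fg]])
      show "?F f \<oplus>\<^bsub>Hom_module R H H\<^esub> ?F g \<in> extensional (carrier H)" unfolding add by simp
      fix z assume z: "z \<in> ZL"
      have "?F (f \<oplus>\<^bsub>Hom_module R M M\<^esub> g) (cls z) = cls (\<phi> c z \<oplus>\<^bsub>E c\<^esub> \<psi> c z)"
      proof (rule local_cohomology_map_cls[OF fg chain_map_sum[OF \<phi>(1) \<psi>(1) complex_E complex_E] _ z], rule ballI)
        fix x assume x: "x \<in> carrier M"
        show "\<phi> 0 (aug x) \<oplus>\<^bsub>E 0\<^esub> \<psi> 0 (aug x) = aug ((f \<oplus>\<^bsub>Hom_module R M M\<^esub> g) x)"
          unfolding add using x \<phi>(2) \<psi>(2) x
            linear_add[OF aug_linear linear_closed[OF f x] linear_closed[OF g x]] by simp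
      qed
      also have "\<dots> = cls (\<phi> c z) \<oplus>\<^bsub>H\<^esub> cls (\<psi> c z)"
        using linear_add[OF cls_linear, of "\<phi> c z" "\<psi> c z"] chain_map_ZL[OF \<phi>(1) z] chain_map_ZL[OF \<psi>(1) z]
        by simp
      finally show "?F (f \<oplus>\<^bsub>Hom_module R M M\<^esub> g) (cls z) = (?F f \<oplus>\<^bsub>Hom_module R H H\<^esub> ?F g) (cls z)"
        unfolding add using z carrier_H cf[OF z] cg[OF z] by auto
    qed
  qed
  have Hom_closed: "f \<oplus>\<^bsub>Hom_module R M M\<^esub> g \<in> carrier (Hom_module R M M)"
    "r \<in> carrier R \<Longrightarrow> r \<odot>\<^bsub>Hom_module R M M\<^esub> f \<in> carrier (Hom_module R M M)"
    if "f \<in> carrier (Hom_module R M M)" "g \<in> carrier (Hom_module R M M)" for f g r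
  proof -
    have f: "linear_map R M M f" and g: "linear_map R M M g" using that unfolding car by (auto intro: mod_hom_linear)
    show "f \<oplus>\<^bsub>Hom_module R M M\<^esub> g \<in> carrier (Hom_module R M M)"
      unfolding car add by (rule restrict_mod_hom[OF linear_sum[OF f g M(1) M(1)] M(1)])
    show "r \<odot>\<^bsub>Hom_module R M M\<^esub> f \<in> carrier (Hom_module R M M)" if "r \<in> carrier R"
      unfolding car smult by (rule restrict_mod_hom[OF linear_scale[OF f M(1) that] M(1)])
  qed
  have "restrict ?F (carrier (Hom_module R M M)) \<in> mod_hom R (Hom_module R M M) (Hom_module R H H)"
    unfolding mod_hom_def[of R "Hom_module R M M"]
    using linear_closed[OF lin] linear_add[OF lin] linear_smult[OF lin] Hom_closed
    by auto
  moreover have "bij_betw ?F (carrier (Hom_module R M M)) (carrier (Hom_module R H H))"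
    unfolding bij_betw_def
  proof
    show "inj_on ?F (carrier (Hom_module R M M))"
    proof (rule inj_onI)
      fix f g assume fg: "f \<in> carrier (Hom_module R M M)" "g \<in> carrier (Hom_module R M M)" "?F f = ?F g"
      then have f: "linear_map R M M f" "f \<in> extensional (carrier M)"
        and g: "linear_map R M M g" "g \<in> extensional (carrier M)" unfolding car mod_hom_iff by auto
      show "f = g"
        by (rule extensionalityI[OF f(2) g(2)]) (rule local_cohomology_map_inj[OF f(1) g(1)], simp add: fg(3))
    qed
    show "?F ` carrier (Hom_module R M M) = carrier (Hom_module R H H)"
    proof
      show "?F ` carrier (Hom_module R M M) \<subseteq> carrier (Hom_module R H H)" using linear_closed[OF lin] by blast
      show "carrier (Hom_module R H H) \<subseteq> ?F ` carrier (Hom_module R M M)"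
      proof
        fix G assume "G \<in> carrier (Hom_module R H H)"
        then have G: "G \<in> mod_hom R H H" unfolding car .
        obtain f where f: "linear_map R M M f" "\<And>z. z \<in> ZL \<Longrightarrow> ?F f (cls z) = G (cls z)"
          by (rule local_cohomology_map_surj[OF mod_hom_linear[OF G]]) (rule that)
        let ?f = "restrict f (carrier M)"
        have rf: "?f \<in> mod_hom R M M" by (rule restrict_mod_hom[OF f(1) M(1)])
        obtain \<phi> where \<phi>: "chain_map R E d E d \<phi>" "\<forall>x\<in>carrier M. \<phi> 0 (aug x) = aug (f x)"
          by (rule lift_exists[OF f(1)]) (rule that, assumption, rule ballI)
        have "?F ?f (cls z) = G (cls z)" if z: "z \<in> ZL" for z
          using local_cohomology_map_cls[OF mod_hom_linear[OF rf] \<phi>(1) _ z]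
            local_cohomology_map_cls[OF f(1) \<phi> z] f(2)[OF z] \<phi>(2) by simp
        then have "?F ?f = G"
          using ext[OF local_cohomology_map_hom[OF mod_hom_linear[OF rf]]] G by (simp add: mod_hom_iff)
        then show "G \<in> ?F ` carrier (Hom_module R M M)" using rf unfolding car by blast
      qed
    qed
  qed
  ultimately show ?thesis
    by (simp add: mod_iso_def)
qed

end


section \<open>Regular sequences and socles\<close>

text \<open>Regularity of a sequence on the quotient \<open>V / U\<close> of two submodules of \<open>A\<close>, where the final
  properness condition is dropped.\<close>

fun weakly_regular :: "('r, 'a) module \<Rightarrow> 'a set \<Rightarrow> 'a set \<Rightarrow> 'r list \<Rightarrow> bool" where
  "weakly_regular A V U [] \<longleftrightarrow> True"
| "weakly_regular A V U (y # ys) \<longleftrightarrow> (\<forall>a\<in>V. y \<odot>\<^bsub>A\<^esub> a \<in> U \<longrightarrow> a \<in> U) \<and>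
     weakly_regular A V {u \<oplus>\<^bsub>A\<^esub> y \<odot>\<^bsub>A\<^esub> v | u v. u \<in> U \<and> v \<in> V} ys"

context fixed_cring
begin

lemma sum_submodule:
  assumes A: "module R (A :: ('r, 'a) module)" and U: "submodule U R A" and V: "submodule V R A"
    and y: "y \<in> carrier R"
  shows "submodule {u \<oplus>\<^bsub>A\<^esub> y \<odot>\<^bsub>A\<^esub> v | u v. u \<in> U \<and> v \<in> V} R A"
proof (rule submoduleI'[OF A])
  note u = submodule_rules[OF U A] and v = submodule_rules[OF V A]
  show "{u \<oplus>\<^bsub>A\<^esub> y \<odot>\<^bsub>A\<^esub> v | u v. u \<in> U \<and> v \<in> V} \<subseteq> carrier A"
    using u(1) v(1) y A by auto
  have "\<zero>\<^bsub>A\<^esub> = \<zero>\<^bsub>A\<^esub> \<oplus>\<^bsub>A\<^esub> y \<odot>\<^bsub>A\<^esub> \<zero>\<^bsub>A\<^esub>" using y A by simp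
  then show "\<zero>\<^bsub>A\<^esub> \<in> {u \<oplus>\<^bsub>A\<^esub> y \<odot>\<^bsub>A\<^esub> v | u v. u \<in> U \<and> v \<in> V}" using u(2) v(2) by blast
  fix a assume "a \<in> {u \<oplus>\<^bsub>A\<^esub> y \<odot>\<^bsub>A\<^esub> v | u v. u \<in> U \<and> v \<in> V}"
  then obtain p q where a: "p \<in> U" "q \<in> V" "a = p \<oplus>\<^bsub>A\<^esub> y \<odot>\<^bsub>A\<^esub> q" by blast
  show "r \<odot>\<^bsub>A\<^esub> a \<in> {u \<oplus>\<^bsub>A\<^esub> y \<odot>\<^bsub>A\<^esub> v | u v. u \<in> U \<and> v \<in> V}" if r: "r \<in> carrier R" for r
  proof -
    have "r \<odot>\<^bsub>A\<^esub> a = r \<odot>\<^bsub>A\<^esub> p \<oplus>\<^bsub>A\<^esub> y \<odot>\<^bsub>A\<^esub> (r \<odot>\<^bsub>A\<^esub> q)"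
      using a u(1)[OF a(1)] v(1)[OF a(2)] r y A by (simp add: mod_distr smult_swap[OF A, of r y])
    then show ?thesis using u(4)[OF r a(1)] v(4)[OF r a(2)] by blast
  qed
  fix b assume "b \<in> {u \<oplus>\<^bsub>A\<^esub> y \<odot>\<^bsub>A\<^esub> v | u v. u \<in> U \<and> v \<in> V}"
  then obtain p' q' where b: "p' \<in> U" "q' \<in> V" "b = p' \<oplus>\<^bsub>A\<^esub> y \<odot>\<^bsub>A\<^esub> q'" by blast
  have "a \<oplus>\<^bsub>A\<^esub> b = (p \<oplus>\<^bsub>A\<^esub> p') \<oplus>\<^bsub>A\<^esub> y \<odot>\<^bsub>A\<^esub> (q \<oplus>\<^bsub>A\<^esub> q')"
    using a b u(1)[OF a(1)] v(1)[OF a(2)] u(1)[OF b(1)] v(1)[OF b(2)] y A by (simp add: mod_distr mod_ac)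
  then show "a \<oplus>\<^bsub>A\<^esub> b \<in> {u \<oplus>\<^bsub>A\<^esub> y \<odot>\<^bsub>A\<^esub> v | u v. u \<in> U \<and> v \<in> V}"
    using u(3)[OF a(1) b(1)] v(3)[OF a(2) b(2)] by blast
qed

text \<open>Weak regularity depends only on the quotient \<open>V / U\<close> as a module. The
  conditions \<open>inj\<close> and \<open>surj\<close> say that \<phi> induces an isomorphism of
  the quotients, and they persist when \<open>U\<close> and \<open>U'\<close> grow by multiples of
  \<open>y\<close>.\<close>

lemma weakly_regular_transfer:
  assumes A: "module R (A :: ('r, 'a) module)" and B: "module R (B :: ('r, 'b) module)"
    and V: "submodule V R A" and V': "submodule V' R B"
    and \<phi>: "linear_map R (A\<lparr>carrier := V\<rparr>) B \<phi>" "\<And>a. a \<in> V \<Longrightarrow> \<phi> a \<in> V'"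
    and U: "submodule U R A" "U \<subseteq> V" and U': "submodule U' R B" "U' \<subseteq> V'"
    and inj: "\<And>a. a \<in> V \<Longrightarrow> \<phi> a \<in> U' \<longleftrightarrow> a \<in> U"
    and surj: "\<And>b. b \<in> V' \<Longrightarrow> \<exists>v\<in>V. \<exists>u\<in>U'. b = \<phi> v \<oplus>\<^bsub>B\<^esub> u"
    and ys: "set ys \<subseteq> carrier R" and reg: "weakly_regular A V U ys"
  shows "weakly_regular B V' U' ys"
  using U U' inj surj ys reg
proof (induction ys arbitrary: U U')
  case (Cons y ys)
  note u = submodule_rules[OF Cons.prems(1) A] and v = submodule_rules[OF V A]
  note u' = submodule_rules[OF Cons.prems(3) B] and v' = submodule_rules[OF V' B]
  note inj = Cons.prems(5) and surj = Cons.prems(6)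
  have y: "y \<in> carrier R" and ys: "set ys \<subseteq> carrier R" using Cons.prems(7) by auto
  have reg: "\<And>a. a \<in> V \<Longrightarrow> y \<odot>\<^bsub>A\<^esub> a \<in> U \<Longrightarrow> a \<in> U"
    and reg': "weakly_regular A V {u \<oplus>\<^bsub>A\<^esub> y \<odot>\<^bsub>A\<^esub> v | u v. u \<in> U \<and> v \<in> V} ys"
    using Cons.prems(8) by auto
  have \<phi>add: "\<phi> (p \<oplus>\<^bsub>A\<^esub> q) = \<phi> p \<oplus>\<^bsub>B\<^esub> \<phi> q" if "p \<in> V" "q \<in> V" for p q
    using linear_add[OF \<phi>(1), of p q] that by simp
  have \<phi>s: "\<phi> (r \<odot>\<^bsub>A\<^esub> q) = r \<odot>\<^bsub>B\<^esub> \<phi> q" if "r \<in> carrier R" "q \<in> V" for r q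
    using linear_smult[OF \<phi>(1), of r q] that by simp
  have \<phi>m: "\<phi> (msub R A p q) = msub R B (\<phi> p) (\<phi> q)" if "p \<in> V" "q \<in> V" for p q
    unfolding msub_def using that v(4) by (simp add: \<phi>add \<phi>s)
  let ?U = "{u \<oplus>\<^bsub>A\<^esub> y \<odot>\<^bsub>A\<^esub> v | u v. u \<in> U \<and> v \<in> V}"
  let ?U' = "{u \<oplus>\<^bsub>B\<^esub> y \<odot>\<^bsub>B\<^esub> v | u v. u \<in> U' \<and> v \<in> V'}"
  have "weakly_regular B V' ?U' ys"
  proof (rule Cons.IH[OF _ _ _ _ _ _ ys reg'])
    show "submodule ?U R A" by (rule sum_submodule[OF A Cons.prems(1) V y])
    show "submodule ?U' R B" by (rule sum_submodule[OF B Cons.prems(3) V' y])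
    show "?U \<subseteq> V" using Cons.prems(2) v(3,4) y by blast
    show "?U' \<subseteq> V'" using Cons.prems(4) v'(3,4) y by blast
    show "\<exists>v\<in>V. \<exists>u\<in>?U'. b = \<phi> v \<oplus>\<^bsub>B\<^esub> u" if b: "b \<in> V'" for b
    proof -
      obtain w t where wt: "w \<in> V" "t \<in> U'" "b = \<phi> w \<oplus>\<^bsub>B\<^esub> t" using surj[OF b] by blast
      have "t = t \<oplus>\<^bsub>B\<^esub> y \<odot>\<^bsub>B\<^esub> \<zero>\<^bsub>B\<^esub>" using u'(1)[OF wt(2)] y B by simp
      then have "t \<in> ?U'" using wt(2) v'(2) by blast
      then show ?thesis using wt by blast
    qed
    show "\<phi> a \<in> ?U' \<longleftrightarrow> a \<in> ?U" if a: "a \<in> V" for a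
    proof
      assume "a \<in> ?U"
      then obtain p q where pq: "p \<in> U" "q \<in> V" "a = p \<oplus>\<^bsub>A\<^esub> y \<odot>\<^bsub>A\<^esub> q" by blast
      have pV: "p \<in> V" using pq(1) Cons.prems(2) by blast
      have "\<phi> a = \<phi> p \<oplus>\<^bsub>B\<^esub> y \<odot>\<^bsub>B\<^esub> \<phi> q"
        unfolding pq(3) using pV pq(2) y v(4) by (simp add: \<phi>add \<phi>s)
      then show "\<phi> a \<in> ?U'" using inj[OF pV] pq(1) \<phi>(2)[OF pq(2)] by blast
    next
      assume "\<phi> a \<in> ?U'"
      then obtain p q where pq: "p \<in> U'" "q \<in> V'" "\<phi> a = p \<oplus>\<^bsub>B\<^esub> y \<odot>\<^bsub>B\<^esub> q" by blast
      obtain w t where wt: "w \<in> V" "t \<in> U'" "q = \<phi> w \<oplus>\<^bsub>B\<^esub> t" using surj[OF pq(2)] by blast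
      have yw: "y \<odot>\<^bsub>A\<^esub> w \<in> V" using v(4)[OF y wt(1)] .
      have c: "p \<in> carrier B" "\<phi> w \<in> carrier B" "t \<in> carrier B"
        using u'(1) v'(1) \<phi>(2) pq(1) wt by auto
      have "\<phi> a = (p \<oplus>\<^bsub>B\<^esub> y \<odot>\<^bsub>B\<^esub> t) \<oplus>\<^bsub>B\<^esub> \<phi> (y \<odot>\<^bsub>A\<^esub> w)"
        using pq(3) wt(3) c y B by (simp add: \<phi>s[OF y wt(1)] mod_distr mod_ac)
      then have "\<phi> (msub R A a (y \<odot>\<^bsub>A\<^esub> w)) = p \<oplus>\<^bsub>B\<^esub> y \<odot>\<^bsub>B\<^esub> t"
        using \<phi>m[OF a yw] c y B \<phi>s[OF y wt(1)] by (simp add: msub_alg(4))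
      then have "\<phi> (msub R A a (y \<odot>\<^bsub>A\<^esub> w)) \<in> U'" using u'(3)[OF pq(1) u'(4)[OF y wt(2)]] by simp
      then have "msub R A a (y \<odot>\<^bsub>A\<^esub> w) \<in> U" using inj[OF v(5)[OF a yw]] by simp
      moreover have "a = msub R A a (y \<odot>\<^bsub>A\<^esub> w) \<oplus>\<^bsub>A\<^esub> y \<odot>\<^bsub>A\<^esub> w"
        using v(1)[OF a] v(1)[OF yw] A by (simp add: msub_alg(2))
      ultimately show "a \<in> ?U" using wt(1) by blast
    qed
  qed
  moreover have "b \<in> U'" if b: "b \<in> V'" "y \<odot>\<^bsub>B\<^esub> b \<in> U'" for b
  proof -
    obtain w t where wt: "w \<in> V" "t \<in> U'" "b = \<phi> w \<oplus>\<^bsub>B\<^esub> t" using surj[OF b(1)] by blast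
    have c: "\<phi> w \<in> carrier B" "t \<in> carrier B" using u'(1) v'(1) \<phi>(2) wt by auto
    have "\<phi> (y \<odot>\<^bsub>A\<^esub> w) = msub R B (y \<odot>\<^bsub>B\<^esub> b) (y \<odot>\<^bsub>B\<^esub> t)"
      using wt(3) c y B by (simp add: \<phi>s[OF y wt(1)] mod_distr msub_alg(4))
    then have "\<phi> (y \<odot>\<^bsub>A\<^esub> w) \<in> U'" using u'(5)[OF b(2) u'(4)[OF y wt(2)]] by simp
    then have "w \<in> U" using inj[OF v(4)[OF y wt(1)]] reg[OF wt(1)] by blast
    then show "b \<in> U'" using inj[OF wt(1)] u'(3) wt by simp
  qed
  ultimately show ?case by simp
qed simp

end

text \<open>The mapping cones below are iterated along a sequence; interleaving sequences keeps them all
  in one type.\<close>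

definition interleave :: "(nat \<Rightarrow> 'e) \<Rightarrow> (nat \<Rightarrow> 'e) \<Rightarrow> nat \<Rightarrow> 'e" where
  "interleave f g n = (if even n then f (n div 2) else g (n div 2))"

definition evens :: "(nat \<Rightarrow> 'e) \<Rightarrow> nat \<Rightarrow> 'e" where "evens f n = f (2 * n)"

definition odds :: "(nat \<Rightarrow> 'e) \<Rightarrow> nat \<Rightarrow> 'e" where "odds f n = f (Suc (2 * n))"

lemma interleave_simps [simp]:
  "evens (interleave f g) = f" "odds (interleave f g) = g" "interleave (evens h) (odds h) = h"
  by (auto simp: interleave_def evens_def odds_def fun_eq_iff elim!: evenE oddE)

lemma interleave_eq: "x = interleave f g \<longleftrightarrow> evens x = f \<and> odds x = g"
  by (metis interleave_simps)

definition prod_module ::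
  "('r, nat \<Rightarrow> 'e) module \<Rightarrow> ('r, nat \<Rightarrow> 'e) module \<Rightarrow> ('r, nat \<Rightarrow> 'e) module" where
  "prod_module A B = \<lparr>carrier = {x. evens x \<in> carrier A \<and> odds x \<in> carrier B},
     monoid.mult = undefined, one = undefined, zero = interleave \<zero>\<^bsub>A\<^esub> \<zero>\<^bsub>B\<^esub>,
     add = (\<lambda>x y. interleave (evens x \<oplus>\<^bsub>A\<^esub> evens y) (odds x \<oplus>\<^bsub>B\<^esub> odds y)),
     smult = (\<lambda>r x. interleave (r \<odot>\<^bsub>A\<^esub> evens x) (r \<odot>\<^bsub>B\<^esub> odds x))\<rparr>"

lemma prod_module_simps [simp]:
  "zero (prod_module A B) = interleave \<zero>\<^bsub>A\<^esub> \<zero>\<^bsub>B\<^esub>"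
  "x \<oplus>\<^bsub>prod_module A B\<^esub> y = interleave (evens x \<oplus>\<^bsub>A\<^esub> evens y) (odds x \<oplus>\<^bsub>B\<^esub> odds y)"
  "r \<odot>\<^bsub>prod_module A B\<^esub> x = interleave (r \<odot>\<^bsub>A\<^esub> evens x) (r \<odot>\<^bsub>B\<^esub> odds x)"
  "x \<in> carrier (prod_module A B) \<longleftrightarrow> evens x \<in> carrier A \<and> odds x \<in> carrier B"
  by (simp_all add: prod_module_def)

section \<open>Mapping cones of multiplication by a ring element\<close>

definition shift :: "(nat \<Rightarrow> ('r, 'e) module) \<Rightarrow> nat \<Rightarrow> ('r, 'e) module" where
  "shift C i = (case i of 0 \<Rightarrow> (C 0)\<lparr>carrier := {\<zero>\<^bsub>C 0\<^esub>}\<rparr> | Suc j \<Rightarrow> C j)"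

definition shift_diff :: "(nat \<Rightarrow> ('r, 'e) module) \<Rightarrow> (nat \<Rightarrow> 'e \<Rightarrow> 'e) \<Rightarrow> nat \<Rightarrow> 'e \<Rightarrow> 'e" where
  "shift_diff C d i x = (case i of 0 \<Rightarrow> \<zero>\<^bsub>C 0\<^esub> | Suc j \<Rightarrow> d j x)"

definition cone :: "(nat \<Rightarrow> ('r, nat \<Rightarrow> 'e) module) \<Rightarrow> nat \<Rightarrow> ('r, nat \<Rightarrow> 'e) module" where
  "cone C i = prod_module (C i) (shift C i)"

text \<open>The differential \<open>(u, v) |-> (d u, y u - d v)\<close> of the cone of
  \<open>y\<close>, indexed so that degree \<open>i\<close> consists of \<open>C i\<close> and
  \<open>C (i - 1)\<close>.\<close>

definition cone_diff :: "'r ring \<Rightarrow> (nat \<Rightarrow> ('r, nat \<Rightarrow> 'e) module) \<Rightarrow>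
    (nat \<Rightarrow> (nat \<Rightarrow> 'e) \<Rightarrow> nat \<Rightarrow> 'e) \<Rightarrow> 'r \<Rightarrow> nat \<Rightarrow> (nat \<Rightarrow> 'e) \<Rightarrow> nat \<Rightarrow> 'e" where
  "cone_diff R C d y i x =
    interleave (d i (evens x)) (msub R (C i) (y \<odot>\<^bsub>C i\<^esub> evens x) (shift_diff C d i (odds x)))"

lemma coboundaries_shift: "coboundaries C d i = shift_diff C d i ` carrier (shift C i)"
  by (cases i) (auto simp: coboundaries_def shift_diff_def shift_def)

lemma shift_Suc [simp]: "shift C (Suc i) = C i" "shift_diff C d (Suc i) = d i"
  by (simp_all add: shift_def shift_diff_def fun_eq_iff)

context noetherian_cring
begin

lemma prod_module_module:
  assumes A: "module R A" and B: "module R B"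
  shows "module R (prod_module A B)"
proof (rule moduleI[OF is_cring])
  show "abelian_group (prod_module A B)"
  proof (rule abelian_groupI)
    fix x assume x: "x \<in> carrier (prod_module A B)"
    have "(\<ominus> \<one>) \<odot>\<^bsub>A\<^esub> evens x \<oplus>\<^bsub>A\<^esub> evens x = \<zero>\<^bsub>A\<^esub>" "(\<ominus> \<one>) \<odot>\<^bsub>B\<^esub> odds x \<oplus>\<^bsub>B\<^esub> odds x = \<zero>\<^bsub>B\<^esub>"
      using mod_simps(6)[OF A, of "evens x"] mod_ac(1)[OF A, of "evens x" "(\<ominus> \<one>) \<odot>\<^bsub>A\<^esub> evens x"]
        mod_simps(6)[OF B, of "odds x"] mod_ac(1)[OF B, of "odds x" "(\<ominus> \<one>) \<odot>\<^bsub>B\<^esub> odds x"] x A B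
      by (simp_all add: msub_def)
    then show "\<exists>y\<in>carrier (prod_module A B). y \<oplus>\<^bsub>prod_module A B\<^esub> x = \<zero>\<^bsub>prod_module A B\<^esub>"
      using x A B by (intro bexI[of _ "(\<ominus> \<one>) \<odot>\<^bsub>prod_module A B\<^esub> x"]) simp_all
  qed (use A B in \<open>auto simp: mod_ac\<close>)
qed (use A B in \<open>auto simp: mod_distr\<close>)

lemma evens_linear: "linear_map R (prod_module A B) A evens"
  and odds_linear: "linear_map R (prod_module A B) B odds"
  by (rule linear_mapI; simp)+

lemma interleave_linear:
  assumes "linear_map R C A f" "linear_map R C B g"
  shows "linear_map R C (prod_module A B) (\<lambda>x. interleave (f x) (g x))"
  by (rule linear_mapI)
    (simp_all add: linear_closed[OF assms(1)] linear_closed[OF assms(2)] linear_add[OF assms(1)]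
      linear_add[OF assms(2)] linear_smult[OF assms(1)] linear_smult[OF assms(2)])

lemma prod_module_baer:
  assumes A: "baer R A" and B: "baer R B"
  shows "baer R (prod_module A B)"
proof (rule baerI[OF prod_module_module[OF baer_module[OF A] baer_module[OF B]]])
  fix \<aa> f
  assume a: "ideal \<aa> R" and f: "\<And>r. r \<in> \<aa> \<Longrightarrow> f r \<in> carrier (prod_module A B)"
    "\<And>r s. r \<in> \<aa> \<Longrightarrow> s \<in> \<aa> \<Longrightarrow> f (r \<oplus> s) = f r \<oplus>\<^bsub>prod_module A B\<^esub> f s"
    "\<And>r s. r \<in> carrier R \<Longrightarrow> s \<in> \<aa> \<Longrightarrow> f (r \<otimes> s) = r \<odot>\<^bsub>prod_module A B\<^esub> f s"
  obtain e0 where e0: "e0 \<in> carrier A" "\<And>r. r \<in> \<aa> \<Longrightarrow> evens (f r) = r \<odot>\<^bsub>A\<^esub> e0"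
    by (rule baerD[OF A a, of "\<lambda>r. evens (f r)"]) (use f in auto)
  obtain e1 where e1: "e1 \<in> carrier B" "\<And>r. r \<in> \<aa> \<Longrightarrow> odds (f r) = r \<odot>\<^bsub>B\<^esub> e1"
    by (rule baerD[OF B a, of "\<lambda>r. odds (f r)"]) (use f in auto)
  show "\<exists>e\<in>carrier (prod_module A B). \<forall>r\<in>\<aa>. f r = r \<odot>\<^bsub>prod_module A B\<^esub> e"
    using e0 e1 by (intro bexI[of _ "interleave e0 e1"]) (simp_all add: interleave_eq)
qed

lemma shift_module: "complex R C d \<Longrightarrow> module R (shift C i)"
proof (cases i)
  case 0
  assume C: "complex R C d"
  have "submodule {\<zero>\<^bsub>C 0\<^esub>} R (C 0)"
    by (rule submoduleI'[OF complexD(1)[OF C]]) (use complexD(1)[OF C, of 0] in auto)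
  then show ?thesis using 0 submodule_mod[OF _ complexD(1)[OF C]] by (simp add: shift_def)
qed (simp add: complexD(1))

lemma shift_baer: "baer R (C 0) \<Longrightarrow> (\<And>i. baer R (C i)) \<Longrightarrow> complex R C d \<Longrightarrow> baer R (shift C i)"
proof (cases i)
  case 0
  assume C: "complex R C d"
  show ?thesis
  proof (rule baerI[OF shift_module[OF C]])
    fix \<aa> f assume "\<And>r. r \<in> \<aa> \<Longrightarrow> f r \<in> carrier (shift C i)" and a: "ideal \<aa> R"
    then have "f r = \<zero>\<^bsub>C 0\<^esub>" if "r \<in> \<aa>" for r using that 0 by (simp add: shift_def)
    moreover have "r \<odot>\<^bsub>C 0\<^esub> \<zero>\<^bsub>C 0\<^esub> = \<zero>\<^bsub>C 0\<^esub>" if "r \<in> \<aa>" for r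
      using ideal_rules(1)[OF a that] complexD(1)[OF C, of 0] by simp
    ultimately show "\<exists>e\<in>carrier (shift C i). \<forall>r\<in>\<aa>. f r = r \<odot>\<^bsub>shift C i\<^esub> e"
      using 0 by (simp add: shift_def)
  qed
qed simp

lemma shift_diff_linear:
  assumes C: "complex R C d"
  shows "linear_map R (shift C i) (C i) (shift_diff C d i)"
proof (cases i)
  case 0
  have "linear_map R (shift C 0) (C 0) (\<lambda>x. \<zero>\<^bsub>C 0\<^esub>)" by (rule linear_null[OF complexD(1)[OF C]])
  then show ?thesis using 0 by (simp add: shift_diff_def[abs_def])
qed (simp add: complexD(2)[OF C])

lemma shift_diff_diff:
  assumes C: "complex R C d" and x: "x \<in> carrier (shift C i)"
  shows "d i (shift_diff C d i x) = \<zero>\<^bsub>C (Suc i)\<^esub>"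
proof (cases i)
  case 0
  then show ?thesis
    using linear_zero[OF complexD(2)[OF C] complexD(1)[OF C] complexD(1)[OF C], of 0]
    by (simp add: shift_diff_def)
next
  case (Suc j)
  then show ?thesis using complexD(3)[OF C, of x j] x by simp
qed

lemma cone_complex:
  assumes C: "complex R C d" and y: "y \<in> carrier R"
  shows "complex R (cone C) (cone_diff R C d y)"
  unfolding complex_def
proof (intro conjI allI ballI)
  note M = complexD(1)[OF C] and lin = complexD(2)[OF C]
  note sd = shift_diff_linear[OF C]
  fix i
  show "module R (cone C i)" unfolding cone_def by (rule prod_module_module[OF M shift_module[OF C]])
  show "linear_map R (cone C i) (cone C (Suc i)) (cone_diff R C d y i)"
    unfolding cone_def cone_diff_def shift_Suc
    by (intro interleave_linear linear_diff[OF _ _ _ M] linear_scale[OF evens_linear M y]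
        linear_comp[OF evens_linear lin] linear_comp[OF odds_linear sd] prod_module_module[OF M shift_module[OF C]])
  fix x assume "x \<in> carrier (cone C i)"
  then have x: "evens x \<in> carrier (C i)" "odds x \<in> carrier (shift C i)" by (simp_all add: cone_def)
  have c: "y \<odot>\<^bsub>C i\<^esub> evens x \<in> carrier (C i)" "shift_diff C d i (odds x) \<in> carrier (C i)"
    using x y M linear_closed[OF sd x(2)] by auto
  have "d i (msub R (C i) (y \<odot>\<^bsub>C i\<^esub> evens x) (shift_diff C d i (odds x))) = y \<odot>\<^bsub>C (Suc i)\<^esub> d i (evens x)"
    using shift_diff_diff[OF C x(2)] linear_closed[OF lin x(1)] y M
    by (simp add: linear_msub[OF lin M c] linear_smult[OF lin y x(1)])
  then show "cone_diff R C d y (Suc i) (cone_diff R C d y i x) = \<zero>\<^bsub>cone C (Suc (Suc i))\<^esub>"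
    using complexD(3)[OF C x(1)] linear_closed[OF lin x(1)] y M by (simp add: cone_diff_def cone_def)
qed

lemma cone_cocycle:
  assumes C: "complex R C d" and y: "y \<in> carrier R"
  shows "x \<in> cocycles (cone C) (cone_diff R C d y) i \<longleftrightarrow>
    evens x \<in> carrier (C i) \<and> odds x \<in> carrier (shift C i) \<and> d i (evens x) = \<zero>\<^bsub>C (Suc i)\<^esub> \<and>
    y \<odot>\<^bsub>C i\<^esub> evens x = shift_diff C d i (odds x)"
proof -
  note M = complexD(1)[OF C]
  have "msub R (C i) (y \<odot>\<^bsub>C i\<^esub> evens x) (shift_diff C d i (odds x)) = \<zero>\<^bsub>C i\<^esub> \<longleftrightarrow>
     y \<odot>\<^bsub>C i\<^esub> evens x = shift_diff C d i (odds x)"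
    if "evens x \<in> carrier (C i)" "odds x \<in> carrier (shift C i)"
    by (rule msub_alg(1)[OF M]) (use that y M linear_closed[OF shift_diff_linear[OF C]] in auto)
  then show ?thesis
    by (auto simp: cocycles_def cone_def cone_diff_def interleave_eq)
qed

text \<open>In the long exact sequence, the cohomology of the cone in degree \<open>k\<close> lies
  between the cokernel of \<open>y\<close> in degree \<open>k - 1\<close> and the kernel of
  \<open>y\<close> in degree \<open>k\<close>. Both vanish for \<open>k\<close> other than
  \<open>j + 1\<close>, the kernel in degree \<open>j\<close> by regularity.\<close>

lemma cone_exact:
  assumes C: "complex R C d" and y: "y \<in> carrier R" and ex: "\<And>i. i \<noteq> j \<Longrightarrow> exact_at C d i"
    and reg: "\<And>a. a \<in> cocycles C d j \<Longrightarrow> y \<odot>\<^bsub>C j\<^esub> a \<in> coboundaries C d j \<Longrightarrow> a \<in> coboundaries C d j"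
    and k: "k \<noteq> Suc j"
  shows "exact_at (cone C) (cone_diff R C d y) k"
  unfolding exact_at_def
proof
  note M = complexD(1)[OF C] and lin = complexD(2)[OF C]
  fix x assume "x \<in> cocycles (cone C) (cone_diff R C d y) k"
  then have x: "evens x \<in> carrier (C k)" "odds x \<in> carrier (shift C k)" "d k (evens x) = \<zero>\<^bsub>C (Suc k)\<^esub>"
    "y \<odot>\<^bsub>C k\<^esub> evens x = shift_diff C d k (odds x)" unfolding cone_cocycle[OF C y] by auto
  have z: "evens x \<in> cocycles C d k" using x by (simp add: cocycles_def)
  have b: "evens x \<in> coboundaries C d k"
  proof (cases "k = j")
    case True
    have "y \<odot>\<^bsub>C k\<^esub> evens x \<in> coboundaries C d k" unfolding x(4) coboundaries_shift using x(2) by blast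
    then show ?thesis using reg z True by blast
  next
    case False
    then show ?thesis using ex z unfolding exact_at_def by blast
  qed
  show "x \<in> coboundaries (cone C) (cone_diff R C d y) k"
  proof (cases k)
    case 0
    then have "evens x = \<zero>\<^bsub>C 0\<^esub>" "odds x = \<zero>\<^bsub>C 0\<^esub>" using b x(2) by (auto simp: coboundaries_def shift_def)
    then have "x = interleave \<zero>\<^bsub>C 0\<^esub> \<zero>\<^bsub>C 0\<^esub>" by (simp add: interleave_eq)
    then show ?thesis using 0 by (simp add: coboundaries_def cone_def shift_def)
  next
    case (Suc l)
    obtain u where u: "u \<in> carrier (C l)" "evens x = d l u" using b Suc by (auto simp: coboundaries_def)
    have v: "odds x \<in> carrier (C l)" "y \<odot>\<^bsub>C (Suc l)\<^esub> d l u = d l (odds x)" using x(2,4) u(2) Suc by auto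
    \<comment> \<open>The first component is \<open>d u\<close>, so \<open>y u\<close> and the
      second component differ by a cocycle, hence by a coboundary \<open>d v'\<close>; the cocycle
      is the boundary of \<open>(u, v')\<close>.\<close>
    let ?w = "msub R (C l) (y \<odot>\<^bsub>C l\<^esub> u) (odds x)"
    have yu: "y \<odot>\<^bsub>C l\<^esub> u \<in> carrier (C l)" using y u(1) M by simp
    have "d l ?w = \<zero>\<^bsub>C (Suc l)\<^esub>"
      using linear_msub[OF lin M yu v(1)] v linear_smult[OF lin y u(1)] linear_closed[OF lin v(1)] M by simp
    then have "?w \<in> cocycles C d l" using yu v(1) M by (simp add: cocycles_def)
    moreover have "exact_at C d l" using ex k Suc by blast
    ultimately have "?w \<in> coboundaries C d l" unfolding exact_at_def by blast
    then obtain v' where v': "v' \<in> carrier (shift C l)" "?w = shift_diff C d l v'"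
      unfolding coboundaries_shift by blast
    have "odds x = msub R (C l) (y \<odot>\<^bsub>C l\<^esub> u) (shift_diff C d l v')"
      using msub_alg(7)[OF M yu v(1)] v'(2) by simp
    then have "x = cone_diff R C d y l (interleave u v')"
      using u(2) by (simp add: cone_diff_def interleave_eq)
    moreover have "interleave u v' \<in> carrier (cone C l)" using u(1) v'(1) by (simp add: cone_def)
    ultimately show ?thesis using Suc by (auto simp: coboundaries_def)
  qed
qed

text \<open>The map \<open>a |-> (0, a)\<close> induces an isomorphism from the cohomology of
  \<open>C\<close> in degree \<open>j\<close> modulo \<open>y\<close> to that of the cone in degree
  \<open>j + 1\<close>.\<close>

lemma cone_weakly_regular:
  assumes C: "complex R C d" and y: "y \<in> carrier R" and ex: "\<And>i. i \<noteq> j \<Longrightarrow> exact_at C d i"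
    and ys: "set ys \<subseteq> carrier R"
    and reg: "weakly_regular (C j) (cocycles C d j)
      {u \<oplus>\<^bsub>C j\<^esub> y \<odot>\<^bsub>C j\<^esub> v | u v. u \<in> coboundaries C d j \<and> v \<in> cocycles C d j} ys"
  shows "weakly_regular (cone C (Suc j)) (cocycles (cone C) (cone_diff R C d y) (Suc j))
      (coboundaries (cone C) (cone_diff R C d y) (Suc j)) ys"
proof -
  note M = complexD(1)[OF C] and lin = complexD(2)[OF C]
  note cone = cone_complex[OF C y]
  let ?Z = "cocycles C d j" and ?B = "coboundaries C d j"
  let ?U = "{u \<oplus>\<^bsub>C j\<^esub> y \<odot>\<^bsub>C j\<^esub> v | u v. u \<in> ?B \<and> v \<in> ?Z}"
  let ?Z' = "cocycles (cone C) (cone_diff R C d y) (Suc j)"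
  let ?B' = "coboundaries (cone C) (cone_diff R C d y) (Suc j)"
  let ?\<phi> = "\<lambda>a. interleave \<zero>\<^bsub>C (Suc j)\<^esub> a"
  note sZ = cocycles_submodule[OF C, of j] and sB = coboundaries_submodule[OF C, of j]
  note z = submodule_rules[OF sZ M] and b = submodule_rules[OF sB M]
  show ?thesis
  proof (rule weakly_regular_transfer[OF M complexD(1)[OF cone] sZ cocycles_submodule[OF cone]
      _ _ sum_submodule[OF M sB sZ y] _ coboundaries_submodule[OF cone] coboundaries_cocycles[OF cone] _ _ ys reg])
    have "linear_map R (C j) (cone C (Suc j)) ?\<phi>"
      unfolding cone_def by (rule interleave_linear[OF linear_null[OF M]]) (simp add: linear_id)
    then show "linear_map R (C j\<lparr>carrier := ?Z\<rparr>) (cone C (Suc j)) ?\<phi>"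
      by (rule linear_domain) (use z(1) in blast)
    show "?U \<subseteq> ?Z" using coboundaries_cocycles[OF C, of j] z(3,4) y by blast
    show "?\<phi> a \<in> ?Z'" if a: "a \<in> ?Z" for a
      unfolding cone_cocycle[OF C y] using a M y linear_zero[OF lin M M, of "Suc j"]
      by (simp add: cocycles_def)
    show "?\<phi> a \<in> ?B' \<longleftrightarrow> a \<in> ?U" if a: "a \<in> ?Z" for a
    proof
      assume "?\<phi> a \<in> ?B'"
      then obtain x where x: "evens x \<in> carrier (C j)" "odds x \<in> carrier (shift C j)"
        "?\<phi> a = cone_diff R C d y j x" by (auto simp: coboundaries_def cone_def)
      then have e: "d j (evens x) = \<zero>\<^bsub>C (Suc j)\<^esub>"
        "a = msub R (C j) (y \<odot>\<^bsub>C j\<^esub> evens x) (shift_diff C d j (odds x))"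
        by (auto simp: cone_diff_def interleave_eq)
      have sB': "shift_diff C d j (odds x) \<in> ?B" unfolding coboundaries_shift using x(2) by blast
      have "a = (\<ominus> \<one>) \<odot>\<^bsub>C j\<^esub> shift_diff C d j (odds x) \<oplus>\<^bsub>C j\<^esub> y \<odot>\<^bsub>C j\<^esub> evens x"
        unfolding e(2) msub_def using b(1)[OF sB'] x(1) y M by (intro mod_ac(1)) auto
      then show "a \<in> ?U" using b(4)[OF neg1_closed sB'] e(1) x(1) unfolding cocycles_def by blast
    next
      assume "a \<in> ?U"
      then obtain p q where pq: "p \<in> ?B" "q \<in> ?Z" "a = p \<oplus>\<^bsub>C j\<^esub> y \<odot>\<^bsub>C j\<^esub> q" by blast
      have "(\<ominus> \<one>) \<odot>\<^bsub>C j\<^esub> p \<in> ?B" using b(4)[OF neg1_closed pq(1)] .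
      then obtain v where v: "v \<in> carrier (shift C j)" "(\<ominus> \<one>) \<odot>\<^bsub>C j\<^esub> p = shift_diff C d j v"
        unfolding coboundaries_shift by blast
      have c: "p \<in> carrier (C j)" "q \<in> carrier (C j)" using b(1)[OF pq(1)] z(1)[OF pq(2)] by auto
      have "(\<ominus> \<one>) \<odot>\<^bsub>C j\<^esub> ((\<ominus> \<one>) \<odot>\<^bsub>C j\<^esub> p) = p"
        using c M by (simp add: mod_distr(3)[symmetric] l_minus)
      then have "a = msub R (C j) (y \<odot>\<^bsub>C j\<^esub> q) (shift_diff C d j v)"
        unfolding pq(3) v(2)[symmetric] msub_def
        using mod_ac(1)[OF M c(1) mod_closed(3)[OF M y c(2)]] by simp
      then have "?\<phi> a = cone_diff R C d y j (interleave q v)"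
        using pq(2) by (simp add: cone_diff_def interleave_eq cocycles_def)
      moreover have "interleave q v \<in> carrier (cone C j)" using c v(1) by (simp add: cone_def)
      ultimately show "?\<phi> a \<in> ?B'" by (auto simp: coboundaries_def)
    qed
    \<comment> \<open>By exactness in degree \<open>j + 1\<close> the first component is some
      \<open>d u\<close>; subtracting the boundary of \<open>(u, 0)\<close> makes it zero.\<close>
    show "\<exists>v\<in>?Z. \<exists>u\<in>?B'. x = ?\<phi> v \<oplus>\<^bsub>cone C (Suc j)\<^esub> u" if "x \<in> ?Z'" for x
    proof -
      have x: "evens x \<in> carrier (C (Suc j))" "odds x \<in> carrier (C j)" "d (Suc j) (evens x) = \<zero>\<^bsub>C (Suc (Suc j))\<^esub>"
        "y \<odot>\<^bsub>C (Suc j)\<^esub> evens x = d j (odds x)" using that unfolding cone_cocycle[OF C y] by auto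
      obtain u where u: "u \<in> carrier (C j)" "evens x = d j u"
        by (rule exact_atD_Suc[OF ex[of "Suc j"] x(1,3)]) (simp, rule that)
      let ?w = "msub R (C j) (odds x) (y \<odot>\<^bsub>C j\<^esub> u)"
      have yu: "y \<odot>\<^bsub>C j\<^esub> u \<in> carrier (C j)" using y u(1) M by simp
      have "d j ?w = \<zero>\<^bsub>C (Suc j)\<^esub>"
        using linear_msub[OF lin M x(2) yu] x(4) u linear_smult[OF lin y u(1)] linear_closed[OF lin x(2)] M by simp
      then have w: "?w \<in> ?Z" using yu x(2) M by (simp add: cocycles_def)
      have s0: "\<zero>\<^bsub>shift C j\<^esub> \<in> carrier (shift C j)" using shift_module[OF C] by blast
      have "shift_diff C d j \<zero>\<^bsub>shift C j\<^esub> = \<zero>\<^bsub>C j\<^esub>"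
        by (rule linear_zero[OF shift_diff_linear[OF C] shift_module[OF C] M])
      then have "cone_diff R C d y j (interleave u \<zero>\<^bsub>shift C j\<^esub>) = interleave (evens x) (y \<odot>\<^bsub>C j\<^esub> u)"
        using u(2) yu M by (simp add: cone_diff_def)
      then have "x = ?\<phi> ?w \<oplus>\<^bsub>cone C (Suc j)\<^esub> cone_diff R C d y j (interleave u \<zero>\<^bsub>shift C j\<^esub>)"
        using x(1,2) yu M by (simp add: cone_def interleave_eq msub_alg(2))
      moreover have "interleave u \<zero>\<^bsub>shift C j\<^esub> \<in> carrier (cone C j)" using u(1) s0 by (simp add: cone_def)
      ultimately show ?thesis using w by (auto simp: coboundaries_def)
    qed
  qed
qed

text \<open>Passing to the cone of multiplication by a regular element moves the cohomology up by one
  degree, and the socle of a cone contains the socle of the original complex.\<close>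

lemma socle_exact:
  assumes C: "complex R (C :: nat \<Rightarrow> ('r, nat \<Rightarrow> 'e) module) d" and inj: "\<And>i. baer R (C i)" and ex: "\<And>i. i \<noteq> j \<Longrightarrow> exact_at C d i"
    and ys: "set ys \<subseteq> \<pp>" and p: "\<pp> \<subseteq> carrier R"
    and reg: "weakly_regular (C j) (cocycles C d j) (coboundaries C d j) ys"
    and i: "i < j + length ys"
    and z: "z \<in> cocycles C d i" "\<And>r. r \<in> \<pp> \<Longrightarrow> r \<odot>\<^bsub>C i\<^esub> z = \<zero>\<^bsub>C i\<^esub>"
  shows "case i of 0 \<Rightarrow> z = \<zero>\<^bsub>C 0\<^esub> |
    Suc l \<Rightarrow> \<exists>w\<in>carrier (C l). d l w = z \<and> (\<forall>r\<in>\<pp>. r \<odot>\<^bsub>C l\<^esub> w = \<zero>\<^bsub>C l\<^esub>)"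
  using C inj ex ys reg i z
proof (induction ys arbitrary: C d j z)
  case Nil
  note C = Nil.prems(1)
  note M = complexD(1)[OF C]
  obtain s where "\<forall>i. (\<forall>j\<le>i. exact_at C d j) \<longrightarrow> linear_map R (C (Suc i)) (C i) (s i) \<and>
     (\<forall>x\<in>carrier (C i). x = s i (d i x) \<oplus>\<^bsub>C i\<^esub> from_below C d s i x)"
    using contraction_exists[OF C Nil.prems(2)] ..
  then have s: "k < j \<Longrightarrow> linear_map R (C (Suc k)) (C k) (s k)"
    "k < j \<Longrightarrow> x \<in> carrier (C k) \<Longrightarrow> x = s k (d k x) \<oplus>\<^bsub>C k\<^esub> from_below C d s k x" for k x
    using Nil.prems(3) by auto
  have i: "i < j" using Nil.prems(6) by simp
  have zi: "z \<in> carrier (C i)" "d i z = \<zero>\<^bsub>C (Suc i)\<^esub>" using Nil.prems(7) by (simp_all add: cocycles_def)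
  have fbc: "from_below C d s i z \<in> carrier (C i)"
    by (rule from_below_closed[OF C]) (use linear_closed[OF s(1)] i zi in auto)
  have zfb: "z = from_below C d s i z"
    using s(2)[OF i zi(1)] zi(2) linear_zero[OF s(1)[OF i] M M] mod_simps(1)[OF M fbc] by simp
  show ?case
  proof (cases i)
    case 0
    then show ?thesis using zfb by (simp add: from_below_def)
  next
    case (Suc l)
    have sl: "linear_map R (C (Suc l)) (C l) (s l)" using s(1) i Suc by simp
    \<comment> \<open>The contraction supplies the primitive, and being linear it produces one that
      is killed by whatever kills \<open>z\<close>.\<close>
    have "d l (s l z) = z" using zfb Suc by (simp add: from_below_def)
    moreover have "r \<odot>\<^bsub>C l\<^esub> s l z = \<zero>\<^bsub>C l\<^esub>" if r: "r \<in> \<pp>" for r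
      using linear_smult[OF sl, of r z] p r zi(1) Nil.prems(8)[OF r] linear_zero[OF sl M M] Suc by auto
    ultimately show ?thesis using Suc linear_closed[OF sl] zi(1) by auto
  qed
next
  case (Cons y ys)
  note C = Cons.prems(1)
  note M = complexD(1)[OF C]
  have y: "y \<in> \<pp>" "y \<in> carrier R" and ys: "set ys \<subseteq> \<pp>" "set ys \<subseteq> carrier R" using Cons.prems(4) p by auto
  have reg: "\<And>a. a \<in> cocycles C d j \<Longrightarrow> y \<odot>\<^bsub>C j\<^esub> a \<in> coboundaries C d j \<Longrightarrow> a \<in> coboundaries C d j"
    and reg': "weakly_regular (C j) (cocycles C d j)
      {u \<oplus>\<^bsub>C j\<^esub> y \<odot>\<^bsub>C j\<^esub> v | u v. u \<in> coboundaries C d j \<and> v \<in> cocycles C d j} ys"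
    using Cons.prems(5) by auto
  have zi: "z \<in> carrier (C i)" "d i z = \<zero>\<^bsub>C (Suc i)\<^esub>" using Cons.prems(7) by (simp_all add: cocycles_def)
  \<comment> \<open>The pair \<open>(z, 0)\<close> is a cocycle of the cone precisely because
    \<open>y\<close>, an element of \<pp>, kills \<open>z\<close>. The first component of a
    primitive of it solves the original problem.\<close>
  let ?z = "interleave z \<zero>\<^bsub>shift C i\<^esub>"
  have s0: "\<zero>\<^bsub>shift C i\<^esub> \<in> carrier (shift C i)" using shift_module[OF C] by blast
  have sd0: "shift_diff C d i \<zero>\<^bsub>shift C i\<^esub> = \<zero>\<^bsub>C i\<^esub>"
    by (rule linear_zero[OF shift_diff_linear[OF C] shift_module[OF C] M])
  have "case i of 0 \<Rightarrow> ?z = \<zero>\<^bsub>cone C 0\<^esub> | Suc l \<Rightarrow> \<exists>w\<in>carrier (cone C l).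
      cone_diff R C d y l w = ?z \<and> (\<forall>r\<in>\<pp>. r \<odot>\<^bsub>cone C l\<^esub> w = \<zero>\<^bsub>cone C l\<^esub>)"
  proof (rule Cons.IH[OF cone_complex[OF C y(2)] _ cone_exact[OF C y(2) Cons.prems(3) reg] ys(1)
        cone_weakly_regular[OF C y(2) Cons.prems(3) ys(2) reg']])
    show "baer R (cone C i)" for i
      unfolding cone_def by (rule prod_module_baer[OF Cons.prems(2) shift_baer[OF _ _ C]]) (rule Cons.prems(2))+
    show "i < Suc j + length ys" using Cons.prems(6) by simp
    show "?z \<in> cocycles (cone C) (cone_diff R C d y) i"
      unfolding cone_cocycle[OF C y(2)] using zi s0 sd0 Cons.prems(8)[OF y(1)] by simp
    show "r \<odot>\<^bsub>cone C i\<^esub> ?z = \<zero>\<^bsub>cone C i\<^esub>" if r: "r \<in> \<pp>" for r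
      using Cons.prems(8)[OF r] shift_module[OF C, of i] r p by (auto simp: cone_def)
  qed
  then show ?case
  proof (cases i)
    case 0
    then show ?thesis
      using \<open>case i of 0 \<Rightarrow> _ | Suc l \<Rightarrow> _ l\<close> by (auto simp: cone_def dest: arg_cong[of _ _ evens])
  next
    case (Suc l)
    then obtain w where w: "w \<in> carrier (cone C l)" "cone_diff R C d y l w = ?z"
      "\<And>r. r \<in> \<pp> \<Longrightarrow> r \<odot>\<^bsub>cone C l\<^esub> w = \<zero>\<^bsub>cone C l\<^esub>"
      using \<open>case i of 0 \<Rightarrow> _ | Suc l \<Rightarrow> _ l\<close> by auto
    have "evens (cone_diff R C d y l w) = z" using w(2) by simp
    then have "d l (evens w) = z" by (simp add: cone_diff_def)
    moreover have "r \<odot>\<^bsub>C l\<^esub> evens w = \<zero>\<^bsub>C l\<^esub>" if "r \<in> \<pp>" for r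
      using arg_cong[OF w(3)[OF that], of evens] by (simp add: cone_def)
    ultimately show ?thesis using w(1) Suc by (auto simp: cone_def)
  qed
qed

end

text \<open>Makes \<open>socle_exact\<close> available for modules of arbitrary type.\<close>

definition const_module :: "('r, 'e) module \<Rightarrow> ('r, nat \<Rightarrow> 'e) module" where
  "const_module A = \<lparr>carrier = (\<lambda>e _. e) ` carrier A, monoid.mult = undefined, one = undefined,
     zero = (\<lambda>_. \<zero>\<^bsub>A\<^esub>), add = (\<lambda>f g _. f 0 \<oplus>\<^bsub>A\<^esub> g 0), smult = (\<lambda>r f _. r \<odot>\<^bsub>A\<^esub> f 0)\<rparr>"

lemma const_module_simps [simp]:
  "zero (const_module A) = (\<lambda>_. \<zero>\<^bsub>A\<^esub>)"
  "f \<oplus>\<^bsub>const_module A\<^esub> g = (\<lambda>_. f 0 \<oplus>\<^bsub>A\<^esub> g 0)"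
  "r \<odot>\<^bsub>const_module A\<^esub> f = (\<lambda>_. r \<odot>\<^bsub>A\<^esub> f 0)"
  "carrier (const_module A) = (\<lambda>e _. e) ` carrier A"
  by (simp_all add: const_module_def)

lemma const_eq [simp]: "(\<lambda>_::nat. a) = (\<lambda>_. b) \<longleftrightarrow> a = b"
  by (simp add: fun_eq_iff)

context noetherian_cring
begin

lemma const_module_module:
  assumes A: "module R A"
  shows "module R (const_module A)"
proof (rule moduleI[OF is_cring])
  show "abelian_group (const_module A)"
  proof (rule abelian_groupI)
    fix x assume "x \<in> carrier (const_module A)"
    then obtain a where a: "a \<in> carrier A" "x = (\<lambda>_. a)" by auto
    have "(\<ominus> \<one>) \<odot>\<^bsub>A\<^esub> a \<oplus>\<^bsub>A\<^esub> a = \<zero>\<^bsub>A\<^esub>"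
      using mod_simps(6)[OF A a(1)] mod_ac(1)[OF A a(1), of "(\<ominus> \<one>) \<odot>\<^bsub>A\<^esub> a"] a A by (simp add: msub_def)
    then show "\<exists>y\<in>carrier (const_module A). y \<oplus>\<^bsub>const_module A\<^esub> x = \<zero>\<^bsub>const_module A\<^esub>"
      using a A by (intro bexI[of _ "\<lambda>_. (\<ominus> \<one>) \<odot>\<^bsub>A\<^esub> a"]) auto
  qed (use A in \<open>auto simp: mod_ac\<close>)
qed (use A in \<open>auto simp: mod_distr\<close>)

lemma const_module_baer:
  assumes A: "baer R A"
  shows "baer R (const_module A)"
proof (rule baerI[OF const_module_module[OF baer_module[OF A]]])
  fix \<aa> f
  assume a: "ideal \<aa> R" and f: "\<And>r. r \<in> \<aa> \<Longrightarrow> f r \<in> carrier (const_module A)"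
    "\<And>r s. r \<in> \<aa> \<Longrightarrow> s \<in> \<aa> \<Longrightarrow> f (r \<oplus> s) = f r \<oplus>\<^bsub>const_module A\<^esub> f s"
    "\<And>r s. r \<in> carrier R \<Longrightarrow> s \<in> \<aa> \<Longrightarrow> f (r \<otimes> s) = r \<odot>\<^bsub>const_module A\<^esub> f s"
  have c: "f r = (\<lambda>_. f r 0)" "f r 0 \<in> carrier A" if "r \<in> \<aa>" for r using f(1)[OF that] by auto
  obtain e where e: "e \<in> carrier A" "\<And>r. r \<in> \<aa> \<Longrightarrow> f r 0 = r \<odot>\<^bsub>A\<^esub> e"
    by (rule baerD[OF A a, of "\<lambda>r. f r 0"]) (use f c in auto)
  have "f r = r \<odot>\<^bsub>const_module A\<^esub> (\<lambda>_. e)" if "r \<in> \<aa>" for r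
    using c(1)[OF that] e(2)[OF that] by (simp add: fun_eq_iff)
  then show "\<exists>e\<in>carrier (const_module A). \<forall>r\<in>\<aa>. f r = r \<odot>\<^bsub>const_module A\<^esub> e"
    using e(1) by (intro bexI[of _ "\<lambda>_. e"]) auto
qed

lemma socle_exact':
  assumes C: "complex R (C :: nat \<Rightarrow> ('r, 'e) module) d" and inj: "\<And>i. baer R (C i)"
    and ex: "\<And>i. i \<noteq> j \<Longrightarrow> exact_at C d i"
    and ys: "set ys \<subseteq> \<pp>" and p: "\<pp> \<subseteq> carrier R"
    and reg: "weakly_regular (C j) (cocycles C d j) (coboundaries C d j) ys"
    and i: "i < j + length ys"
    and z: "z \<in> cocycles C d i" "\<And>r. r \<in> \<pp> \<Longrightarrow> r \<odot>\<^bsub>C i\<^esub> z = \<zero>\<^bsub>C i\<^esub>"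
  shows "case i of 0 \<Rightarrow> z = \<zero>\<^bsub>C 0\<^esub> |
    Suc l \<Rightarrow> \<exists>w\<in>carrier (C l). d l w = z \<and> (\<forall>r\<in>\<pp>. r \<odot>\<^bsub>C l\<^esub> w = \<zero>\<^bsub>C l\<^esub>)"
proof -
  note M = complexD(1)[OF C] and lin = complexD(2)[OF C]
  let ?C = "\<lambda>i. const_module (C i)"
  define D where "D i f = (\<lambda>_::nat. d i (f 0))" for i and f :: "nat \<Rightarrow> 'e"
  have DC: "complex R ?C D"
    unfolding complex_def
  proof (intro conjI allI ballI)
    show "module R (?C i)" for i by (rule const_module_module[OF M])
    show "linear_map R (?C i) (?C (Suc i)) (D i)" for i
      by (rule linear_mapI) (auto simp: D_def linear_add[OF lin] linear_smult[OF lin] linear_closed[OF lin])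
    show "D (Suc i) (D i x) = \<zero>\<^bsub>?C (Suc (Suc i))\<^esub>" if "x \<in> carrier (?C i)" for i x
      using that complexD(3)[OF C] by (auto simp: D_def)
  qed
  have Z: "cocycles ?C D i = (\<lambda>e _. e) ` cocycles C d i" for i
    by (auto simp: cocycles_def D_def)
  have B: "coboundaries ?C D i = (\<lambda>e _. e) ` coboundaries C d i" for i
    by (cases i) (auto simp: coboundaries_def D_def image_iff)
  have mem: "(\<lambda>_. a) \<in> (\<lambda>e (_::nat). e) ` T \<longleftrightarrow> a \<in> T" for a and T :: "'e set" by auto
  have "weakly_regular (?C j) (cocycles ?C D j) (coboundaries ?C D j) ys"
  proof (rule weakly_regular_transfer[OF M complexD(1)[OF DC] cocycles_submodule[OF C] cocycles_submodule[OF DC]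
      _ _ coboundaries_submodule[OF C] coboundaries_cocycles[OF C] coboundaries_submodule[OF DC]
      coboundaries_cocycles[OF DC] _ _ _ reg])
    show "linear_map R (C j\<lparr>carrier := cocycles C d j\<rparr>) (?C j) (\<lambda>e _. e)"
      by (rule linear_mapI) (auto simp: cocycles_def)
    show "(\<lambda>_. a) \<in> cocycles ?C D j" if "a \<in> cocycles C d j" for a using that unfolding Z by blast
    show "(\<lambda>_. a) \<in> coboundaries ?C D j \<longleftrightarrow> a \<in> coboundaries C d j" for a unfolding B mem ..
    show "\<exists>v\<in>cocycles C d j. \<exists>u\<in>coboundaries ?C D j. b = (\<lambda>_. v) \<oplus>\<^bsub>?C j\<^esub> u"
      if "b \<in> cocycles ?C D j" for b
    proof -
      obtain v where v: "v \<in> cocycles C d j" "b = (\<lambda>_. v)" using \<open>b \<in> _\<close> unfolding Z by blast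
      have "(\<lambda>_. \<zero>\<^bsub>C j\<^esub>) \<in> coboundaries ?C D j"
        unfolding B mem by (rule submodule_rules(2)[OF coboundaries_submodule[OF C] M])
      moreover have "v \<oplus>\<^bsub>C j\<^esub> \<zero>\<^bsub>C j\<^esub> = v" using v(1) M[of j] by (simp add: cocycles_def)
      ultimately show ?thesis using v by (intro bexI[of _ v] bexI[of _ "\<lambda>_. \<zero>\<^bsub>C j\<^esub>"]) auto
    qed
    show "set ys \<subseteq> carrier R" using ys p by blast
  qed
  moreover have "exact_at ?C D k" if "k \<noteq> j" for k
    using ex[OF that] unfolding exact_at_def Z B by blast
  ultimately have "case i of 0 \<Rightarrow> (\<lambda>_. z) = \<zero>\<^bsub>?C 0\<^esub> | Suc l \<Rightarrow> \<exists>w\<in>carrier (?C l).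
      D l w = (\<lambda>_. z) \<and> (\<forall>r\<in>\<pp>. r \<odot>\<^bsub>?C l\<^esub> w = \<zero>\<^bsub>?C l\<^esub>)"
    by (intro socle_exact[OF DC const_module_baer[OF inj] _ ys p _ i]) (use z in \<open>auto simp: Z\<close>)
  then show ?thesis by (cases i) (auto simp: D_def)
qed

text \<open>A complement of the torsion submodule of an injective module is a model of its localization
  that lives on the same type.\<close>

lemma torsion_projection:
  assumes E: "baer R (E :: ('r, 'e) module)" and S: "submonoid S R"
  shows "\<exists>\<sigma>. linear_map R E E \<sigma> \<and> (\<forall>x\<in>carrier E. msub R E x (\<sigma> x) \<in> carrier (tors R S E)) \<and>
     (\<forall>x\<in>carrier (tors R S E). \<sigma> x = \<zero>\<^bsub>E\<^esub>)"
proof -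
  let ?T = "tors R S E"
  have E': "module R E" by (rule baer_module[OF E])
  have T: "submodule (carrier ?T) R E" by (rule tors_submodule[OF E' S])
  note t = submodule_rules[OF T E']
  obtain \<rho> where \<rho>: "linear_map R E ?T \<rho>" "\<And>x. x \<in> carrier ?T \<Longrightarrow> \<rho> x = x"
    by (rule baer_extend_submodule[OF baer_tors[OF E S] E' T, of "\<lambda>x. x"]) (simp add: tors_def linear_id, rule that)
  have \<rho>E: "linear_map R E E \<rho>"
  proof (rule linear_codomain')
    show "linear_map R E (E\<lparr>carrier := carrier ?T\<rparr>) \<rho>" using \<rho>(1) by (simp add: tors_def)
  qed (use t(1) in blast)
  let ?\<sigma> = "\<lambda>x. msub R E x (\<rho> x)"
  have "linear_map R E E ?\<sigma>" by (rule linear_diff[OF linear_id \<rho>E E' E'])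
  moreover have "msub R E x (?\<sigma> x) \<in> carrier ?T" if x: "x \<in> carrier E" for x
    using msub_alg(7)[OF E' x linear_closed[OF \<rho>E x]] linear_closed[OF \<rho>(1) x] by simp
  moreover have "?\<sigma> x = \<zero>\<^bsub>E\<^esub>" if "x \<in> carrier ?T" for x using \<rho>(2)[OF that] t(1)[OF that] E' by simp
  ultimately show ?thesis by (intro exI[of _ ?\<sigma>]) blast
qed

end

section \<open>A model of the localized resolution on the same type\<close>

locale localized_complex = noetherian_cring R for R :: "'r ring" (structure) +
  fixes S :: "'r set" and E :: "nat \<Rightarrow> ('r, 'e) module" and d :: "nat \<Rightarrow> 'e \<Rightarrow> 'e"
  assumes S: "submonoid S R" and complex: "complex R E d" and inj: "\<And>i. baer R (E i)"
    and exact: "\<And>i. 0 < i \<Longrightarrow> exact_at E d i"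
begin

abbreviation T where "T i \<equiv> tors R S (E i)"

definition \<sigma> :: "nat \<Rightarrow> 'e \<Rightarrow> 'e" where
  "\<sigma> i = (SOME \<sigma>. linear_map R (E i) (E i) \<sigma> \<and>
     (\<forall>x\<in>carrier (E i). msub R (E i) x (\<sigma> x) \<in> carrier (T i)) \<and>
     (\<forall>x\<in>carrier (T i). \<sigma> x = \<zero>\<^bsub>E i\<^esub>))"

lemma \<sigma>: "linear_map R (E i) (E i) (\<sigma> i)"
  and \<sigma>_diff: "x \<in> carrier (E i) \<Longrightarrow> msub R (E i) x (\<sigma> i x) \<in> carrier (T i)"
  and \<sigma>_T: "x \<in> carrier (T i) \<Longrightarrow> \<sigma> i x = \<zero>\<^bsub>E i\<^esub>"
  using someI_ex[OF torsion_projection[OF inj S], of i] unfolding \<sigma>_def by blast+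

lemma M: "module R (E i)"
  by (rule complexD(1)[OF complex])

lemmas lin = complexD(2)[OF complex] and dd = complexD(3)[OF complex] and dc = complexD(4)[OF complex]
lemmas SD = submonoid_rules[OF S]

lemma \<sigma>c: "x \<in> carrier (E i) \<Longrightarrow> \<sigma> i x \<in> carrier (E i)"
  by (rule linear_closed[OF \<sigma>])

lemma \<sigma>\<sigma>: "x \<in> carrier (E i) \<Longrightarrow> \<sigma> i (\<sigma> i x) = \<sigma> i x"
  using \<sigma>_T[OF \<sigma>_diff, of x i] linear_msub[OF \<sigma> M, of x i "\<sigma> i x"] \<sigma>c msub_alg(1)[OF M, of "\<sigma> i x" i "\<sigma> i (\<sigma> i x)"]
  by simp

lemma \<sigma>_zero: "x \<in> carrier (E i) \<Longrightarrow> \<sigma> i x = \<zero>\<^bsub>E i\<^esub> \<Longrightarrow> x \<in> carrier (T i)"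
  using \<sigma>_diff[of x i] mod_simps(7)[OF M, of x i] by simp

text \<open>The elements of \<open>S\<close> act bijectively on this complement of the torsion
  (\<open>D_inj\<close>, \<open>D_div\<close>), so it stands for the localization of
  \<open>E i\<close> at \<open>S\<close>.\<close>

definition D :: "nat \<Rightarrow> ('r, 'e) module" where
  "D i = (E i)\<lparr>carrier := {x \<in> carrier (E i). \<sigma> i x = x}\<rparr>"

text \<open>The differential need not respect the chosen complements, only the torsion; projecting
  back gives the differential induced on the quotients by torsion.\<close>

definition d' :: "nat \<Rightarrow> 'e \<Rightarrow> 'e" where "d' i x = \<sigma> (Suc i) (d i x)"

lemma D_simps [simp]: "zero (D i) = zero (E i)" "add (D i) = add (E i)" "smult (D i) = smult (E i)"
  "msub R (D i) = msub R (E i)"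
  by (simp_all add: D_def)

lemma D_carrier: "x \<in> carrier (D i) \<longleftrightarrow> x \<in> carrier (E i) \<and> \<sigma> i x = x"
  by (simp add: D_def)

lemma D_module: "module R (D i)"
proof -
  have "submodule {x \<in> carrier (E i). \<sigma> i x = x} R (E i)"
    by (rule submoduleI'[OF M])
      (use M[of i] in \<open>auto simp: linear_add[OF \<sigma>] linear_smult[OF \<sigma>] linear_zero[OF \<sigma> M M]\<close>)
  then show ?thesis using submodule_mod[OF _ M] by (simp add: D_def)
qed

lemma \<sigma>_D: "x \<in> carrier (E i) \<Longrightarrow> \<sigma> i x \<in> carrier (D i)"
  by (simp add: D_carrier \<sigma>c \<sigma>\<sigma>)

lemma \<sigma>_linear_D: "linear_map R (E i) (D i) (\<sigma> i)"
  unfolding D_def by (rule linear_codomain[OF \<sigma>]) (simp add: \<sigma>c \<sigma>\<sigma>)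

lemma D_baer: "baer R (D i)"
proof (rule baerI[OF D_module])
  fix \<aa> f
  assume a: "ideal \<aa> R" and f: "\<And>r. r \<in> \<aa> \<Longrightarrow> f r \<in> carrier (D i)"
    "\<And>r s. r \<in> \<aa> \<Longrightarrow> s \<in> \<aa> \<Longrightarrow> f (r \<oplus> s) = f r \<oplus>\<^bsub>D i\<^esub> f s"
    "\<And>r s. r \<in> carrier R \<Longrightarrow> s \<in> \<aa> \<Longrightarrow> f (r \<otimes> s) = r \<odot>\<^bsub>D i\<^esub> f s"
  obtain e where e: "e \<in> carrier (E i)" "\<And>r. r \<in> \<aa> \<Longrightarrow> f r = r \<odot>\<^bsub>E i\<^esub> e"
    by (rule baerD[OF inj[of i] a, of f]) (use f in \<open>simp_all add: D_carrier\<close>)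
  have "f r = r \<odot>\<^bsub>D i\<^esub> \<sigma> i e" if r: "r \<in> \<aa>" for r
    using f(1)[OF r] e linear_smult[OF \<sigma> ideal_rules(1)[OF a r] e(1)] e(2)[OF r] by (simp add: D_carrier)
  then show "\<exists>e\<in>carrier (D i). \<forall>r\<in>\<aa>. f r = r \<odot>\<^bsub>D i\<^esub> e" using \<sigma>_D[OF e(1)] by blast
qed

text \<open>The differential maps torsion to torsion, which the projection removes. This is what
  makes \<open>d'\<close> square to zero.\<close>

lemma \<sigma>d: "x \<in> carrier (E i) \<Longrightarrow> \<sigma> (Suc i) (d i (\<sigma> i x)) = \<sigma> (Suc i) (d i x)"
proof -
  assume x: "x \<in> carrier (E i)"
  have "d i (msub R (E i) x (\<sigma> i x)) \<in> carrier (T (Suc i))"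
    by (rule tors_mem_map[OF lin M M S \<sigma>_diff[OF x]])
  then have "\<sigma> (Suc i) (d i (msub R (E i) x (\<sigma> i x))) = \<zero>\<^bsub>E (Suc i)\<^esub>" by (rule \<sigma>_T)
  then show ?thesis
    using msub_alg(1)[OF M \<sigma>c[OF dc[OF x]] \<sigma>c[OF dc[OF \<sigma>c[OF x]]]]
    by (simp add: linear_msub[OF lin M x \<sigma>c[OF x]] linear_msub[OF \<sigma> M dc[OF x] dc[OF \<sigma>c[OF x]]])
qed

lemma D_complex: "complex R D d'"
  unfolding complex_def
proof (intro conjI allI ballI D_module)
  show "linear_map R (D i) (D (Suc i)) (d' i)" for i
  proof -
    have "linear_map R (D i) (E (Suc i)) (d i)"
      unfolding D_def by (rule linear_domain[OF lin]) auto
    then show ?thesis unfolding d'_def by (rule linear_comp[OF _ \<sigma>_linear_D])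
  qed
  show "d' (Suc i) (d' i x) = \<zero>\<^bsub>D (Suc (Suc i))\<^esub>" if "x \<in> carrier (D i)" for i x
    using that \<sigma>d[OF dc] dd linear_zero[OF \<sigma> M M] by (simp add: d'_def D_carrier)
qed

lemma D_inj: "s \<in> S \<Longrightarrow> x \<in> carrier (D i) \<Longrightarrow> s \<odot>\<^bsub>E i\<^esub> x = \<zero>\<^bsub>E i\<^esub> \<Longrightarrow> x = \<zero>\<^bsub>E i\<^esub>"
  using \<sigma>_T[of x i] by (auto simp: D_carrier tors_carrier)

lemma D_cancel:
  assumes s: "s \<in> S" and xy: "x \<in> carrier (D i)" "y \<in> carrier (D i)" "s \<odot>\<^bsub>E i\<^esub> x = s \<odot>\<^bsub>E i\<^esub> y"
  shows "x = y"
proof -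
  have c: "x \<in> carrier (E i)" "y \<in> carrier (E i)" using xy by (auto simp: D_carrier)
  have "s \<odot>\<^bsub>E i\<^esub> msub R (E i) x y = \<zero>\<^bsub>E i\<^esub>"
    using xy(3) c SD(1)[OF s] M[of i] by (simp add: msub_alg(8))
  moreover have "msub R (E i) x y \<in> carrier (D i)" using mod_closed(4)[OF D_module xy(1,2)] by simp
  ultimately have "msub R (E i) x y = \<zero>\<^bsub>E i\<^esub>" using D_inj[OF s] by blast
  then show ?thesis using msub_alg(1)[OF M c] by simp
qed

lemma D_div:
  assumes s: "s \<in> S" and x: "x \<in> carrier (D i)"
  obtains y where "y \<in> carrier (D i)" "s \<odot>\<^bsub>E i\<^esub> y = x"
proof -
  have xE: "x \<in> carrier (E i)" "\<sigma> i x = x" using x by (auto simp: D_carrier)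
  obtain e where e: "e \<in> carrier (E i)" "msub R (E i) (s \<odot>\<^bsub>E i\<^esub> e) x \<in> carrier (T i)"
    by (rule tors_divisible[OF inj S s xE(1)])
  have se: "s \<odot>\<^bsub>E i\<^esub> e \<in> carrier (E i)" using e(1) SD(1)[OF s] M[of i] by simp
  have "msub R (E i) (\<sigma> i (s \<odot>\<^bsub>E i\<^esub> e)) (\<sigma> i x) = \<zero>\<^bsub>E i\<^esub>"
    using \<sigma>_T[OF e(2)] linear_msub[OF \<sigma> M se xE(1)] by simp
  then have "\<sigma> i (s \<odot>\<^bsub>E i\<^esub> e) = x" using msub_alg(1)[OF M \<sigma>c[OF se] xE(1)] xE(2) by simp
  then have "s \<odot>\<^bsub>E i\<^esub> \<sigma> i e = x" using linear_smult[OF \<sigma> SD(1)[OF s] e(1)] by simp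
  then show ?thesis using that[OF \<sigma>_D[OF e(1)]] by blast
qed

lemma d'_zero:
  assumes x: "x \<in> carrier (E i)" "d' i x = \<zero>\<^bsub>E (Suc i)\<^esub>"
  obtains s where "s \<in> S" "s \<odot>\<^bsub>E i\<^esub> x \<in> cocycles E d i"
proof -
  have "d i x \<in> carrier (T (Suc i))" using \<sigma>_zero[OF dc[OF x(1)]] x(2) by (simp add: d'_def)
  then obtain s where s: "s \<in> S" "s \<odot>\<^bsub>E (Suc i)\<^esub> d i x = \<zero>\<^bsub>E (Suc i)\<^esub>" by (auto simp: tors_carrier)
  then have "s \<odot>\<^bsub>E i\<^esub> x \<in> cocycles E d i"
    using x(1) M[of i] SD(1)[OF s(1)] linear_smult[OF lin SD(1)[OF s(1)] x(1)] by (simp add: cocycles_def)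
  then show ?thesis using that s(1) by blast
qed

text \<open>Exactness of localization by clearing denominators: some multiple \<open>s x\<close> is
  a cocycle of \<open>E\<close>, hence \<open>d w\<close>, and the projection of \<open>w\<close>
  can be divided by \<open>s\<close> in \<open>D\<close>.\<close>

lemma D_exact:
  assumes i: "i \<noteq> 0"
  shows "exact_at D d' i"
  unfolding exact_at_def
proof
  fix x assume "x \<in> cocycles D d' i"
  then have x: "x \<in> carrier (D i)" "d' i x = \<zero>\<^bsub>E (Suc i)\<^esub>" by (auto simp: cocycles_def)
  obtain l where l: "i = Suc l" using i by (cases i) auto
  have xE: "x \<in> carrier (E (Suc l))" using x(1) l by (simp add: D_carrier)
  obtain s where s: "s \<in> S" "s \<odot>\<^bsub>E (Suc l)\<^esub> x \<in> cocycles E d (Suc l)"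
    by (rule d'_zero[of x "Suc l"]) (use xE x(2) l in auto)
  have sx: "s \<odot>\<^bsub>E (Suc l)\<^esub> x \<in> carrier (E (Suc l))" "d (Suc l) (s \<odot>\<^bsub>E (Suc l)\<^esub> x) = \<zero>\<^bsub>E (Suc (Suc l))\<^esub>"
    using s(2) by (auto simp: cocycles_def)
  obtain w where w: "w \<in> carrier (E l)" "s \<odot>\<^bsub>E (Suc l)\<^esub> x = d l w"
    by (rule exact_atD_Suc[OF exact sx]) (simp, rule that)
  obtain v where v: "v \<in> carrier (D l)" "s \<odot>\<^bsub>E l\<^esub> v = \<sigma> l w" by (rule D_div[OF s(1) \<sigma>_D[OF w(1)]])
  have "s \<odot>\<^bsub>E (Suc l)\<^esub> d' l v = d' l (\<sigma> l w)"
    using linear_smult[OF complexD(2)[OF D_complex] SD(1)[OF s(1)] v(1)] v(2) by simp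
  also have "\<dots> = \<sigma> (Suc l) (s \<odot>\<^bsub>E (Suc l)\<^esub> x)" unfolding d'_def \<sigma>d[OF w(1)] w(2) ..
  also have "\<dots> = s \<odot>\<^bsub>E (Suc l)\<^esub> x"
    using linear_smult[OF \<sigma> SD(1)[OF s(1)] xE] x(1) l by (simp add: D_carrier)
  finally have "d' l v = x"
    using D_cancel[OF s(1) complexD(4)[OF D_complex v(1)]] x(1) l by blast
  then show "x \<in> coboundaries D d' i" using v(1) l by (auto simp: coboundaries_def)
qed

end

text \<open>Here \<open>V k\<close> plays the part of the preimage in \<open>M\<close> of the submodule generated by the first \<open>k\<close>
  elements of a sequence in the localization.\<close>

locale localized_resolution = localized_complex R S E d
  for R :: "'r ring" (structure) and S and E :: "nat \<Rightarrow> ('r, 'e) module" and d +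
  fixes M :: "('r, 'm) module" and aug :: "'m \<Rightarrow> 'e" and V :: "nat \<Rightarrow> 'm set" and ys :: "'r list"
  assumes modM: "module R M" and aug: "linear_map R M (E 0) aug"
    and aug_inj: "\<And>m. m \<in> carrier M \<Longrightarrow> aug m = \<zero>\<^bsub>E 0\<^esub> \<Longrightarrow> m = \<zero>\<^bsub>M\<^esub>"
    and aug_image: "aug ` carrier M = cocycles E d 0"
    and ys: "set ys \<subseteq> carrier R"
    and V_sub: "\<And>k. submodule (V k) R M"
    and V_0: "V 0 = carrier (tors R S M)"
    and V_sat: "\<And>k s m. s \<in> S \<Longrightarrow> m \<in> carrier M \<Longrightarrow> s \<odot>\<^bsub>M\<^esub> m \<in> V k \<Longrightarrow> m \<in> V k"
    and V_reg: "\<And>k m. k < length ys \<Longrightarrow> m \<in> carrier M \<Longrightarrow> ys ! k \<odot>\<^bsub>M\<^esub> m \<in> V k \<Longrightarrow> m \<in> V k"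
    and V_inc: "\<And>k. k < length ys \<Longrightarrow> V k \<subseteq> V (Suc k)"
    and V_mult: "\<And>k m. k < length ys \<Longrightarrow> m \<in> carrier M \<Longrightarrow> ys ! k \<odot>\<^bsub>M\<^esub> m \<in> V (Suc k)"
    and V_gen: "\<And>k m. k < length ys \<Longrightarrow> m \<in> V (Suc k) \<Longrightarrow>
      \<exists>s\<in>S. \<exists>m'\<in>carrier M. msub R M (s \<odot>\<^bsub>M\<^esub> m) (ys ! k \<odot>\<^bsub>M\<^esub> m') \<in> V k"
begin

abbreviation Z where "Z \<equiv> cocycles D d' 0"

text \<open>The localization map of \<open>M\<close>: its kernel is the torsion
  (\<open>\<alpha>_zero\<close>), and every cocycle of \<open>D\<close> in degree 0 is a quotient of
  an image by an element of \<open>S\<close> (\<open>Z_\<alpha>\<close>).\<close>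

definition \<alpha> :: "'m \<Rightarrow> 'e" where "\<alpha> m = \<sigma> 0 (aug m)"

lemma \<alpha>_linear: "linear_map R M (D 0) \<alpha>"
  unfolding \<alpha>_def by (rule linear_comp[OF aug \<sigma>_linear_D])

lemma \<alpha>_Z: "m \<in> carrier M \<Longrightarrow> \<alpha> m \<in> Z"
proof -
  assume m: "m \<in> carrier M"
  have "aug m \<in> cocycles E d 0" using aug_image m by blast
  then have "d' 0 (\<alpha> m) = \<zero>\<^bsub>E (Suc 0)\<^esub>"
    using \<sigma>d[of "aug m" 0] linear_zero[OF \<sigma> M M, of "Suc 0"] by (simp add: cocycles_def d'_def \<alpha>_def)
  then show ?thesis using linear_closed[OF \<alpha>_linear m] by (simp add: cocycles_def)
qed

lemma \<alpha>_zero: "m \<in> carrier M \<Longrightarrow> \<alpha> m = \<zero>\<^bsub>E 0\<^esub> \<longleftrightarrow> m \<in> V 0"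
proof
  assume m: "m \<in> carrier M" "\<alpha> m = \<zero>\<^bsub>E 0\<^esub>"
  then have "aug m \<in> carrier (T 0)" using \<sigma>_zero[OF linear_closed[OF aug m(1)]] by (simp add: \<alpha>_def)
  then obtain s where s: "s \<in> S" "s \<odot>\<^bsub>E 0\<^esub> aug m = \<zero>\<^bsub>E 0\<^esub>" by (auto simp: tors_carrier)
  have "aug (s \<odot>\<^bsub>M\<^esub> m) = \<zero>\<^bsub>E 0\<^esub>" using linear_smult[OF aug SD(1)[OF s(1)] m(1)] s(2) by simp
  then have "s \<odot>\<^bsub>M\<^esub> m = \<zero>\<^bsub>M\<^esub>" using aug_inj mod_closed(3)[OF modM SD(1)[OF s(1)] m(1)] by blast
  then show "m \<in> V 0" unfolding V_0 using s(1) m(1) by (auto simp: tors_carrier)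
next
  assume "m \<in> V 0"
  then have "aug m \<in> carrier (T 0)" unfolding V_0 by (rule tors_mem_map[OF aug modM M S])
  then show "\<alpha> m = \<zero>\<^bsub>E 0\<^esub>" unfolding \<alpha>_def by (rule \<sigma>_T)
qed

lemma Z_\<alpha>:
  assumes e: "e \<in> Z"
  obtains s m where "s \<in> S" "m \<in> carrier M" "s \<odot>\<^bsub>E 0\<^esub> e = \<alpha> m"
proof -
  have eD: "e \<in> carrier (E 0)" "\<sigma> 0 e = e" "d' 0 e = \<zero>\<^bsub>E (Suc 0)\<^esub>" using e by (auto simp: cocycles_def D_carrier)
  obtain s where s: "s \<in> S" "s \<odot>\<^bsub>E 0\<^esub> e \<in> cocycles E d 0" by (rule d'_zero[OF eD(1,3)])
  then obtain m where m: "m \<in> carrier M" "s \<odot>\<^bsub>E 0\<^esub> e = aug m" using aug_image by blast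
  have "\<alpha> m = s \<odot>\<^bsub>E 0\<^esub> e"
    unfolding \<alpha>_def m(2)[symmetric] using linear_smult[OF \<sigma> SD(1)[OF s(1)] eD(1)] eD(2) by simp
  then show ?thesis using that s(1) m(1) by simp
qed

text \<open>The submodule of the localized module corresponding to \<open>V k\<close>. These are the
  submodules that the recursion of \<open>weakly_regular\<close> runs through, as
  \<open>U_Suc\<close> shows.\<close>

definition U :: "nat \<Rightarrow> 'e set" where
  "U k = {e \<in> Z. \<exists>s\<in>S. \<exists>m\<in>V k. s \<odot>\<^bsub>E 0\<^esub> e = \<alpha> m}"

lemma V_M: "m \<in> V k \<Longrightarrow> m \<in> carrier M"
  by (rule submodule_rules(1)[OF V_sub modM])

lemma U_0: "U 0 = {\<zero>\<^bsub>E 0\<^esub>}"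
proof
  show "U 0 \<subseteq> {\<zero>\<^bsub>E 0\<^esub>}"
  proof
    fix e assume "e \<in> U 0"
    then obtain s m where e: "e \<in> Z" "s \<in> S" "m \<in> V 0" "s \<odot>\<^bsub>E 0\<^esub> e = \<alpha> m" by (auto simp: U_def)
    then have "s \<odot>\<^bsub>E 0\<^esub> e = \<zero>\<^bsub>E 0\<^esub>" using \<alpha>_zero V_M by simp
    then show "e \<in> {\<zero>\<^bsub>E 0\<^esub>}" using D_inj[OF e(2)] e(1) by (simp add: cocycles_def)
  qed
  have "\<one> \<odot>\<^bsub>E 0\<^esub> \<zero>\<^bsub>E 0\<^esub> = \<alpha> \<zero>\<^bsub>M\<^esub>"
    using linear_zero[OF \<alpha>_linear modM D_module] M[of 0] by simp
  moreover have "\<zero>\<^bsub>M\<^esub> \<in> V 0" by (rule submodule_rules(2)[OF V_sub modM])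
  moreover have "\<zero>\<^bsub>E 0\<^esub> \<in> Z" using submodule_rules(2)[OF cocycles_submodule[OF D_complex] D_module] by simp
  ultimately show "{\<zero>\<^bsub>E 0\<^esub>} \<subseteq> U 0" using SD(2) unfolding U_def by blast
qed

lemma V_0_le: "k \<le> length ys \<Longrightarrow> V 0 \<subseteq> V k"
proof (induction k)
  case (Suc k)
  then show ?case using V_inc[of k] by auto
qed simp

text \<open>With denominators cleared the relation holds in \<open>M\<close> up to the kernel of
  \<alpha>, which is \<open>V 0\<close>. Saturation of \<open>V k\<close> then removes the
  denominator and \<open>V_reg\<close> the factor from \<open>ys\<close>.\<close>

lemma U_reg:
  assumes k: "k < length ys" and e: "e \<in> Z" "ys ! k \<odot>\<^bsub>E 0\<^esub> e \<in> U k"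
  shows "e \<in> U k"
proof -
  let ?y = "ys ! k"
  have y: "?y \<in> carrier R" using k ys by auto
  obtain s m where sm: "s \<in> S" "m \<in> V k" "s \<odot>\<^bsub>E 0\<^esub> (?y \<odot>\<^bsub>E 0\<^esub> e) = \<alpha> m" using e(2) by (auto simp: U_def)
  obtain t n where tn: "t \<in> S" "n \<in> carrier M" "t \<odot>\<^bsub>E 0\<^esub> e = \<alpha> n" by (rule Z_\<alpha>[OF e(1)])
  have eE: "e \<in> carrier (E 0)" using e(1) by (simp add: cocycles_def D_carrier)
  have c: "s \<in> carrier R" "t \<in> carrier R" "m \<in> carrier M" using SD(1) sm V_M tn by auto
  let ?a = "t \<odot>\<^bsub>M\<^esub> m" and ?b = "s \<odot>\<^bsub>M\<^esub> (?y \<odot>\<^bsub>M\<^esub> n)"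
  have ab: "?a \<in> carrier M" "?b \<in> carrier M" using c y tn(2) modM by auto
  have "\<alpha> ?a = t \<odot>\<^bsub>E 0\<^esub> (s \<odot>\<^bsub>E 0\<^esub> (?y \<odot>\<^bsub>E 0\<^esub> e))"
    using linear_smult[OF \<alpha>_linear c(2,3)] sm(3) by simp
  also have "\<dots> = s \<odot>\<^bsub>E 0\<^esub> (?y \<odot>\<^bsub>E 0\<^esub> (t \<odot>\<^bsub>E 0\<^esub> e))"
    using c y eE M[of 0] smult_swap[OF M c(2,1), of "?y \<odot>\<^bsub>E 0\<^esub> e" 0] smult_swap[OF M c(2) y eE] by simp
  also have "\<dots> = \<alpha> ?b"
    using tn(2,3) linear_smult[OF \<alpha>_linear y tn(2)] linear_smult[OF \<alpha>_linear c(1), of "?y \<odot>\<^bsub>M\<^esub> n"] y modM by simp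
  finally have "\<alpha> (msub R M ?b ?a) = \<zero>\<^bsub>E 0\<^esub>"
    using linear_msub[OF \<alpha>_linear modM ab(2,1)] linear_closed[OF \<alpha>_linear ab(2)] mod_simps(6)[OF D_module, of "\<alpha> ?b" 0] by simp
  then have d: "msub R M ?b ?a \<in> V k"
    using \<alpha>_zero[of "msub R M ?b ?a"] ab modM V_0_le[of k] k by auto
  have "?b = msub R M ?b ?a \<oplus>\<^bsub>M\<^esub> ?a" using ab modM by (simp add: msub_alg(2))
  then have "?b \<in> V k"
    using submodule_rules(3)[OF V_sub modM d submodule_rules(4)[OF V_sub modM c(2) sm(2)]] by simp
  then have "?y \<odot>\<^bsub>M\<^esub> n \<in> V k" by (rule V_sat[OF sm(1) mod_closed(3)[OF modM y tn(2)]])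
  then have "n \<in> V k" by (rule V_reg[OF k tn(2)])
  then show ?thesis using e(1) tn unfolding U_def by blast
qed

lemma Z_sub: "submodule Z R (D 0)"
  by (rule cocycles_submodule[OF D_complex])

lemma Z_div:
  assumes s: "s \<in> S" and x: "x \<in> Z"
  obtains y where "y \<in> Z" "s \<odot>\<^bsub>E 0\<^esub> y = x"
proof -
  have xD: "x \<in> carrier (D 0)" "d' 0 x = \<zero>\<^bsub>E (Suc 0)\<^esub>" using x by (auto simp: cocycles_def)
  obtain y where y: "y \<in> carrier (D 0)" "s \<odot>\<^bsub>E 0\<^esub> y = x" by (rule D_div[OF s xD(1)])
  have "s \<odot>\<^bsub>E (Suc 0)\<^esub> d' 0 y = \<zero>\<^bsub>E (Suc 0)\<^esub>"
    using linear_smult[OF complexD(2)[OF D_complex] SD(1)[OF s] y(1)] y(2) xD(2) by simp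
  then have "d' 0 y = \<zero>\<^bsub>E (Suc 0)\<^esub>" by (rule D_inj[OF s complexD(4)[OF D_complex y(1)]])
  then show ?thesis using that y by (simp add: cocycles_def)
qed

text \<open>The localized form of \<open>V_mult\<close> and \<open>V_gen\<close>; the factors from
  \<open>S\<close> that occur there become divisible after localization.\<close>

lemma U_Suc:
  assumes k: "k < length ys"
  shows "{u \<oplus>\<^bsub>D 0\<^esub> ys ! k \<odot>\<^bsub>D 0\<^esub> v | u v. u \<in> U k \<and> v \<in> Z} = U (Suc k)"
proof
  let ?y = "ys ! k"
  have y: "?y \<in> carrier R" using k ys by auto
  note z = submodule_rules[OF Z_sub D_module, unfolded D_simps]
  have ZE: "e \<in> carrier (E 0)" if "e \<in> Z" for e using that by (simp add: cocycles_def D_carrier)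
  show "{u \<oplus>\<^bsub>D 0\<^esub> ?y \<odot>\<^bsub>D 0\<^esub> v | u v. u \<in> U k \<and> v \<in> Z} \<subseteq> U (Suc k)"
  proof
    fix e assume "e \<in> {u \<oplus>\<^bsub>D 0\<^esub> ?y \<odot>\<^bsub>D 0\<^esub> v | u v. u \<in> U k \<and> v \<in> Z}"
    then obtain u v where uv: "u \<in> U k" "v \<in> Z" "e = u \<oplus>\<^bsub>E 0\<^esub> ?y \<odot>\<^bsub>E 0\<^esub> v" by auto
    obtain s m where sm: "u \<in> Z" "s \<in> S" "m \<in> V k" "s \<odot>\<^bsub>E 0\<^esub> u = \<alpha> m" using uv(1) by (auto simp: U_def)
    obtain t n where tn: "t \<in> S" "n \<in> carrier M" "t \<odot>\<^bsub>E 0\<^esub> v = \<alpha> n" by (rule Z_\<alpha>[OF uv(2)])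
    have c: "s \<in> carrier R" "t \<in> carrier R" "m \<in> carrier M" "u \<in> carrier (E 0)" "v \<in> carrier (E 0)"
      using SD(1) sm V_M tn ZE uv(2) by auto
    let ?a = "t \<odot>\<^bsub>M\<^esub> m" and ?b = "?y \<odot>\<^bsub>M\<^esub> (s \<odot>\<^bsub>M\<^esub> n)"
    have ab: "?a \<in> carrier M" "?b \<in> carrier M" "s \<odot>\<^bsub>M\<^esub> n \<in> carrier M" using c y tn(2) modM by auto
    have "(s \<otimes> t) \<odot>\<^bsub>E 0\<^esub> e = t \<odot>\<^bsub>E 0\<^esub> (s \<odot>\<^bsub>E 0\<^esub> u) \<oplus>\<^bsub>E 0\<^esub> ?y \<odot>\<^bsub>E 0\<^esub> (s \<odot>\<^bsub>E 0\<^esub> (t \<odot>\<^bsub>E 0\<^esub> v))"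
      unfolding uv(3) using c y M[of 0]
      by (simp add: mod_distr smult_swap[OF M c(2,1)] smult_swap[OF M y])
    also have "\<dots> = \<alpha> (?a \<oplus>\<^bsub>M\<^esub> ?b)"
      unfolding sm(4) tn(3) using c y tn(2) modM ab
      by (simp add: linear_add[OF \<alpha>_linear] linear_smult[OF \<alpha>_linear])
    finally have eq: "(s \<otimes> t) \<odot>\<^bsub>E 0\<^esub> e = \<alpha> (?a \<oplus>\<^bsub>M\<^esub> ?b)" .
    have "?a \<in> V (Suc k)"
      using submodule_rules(4)[OF V_sub modM c(2) sm(3)] V_inc[OF k] by blast
    then have "?a \<oplus>\<^bsub>M\<^esub> ?b \<in> V (Suc k)"
      by (rule submodule_rules(3)[OF V_sub modM _ V_mult[OF k ab(3)]])
    moreover have "e \<in> Z" unfolding uv(3) by (rule z(3)[OF sm(1) z(4)[OF y uv(2)]])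
    ultimately show "e \<in> U (Suc k)" using eq SD(3)[OF sm(2) tn(1)] unfolding U_def by blast
  qed
  show "U (Suc k) \<subseteq> {u \<oplus>\<^bsub>D 0\<^esub> ?y \<odot>\<^bsub>D 0\<^esub> v | u v. u \<in> U k \<and> v \<in> Z}"
  proof
    fix e assume "e \<in> U (Suc k)"
    then obtain s m where sm: "e \<in> Z" "s \<in> S" "m \<in> V (Suc k)" "s \<odot>\<^bsub>E 0\<^esub> e = \<alpha> m" by (auto simp: U_def)
    obtain t m' where t: "t \<in> S" "m' \<in> carrier M" "msub R M (t \<odot>\<^bsub>M\<^esub> m) (?y \<odot>\<^bsub>M\<^esub> m') \<in> V k"
      using V_gen[OF k sm(3)] by blast
    let ?v = "msub R M (t \<odot>\<^bsub>M\<^esub> m) (?y \<odot>\<^bsub>M\<^esub> m')"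
    have c: "s \<in> carrier R" "t \<in> carrier R" "m \<in> carrier M" "e \<in> carrier (E 0)" "?v \<in> carrier M"
      using SD(1) sm V_M t ZE by auto
    have st: "t \<otimes> s \<in> S" "t \<otimes> s \<in> carrier R" using SD(3)[OF t(1) sm(2)] SD(1) by auto
    obtain e1 where e1: "e1 \<in> Z" "(t \<otimes> s) \<odot>\<^bsub>E 0\<^esub> e1 = \<alpha> ?v" by (rule Z_div[OF st(1) \<alpha>_Z[OF c(5)]])
    obtain e2 where e2: "e2 \<in> Z" "(t \<otimes> s) \<odot>\<^bsub>E 0\<^esub> e2 = \<alpha> m'" by (rule Z_div[OF st(1) \<alpha>_Z[OF t(2)]])
    have ym: "?y \<odot>\<^bsub>M\<^esub> m' \<in> carrier M" "t \<odot>\<^bsub>M\<^esub> m \<in> carrier M" using y t(2) c modM by auto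
    have "(t \<otimes> s) \<odot>\<^bsub>E 0\<^esub> e = \<alpha> (t \<odot>\<^bsub>M\<^esub> m)"
      using linear_smult[OF \<alpha>_linear c(2,3)] sm(4) c M[of 0] by (simp add: mod_distr)
    also have "\<dots> = \<alpha> (?v \<oplus>\<^bsub>M\<^esub> ?y \<odot>\<^bsub>M\<^esub> m')" using ym modM by (simp add: msub_alg(2))
    also have "\<dots> = (t \<otimes> s) \<odot>\<^bsub>E 0\<^esub> e1 \<oplus>\<^bsub>E 0\<^esub> ?y \<odot>\<^bsub>E 0\<^esub> ((t \<otimes> s) \<odot>\<^bsub>E 0\<^esub> e2)"
      using linear_add[OF \<alpha>_linear c(5) ym(1)] linear_smult[OF \<alpha>_linear y t(2)] e1(2) e2(2) by simp
    also have "\<dots> = (t \<otimes> s) \<odot>\<^bsub>E 0\<^esub> (e1 \<oplus>\<^bsub>E 0\<^esub> ?y \<odot>\<^bsub>E 0\<^esub> e2)"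
      using ZE[OF e1(1)] ZE[OF e2(1)] st(2) y M[of 0] mod_distr(1)[OF M st(2)] smult_swap[OF M y st(2)] by simp
    finally have "e = e1 \<oplus>\<^bsub>E 0\<^esub> ?y \<odot>\<^bsub>E 0\<^esub> e2"
      by (rule D_cancel[OF st(1) z(1)[OF sm(1)] z(1)[OF z(3)[OF e1(1) z(4)[OF y e2(1)]]]])
    moreover have "e1 \<in> U k" using e1 st(1) t(3) unfolding U_def by blast
    ultimately show "e \<in> {u \<oplus>\<^bsub>D 0\<^esub> ?y \<odot>\<^bsub>D 0\<^esub> v | u v. u \<in> U k \<and> v \<in> Z}" using e2(1) by auto
  qed
qed

lemma D_weakly_regular: "weakly_regular (D 0) Z (coboundaries D d' 0) ys"
proof -
  have "weakly_regular (D 0) Z (U k) (drop k ys)" if "k \<le> length ys" for k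
    using that
  proof (induction k rule: inc_induct)
    case (step k)
    have "drop k ys = ys ! k # drop (Suc k) ys" using step(2) by (simp add: Cons_nth_drop_Suc)
    then show ?case using step U_Suc[of k] U_reg[of k] by simp
  qed simp
  from this[of 0] show ?thesis by (simp add: U_0 coboundaries_def)
qed

text \<open>The projection carries \<open>z\<close> to \<open>D\<close>, whose cohomology is
  concentrated in degree 0, so \<open>socle_exact'\<close> applies in all degrees below the length
  of \<open>ys\<close>. Returning to \<open>E\<close> costs a factor from \<open>S\<close>.\<close>

theorem localized_socle:
  assumes yp: "set ys \<subseteq> \<pp>" "\<pp> \<subseteq> carrier R" and i: "i < length ys"
    and z: "z \<in> cocycles E d i" "\<And>r. r \<in> \<pp> \<Longrightarrow> r \<odot>\<^bsub>E i\<^esub> z = \<zero>\<^bsub>E i\<^esub>"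
  shows "\<exists>s\<in>S. case i of 0 \<Rightarrow> s \<odot>\<^bsub>E i\<^esub> z = \<zero>\<^bsub>E i\<^esub> |
    Suc l \<Rightarrow> \<exists>w\<in>carrier (E l). d l w = s \<odot>\<^bsub>E i\<^esub> z \<and> (\<forall>r\<in>\<pp>. r \<odot>\<^bsub>E l\<^esub> w = \<zero>\<^bsub>E l\<^esub>)"
proof -
  have zE: "z \<in> carrier (E i)" "d i z = \<zero>\<^bsub>E (Suc i)\<^esub>" using z(1) by (auto simp: cocycles_def)
  have "d' i (\<sigma> i z) = \<zero>\<^bsub>E (Suc i)\<^esub>"
    using \<sigma>d[OF zE(1)] zE(2) linear_zero[OF \<sigma> M M] by (simp add: d'_def)
  then have zZ: "\<sigma> i z \<in> cocycles D d' i" using \<sigma>_D[OF zE(1)] by (simp add: cocycles_def)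
  have zp: "r \<odot>\<^bsub>D i\<^esub> \<sigma> i z = \<zero>\<^bsub>D i\<^esub>" if "r \<in> \<pp>" for r
    using linear_smult[OF \<sigma> _ zE(1), of r] yp(2) that z(2)[OF that] linear_zero[OF \<sigma> M M] by auto
  have main: "case i of 0 \<Rightarrow> \<sigma> i z = \<zero>\<^bsub>D 0\<^esub> |
    Suc l \<Rightarrow> \<exists>w\<in>carrier (D l). d' l w = \<sigma> i z \<and> (\<forall>r\<in>\<pp>. r \<odot>\<^bsub>D l\<^esub> w = \<zero>\<^bsub>D l\<^esub>)"
    by (rule socle_exact'[OF D_complex D_baer D_exact yp D_weakly_regular _ zZ zp]) (use i in auto)
  show ?thesis
  proof (cases i)
    case 0
    then have "z \<in> carrier (T 0)" using main \<sigma>_zero[of z 0] zE(1) by simp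
    then show ?thesis using 0 by (auto simp: tors_carrier)
  next
    case (Suc l)
    then obtain w where w: "w \<in> carrier (D l)" "d' l w = \<sigma> (Suc l) z"
      "\<And>r. r \<in> \<pp> \<Longrightarrow> r \<odot>\<^bsub>E l\<^esub> w = \<zero>\<^bsub>E l\<^esub>" using main by auto
    have wE: "w \<in> carrier (E l)" and zE': "z \<in> carrier (E (Suc l))" using w(1) zE(1) Suc by (auto simp: D_carrier)
    \<comment> \<open>The primitive found in \<open>D\<close> is one for \<open>z\<close> up to
      torsion, so an element of \<open>S\<close> turns it into a genuine primitive of a multiple of
      \<open>z\<close>.\<close>
    have "\<sigma> (Suc l) (msub R (E (Suc l)) (d l w) z) = \<zero>\<^bsub>E (Suc l)\<^esub>"
      using linear_msub[OF \<sigma> M dc[OF wE] zE'] w(2) \<sigma>c[OF zE'] mod_simps(6)[OF M, of "\<sigma> (Suc l) z" "Suc l"]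
      by (simp add: d'_def)
    then have "msub R (E (Suc l)) (d l w) z \<in> carrier (T (Suc l))"
      by (rule \<sigma>_zero[OF mod_closed(4)[OF M dc[OF wE] zE']])
    then obtain s where s: "s \<in> S" "s \<odot>\<^bsub>E (Suc l)\<^esub> msub R (E (Suc l)) (d l w) z = \<zero>\<^bsub>E (Suc l)\<^esub>"
      by (auto simp: tors_carrier)
    have sR: "s \<in> carrier R" by (rule SD(1)[OF s(1)])
    have "s \<odot>\<^bsub>E (Suc l)\<^esub> d l w = s \<odot>\<^bsub>E (Suc l)\<^esub> z"
      using s(2) msub_alg(8)[OF M sR dc[OF wE] zE']
        msub_alg(1)[OF M mod_closed(3)[OF M sR dc[OF wE]] mod_closed(3)[OF M sR zE']] by simp
    then have "d l (s \<odot>\<^bsub>E l\<^esub> w) = s \<odot>\<^bsub>E (Suc l)\<^esub> z" using linear_smult[OF lin sR wE] by simp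
    moreover have "r \<odot>\<^bsub>E l\<^esub> (s \<odot>\<^bsub>E l\<^esub> w) = \<zero>\<^bsub>E l\<^esub>" if r: "r \<in> \<pp>" for r
      using smult_swap[OF M _ sR wE, of r] w(3)[OF r] yp(2) r sR M[of l] by auto
    ultimately show ?thesis using s(1) sR wE M[of l] Suc by (auto intro!: bexI[of _ s] bexI[of _ "s \<odot>\<^bsub>E l\<^esub> w"])
  qed
qed

end


section \<open>Localization\<close>

locale localization = fixed_cring R for R :: "'r ring" (structure) +
  fixes S :: "'r set"
  assumes S: "submonoid S R"
begin

lemmas SD = submonoid_rules[OF S]

abbreviation fr :: "('r, 'a) module \<Rightarrow> 'a \<Rightarrow> 'r \<Rightarrow> ('a \<times> 'r) set" where
  "fr \<equiv> fraction R S"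

abbreviation loc :: "('r, 'a) module \<Rightarrow> (('r \<times> 'r) set, ('a \<times> 'r) set) module" where
  "loc \<equiv> loc_module R S"

abbreviation RR :: "('r, 'r) module" where "RR \<equiv> regular_module R"
abbreviation RS :: "('r \<times> 'r) set ring" where "RS \<equiv> loc_ring R S"

lemma RR_simps [simp]: "carrier RR = carrier R" "r \<odot>\<^bsub>RR\<^esub> s = r \<otimes> s" "zero RR = \<zero>" "add RR = add R"
  by (simp_all add: regular_module_def)

lemma fr_eq:
  assumes A: "module R (A :: ('r, 'a) module)" and xs: "x \<in> carrier A" "s \<in> S" and yt: "y \<in> carrier A" "t \<in> S"
  shows "fr A x s = fr A y t \<longleftrightarrow> (\<exists>u\<in>S. u \<odot>\<^bsub>A\<^esub> (t \<odot>\<^bsub>A\<^esub> x) = u \<odot>\<^bsub>A\<^esub> (s \<odot>\<^bsub>A\<^esub> y))"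
proof
  have yt': "(y, t) \<in> fr A y t" using yt SD(2) by (auto simp: fraction_def)
  show "\<exists>u\<in>S. u \<odot>\<^bsub>A\<^esub> (t \<odot>\<^bsub>A\<^esub> x) = u \<odot>\<^bsub>A\<^esub> (s \<odot>\<^bsub>A\<^esub> y)" if "fr A x s = fr A y t"
    using yt' unfolding that[symmetric] by (simp add: fraction_def)
next
  \<comment> \<open>Transitivity of the equivalence of pairs: the product of both witnesses with
    \<open>s\<close> is the new witness.\<close>
  have sub: "fr A x s \<subseteq> fr A y t"
    if "x \<in> carrier A" "s \<in> S" "y \<in> carrier A" "t \<in> S"
      and u: "u \<in> S" "u \<odot>\<^bsub>A\<^esub> (t \<odot>\<^bsub>A\<^esub> x) = u \<odot>\<^bsub>A\<^esub> (s \<odot>\<^bsub>A\<^esub> y)" for x s y t u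
  proof
    note h = that
    fix p assume "p \<in> fr A x s"
    then obtain z w v where p: "p = (z, w)" "z \<in> carrier A" "w \<in> S" "v \<in> S"
      "v \<odot>\<^bsub>A\<^esub> (w \<odot>\<^bsub>A\<^esub> x) = v \<odot>\<^bsub>A\<^esub> (s \<odot>\<^bsub>A\<^esub> z)" unfolding fraction_def by blast
    note c = SD(1)[OF h(2)] SD(1)[OF h(4)] SD(1)[OF h(5)] SD(1)[OF p(3)] SD(1)[OF p(4)]
    have "(u \<otimes> (v \<otimes> s)) \<odot>\<^bsub>A\<^esub> (w \<odot>\<^bsub>A\<^esub> y) = v \<odot>\<^bsub>A\<^esub> (w \<odot>\<^bsub>A\<^esub> (u \<odot>\<^bsub>A\<^esub> (s \<odot>\<^bsub>A\<^esub> y)))"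
      using c A h(3) by (simp add: mod_distr smult_swap[OF A])
    also have "\<dots> = v \<odot>\<^bsub>A\<^esub> (w \<odot>\<^bsub>A\<^esub> (u \<odot>\<^bsub>A\<^esub> (t \<odot>\<^bsub>A\<^esub> x)))" by (simp only: u(2))
    also have "\<dots> = u \<odot>\<^bsub>A\<^esub> (t \<odot>\<^bsub>A\<^esub> (v \<odot>\<^bsub>A\<^esub> (w \<odot>\<^bsub>A\<^esub> x)))"
      using c A h(1) by (simp add: mod_distr smult_swap[OF A])
    also have "\<dots> = u \<odot>\<^bsub>A\<^esub> (t \<odot>\<^bsub>A\<^esub> (v \<odot>\<^bsub>A\<^esub> (s \<odot>\<^bsub>A\<^esub> z)))" by (simp only: p(5))
    also have "\<dots> = (u \<otimes> (v \<otimes> s)) \<odot>\<^bsub>A\<^esub> (t \<odot>\<^bsub>A\<^esub> z)"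
      using c A p(2) by (simp add: mod_distr smult_swap[OF A])
    finally show "p \<in> fr A y t"
      using p SD(3)[OF h(5) SD(3)[OF p(4) h(2)]] unfolding fraction_def by blast
  qed
  assume "\<exists>u\<in>S. u \<odot>\<^bsub>A\<^esub> (t \<odot>\<^bsub>A\<^esub> x) = u \<odot>\<^bsub>A\<^esub> (s \<odot>\<^bsub>A\<^esub> y)"
  then obtain u where u: "u \<in> S" "u \<odot>\<^bsub>A\<^esub> (t \<odot>\<^bsub>A\<^esub> x) = u \<odot>\<^bsub>A\<^esub> (s \<odot>\<^bsub>A\<^esub> y)" by blast
  show "fr A x s = fr A y t"
    using sub[OF xs yt u] sub[OF yt xs u(1) u(2)[symmetric]] by (rule equalityI)
qed

lemma fr_mem:
  assumes A: "module R (A :: ('r, 'a) module)" and xs: "x \<in> carrier A" "s \<in> S" and p: "(y, t) \<in> fr A x s"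
  shows "y \<in> carrier A" "t \<in> S" "fr A y t = fr A x s"
proof -
  show yt: "y \<in> carrier A" "t \<in> S" using p by (auto simp: fraction_def)
  have "fr A x s = fr A y t" using p fr_eq[OF A xs yt] by (simp add: fraction_def)
  then show "fr A y t = fr A x s" ..
qed

lemma fr_self:
  assumes "x \<in> carrier A" "s \<in> S"
  shows "(x, s) \<in> fr A x s"
  using assms SD(2) by (auto simp: fraction_def)

lemma fr_cancel:
  assumes A: "module R (A :: ('r, 'a) module)" and x: "x \<in> carrier A" "s \<in> S" "t \<in> S"
  shows "fr A (t \<odot>\<^bsub>A\<^esub> x) (t \<otimes> s) = fr A x s"
proof -
  note c = SD(1)[OF x(2)] SD(1)[OF x(3)]
  show ?thesis
    by (subst fr_eq[OF A mod_closed(3)[OF A c(2) x(1)] SD(3)[OF x(3,2)] x(1,2)], rule bexI[OF _ SD(2)])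
      (use c x A in \<open>simp add: mod_distr smult_swap[OF A]\<close>)
qed

text \<open>All fractions in the union over representatives coincide, so the union collapses to any
  one of them.\<close>

lemma fr_add:
  assumes A: "module R (A :: ('r, 'a) module)" and xs: "x \<in> carrier A" "s \<in> S" and yt: "y \<in> carrier A" "t \<in> S"
  shows "fr A x s \<oplus>\<^bsub>loc A\<^esub> fr A y t = fr A (t \<odot>\<^bsub>A\<^esub> x \<oplus>\<^bsub>A\<^esub> s \<odot>\<^bsub>A\<^esub> y) (s \<otimes> t)"
proof -
  have wd: "fr A (t' \<odot>\<^bsub>A\<^esub> x' \<oplus>\<^bsub>A\<^esub> s' \<odot>\<^bsub>A\<^esub> y') (s' \<otimes> t') = fr A (t \<odot>\<^bsub>A\<^esub> x \<oplus>\<^bsub>A\<^esub> s \<odot>\<^bsub>A\<^esub> y) (s \<otimes> t)"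
    if m: "(x', s') \<in> fr A x s" "(y', t') \<in> fr A y t" for x' s' y' t'
  proof -
    note m1 = fr_mem[OF A xs m(1)] and m2 = fr_mem[OF A yt m(2)]
    obtain u where u: "u \<in> S" "u \<odot>\<^bsub>A\<^esub> (s' \<odot>\<^bsub>A\<^esub> x) = u \<odot>\<^bsub>A\<^esub> (s \<odot>\<^bsub>A\<^esub> x')"
      using m(1) unfolding fraction_def by blast
    obtain v where v: "v \<in> S" "v \<odot>\<^bsub>A\<^esub> (t' \<odot>\<^bsub>A\<^esub> y) = v \<odot>\<^bsub>A\<^esub> (t \<odot>\<^bsub>A\<^esub> y')"
      using m(2) unfolding fraction_def by blast
    note c = xs(1) yt(1) m1(1) m2(1) SD(1)[OF xs(2)] SD(1)[OF yt(2)] SD(1)[OF m1(2)] SD(1)[OF m2(2)]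
      SD(1)[OF u(1)] SD(1)[OF v(1)]
    have "(u \<otimes> v) \<odot>\<^bsub>A\<^esub> ((s \<otimes> t) \<odot>\<^bsub>A\<^esub> (t' \<odot>\<^bsub>A\<^esub> x' \<oplus>\<^bsub>A\<^esub> s' \<odot>\<^bsub>A\<^esub> y')) =
        (v \<otimes> t \<otimes> t') \<odot>\<^bsub>A\<^esub> (u \<odot>\<^bsub>A\<^esub> (s \<odot>\<^bsub>A\<^esub> x')) \<oplus>\<^bsub>A\<^esub> (u \<otimes> s \<otimes> s') \<odot>\<^bsub>A\<^esub> (v \<odot>\<^bsub>A\<^esub> (t \<odot>\<^bsub>A\<^esub> y'))"
      using c A by (simp add: mod_distr smult_swap[OF A])
    also have "\<dots> = (v \<otimes> t \<otimes> t') \<odot>\<^bsub>A\<^esub> (u \<odot>\<^bsub>A\<^esub> (s' \<odot>\<^bsub>A\<^esub> x)) \<oplus>\<^bsub>A\<^esub> (u \<otimes> s \<otimes> s') \<odot>\<^bsub>A\<^esub> (v \<odot>\<^bsub>A\<^esub> (t' \<odot>\<^bsub>A\<^esub> y))"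
      by (simp only: u(2) v(2))
    also have "\<dots> = (u \<otimes> v) \<odot>\<^bsub>A\<^esub> ((s' \<otimes> t') \<odot>\<^bsub>A\<^esub> (t \<odot>\<^bsub>A\<^esub> x \<oplus>\<^bsub>A\<^esub> s \<odot>\<^bsub>A\<^esub> y))"
      using c A by (simp add: mod_distr smult_swap[OF A])
    finally show ?thesis
      using c A by (subst fr_eq[OF A _ SD(3)[OF m1(2) m2(2)] _ SD(3)[OF xs(2) yt(2)]])
        (auto intro!: bexI[OF _ SD(3)[OF u(1) v(1)]])
  qed
  have "fr A x s \<oplus>\<^bsub>loc A\<^esub> fr A y t = (\<Union>(x', s')\<in>fr A x s. \<Union>(y', t')\<in>fr A y t.
      fr A (t' \<odot>\<^bsub>A\<^esub> x' \<oplus>\<^bsub>A\<^esub> s' \<odot>\<^bsub>A\<^esub> y') (s' \<otimes> t'))" by (simp add: loc_module_def)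
  also have "\<dots> = (\<Union>(x', s')\<in>fr A x s. \<Union>(y', t')\<in>fr A y t. fr A (t \<odot>\<^bsub>A\<^esub> x \<oplus>\<^bsub>A\<^esub> s \<odot>\<^bsub>A\<^esub> y) (s \<otimes> t))"
    by (intro SUP_cong refl) (auto simp: wd split: prod.splits)
  also have "\<dots> = fr A (t \<odot>\<^bsub>A\<^esub> x \<oplus>\<^bsub>A\<^esub> s \<odot>\<^bsub>A\<^esub> y) (s \<otimes> t)"
    using fr_self[OF xs] fr_self[OF yt] by auto
  finally show ?thesis .
qed

lemma fr_smult:
  assumes A: "module R (A :: ('r, 'a) module)" and xs: "r \<in> carrier R" "s \<in> S" and yt: "y \<in> carrier A" "t \<in> S"
  shows "fr RR r s \<odot>\<^bsub>loc A\<^esub> fr A y t = fr A (r \<odot>\<^bsub>A\<^esub> y) (s \<otimes> t)"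
proof -
  have wd: "fr A (r' \<odot>\<^bsub>A\<^esub> y') (s' \<otimes> t') = fr A (r \<odot>\<^bsub>A\<^esub> y) (s \<otimes> t)"
    if m: "(r', s') \<in> fr RR r s" "(y', t') \<in> fr A y t" for r' s' y' t'
  proof -
    note m1 = fr_mem[OF regular_module_module _ xs(2) m(1), unfolded RR_simps, OF xs(1)]
      and m2 = fr_mem[OF A yt m(2)]
    obtain u where u: "u \<in> S" "u \<otimes> (s' \<otimes> r) = u \<otimes> (s \<otimes> r')"
      using m(1) unfolding fraction_def by auto
    obtain v where v: "v \<in> S" "v \<odot>\<^bsub>A\<^esub> (t' \<odot>\<^bsub>A\<^esub> y) = v \<odot>\<^bsub>A\<^esub> (t \<odot>\<^bsub>A\<^esub> y')"
      using m(2) unfolding fraction_def by blast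
    note c = xs(1) yt(1) m1(1) m2(1) SD(1)[OF xs(2)] SD(1)[OF yt(2)] SD(1)[OF m1(2)] SD(1)[OF m2(2)]
      SD(1)[OF u(1)] SD(1)[OF v(1)]
    have "(u \<otimes> v) \<odot>\<^bsub>A\<^esub> ((s \<otimes> t) \<odot>\<^bsub>A\<^esub> (r' \<odot>\<^bsub>A\<^esub> y')) = (u \<otimes> (s \<otimes> r')) \<odot>\<^bsub>A\<^esub> (v \<odot>\<^bsub>A\<^esub> (t \<odot>\<^bsub>A\<^esub> y'))"
      using c A by (simp add: mod_distr smult_swap[OF A])
    also have "\<dots> = (u \<otimes> (s' \<otimes> r)) \<odot>\<^bsub>A\<^esub> (v \<odot>\<^bsub>A\<^esub> (t' \<odot>\<^bsub>A\<^esub> y))"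
      by (simp only: u(2) v(2))
    also have "\<dots> = (u \<otimes> v) \<odot>\<^bsub>A\<^esub> ((s' \<otimes> t') \<odot>\<^bsub>A\<^esub> (r \<odot>\<^bsub>A\<^esub> y))"
      using c A by (simp add: mod_distr smult_swap[OF A])
    finally show ?thesis
      using c A by (subst fr_eq[OF A _ SD(3)[OF m1(2) m2(2)] _ SD(3)[OF xs(2) yt(2)]])
        (auto intro!: bexI[OF _ SD(3)[OF u(1) v(1)]])
  qed
  have "fr RR r s \<odot>\<^bsub>loc A\<^esub> fr A y t = (\<Union>(r', s')\<in>fr RR r s. \<Union>(y', t')\<in>fr A y t.
      fr A (r' \<odot>\<^bsub>A\<^esub> y') (s' \<otimes> t'))" by (simp add: loc_module_def)
  also have "\<dots> = (\<Union>(r', s')\<in>fr RR r s. \<Union>(y', t')\<in>fr A y t. fr A (r \<odot>\<^bsub>A\<^esub> y) (s \<otimes> t))"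
    by (intro SUP_cong refl) (auto simp: wd split: prod.splits)
  also have "\<dots> = fr A (r \<odot>\<^bsub>A\<^esub> y) (s \<otimes> t)"
    using fr_self[of r RR s] xs fr_self[OF yt] by auto
  finally show ?thesis .
qed

lemma loc_carrier: "U \<in> carrier (loc A) \<longleftrightarrow> (\<exists>x\<in>carrier A. \<exists>s\<in>S. U = fr A x s)"
  by (auto simp: loc_module_def)

lemma loc_zero: "\<zero>\<^bsub>loc A\<^esub> = fr A \<zero>\<^bsub>A\<^esub> \<one>"
  by (simp add: loc_module_def)

lemma RS_simps [simp]: "carrier RS = carrier (loc RR)" "monoid.mult RS = smult (loc RR)" "one RS = fr RR \<one> \<one>"
  "zero RS = zero (loc RR)" "add RS = add (loc RR)"
  by (simp_all add: loc_ring_def Let_def)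

lemma fr_zero: "module R (A :: ('r, 'a) module) \<Longrightarrow> s \<in> S \<Longrightarrow> fr A \<zero>\<^bsub>A\<^esub> s = \<zero>\<^bsub>loc A\<^esub>"
  unfolding loc_zero by (subst fr_eq) (use SD(1,2) in auto)

lemma fr_eq_zero:
  assumes A: "module R (A :: ('r, 'a) module)" and x: "x \<in> carrier A" "s \<in> S"
  shows "fr A x s = \<zero>\<^bsub>loc A\<^esub> \<longleftrightarrow> x \<in> carrier (tors R S A)"
proof -
  have "fr A x s = \<zero>\<^bsub>loc A\<^esub> \<longleftrightarrow> (\<exists>u\<in>S. u \<odot>\<^bsub>A\<^esub> (\<one> \<odot>\<^bsub>A\<^esub> x) = u \<odot>\<^bsub>A\<^esub> (s \<odot>\<^bsub>A\<^esub> \<zero>\<^bsub>A\<^esub>))"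
    unfolding loc_zero by (rule fr_eq[OF A x mod_closed(2)[OF A] SD(2)])
  also have "\<dots> \<longleftrightarrow> x \<in> carrier (tors R S A)"
    using A x SD(1) by (auto simp: tors_carrier)
  finally show ?thesis .
qed

lemma fr_add_same:
  assumes A: "module R (A :: ('r, 'a) module)" and x: "x \<in> carrier A" "y \<in> carrier A" "s \<in> S"
  shows "fr A x s \<oplus>\<^bsub>loc A\<^esub> fr A y s = fr A (x \<oplus>\<^bsub>A\<^esub> y) s"
proof -
  have "fr A x s \<oplus>\<^bsub>loc A\<^esub> fr A y s = fr A (s \<odot>\<^bsub>A\<^esub> (x \<oplus>\<^bsub>A\<^esub> y)) (s \<otimes> s)"
    using fr_add[OF A x(1,3,2,3)] mod_distr(1)[OF A SD(1)[OF x(3)] x(1,2)] by simp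
  then show ?thesis using fr_cancel[OF A mod_closed(1)[OF A x(1,2)] x(3,3)] by simp
qed

lemma common_denominator:
  assumes A: "module R (A :: ('r, 'a) module)" and U: "U \<in> carrier (loc A)" and V: "V \<in> carrier (loc A)"
  obtains x y s where "x \<in> carrier A" "y \<in> carrier A" "s \<in> S" "U = fr A x s" "V = fr A y s"
proof -
  obtain x s y t where xs: "x \<in> carrier A" "s \<in> S" "U = fr A x s" "y \<in> carrier A" "t \<in> S" "V = fr A y t"
    using U V by (auto simp: loc_carrier)
  have "U = fr A (t \<odot>\<^bsub>A\<^esub> x) (s \<otimes> t)"
    using fr_cancel[OF A xs(1,2,5)] SD(1) xs m_comm[of s t] by simp
  moreover have "V = fr A (s \<odot>\<^bsub>A\<^esub> y) (s \<otimes> t)" using fr_cancel[OF A xs(4,5,2)] xs(6) by simp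
  ultimately show ?thesis
    using that[of "t \<odot>\<^bsub>A\<^esub> x" "s \<odot>\<^bsub>A\<^esub> y" "s \<otimes> t"] SD(1,3) xs A by simp
qed

lemma common_denominator3:
  assumes A: "module R (A :: ('r, 'a) module)"
    and U: "U \<in> carrier (loc A)" and V: "V \<in> carrier (loc A)" and W: "W \<in> carrier (loc A)"
  obtains x y z s where "x \<in> carrier A" "y \<in> carrier A" "z \<in> carrier A" "s \<in> S"
    "U = fr A x s" "V = fr A y s" "W = fr A z s"
proof -
  obtain x y s where xs: "x \<in> carrier A" "y \<in> carrier A" "s \<in> S" "U = fr A x s" "V = fr A y s"
    by (rule common_denominator[OF A U V])
  obtain z t where zt: "z \<in> carrier A" "t \<in> S" "W = fr A z t" using W by (auto simp: loc_carrier)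
  have "U = fr A (t \<odot>\<^bsub>A\<^esub> x) (t \<otimes> s)" "V = fr A (t \<odot>\<^bsub>A\<^esub> y) (t \<otimes> s)"
    using fr_cancel[OF A xs(1,3) zt(2)] fr_cancel[OF A xs(2,3) zt(2)] xs by simp_all
  moreover have "W = fr A (s \<odot>\<^bsub>A\<^esub> z) (t \<otimes> s)"
    using fr_cancel[OF A zt(1,2) xs(3)] zt SD(1) xs(3) m_comm[of s t] by simp
  ultimately show ?thesis
    using that[of "t \<odot>\<^bsub>A\<^esub> x" "t \<odot>\<^bsub>A\<^esub> y" "s \<odot>\<^bsub>A\<^esub> z" "t \<otimes> s"] SD(1,3) xs zt A by simp
qed

lemma loc_abelian_group:
  assumes A: "module R (A :: ('r, 'a) module)"
  shows "abelian_group (loc A)"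
proof (rule abelian_groupI)
  show zero: "\<zero>\<^bsub>loc A\<^esub> \<in> carrier (loc A)" using A SD(2) by (auto simp: loc_zero loc_carrier)
  fix U assume U: "U \<in> carrier (loc A)"
  obtain x s where x: "x \<in> carrier A" "s \<in> S" "U = fr A x s" using U by (auto simp: loc_carrier)
  show "\<zero>\<^bsub>loc A\<^esub> \<oplus>\<^bsub>loc A\<^esub> U = U"
    using fr_zero[OF A x(2)] fr_add_same[OF A mod_closed(2)[OF A] x(1,2)] A x by simp
  have n: "(\<ominus> \<one>) \<odot>\<^bsub>A\<^esub> x \<in> carrier A" using x A by simp
  have "(\<ominus> \<one>) \<odot>\<^bsub>A\<^esub> x \<oplus>\<^bsub>A\<^esub> x = \<zero>\<^bsub>A\<^esub>"
    using mod_simps(6)[OF A x(1)] mod_ac(1)[OF A x(1) n] by (simp add: msub_def)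
  then have "fr A ((\<ominus> \<one>) \<odot>\<^bsub>A\<^esub> x) s \<oplus>\<^bsub>loc A\<^esub> U = \<zero>\<^bsub>loc A\<^esub>"
    using fr_add_same[OF A n x(1,2)] fr_zero[OF A x(2)] x(3) by simp
  then show "\<exists>V\<in>carrier (loc A). V \<oplus>\<^bsub>loc A\<^esub> U = \<zero>\<^bsub>loc A\<^esub>" 
    using n x(2) by (intro bexI[of _ "fr A ((\<ominus> \<one>) \<odot>\<^bsub>A\<^esub> x) s"]) (auto simp: loc_carrier)
  fix V assume V: "V \<in> carrier (loc A)"
  obtain x y s where xy: "x \<in> carrier A" "y \<in> carrier A" "s \<in> S" "U = fr A x s" "V = fr A y s"
    by (rule common_denominator[OF A U V])
  show "U \<oplus>\<^bsub>loc A\<^esub> V \<in> carrier (loc A)"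
    using xy A by (auto simp: fr_add_same loc_carrier)
  show "U \<oplus>\<^bsub>loc A\<^esub> V = V \<oplus>\<^bsub>loc A\<^esub> U"
    using xy A mod_ac(1)[OF A xy(1,2)] by (simp add: fr_add_same)
  fix W assume W: "W \<in> carrier (loc A)"
  obtain x y z s where xyz: "x \<in> carrier A" "y \<in> carrier A" "z \<in> carrier A" "s \<in> S"
    "U = fr A x s" "V = fr A y s" "W = fr A z s" by (rule common_denominator3[OF A U V W])
  show "U \<oplus>\<^bsub>loc A\<^esub> V \<oplus>\<^bsub>loc A\<^esub> W = U \<oplus>\<^bsub>loc A\<^esub> (V \<oplus>\<^bsub>loc A\<^esub> W)"
    using xyz A mod_ac(2)[OF A xyz(1-3)] by (simp add: fr_add_same)
qed

text \<open>Taking \<open>A\<close> to be the ring itself also gives the ring laws of the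
  localization, so the ring and its modules are treated together.\<close>

lemma loc_smult_axioms:
  assumes A: "module R (A :: ('r, 'a) module)"
    and P: "P \<in> carrier (loc RR)" and Q: "Q \<in> carrier (loc RR)"
    and U: "U \<in> carrier (loc A)" and V: "V \<in> carrier (loc A)"
  shows "P \<odot>\<^bsub>loc A\<^esub> U \<in> carrier (loc A)"
    and "(P \<oplus>\<^bsub>loc RR\<^esub> Q) \<odot>\<^bsub>loc A\<^esub> U = P \<odot>\<^bsub>loc A\<^esub> U \<oplus>\<^bsub>loc A\<^esub> Q \<odot>\<^bsub>loc A\<^esub> U"
    and "P \<odot>\<^bsub>loc A\<^esub> (U \<oplus>\<^bsub>loc A\<^esub> V) = P \<odot>\<^bsub>loc A\<^esub> U \<oplus>\<^bsub>loc A\<^esub> P \<odot>\<^bsub>loc A\<^esub> V"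
    and "(P \<odot>\<^bsub>loc RR\<^esub> Q) \<odot>\<^bsub>loc A\<^esub> U = P \<odot>\<^bsub>loc A\<^esub> (Q \<odot>\<^bsub>loc A\<^esub> U)"
proof -
  note RRm = regular_module_module
  obtain p q s where pq: "p \<in> carrier R" "q \<in> carrier R" "s \<in> S" "P = fr RR p s" "Q = fr RR q s"
    by (rule common_denominator[OF RRm P Q]) (use that in auto)
  obtain x y t where xy: "x \<in> carrier A" "y \<in> carrier A" "t \<in> S" "U = fr A x t" "V = fr A y t"
    by (rule common_denominator[OF A U V])
  note c = SD(1)[OF pq(3)] SD(1)[OF xy(3)] SD(3)[OF pq(3) xy(3)] SD(3)[OF pq(3,3)]
  note frs = fr_smult[OF A] fr_add_same[OF A] fr_add_same[OF RRm] fr_smult[OF RRm]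
  show "P \<odot>\<^bsub>loc A\<^esub> U \<in> carrier (loc A)"
    using pq xy c A by (auto simp: frs loc_carrier intro!: bexI)
  show "(P \<oplus>\<^bsub>loc RR\<^esub> Q) \<odot>\<^bsub>loc A\<^esub> U = P \<odot>\<^bsub>loc A\<^esub> U \<oplus>\<^bsub>loc A\<^esub> Q \<odot>\<^bsub>loc A\<^esub> U"
    using pq xy c A by (simp add: frs mod_distr(2)[OF A])
  show "P \<odot>\<^bsub>loc A\<^esub> (U \<oplus>\<^bsub>loc A\<^esub> V) = P \<odot>\<^bsub>loc A\<^esub> U \<oplus>\<^bsub>loc A\<^esub> P \<odot>\<^bsub>loc A\<^esub> V"
    using pq xy c A by (simp add: frs mod_distr(1)[OF A])
  show "(P \<odot>\<^bsub>loc RR\<^esub> Q) \<odot>\<^bsub>loc A\<^esub> U = P \<odot>\<^bsub>loc A\<^esub> (Q \<odot>\<^bsub>loc A\<^esub> U)"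
    using pq xy c A by (simp add: frs mod_distr(3)[OF A] m_assoc)
qed

lemma loc_one:
  assumes A: "module R (A :: ('r, 'a) module)" and U: "U \<in> carrier (loc A)"
  shows "fr RR \<one> \<one> \<odot>\<^bsub>loc A\<^esub> U = U"
  using A U SD(1,2) by (auto simp: loc_carrier fr_smult)

lemma loc_ring_cring: "cring RS"
proof -
  note RRm = regular_module_module
  have ag: "abelian_group (loc RR)" by (rule loc_abelian_group[OF RRm])
  interpret L: abelian_group "loc RR" by (rule ag)
  have ag': "abelian_group RS"
    by (rule abelian_groupI) (auto simp: L.a_ac intro!: bexI[where P = "\<lambda>V. V \<oplus>\<^bsub>loc RR\<^esub> U = \<zero>\<^bsub>loc RR\<^esub>" for U, OF L.l_neg])
  have one: "fr RR \<one> \<one> \<in> carrier (loc RR)" using SD(2) by (auto simp: loc_carrier)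
  have comm: "P \<odot>\<^bsub>loc RR\<^esub> Q = Q \<odot>\<^bsub>loc RR\<^esub> P" if P: "P \<in> carrier (loc RR)" and Q: "Q \<in> carrier (loc RR)" for P Q
  proof -
    obtain p q s where "p \<in> carrier R" "q \<in> carrier R" "s \<in> S" "P = fr RR p s" "Q = fr RR q s"
      by (rule common_denominator[OF RRm P Q]) (use that in auto)
    then show ?thesis by (simp add: fr_smult[OF RRm] m_comm)
  qed
  have "comm_monoid RS"
    by (rule comm_monoidI) (use one loc_smult_axioms[OF RRm] loc_one[OF RRm] comm in auto)
  then show ?thesis
    by (rule cringI[OF ag']) (use loc_smult_axioms(2)[OF RRm] in auto)
qed

lemma loc_module_module:
  assumes A: "module R (A :: ('r, 'a) module)"
  shows "module RS (loc A)"
  by (rule moduleI[OF loc_ring_cring loc_abelian_group[OF A]]) (use loc_smult_axioms[OF A] loc_one[OF A] in auto)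

end

section \<open>Multiples by ideals, and their preimages under localization\<close>

context fixed_cring
begin

lemma ideal_mult_submodule:
  assumes A: "module R (A :: ('r, 'a) module)" and Z: "Z \<subseteq> carrier R"
  shows "submodule (ideal_mult R Z A) R A"
  unfolding ideal_mult_def using A Z by (intro mod_span_submodule) auto

lemma ideal_mult_empty:
  assumes A: "module R (A :: ('r, 'a) module)"
  shows "ideal_mult R {} A = {\<zero>\<^bsub>A\<^esub>}"
proof
  have "submodule {\<zero>\<^bsub>A\<^esub>} R A" by (rule submoduleI'[OF A]) (use A in auto)
  then show "ideal_mult R {} A \<subseteq> {\<zero>\<^bsub>A\<^esub>}" unfolding ideal_mult_def by (rule mod_span_minimal) simp
  show "{\<zero>\<^bsub>A\<^esub>} \<subseteq> ideal_mult R {} A" using submodule_rules(2)[OF ideal_mult_submodule[OF A, of "{}"] A] by simp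
qed

lemma ideal_mult_mono:
  assumes A: "module R (A :: ('r, 'a) module)" and Z: "Z \<subseteq> Z'" "Z' \<subseteq> carrier R"
  shows "ideal_mult R Z A \<subseteq> ideal_mult R Z' A"
  unfolding ideal_mult_def[of R Z A]
proof (rule mod_span_minimal[OF ideal_mult_submodule[OF A Z(2)]])
  show "{r \<odot>\<^bsub>A\<^esub> x | r x. r \<in> Z \<and> x \<in> carrier A} \<subseteq> ideal_mult R Z' A"
    using Z(1) mod_span_superset[of "{r \<odot>\<^bsub>A\<^esub> x | r x. r \<in> Z' \<and> x \<in> carrier A}" A] unfolding ideal_mult_def by blast
qed

lemma ideal_mult_mem:
  assumes "r \<in> Z" "x \<in> carrier A"
  shows "r \<odot>\<^bsub>A\<^esub> x \<in> ideal_mult R Z (A :: ('r, 'a) module)"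
  using assms mod_span_superset[of "{r \<odot>\<^bsub>A\<^esub> x | r x. r \<in> Z \<and> x \<in> carrier A}" A] unfolding ideal_mult_def by blast

lemma ideal_mult_insertE:
  assumes A: "module R (A :: ('r, 'a) module)" and r: "r \<in> carrier R" and Z: "Z \<subseteq> carrier R"
    and v: "v \<in> ideal_mult R (insert r Z) A"
  shows "\<exists>x\<in>carrier A. \<exists>n\<in>ideal_mult R Z A. v = n \<oplus>\<^bsub>A\<^esub> r \<odot>\<^bsub>A\<^esub> x"
proof -
  note s = submodule_rules[OF ideal_mult_submodule[OF A Z] A]
  let ?N = "{n \<oplus>\<^bsub>A\<^esub> r \<odot>\<^bsub>A\<^esub> x | n x. n \<in> ideal_mult R Z A \<and> x \<in> carrier A}"
  have N: "submodule ?N R A"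
    by (rule sum_submodule[OF A ideal_mult_submodule[OF A Z] module.carrier_is_submodule[OF A] r])
  have "q \<odot>\<^bsub>A\<^esub> x \<in> ?N" if q: "q \<in> insert r Z" "x \<in> carrier A" for q x
  proof (cases "q = r")
    case True
    have "\<zero>\<^bsub>A\<^esub> \<oplus>\<^bsub>A\<^esub> r \<odot>\<^bsub>A\<^esub> x \<in> ?N" using s(2) q(2) by blast
    then show ?thesis using True q r A by simp
  next
    case False
    then have "q \<odot>\<^bsub>A\<^esub> x \<in> ideal_mult R Z A" using q by (intro ideal_mult_mem) auto
    then have "q \<odot>\<^bsub>A\<^esub> x \<oplus>\<^bsub>A\<^esub> r \<odot>\<^bsub>A\<^esub> \<zero>\<^bsub>A\<^esub> \<in> ?N" using A by blast
    moreover have "q \<odot>\<^bsub>A\<^esub> x \<oplus>\<^bsub>A\<^esub> r \<odot>\<^bsub>A\<^esub> \<zero>\<^bsub>A\<^esub> = q \<odot>\<^bsub>A\<^esub> x" using r q Z A False by auto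
    ultimately show ?thesis by (simp only:)
  qed
  then have "{q \<odot>\<^bsub>A\<^esub> x | q x. q \<in> insert r Z \<and> x \<in> carrier A} \<subseteq> ?N" by blast
  from mod_span_minimal[OF N this] show ?thesis using v unfolding ideal_mult_def[of R "insert r Z"] by blast
qed

end

context localization
begin

lemma fr_RS: "r \<in> carrier R \<Longrightarrow> s \<in> S \<Longrightarrow> fr RR r s \<in> carrier RS"
  by (auto simp: loc_carrier)

text \<open>For \<open>Z\<close> an initial segment of a regular sequence of the localization, these
  are the submodules \<open>V k\<close> of \<open>localized_resolution\<close>; they carry the depth
  hypothesis back to the module itself.\<close>

definition preimage :: "('r, 'a) module \<Rightarrow> ('r \<times> 'r) set set \<Rightarrow> 'a set" where
  "preimage A Z = {m \<in> carrier A. fr A m \<one> \<in> ideal_mult RS Z (loc A)}"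

lemma RS_fixed: "fixed_cring RS"
  by (intro fixed_cring.intro loc_ring_cring)

lemmas RS_rules = fixed_cring.submodule_rules[OF RS_fixed fixed_cring.ideal_mult_submodule[OF RS_fixed loc_module_module]
  loc_module_module]

lemma fr1_add: "module R (A :: ('r, 'a) module) \<Longrightarrow> x \<in> carrier A \<Longrightarrow> y \<in> carrier A \<Longrightarrow>
    fr A (x \<oplus>\<^bsub>A\<^esub> y) \<one> = fr A x \<one> \<oplus>\<^bsub>loc A\<^esub> fr A y \<one>"
  using fr_add_same[of A x y \<one>] SD(2) by simp

lemma fr1_smult: "module R (A :: ('r, 'a) module) \<Longrightarrow> r \<in> carrier R \<Longrightarrow> x \<in> carrier A \<Longrightarrow>
    fr A (r \<odot>\<^bsub>A\<^esub> x) \<one> = fr RR r \<one> \<odot>\<^bsub>loc A\<^esub> fr A x \<one>"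
  using fr_smult[of A r \<one> x \<one>] SD(2) by simp

lemma preimage_submodule:
  assumes A: "module R (A :: ('r, 'a) module)" and Z: "Z \<subseteq> carrier RS"
  shows "submodule (preimage A Z) R A"
proof (rule submoduleI'[OF A])
  note r = RS_rules[OF A Z A]
  show "preimage A Z \<subseteq> carrier A" by (auto simp: preimage_def)
  show "\<zero>\<^bsub>A\<^esub> \<in> preimage A Z" using A r(2) by (simp add: preimage_def loc_zero)
  fix x assume x: "x \<in> preimage A Z"
  show "x \<oplus>\<^bsub>A\<^esub> y \<in> preimage A Z" if "y \<in> preimage A Z" for y
    using x that A r(3) by (simp add: preimage_def fr1_add)
  show "q \<odot>\<^bsub>A\<^esub> x \<in> preimage A Z" if q: "q \<in> carrier R" for q
    using x q A r(4)[OF fr_RS[OF q SD(2)]] by (simp add: preimage_def fr1_smult)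
qed

lemma preimage_empty:
  assumes A: "module R (A :: ('r, 'a) module)"
  shows "preimage A {} = carrier (tors R S A)"
  unfolding preimage_def fixed_cring.ideal_mult_empty[OF RS_fixed loc_module_module[OF A]]
  using fr_eq_zero[OF A _ SD(2)] by (auto simp: tors_carrier)

lemma preimage_saturated:
  assumes A: "module R (A :: ('r, 'a) module)" and Z: "Z \<subseteq> carrier RS"
    and s: "s \<in> S" and m: "m \<in> carrier A" "s \<odot>\<^bsub>A\<^esub> m \<in> preimage A Z"
  shows "m \<in> preimage A Z"
proof -
  have sm: "s \<odot>\<^bsub>A\<^esub> m \<in> carrier A" by (rule mod_closed(3)[OF A SD(1)[OF s] m(1)])
  have "fr RR \<one> s \<odot>\<^bsub>loc A\<^esub> fr A (s \<odot>\<^bsub>A\<^esub> m) \<one> = fr A m \<one>"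
    using fr_smult[OF A one_closed s sm SD(2)] fr_cancel[OF A m(1) SD(2) s] A sm by simp
  then show ?thesis
    using RS_rules(4)[OF A Z A fr_RS[OF one_closed s], of "fr A (s \<odot>\<^bsub>A\<^esub> m) \<one>"] m by (simp add: preimage_def)
qed

text \<open>The fraction \<open>y / t\<close> and the numerator \<open>y\<close> differ by a unit of
  the localization, so regularity passes to numerators.\<close>

lemma preimage_regular:
  assumes A: "module R (A :: ('r, 'a) module)" and Z: "Z \<subseteq> carrier RS"
    and y: "y \<in> carrier R" "t \<in> S" and m: "m \<in> carrier A" "y \<odot>\<^bsub>A\<^esub> m \<in> preimage A Z"
    and reg: "\<And>U. U \<in> carrier (loc A) \<Longrightarrow> fr RR y t \<odot>\<^bsub>loc A\<^esub> U \<in> ideal_mult RS Z (loc A) \<Longrightarrow>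
      U \<in> ideal_mult RS Z (loc A)"
  shows "m \<in> preimage A Z"
proof -
  have ym: "y \<odot>\<^bsub>A\<^esub> m \<in> carrier A" by (rule mod_closed(3)[OF A y(1) m(1)])
  have "fr RR \<one> t \<odot>\<^bsub>loc A\<^esub> fr A (y \<odot>\<^bsub>A\<^esub> m) \<one> = fr RR y t \<odot>\<^bsub>loc A\<^esub> fr A m \<one>"
    using fr_smult[OF A one_closed y(2) ym SD(2)] fr_smult[OF A y m(1) SD(2)] A ym by simp
  then have "fr RR y t \<odot>\<^bsub>loc A\<^esub> fr A m \<one> \<in> ideal_mult RS Z (loc A)"
    using RS_rules(4)[OF A Z A fr_RS[OF one_closed y(2)], of "fr A (y \<odot>\<^bsub>A\<^esub> m) \<one>"] m(2) by (simp add: preimage_def)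
  then show ?thesis using reg[of "fr A m \<one>"] m(1) SD(2) by (auto simp: preimage_def loc_carrier)
qed

lemma preimage_mono:
  assumes A: "module R (A :: ('r, 'a) module)" and Z: "Z \<subseteq> Z'" "Z' \<subseteq> carrier RS"
  shows "preimage A Z \<subseteq> preimage A Z'"
  using fixed_cring.ideal_mult_mono[OF RS_fixed loc_module_module[OF A] Z] unfolding preimage_def by blast

lemma preimage_mult:
  assumes A: "module R (A :: ('r, 'a) module)" and Z: "Z \<subseteq> carrier RS"
    and y: "y \<in> carrier R" "t \<in> S" "fr RR y t \<in> Z" and m: "m \<in> carrier A"
  shows "y \<odot>\<^bsub>A\<^esub> m \<in> preimage A Z"
proof -
  have c: "y \<odot>\<^bsub>A\<^esub> m \<in> carrier A" "t \<in> carrier R" "fr A m \<one> \<in> carrier (loc A)"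
    using A y(1) m SD(1)[OF y(2)] SD(2) by (auto simp: loc_carrier)
  have "fr RR t \<one> \<odot>\<^bsub>loc A\<^esub> (fr RR y t \<odot>\<^bsub>loc A\<^esub> fr A m \<one>) = fr A (y \<odot>\<^bsub>A\<^esub> m) \<one>"
    using fr_smult[OF A y(1,2) m SD(2)] fr_smult[OF A c(2) SD(2) c(1) y(2)] fr_cancel[OF A c(1) SD(2) y(2)] c by simp
  then show ?thesis
    using RS_rules(4)[OF A Z A fr_RS[OF c(2) SD(2)] fixed_cring.ideal_mult_mem[OF RS_fixed y(3) c(3)]] c(1)
    by (simp add: preimage_def)
qed

lemma preimage_insert:
  assumes A: "module R (A :: ('r, 'a) module)" and Z: "Z \<subseteq> carrier RS"
    and y: "y \<in> carrier R" "t \<in> S" and m: "m \<in> preimage A (insert (fr RR y t) Z)"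
  shows "\<exists>s\<in>S. \<exists>m'\<in>carrier A. msub R A (s \<odot>\<^bsub>A\<^esub> m) (y \<odot>\<^bsub>A\<^esub> m') \<in> preimage A Z"
proof -
  have mA: "m \<in> carrier A" using m by (simp add: preimage_def)
  obtain U n where U: "U \<in> carrier (loc A)" "n \<in> ideal_mult RS Z (loc A)"
    "fr A m \<one> = n \<oplus>\<^bsub>loc A\<^esub> fr RR y t \<odot>\<^bsub>loc A\<^esub> U"
    using fixed_cring.ideal_mult_insertE[OF RS_fixed loc_module_module[OF A] fr_RS[OF y] Z, of "fr A m \<one>"] m
    by (auto simp: preimage_def)
  obtain x s where x: "x \<in> carrier A" "s \<in> S" "U = fr A x s" using U(1) by (auto simp: loc_carrier)
  \<comment> \<open>This clears both denominators in the product of \<open>y / t\<close> and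
    \<open>x / s\<close>.\<close>
  let ?u = "t \<otimes> s"
  have u: "?u \<in> S" "?u \<in> carrier R" using SD(1,3) x(2) y(2) by auto
  have c: "y \<odot>\<^bsub>A\<^esub> x \<in> carrier A" "?u \<odot>\<^bsub>A\<^esub> m \<in> carrier A" using A x y u mA by auto
  have F: "fr A (y \<odot>\<^bsub>A\<^esub> x) ?u \<in> carrier (loc A)" using c u by (auto simp: loc_carrier)
  let ?n = "fr RR ?u \<one> \<odot>\<^bsub>loc A\<^esub> n"
  note R = RS_rules[OF A Z A]
  have n: "n \<in> carrier (loc A)" "?n \<in> ideal_mult RS Z (loc A)" "?n \<in> carrier (loc A)"
    using R(1)[OF U(2)] R(4)[OF fr_RS[OF u(2) SD(2)] U(2)] R(1) by auto
  note LM = fixed_cring.mod_distr[OF RS_fixed loc_module_module[OF A]]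
  have "fr A (?u \<odot>\<^bsub>A\<^esub> m) \<one> = fr RR ?u \<one> \<odot>\<^bsub>loc A\<^esub> (n \<oplus>\<^bsub>loc A\<^esub> fr A (y \<odot>\<^bsub>A\<^esub> x) ?u)"
    using fr1_smult[OF A u(2) mA] U(3) fr_smult[OF A y x(1,2)] x(3) by simp
  also have "\<dots> = ?n \<oplus>\<^bsub>loc A\<^esub> fr RR ?u \<one> \<odot>\<^bsub>loc A\<^esub> fr A (y \<odot>\<^bsub>A\<^esub> x) ?u"
    by (rule LM(1)[OF fr_RS[OF u(2) SD(2)] n(1) F])
  also have "fr RR ?u \<one> \<odot>\<^bsub>loc A\<^esub> fr A (y \<odot>\<^bsub>A\<^esub> x) ?u = fr A (y \<odot>\<^bsub>A\<^esub> x) \<one>"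
    using fr_smult[OF A u(2) SD(2) c(1) u(1)] fr_cancel[OF A c(1) SD(2) u(1)] u(2) by simp
  finally have eq: "fr A (?u \<odot>\<^bsub>A\<^esub> m) \<one> = ?n \<oplus>\<^bsub>loc A\<^esub> fr A (y \<odot>\<^bsub>A\<^esub> x) \<one>" .
  let ?d = "msub R A (?u \<odot>\<^bsub>A\<^esub> m) (y \<odot>\<^bsub>A\<^esub> x)"
  have d: "?d \<in> carrier A" by (rule mod_closed(4)[OF A c(2,1)])
  have "fr A ?d \<one> \<oplus>\<^bsub>loc A\<^esub> fr A (y \<odot>\<^bsub>A\<^esub> x) \<one> = fr A (?u \<odot>\<^bsub>A\<^esub> m) \<one>"
    unfolding fr1_add[OF A d c(1), symmetric] msub_alg(2)[OF A c(2,1)] ..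
  then have "fr A ?d \<one> \<oplus>\<^bsub>loc A\<^esub> fr A (y \<odot>\<^bsub>A\<^esub> x) \<one> = ?n \<oplus>\<^bsub>loc A\<^esub> fr A (y \<odot>\<^bsub>A\<^esub> x) \<one>" unfolding eq .
  moreover have "fr A (y \<odot>\<^bsub>A\<^esub> x) \<one> \<in> carrier (loc A)" "fr A ?d \<one> \<in> carrier (loc A)"
    using c(1) d SD(2) by (auto simp: loc_carrier)
  ultimately have "fr A ?d \<one> = ?n"
    using fixed_cring.msub_alg(4)[OF RS_fixed loc_module_module[OF A]] n(3) by metis
  then have "?d \<in> preimage A Z" using d n(2) by (simp add: preimage_def)
  then show ?thesis using u(1) x(1) by blast
qed

text \<open>Each of the finitely many generators is killed by an element of \<open>S\<close>, and
  the product of these elements kills the module.\<close>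

lemma zero_localization:
  assumes A: "module R (A :: ('r, 'a) module)" and fg: "fin_gen_module R A" and zero: "zero_module (loc A)"
  obtains s where "s \<in> S" "\<And>x. x \<in> carrier A \<Longrightarrow> s \<odot>\<^bsub>A\<^esub> x = \<zero>\<^bsub>A\<^esub>"
proof -
  obtain G where G: "G \<subseteq> carrier A" "finite G" "carrier A = mod_span R A G"
    using fg unfolding fin_gen_module_def by blast
  have t: "\<exists>s\<in>S. s \<odot>\<^bsub>A\<^esub> x = \<zero>\<^bsub>A\<^esub>" if "x \<in> carrier A" for x
  proof -
    have "fr A x \<one> \<in> carrier (loc A)" using that SD(2) by (auto simp: loc_carrier)
    then have "fr A x \<one> = \<zero>\<^bsub>loc A\<^esub>" using zero unfolding zero_module_def by blast
    then show ?thesis using fr_eq_zero[OF A that SD(2)] by (simp add: tors_carrier)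
  qed
  have "\<exists>s\<in>S. \<forall>x\<in>G. s \<odot>\<^bsub>A\<^esub> x = \<zero>\<^bsub>A\<^esub>"
    using G(2,1)
  proof (induction rule: finite_induct)
    case empty
    then show ?case using SD(2) by auto
  next
    case (insert g F)
    then obtain s where s: "s \<in> S" "\<forall>x\<in>F. s \<odot>\<^bsub>A\<^esub> x = \<zero>\<^bsub>A\<^esub>" by auto
    obtain u where u: "u \<in> S" "u \<odot>\<^bsub>A\<^esub> g = \<zero>\<^bsub>A\<^esub>" using t[of g] insert.prems by auto
    note c = SD(1)[OF s(1)] SD(1)[OF u(1)]
    have "(s \<otimes> u) \<odot>\<^bsub>A\<^esub> x = \<zero>\<^bsub>A\<^esub>" if x: "x \<in> insert g F" for x
    proof -
      have xA: "x \<in> carrier A" using x insert.prems by blast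
      show ?thesis
      proof (cases "x = g")
        case True
        then show ?thesis using c xA u(2) A by (simp add: mod_distr)
      next
        case False
        then have "s \<odot>\<^bsub>A\<^esub> x = \<zero>\<^bsub>A\<^esub>" using x s(2) by blast
        then show ?thesis using c xA A by (simp add: mod_distr smult_swap[OF A c])
      qed
    qed
    then show ?case using SD(3)[OF s(1) u(1)] by blast
  qed
  then obtain s where s: "s \<in> S" "\<And>x. x \<in> G \<Longrightarrow> s \<odot>\<^bsub>A\<^esub> x = \<zero>\<^bsub>A\<^esub>" by blast
  have N: "submodule {x \<in> carrier A. s \<odot>\<^bsub>A\<^esub> x = \<zero>\<^bsub>A\<^esub>} R A"
    by (rule submoduleI'[OF A]) (use SD(1)[OF s(1)] A in \<open>auto simp: mod_distr smult_swap[OF A, of s]\<close>)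
  have "carrier A \<subseteq> {x \<in> carrier A. s \<odot>\<^bsub>A\<^esub> x = \<zero>\<^bsub>A\<^esub>}"
    unfolding G(3) by (rule mod_span_minimal[OF N[unfolded G(3)]]) (use G s(2) in auto)
  then show ?thesis using that s(1) by blast
qed

end

section \<open>Prime ideals and localization at a prime\<close>

context fixed_cring
begin

lemma prime_pow:
  assumes p: "primeideal \<pp> R" and a: "a \<in> carrier R" "a [^] (n::nat) \<in> \<pp>"
  shows "a \<in> \<pp>"
  using a(2)
proof (induction n)
  case 0
  have "\<one> \<notin> \<pp>"
    using primeideal.I_notcarr[OF p] ideal.one_imp_carrier[OF primeideal.axioms(1)[OF p]] by auto
  then show ?case using 0 by simp
next
  case (Suc n)
  then show ?case using primeideal.I_prime[OF p, of "a [^] n" a] a(1) by auto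
qed

lemma prime_complement:
  assumes p: "primeideal \<pp> R"
  shows "submonoid (carrier R - \<pp>) R"
proof (rule submonoid.intro)
  show "\<one> \<in> carrier R - \<pp>" using prime_pow[OF p zero_closed, of 0]
    ideal_rules(2)[OF primeideal.axioms(1)[OF p]] primeideal.I_notcarr[OF p]
      ideal.one_imp_carrier[OF primeideal.axioms(1)[OF p]] by auto
qed (use primeideal.I_prime[OF p] in auto)

end

text \<open>A maximal element among the annihilators modulo \<open>W\<close> of those multiples of \<open>z\<close> that no power of
  \<open>a\<close> moves into \<open>W\<close> is prime.\<close>

lemma (in noetherian_cring) prime_colon:
  assumes A: "module R (A :: ('r, 'a) module)" and W: "submodule W R A" and z: "z \<in> carrier A"
    and a: "a \<in> carrier R" "\<And>n::nat. a [^] n \<odot>\<^bsub>A\<^esub> z \<notin> W"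
  obtains r where "r \<in> carrier R" "primeideal {q \<in> carrier R. q \<odot>\<^bsub>A\<^esub> (r \<odot>\<^bsub>A\<^esub> z) \<in> W} R"
    "a \<odot>\<^bsub>A\<^esub> (r \<odot>\<^bsub>A\<^esub> z) \<notin> W"
proof -
  note w = submodule_rules[OF W A]
  define ann where "ann r = {q \<in> carrier R. q \<odot>\<^bsub>A\<^esub> (r \<odot>\<^bsub>A\<^esub> z) \<in> W}" for r
  define P where "P r \<longleftrightarrow> r \<in> carrier R \<and> (\<forall>n::nat. a [^] n \<odot>\<^bsub>A\<^esub> (r \<odot>\<^bsub>A\<^esub> z) \<notin> W)" for r
  have ann: "ideal (ann r) R" if r: "r \<in> carrier R" for r
  proof (rule idealI')
    have rz: "r \<odot>\<^bsub>A\<^esub> z \<in> carrier A" using r z A by simp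
    show "ann r \<subseteq> carrier R" "\<zero> \<in> ann r" using rz A w(2) by (auto simp: ann_def)
    show "x \<oplus> y \<in> ann r" if "x \<in> ann r" "y \<in> ann r" for x y
      using that rz A w(3) by (auto simp: ann_def mod_distr(2))
    show "x \<otimes> y \<in> ann r" if "x \<in> carrier R" "y \<in> ann r" for x y
      using that rz A w(4) by (auto simp: ann_def mod_distr(3))
  qed
  have "\<exists>N\<in>ann ` Collect P. \<forall>X\<in>ann ` Collect P. N \<subseteq> X \<longrightarrow> X = N"
  proof (rule subset_Zorn_nonempty)
    have "P \<one>" using a z A by (simp add: P_def)
    then show "ann ` Collect P \<noteq> {}" by blast
    fix C assume C: "C \<noteq> {}" "subset.chain (ann ` Collect P) C"
    have "subset.chain {I. ideal I R} C"
      using C(2) ann unfolding subset_chain_def P_def by blast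
    then have "\<Union> C \<in> C" by (rule ideal_chain_is_trivial[OF C(1)])
    then show "\<Union> C \<in> ann ` Collect P" using C(2) unfolding subset_chain_def by blast
  qed
  then obtain r where r: "P r" "\<And>q. P q \<Longrightarrow> ann r \<subseteq> ann q \<Longrightarrow> ann q = ann r" by blast
  have rR: "r \<in> carrier R" and rP: "\<And>n::nat. a [^] n \<odot>\<^bsub>A\<^esub> (r \<odot>\<^bsub>A\<^esub> z) \<notin> W" using r(1) by (auto simp: P_def)
  have rz: "r \<odot>\<^bsub>A\<^esub> z \<in> carrier A" using rR z A by simp
  have assoc: "p \<odot>\<^bsub>A\<^esub> ((q \<otimes> r) \<odot>\<^bsub>A\<^esub> z) = (p \<otimes> q) \<odot>\<^bsub>A\<^esub> (r \<odot>\<^bsub>A\<^esub> z)"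
    if "p \<in> carrier R" "q \<in> carrier R" for p q using that rR z A by (simp add: mod_distr(3))
  have anr: "p \<in> ann (q \<otimes> r) \<longleftrightarrow> p \<otimes> q \<in> ann r" if "p \<in> carrier R" "q \<in> carrier R" for p q
    using assoc[OF that] that by (simp add: ann_def)
  have le: "ann r \<subseteq> ann (q \<otimes> r)" if q: "q \<in> carrier R" for q
    using anr[OF _ q] ideal_rules(1,5)[OF ann[OF rR]] q by blast
  have an: "a [^] n \<in> carrier R" for n :: nat using a(1) by simp
  \<comment> \<open>Replacing \<open>r\<close> by \<open>a^n r\<close> keeps the defining property
    and can only enlarge the annihilator, so by maximality the annihilator stays the same and powers
    of \<open>a\<close> can be cancelled.\<close>
  have can: "p \<in> ann r" if p: "p \<in> carrier R" "p \<otimes> a [^] n \<in> ann r" for p and n :: nat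
  proof -
    have "a [^] k \<odot>\<^bsub>A\<^esub> ((a [^] n \<otimes> r) \<odot>\<^bsub>A\<^esub> z) \<notin> W" for k :: nat
      unfolding assoc[OF an an] nat_pow_mult[OF a(1)] by (rule rP)
    then have "P (a [^] n \<otimes> r)" using an rR by (simp add: P_def)
    then have "ann (a [^] n \<otimes> r) = ann r" using r(2) le[OF an] by blast
    then show ?thesis using anr[OF p(1) an] p(2) by blast
  qed
  have "primeideal (ann r) R"
  proof (rule primeidealI[OF ann[OF rR] is_cring])
    have "\<one> \<notin> ann r" using rP[of 0] by (simp add: ann_def)
    then show "carrier R \<noteq> ann r" by blast
    fix p q assume pq: "p \<in> carrier R" "q \<in> carrier R" "p \<otimes> q \<in> ann r"
    show "p \<in> ann r \<or> q \<in> ann r"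
    proof (rule disjCI)
      assume q: "q \<notin> ann r"
      have "a [^] n \<odot>\<^bsub>A\<^esub> ((q \<otimes> r) \<odot>\<^bsub>A\<^esub> z) \<notin> W" for n :: nat
      proof
        assume "a [^] n \<odot>\<^bsub>A\<^esub> ((q \<otimes> r) \<odot>\<^bsub>A\<^esub> z) \<in> W"
        then have "q \<otimes> a [^] n \<in> ann r" using assoc[OF an pq(2)] an pq(2) m_comm[OF an pq(2)] by (simp add: ann_def)
        then show False using can[OF pq(2)] q by blast
      qed
      then have "P (q \<otimes> r)" using pq(2) rR by (simp add: P_def)
      then have "ann (q \<otimes> r) = ann r" using r(2) le[OF pq(2)] by blast
      then show "p \<in> ann r" using anr[OF pq(1,2)] pq(3) by blast
    qed
  qed
  then show ?thesis using that[OF rR] rP[of 1] a(1) by (simp add: ann_def)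
qed

locale prime_localization = fixed_cring R for R :: "'r ring" (structure) +
  fixes \<pp> :: "'r set"
  assumes prime: "primeideal \<pp> R"
begin

sublocale localization R "carrier R - \<pp>"
  by (rule localization.intro[OF fixed_cring_axioms localization_axioms.intro[OF prime_complement[OF prime]]])

lemmas prime_rules = ideal_rules[OF primeideal.axioms(1)[OF prime]]

text \<open>Cross-multiplication puts \<open>y\<close> times an element outside \<pp> into \<pp>;
  primality then makes membership independent of the numerator chosen.\<close>

lemma numerator_mem:
  assumes r: "r \<in> \<pp>" "s \<in> carrier R - \<pp>" and y: "y \<in> carrier R" "t \<in> carrier R - \<pp>"
    and eq: "fr RR y t = fr RR r s"
  shows "y \<in> \<pp>"
proof -
  have rR: "r \<in> carrier R" by (rule prime_rules(1)[OF r(1)])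
  obtain u where u: "u \<in> carrier R - \<pp>" "u \<otimes> (s \<otimes> y) = u \<otimes> (t \<otimes> r)"
    using fr_eq[OF regular_module_module, of y t r s] eq y r(2) rR by auto
  have "u \<otimes> (t \<otimes> r) \<in> \<pp>" using u(1) y(2) prime_rules(4) r(1) by blast
  then have "(u \<otimes> s) \<otimes> y \<in> \<pp>" using u r(2) y(1) by (simp add: m_assoc)
  moreover have "u \<otimes> s \<in> carrier R - \<pp>" by (rule SD(3)[OF u(1) r(2)])
  ultimately show ?thesis using primeideal.I_prime[OF prime, of "u \<otimes> s" y] y(1) by blast
qed

lemma ideal_at_fractions:
  assumes a: "\<aa> \<subseteq> \<pp>"
  shows "ideal_at R \<pp> \<aa> \<subseteq> {fr RR r s | r s. r \<in> \<pp> \<and> s \<in> carrier R - \<pp>}" (is "_ \<subseteq> ?P")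
proof -
  note RRm = regular_module_module
  have pR: "r \<in> carrier RR" if "r \<in> \<pp>" for r using prime_rules(1)[OF that] by simp
  have "ideal ?P RS"
  proof (rule fixed_cring.idealI'[OF RS_fixed])
    show "?P \<subseteq> carrier RS" using pR fr_RS by auto
    show "\<zero>\<^bsub>RS\<^esub> \<in> ?P" using fr_zero[OF RRm SD(2)] prime_rules(2) SD(2) by auto
    fix U assume "U \<in> ?P"
    then obtain r s where rs: "r \<in> \<pp>" "s \<in> carrier R - \<pp>" "U = fr RR r s" by blast
    {
      fix V assume "V \<in> ?P"
      then obtain q t where qt: "q \<in> \<pp>" "t \<in> carrier R - \<pp>" "V = fr RR q t" by blast
      have "U \<oplus>\<^bsub>RS\<^esub> V = fr RR (t \<otimes> r \<oplus> s \<otimes> q) (s \<otimes> t)"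
        using fr_add[OF RRm _ rs(2) _ qt(2)] pR rs qt by simp
      moreover have "t \<otimes> r \<oplus> s \<otimes> q \<in> \<pp>" using prime_rules(3,4) rs qt by blast
      ultimately show "U \<oplus>\<^bsub>RS\<^esub> V \<in> ?P" using SD(3)[OF rs(2) qt(2)] by blast
    next
      fix V assume "V \<in> carrier RS"
      then obtain q t where qt: "q \<in> carrier R" "t \<in> carrier R - \<pp>" "V = fr RR q t"
        by (auto simp: loc_carrier)
      have "V \<otimes>\<^bsub>RS\<^esub> U = fr RR (q \<otimes> r) (t \<otimes> s)"
        using fr_smult[OF RRm qt(1,2) _ rs(2)] pR rs qt by simp
      then show "V \<otimes>\<^bsub>RS\<^esub> U \<in> ?P" using SD(3)[OF qt(2) rs(2)] prime_rules(4)[OF qt(1) rs(1)] by blast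
    }
  qed
  moreover have "(\<lambda>a. fr RR a \<one>) ` \<aa> \<subseteq> ?P" using a SD(2) by blast
  ultimately show ?thesis unfolding loc_ideal_def genideal_def by blast
qed

text \<open>Since \<open>J\<close> lies in \<pp>, its extension consists of fractions with
  numerators in \<pp>. Equality of the radicals puts some power of each element of \<open>I\<close>
  among them, hence the element itself into \<pp>.\<close>

lemma radical_le_prime:
  assumes I: "I \<subseteq> carrier R" and J: "J \<subseteq> \<pp>"
    and rad: "radical (ring_at R \<pp>) (ideal_at R \<pp> I) = radical (ring_at R \<pp>) (ideal_at R \<pp> J)"
  shows "I \<subseteq> \<pp>"
proof
  fix a assume a: "a \<in> I"
  then have aR: "a \<in> carrier R" using I by blast
  note RRm = regular_module_module
  have fa: "fr RR a \<one> \<in> carrier RS" by (rule fr_RS[OF aR SD(2)])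
  have pow: "fr RR a \<one> [^]\<^bsub>RS\<^esub> n = fr RR (a [^] n) \<one>" for n :: nat
  proof (induction n)
    case (Suc n)
    then show ?case using fr_smult[OF RRm _ SD(2) _ SD(2), of "a [^] n" a] aR by simp
  qed simp
  have "fr RR a \<one> \<in> ideal_at R \<pp> I"
    unfolding loc_ideal_def genideal_def using a by blast
  moreover have "fr RR a \<one> [^]\<^bsub>RS\<^esub> (1::nat) = fr RR a \<one>" using pow[of 1] aR by simp
  ultimately have "fr RR a \<one> \<in> radical RS (ideal_at R \<pp> I)"
    using fa unfolding radical_def by (metis (mono_tags, lifting) mem_Collect_eq)
  then obtain n :: nat where "fr RR a \<one> [^]\<^bsub>RS\<^esub> n \<in> ideal_at R \<pp> J"
    unfolding rad by (auto simp: radical_def)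
  then obtain r s where "r \<in> \<pp>" "s \<in> carrier R - \<pp>" "fr RR (a [^] n) \<one> = fr RR r s"
    using ideal_at_fractions[OF J] unfolding pow by blast
  then have "a [^] n \<in> \<pp>" using numerator_mem[of r s "a [^] n" \<one>] aR SD(2) by blast
  then show "a \<in> \<pp>" by (rule prime_pow[OF prime aR])
qed

text \<open>Depth is a supremum of lengths, so exceeding \<open>c\<close> means that a single
  sequence is longer than \<open>c\<close>; its entries can be written with numerators in
  \<pp>.\<close>

lemma deep_regular_sequence:
  assumes depth: "\<not> depth (ring_at R \<pp>) (ideal_at R \<pp> \<pp>) (module_at R \<pp> A) \<le> enat c"
  obtains rs Y T where "regular_sequence (ring_at R \<pp>) (module_at R \<pp> A) rs" "c < length rs"
    "\<And>i. i < length rs \<Longrightarrow> Y i \<in> \<pp> \<and> T i \<in> carrier R - \<pp> \<and> rs ! i = fr RR (Y i) (T i)"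
proof -
  obtain rs where rs: "set rs \<subseteq> ideal_at R \<pp> \<pp>" "regular_sequence (ring_at R \<pp>) (module_at R \<pp> A) rs" "c < length rs"
    using depth unfolding depth_def not_le less_Sup_iff by auto
  have "\<exists>Y T. Y \<in> \<pp> \<and> T \<in> carrier R - \<pp> \<and> rs ! i = fr RR Y T" if "i < length rs" for i
    using nth_mem[OF that] rs(1) ideal_at_fractions[of \<pp>] by blast
  then obtain Y T where "\<And>i. i < length rs \<Longrightarrow> Y i \<in> \<pp> \<and> T i \<in> carrier R - \<pp> \<and> rs ! i = fr RR (Y i) (T i)"
    by metis
  then show ?thesis using that rs by blast
qed

end


section \<open>The cohomology with respect to the smaller ideal\<close>

text \<open>The numerators of a long regular sequence of the localization, together with the
  preimages in \<open>M\<close> of the submodules generated by its initial segments, satisfy the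
  assumptions of \<open>localized_resolution\<close>.\<close>

lemma (in resolved_module) deep_socle:
  assumes p: "primeideal \<pp> R"
    and depth: "\<not> depth (ring_at R \<pp>) (ideal_at R \<pp> \<pp>) (module_at R \<pp> M) \<le> enat c"
    and z: "z \<in> cocycles E d c" "\<And>q. q \<in> \<pp> \<Longrightarrow> q \<odot>\<^bsub>E c\<^esub> z = \<zero>\<^bsub>E c\<^esub>"
  shows "\<exists>s\<in>carrier R - \<pp>. case c of 0 \<Rightarrow> s \<odot>\<^bsub>E c\<^esub> z = \<zero>\<^bsub>E c\<^esub> |
    Suc l \<Rightarrow> \<exists>w\<in>carrier (E l). d l w = s \<odot>\<^bsub>E c\<^esub> z \<and> (\<forall>q\<in>\<pp>. q \<odot>\<^bsub>E l\<^esub> w = \<zero>\<^bsub>E l\<^esub>)"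
proof -
  interpret P: prime_localization R \<pp>
    by (rule prime_localization.intro[OF fixed_cring_axioms prime_localization_axioms.intro[OF p]])
  let ?A = "module_at R \<pp> M"
  obtain rs Y T where rs: "regular_sequence (ring_at R \<pp>) ?A rs" "c < length rs"
    "\<And>i. i < length rs \<Longrightarrow> Y i \<in> \<pp> \<and> T i \<in> carrier R - \<pp> \<and> rs ! i = P.fr P.RR (Y i) (T i)"
    by (rule P.deep_regular_sequence[OF depth]) (rule that)
  have rsR: "set (take k rs) \<subseteq> carrier P.RS" for k
    using rs(1) set_take_subset[of k rs] unfolding regular_sequence_def by blast
  have reg: "U \<in> ideal_mult P.RS (set (take i rs)) ?A"
    if "i < length rs" "U \<in> carrier ?A" "rs ! i \<odot>\<^bsub>?A\<^esub> U \<in> ideal_mult P.RS (set (take i rs)) ?A" for i U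
    using rs(1) that unfolding regular_sequence_def by blast
  let ?ys = "map Y [0..<length rs]"
  let ?V = "\<lambda>k. P.preimage M (set (take k rs))"
  have Y: "Y k \<in> carrier R" "Y k \<in> \<pp>" "T k \<in> carrier R - \<pp>" "rs ! k = P.fr P.RR (Y k) (T k)"
    if "k < length rs" for k using rs(3)[OF that] P.prime_rules(1) by auto
  have ins: "set (take (Suc k) rs) = insert (P.fr P.RR (Y k) (T k)) (set (take k rs))" if "k < length rs" for k
    using that Y(4)[OF that] by (simp add: take_Suc_conv_app_nth)
  interpret L: localized_resolution R "carrier R - \<pp>" E d M aug ?V ?ys
  proof (intro localized_resolution.intro localized_complex.intro localized_complex_axioms.intro
      localized_resolution_axioms.intro)
    show "noetherian_cring R" by (rule noetherian_cring_axioms)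
    show "submonoid (carrier R - \<pp>) R" by (rule prime_complement[OF p])
    show "complex R E d" by (rule complex_E)
    show "baer R (E i)" for i by (rule baer_E)
    show "exact_at E d i" if "0 < i" for i by (rule exact_E[OF that])
    show "module R M" by (rule M(1))
    show "linear_map R M (E 0) aug" by (rule aug_linear)
    show "m = \<zero>\<^bsub>M\<^esub>" if "m \<in> carrier M" "aug m = \<zero>\<^bsub>E 0\<^esub>" for m
      using aug_eq[of m "\<zero>\<^bsub>M\<^esub>"] that linear_zero[OF aug_linear M(1) module_E] M(1) by simp
    show "aug ` carrier M = cocycles E d 0" by (rule resolution_facts(5)[OF res])
    show "set ?ys \<subseteq> carrier R" using Y(1) by auto
    show "submodule (?V k) R M" for k by (rule P.preimage_submodule[OF M(1) rsR])
    show "?V 0 = carrier (tors R (carrier R - \<pp>) M)" using P.preimage_empty[OF M(1)] by simp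
    show "m \<in> ?V k" if "s \<in> carrier R - \<pp>" "m \<in> carrier M" "s \<odot>\<^bsub>M\<^esub> m \<in> ?V k" for k s m
      by (rule P.preimage_saturated[OF M(1) rsR that])
    fix k m assume "k < length ?ys"
    then have k: "k < length rs" "?ys ! k = Y k" by auto
    show "m \<in> ?V k" if m: "m \<in> carrier M" "?ys ! k \<odot>\<^bsub>M\<^esub> m \<in> ?V k"
      by (rule P.preimage_regular[OF M(1) rsR Y(1,3)[OF k(1)] m[unfolded k(2)]])
        (use reg[OF k(1)] Y(4)[OF k(1)] in auto)
    show "?V k \<subseteq> ?V (Suc k)"
      by (rule P.preimage_mono[OF M(1) _ rsR]) (use ins[OF k(1)] in blast)
    show "?ys ! k \<odot>\<^bsub>M\<^esub> m \<in> ?V (Suc k)" if "m \<in> carrier M"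
      unfolding k(2) by (rule P.preimage_mult[OF M(1) rsR Y(1,3)[OF k(1)] _ that]) (use ins[OF k(1)] in blast)
    show "\<exists>s\<in>carrier R - \<pp>. \<exists>m'\<in>carrier M. msub R M (s \<odot>\<^bsub>M\<^esub> m) (?ys ! k \<odot>\<^bsub>M\<^esub> m') \<in> ?V k"
      if m: "m \<in> ?V (Suc k)"
      unfolding k(2) by (rule P.preimage_insert[OF M(1) rsR Y(1,3)[OF k(1)] m[unfolded ins[OF k(1)]]])
  qed
  show ?thesis
  proof (rule L.localized_socle[OF _ _ _ z])
    show "set ?ys \<subseteq> \<pp>" using Y(2) by auto
    show "\<pp> \<subseteq> carrier R" using P.prime_rules(1) by blast
    show "c < length ?ys" using rs(2) by simp
  qed
qed

context two_ideals
begin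

text \<open>Outside the support some \<open>s\<close> not in \<pp> kills \<open>M\<close>.
  Multiplication by \<open>s\<close> on the resolution then lifts the zero map, so it is
  null-homotopic and \<open>s\<close> kills the class of \<open>z\<close>, contrary to
  \<open>ann\<close>.\<close>

lemma prime_in_support:
  assumes p: "primeideal \<pp> R" and z: "z \<in> ZK" and ann: "\<And>q. q \<in> carrier R \<Longrightarrow> q \<odot>\<^bsub>E c\<^esub> z \<in> BK \<Longrightarrow> q \<in> \<pp>"
  shows "\<pp> \<in> Supp R M"
proof (rule ccontr)
  interpret P: prime_localization R \<pp>
    by (rule prime_localization.intro[OF fixed_cring_axioms prime_localization_axioms.intro[OF p]])
  assume "\<pp> \<notin> Supp R M"
  then have zero: "zero_module (module_at R \<pp> M)" using p by (simp add: Supp_def)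
  obtain s where s: "s \<in> carrier R - \<pp>" "\<And>x. x \<in> carrier M \<Longrightarrow> s \<odot>\<^bsub>M\<^esub> x = \<zero>\<^bsub>M\<^esub>"
    by (rule P.zero_localization[OF M zero]) (rule that)
  have sR: "s \<in> carrier R" using s(1) by blast
  have "chain_map R E d E d (\<lambda>i x. s \<odot>\<^bsub>E i\<^esub> x)"
    unfolding chain_map_def
  proof (intro conjI allI ballI)
    show "linear_map R (E i) (E i) (\<lambda>x. s \<odot>\<^bsub>E i\<^esub> x)" for i
      by (rule linear_scale[OF linear_id module_E sR])
  qed (use linear_smult[OF complexD(2)[OF complex_E] sR] in simp)
  moreover have "s \<odot>\<^bsub>E 0\<^esub> aug x = \<zero>\<^bsub>E 0\<^esub>" if "x \<in> carrier M" for x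
    using linear_smult[OF aug_linear sR that] s(2)[OF that] linear_zero[OF aug_linear M(1) module_E] by simp
  ultimately have "null_homotopic R E d E d (\<lambda>i x. s \<odot>\<^bsub>E i\<^esub> x)" by (rule null_homotopic_lift)
  then have "s \<odot>\<^bsub>E c\<^esub> z \<in> BK" using J z by (rule null_homotopic_coboundary)
  then show False using ann[OF sR] s(1) by blast
qed

text \<open>If the depth were larger, \<open>deep_socle\<close> would give a primitive of a multiple
  \<open>s (pr z)\<close> with \<open>s\<close> not in \<pp>. The point is that this primitive can
  be found inside \<open>K\<close>, so that \<open>s\<close> kills the class of
  \<open>z\<close>.\<close>

lemma prime_shallow:
  assumes p: "primeideal \<pp> R" and z: "z \<in> ZK"
    and ann: "\<And>q. q \<in> carrier R \<Longrightarrow> q \<in> \<pp> \<longleftrightarrow> q \<odot>\<^bsub>E c\<^esub> z \<in> BK" and Jp: "J \<subseteq> \<pp>"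
  shows "depth (ring_at R \<pp>) (ideal_at R \<pp> \<pp>) (module_at R \<pp> M) \<le> enat c"
proof (rule ccontr)
  assume deep: "\<not> depth (ring_at R \<pp>) (ideal_at R \<pp> \<pp>) (module_at R \<pp> M) \<le> enat c"
  note pR = ideal_rules(1)[OF primeideal.axioms(1)[OF p]]
  have zK: "z \<in> carrier (K c)" by (rule ZKD(1)[OF z])
  let ?z = "pr z"
  have z': "?z \<in> ZK" by (rule pr_ZK[OF z])
  \<comment> \<open>The prime annihilates only the class of \<open>z\<close>; passing to
    \<open>pr z\<close> makes it annihilate the cocycle itself.\<close>
  have kill: "q \<odot>\<^bsub>E c\<^esub> ?z = \<zero>\<^bsub>E c\<^esub>" if q: "q \<in> \<pp>" for q
    using linear_smult[OF pr_linear pR[OF q] zK] pr_BK[of "q \<odot>\<^bsub>E c\<^esub> z"] ann[OF pR[OF q]] q by simp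
  have zE: "?z \<in> cocycles E d c" using z' K_E by (simp add: cocycles_def)
  obtain s where s: "s \<in> carrier R - \<pp>" "case c of 0 \<Rightarrow> s \<odot>\<^bsub>E c\<^esub> ?z = \<zero>\<^bsub>E c\<^esub> |
    Suc l \<Rightarrow> \<exists>w\<in>carrier (E l). d l w = s \<odot>\<^bsub>E c\<^esub> ?z \<and> (\<forall>q\<in>\<pp>. q \<odot>\<^bsub>E l\<^esub> w = \<zero>\<^bsub>E l\<^esub>)"
    using deep_socle[OF p deep zE kill] by blast
  have sR: "s \<in> carrier R" using s(1) by blast
  have "s \<odot>\<^bsub>E c\<^esub> ?z \<in> BK"
  proof (cases c)
    case 0
    then show ?thesis using s(2) by (simp add: coboundaries_def)
  next
    case (Suc l)
    then obtain w where w: "w \<in> carrier (E l)" "d l w = s \<odot>\<^bsub>E c\<^esub> ?z" "\<And>q. q \<in> \<pp> \<Longrightarrow> q \<odot>\<^bsub>E l\<^esub> w = \<zero>\<^bsub>E l\<^esub>"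
      using s(2) by auto
    \<comment> \<open>The primitive is killed by \<pp>, hence by \<open>J\<close>, so it is
      \<open>J\<close>-torsion and belongs to \<open>K\<close>.\<close>
    have "J [^]\<^bsub>ideals_set R\<^esub> (1::nat) \<subseteq> J"
      using ideal_prod_inter[OF oneideal J] by simp
    then have "\<forall>a \<in> J [^]\<^bsub>ideals_set R\<^esub> (1::nat). a \<odot>\<^bsub>E l\<^esub> w = \<zero>\<^bsub>E l\<^esub>" using Jp w(3) by blast
    then have "w \<in> carrier (K l)" using w(1) unfolding torsion_part_carrier by blast
    then show ?thesis unfolding w(2)[symmetric] using Suc by (auto simp: coboundaries_def)
  qed
  moreover have "s \<odot>\<^bsub>E c\<^esub> msub R (E c) z ?z \<in> BK"
    using submodule_rules(4)[OF sub_BK module_K sR pr_diff[OF zK]] by simp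
  ultimately have "s \<odot>\<^bsub>E c\<^esub> msub R (E c) z ?z \<oplus>\<^bsub>E c\<^esub> s \<odot>\<^bsub>E c\<^esub> ?z \<in> BK"
    using submodule_rules(3)[OF sub_BK module_K] by simp
  moreover have "s \<odot>\<^bsub>E c\<^esub> msub R (E c) z ?z \<oplus>\<^bsub>E c\<^esub> s \<odot>\<^bsub>E c\<^esub> ?z = s \<odot>\<^bsub>E c\<^esub> z"
    using mod_distr(1)[OF module_E sR mod_closed(4)[OF module_E K_E[OF zK] K_E[OF ZKD(1)[OF z']]] K_E[OF ZKD(1)[OF z']]]
      msub_alg(2)[OF module_E K_E[OF zK] K_E[OF ZKD(1)[OF z']]] by simp
  ultimately show False using ann[OF sR] s(1) by simp
qed

lemma cohomology_torsion:
  assumes rad: "\<And>\<pp>. \<pp> \<in> prime_variety R J \<inter> Supp R M \<Longrightarrow>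
      depth (ring_at R \<pp>) (ideal_at R \<pp> \<pp>) (module_at R \<pp> M) \<le> enat c \<Longrightarrow>
      radical (ring_at R \<pp>) (ideal_at R \<pp> I) = radical (ring_at R \<pp>) (ideal_at R \<pp> J)"
    and z: "z \<in> ZK"
  shows "\<exists>t::nat. \<forall>a \<in> I [^]\<^bsub>ideals_set R\<^esub> t. a \<odot>\<^bsub>E c\<^esub> z \<in> BK"
proof -
  have zK: "z \<in> carrier (K c)" by (rule ZKD(1)[OF z])
  have "\<exists>n::nat. a [^] n \<odot>\<^bsub>E c\<^esub> z \<in> BK" if a: "a \<in> I" for a
  proof (rule ccontr)
    assume "\<nexists>n::nat. a [^] n \<odot>\<^bsub>E c\<^esub> z \<in> BK"
    then have na: "\<And>n::nat. a [^] n \<odot>\<^bsub>K c\<^esub> z \<notin> BK" by simp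
    have aR: "a \<in> carrier R" by (rule ideal_rules(1)[OF I a])
    \<comment> \<open>With the coboundaries as \<open>W\<close>, a multiple of the class has a prime
      annihilator that does not contain \<open>a\<close>, although \<open>a\<close> lies in
      \<open>I\<close>.\<close>
    obtain r where r: "r \<in> carrier R" "primeideal {q \<in> carrier R. q \<odot>\<^bsub>K c\<^esub> (r \<odot>\<^bsub>K c\<^esub> z) \<in> BK} R"
      "a \<odot>\<^bsub>K c\<^esub> (r \<odot>\<^bsub>K c\<^esub> z) \<notin> BK"
      by (rule prime_colon[OF module_K sub_BK zK aR na]) (rule that)
    define x where "x = r \<odot>\<^bsub>E c\<^esub> z"
    define \<pp> where "\<pp> = {q \<in> carrier R. q \<odot>\<^bsub>E c\<^esub> x \<in> BK}"
    have p: "primeideal \<pp> R" using r(2) by (simp add: \<pp>_def x_def)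
    have x: "x \<in> ZK" using submodule_rules(4)[OF sub_ZK module_K r(1) z] by (simp add: x_def)
    have Jp: "J \<subseteq> \<pp>"
    proof
      fix b assume b: "b \<in> J"
      have bR: "b \<in> carrier R" by (rule ideal_rules(1)[OF J b])
      obtain t :: nat where "b [^] t \<odot>\<^bsub>E c\<^esub> x = \<zero>\<^bsub>E c\<^esub>"
        using ZKD(1)[OF x] ideal_pow_mem[OF J b] unfolding torsion_part_carrier by blast
      then have "b [^] t \<in> \<pp>" using bR submodule_rules(2)[OF sub_BK module_K] by (simp add: \<pp>_def)
      then show "b \<in> \<pp>" by (rule prime_pow[OF p bR])
    qed
    have "\<pp> \<in> Supp R M" by (rule prime_in_support[OF p x]) (simp add: \<pp>_def)
    moreover have "\<pp> \<in> prime_variety R J" using p Jp by (simp add: prime_variety_def)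
    moreover have "depth (ring_at R \<pp>) (ideal_at R \<pp> \<pp>) (module_at R \<pp> M) \<le> enat c"
      by (rule prime_shallow[OF p x _ Jp]) (simp add: \<pp>_def)
    ultimately have rad': "radical (ring_at R \<pp>) (ideal_at R \<pp> I) = radical (ring_at R \<pp>) (ideal_at R \<pp> J)"
      by (intro rad) auto
    interpret P: prime_localization R \<pp>
      by (rule prime_localization.intro[OF fixed_cring_axioms prime_localization_axioms.intro[OF p]])
    have "I \<subseteq> \<pp>" by (rule P.radical_le_prime[OF _ Jp rad']) (use ideal_rules(1)[OF I] in blast)
    then show False using a r(3) by (auto simp: \<pp>_def x_def)
  qed
  \<comment> \<open>The exponents found for single elements are combined over finitely many
    generators into a power of \<open>I\<close>.\<close>
  then obtain k where k: "\<And>a. a \<in> I \<Longrightarrow> a [^] (k a :: nat) \<odot>\<^bsub>E c\<^esub> z \<in> BK" by metis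
  obtain xs where xs: "set xs \<subseteq> carrier R" "set xs \<subseteq> I" "I = Idl (set xs)"
    by (rule ideal_generators_list[OF I]) (rule that)
  have "\<forall>a \<in> (Idl (set xs)) [^]\<^bsub>ideals_set R\<^esub> Suc (sum k (set xs)). a \<odot>\<^bsub>K c\<^esub> z \<in> BK"
    by (rule ideal_pow_kills[OF module_K sub_BK _ xs(1) zK]) (use xs(2) k in auto)
  then show ?thesis unfolding xs(3) torsion_part_simps by blast
qed

end

section \<open>The unit ideal and the conclusion\<close>

context noetherian_cring
begin

lemma torsion_part_improper:
  assumes "ideal J R" "\<one> \<in> J" "module R A"
  shows "carrier (torsion_part R J A) = {\<zero>\<^bsub>A\<^esub>}"
proof
  show "carrier (torsion_part R J A) \<subseteq> {\<zero>\<^bsub>A\<^esub>}"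
  proof
    fix x assume "x \<in> carrier (torsion_part R J A)"
    then obtain t :: nat where t: "x \<in> carrier A" "\<forall>a \<in> J [^]\<^bsub>ideals_set R\<^esub> t. a \<odot>\<^bsub>A\<^esub> x = \<zero>\<^bsub>A\<^esub>"
      unfolding torsion_part_carrier by blast
    then show "x \<in> {\<zero>\<^bsub>A\<^esub>}" using ideal_pow_mem[OF assms(1,2), of t] assms(3) by auto
  qed
  show "{\<zero>\<^bsub>A\<^esub>} \<subseteq> carrier (torsion_part R J A)"
    using assms(3) ideal_rules(1)[OF ideal_pow_ideal[OF assms(1)]] unfolding torsion_part_carrier by auto
qed

lemma zero_module_local_cohomology:
  assumes "ideal J R" and "complex R (res_term X) (res_diff X)"
  shows "zero_module (local_cohomology R J X i) \<longleftrightarrow>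
    exact_at (\<lambda>i. torsion_part R J (res_term X i)) (res_diff X) i"
  unfolding local_cohomology_def by (rule zero_module_cohomology[OF torsion_part_complex[OF assms]])

text \<open>The unit ideal has no torsion, so its local cohomology vanishes in all degrees and its
  grade is infinite. This excludes \<open>1 \<in> J\<close> in the theorem.\<close>

lemma exact_at_improper:
  assumes J: "ideal J R" "\<one> \<in> J" and C: "complex R (res_term X) (res_diff X)"
  shows "exact_at (\<lambda>i. torsion_part R J (res_term X i)) (res_diff X) i"
proof -
  let ?K = "\<lambda>i. torsion_part R J (res_term X i)"
  have K: "complex R ?K (res_diff X)" by (rule torsion_part_complex[OF J(1) C])
  have "cocycles ?K (res_diff X) i \<subseteq> {\<zero>\<^bsub>res_term X i\<^esub>}"
    using torsion_part_improper[OF J complexD(1)[OF C], of i] by (auto simp: cocycles_def)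
  then show ?thesis
    using submodule_rules(2)[OF coboundaries_submodule[OF K, of i] complexD(1)[OF K]]
    unfolding exact_at_def by auto
qed

end

theorem theorem1p2:
  fixes R :: "'r ring" and \<mm> I J :: "'r set" and M :: "('r, 'm) module"
    and X :: "('r, 'm, 'e) resolution" and n c :: nat
  assumes "local_ring R \<mm>" and "noetherian_ring R" and "adic_complete R \<mm>"
    and "krull_dim R = enat n"
    and "ideal I R" and "ideal J R" and "J \<subseteq> I"
    and "module R M" and "fin_gen_module R M"
    and "injective_resolution R M X"
    and "grade R I X = enat c" and "grade R J X = enat c"
    and "\<And>i. i \<noteq> c \<Longrightarrow> zero_module (local_cohomology R J X i)"
    and "\<And>\<pp>. \<pp> \<in> prime_variety R J \<inter> Supp R M \<Longrightarrow>
           depth (ring_at R \<pp>) (ideal_at R \<pp> \<pp>) (module_at R \<pp> M) \<le> enat c \<Longrightarrow>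
           radical (ring_at R \<pp>) (ideal_at R \<pp> I) = radical (ring_at R \<pp>) (ideal_at R \<pp> J)"
  shows "(\<lambda>f\<in>carrier (Hom_module R M M). local_cohomology_map R I M X X c f)
           \<in> mod_iso R (Hom_module R M M)
               (Hom_module R (local_cohomology R I X c) (local_cohomology R I X c))"
proof -
  have "cring R" using assms(1) by (simp add: local_ring_def)
  then have "noetherian_cring R"
    by (intro noetherian_cring.intro fixed_cring.intro assms(2))
  then interpret complete_local_ring R \<mm>
    by (rule complete_local_ring.intro) (intro complete_local_ring_axioms.intro assms(1,3))
  interpret resolved_module R \<mm> M X
    by (intro resolved_module.intro resolved_module_axioms.intro complete_local_ring_axioms assms(8-10))
  have "\<one>\<^bsub>R\<^esub> \<notin> J"
  proof
    assume "\<one>\<^bsub>R\<^esub> \<in> J"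
    then have "grade R J X = Inf {}"
      using exact_at_improper[OF assms(6) _ complex_E]
      by (simp add: grade_def zero_module_local_cohomology[OF assms(6) complex_E])
    then show False using assms(12) by (simp add: Inf_enat_def)
  qed
  then interpret two_ideals R \<mm> M X I J c
    by (intro two_ideals.intro two_ideals_axioms.intro resolved_module_axioms assms(5-7)
      zero_module_local_cohomology[OF assms(6) complex_E, THEN iffD1] assms(13))
  interpret torsion_ideals R \<mm> M X I J c
    by (intro torsion_ideals.intro torsion_ideals_axioms.intro two_ideals_axioms cohomology_torsion assms(14))
  show ?thesis using endomorphism_iso by (simp add: local_cohomology_def cohomology_def)
qed

end
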